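(* Let $D=((a_n),(b_n))$ be a divisor with $a_n\neq 0$ and $b_n\neq 0$ for all $n$. Then $D$ is the divisor of some $f\in{\cal N}_1$ if and only if all of the following hold: (a) $\inf_{n,k}|a_n-b_k|>0$; (b) there is $C<\infty$ such that ${\rm card}\{n:|a_n-c|\le 1\}+{\rm card}\{n:|b_n-c|\le1\}<C$ for all $c\in\mathbb{C}$; (c) there is $R<\infty$ such that for every $c\in\mathbb{C}$ the disc $B(c,R)$ contains some $a_n$ and some $b_k$; (d) there is $C<\infty$ such that for all $c\in\mathbb{C}$ and all $r>1$, $$\Big|\int_1^r\frac{{\rm card}\{n:|a_n-c|<t\}-{\rm card}\{n:|b_n-c|<t\}}{t}\,dt\Big|<C;$$ (e) there is $C<\infty$ such that for all $c\in\mathbb{C}$ and all $r>1$, $$\Big|\frac1r\int_1^r\Big(\sum_{n:|a_n-c|<t}(a_n-c)-\sum_{n:|b_n-c|<t}(b_n-c)\Big)\frac{dt}{t}\Big|<C;$$ (f) the limit $\lim_{r\to\infty}\Big(\sum_{1\le|a_n|<r}a_n^{-2}-\sum_{1\le|b_n|<r}b_n^{-2}\Big)$ exists and is finite. Moreover, in this case the limit $$\alpha=\lim_{r\to\infty}\Big(\sum_{n:|b_n|<r}\big(1/b_n-\overline{b_n}/r^2\big)-\sum_{n:|a_n|<r}\big(1/a_n-\overline{a_n}/r^2\big)\Big)$$ exists, the limit $$f(z)=e^{\alpha z}\lim_{r\to\infty}\frac{\prod_{n:|a_n|<r}(1-z/a_n)e^{z/a_n}}{\prod_{n:|b_n|<r}(1-z/b_n)e^{z/b_n}}$$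 exists uniformly on compact subsets of $\mathbb{C}$ (in the spherical metric), and every ${\cal N}_1$-function with divisor $D$ equals a constant multiple of this $f$.
   Context: $\rho_S$ denotes the spherical (chordal) metric on the Riemann sphere. A meromorphic function $f$ on $\mathbb{C}$ is called normal if for every sequence $(h_n)\subset\mathbb{C}$ there is a subsequence $(h_{n'})$ with $\rho_S(f(z+h_{n'}),f(z+h_{m'}))\to0$ as $n',m'\to\infty$ uniformly on compact subsets of $\mathbb{C}$. A normal function is of the first category, written $f\in{\cal N}_1$, if no limit (uniformly on compacta in $\rho_S$) of a sequence of translates $f(z+h_n)$ is a constant function (the constant $\infty$ included). A divisor is a map $D:\mathbb{C}\to\mathbb{Z}$ with discrete support; it is written $D=((a_n),(b_n))$, where $(a_n)$ lists the points with $D>0$, each point $a$ repeated $D(a)$ times, and $(b_n)$ lists the points with $D<0$, each point $b$ repeated $-D(b)$ times. $D$ is the divisor of a meromorphic $f$ if the $a_n$ are the zeros and the $b_n$ the poles of $f$ counted with multiplicity. $B(c,R)=\{z:|z-c|<R\}$. *)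

theory Defs
  imports "HOL-Analysis.Analysis"
begin

text \<open>The Riemann sphere is modelled as complex option: None is the point infinity.\<close>

definition chordal :: "complex option \<Rightarrow> complex option \<Rightarrow> real" where
  "chordal u v = (case (u, v) of
      (Some z, Some w) \<Rightarrow> 2 * cmod (z - w) / sqrt ((1 + (cmod z)^2) * (1 + (cmod w)^2))
    | (Some z, None) \<Rightarrow> 2 / sqrt (1 + (cmod z)^2)
    | (None, Some w) \<Rightarrow> 2 / sqrt (1 + (cmod w)^2)
    | (None, None) \<Rightarrow> 0)"

definition meromorphic_C :: "(complex \<Rightarrow> complex option) \<Rightarrow> bool" where
  "meromorphic_C f \<longleftrightarrow> (\<exists>P. (\<forall>r. finite (P \<inter> cball 0 r)) \<and>
      (\<forall>z. f z = None \<longleftrightarrow> z \<in> P) \<and>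
      (\<lambda>z. the (f z)) holomorphic_on (- P) \<and>
      (\<forall>p\<in>P. filterlim (\<lambda>z. the (f z)) at_infinity (at p)))"

definition chordal_cauchy_seq :: "(nat \<Rightarrow> complex \<Rightarrow> complex option) \<Rightarrow> bool" where
  "chordal_cauchy_seq F \<longleftrightarrow> (\<forall>K. compact K \<longrightarrow> (\<forall>e>0. \<exists>N. \<forall>n\<ge>N. \<forall>m\<ge>N. \<forall>z\<in>K.
      chordal (F n z) (F m z) < e))"

definition chordal_lim_seq :: "(nat \<Rightarrow> complex \<Rightarrow> complex option) \<Rightarrow> (complex \<Rightarrow> complex option) \<Rightarrow> bool" where
  "chordal_lim_seq F g \<longleftrightarrow> (\<forall>K. compact K \<longrightarrow> (\<forall>e>0. \<exists>N. \<forall>n\<ge>N. \<forall>z\<in>K.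
      chordal (F n z) (g z) < e))"

definition chordal_lim_real :: "(real \<Rightarrow> complex \<Rightarrow> complex option) \<Rightarrow> (complex \<Rightarrow> complex option) \<Rightarrow> bool" where
  "chordal_lim_real F g \<longleftrightarrow> (\<forall>K. compact K \<longrightarrow> (\<forall>e>0. \<exists>R. \<forall>r\<ge>R. \<forall>z\<in>K.
      chordal (F r z) (g z) < e))"

definition normal_fun :: "(complex \<Rightarrow> complex option) \<Rightarrow> bool" where
  "normal_fun f \<longleftrightarrow> meromorphic_C f \<and>
     (\<forall>h :: nat \<Rightarrow> complex. \<exists>\<sigma>. strict_mono \<sigma> \<and>
        chordal_cauchy_seq (\<lambda>n z. f (z + h (\<sigma> n))))"

definition N1 :: "(complex \<Rightarrow> complex option) \<Rightarrow> bool" where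
  "N1 f \<longleftrightarrow> normal_fun f \<and>
     \<not> (\<exists>(h :: nat \<Rightarrow> complex) (c :: complex option).
          chordal_lim_seq (\<lambda>n z. f (z + h n)) (\<lambda>_. c))"

definition mer_order :: "(complex \<Rightarrow> complex option) \<Rightarrow> complex \<Rightarrow> int \<Rightarrow> bool" where
  "mer_order f z0 k \<longleftrightarrow> (\<exists>r>0. \<exists>g. g holomorphic_on ball z0 r \<and> g z0 \<noteq> 0 \<and>
      (\<forall>z\<in>ball z0 r - {z0}. f z = Some ((z - z0) powi k * g z)) \<and>
      f z0 = (if k < 0 then None else Some ((z0 - z0) ^ nat k * g z0)))"

definition divisor_of :: "(complex \<Rightarrow> int) \<Rightarrow> (complex \<Rightarrow> complex option) \<Rightarrow> bool" where
  "divisor_of D f \<longleftrightarrow> meromorphic_C f \<and> (\<forall>z. mer_order f z (D z))"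

text \<open>card {n. a_n \<in> S} (zeros counted with multiplicity) and likewise for poles.\<close>
definition zcount :: "(complex \<Rightarrow> int) \<Rightarrow> complex set \<Rightarrow> int" where
  "zcount D S = (\<Sum>z\<in>{z\<in>S. D z > 0}. D z)"

definition pcount :: "(complex \<Rightarrow> int) \<Rightarrow> complex set \<Rightarrow> int" where
  "pcount D S = (\<Sum>z\<in>{z\<in>S. D z < 0}. - D z)"

definition zsum :: "(complex \<Rightarrow> int) \<Rightarrow> complex set \<Rightarrow> (complex \<Rightarrow> complex) \<Rightarrow> complex" where
  "zsum D S \<phi> = (\<Sum>z\<in>{z\<in>S. D z > 0}. of_int (D z) * \<phi> z)"

definition psum :: "(complex \<Rightarrow> int) \<Rightarrow> complex set \<Rightarrow> (complex \<Rightarrow> complex) \<Rightarrow> complex" where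
  "psum D S \<phi> = (\<Sum>z\<in>{z\<in>S. D z < 0}. of_int (- D z) * \<phi> z)"

definition condA :: "(complex \<Rightarrow> int) \<Rightarrow> bool" where
  "condA D \<longleftrightarrow> (\<exists>\<delta>>0. \<forall>a b. D a > 0 \<longrightarrow> D b < 0 \<longrightarrow> \<delta> \<le> cmod (a - b))"

definition condB :: "(complex \<Rightarrow> int) \<Rightarrow> bool" where
  "condB D \<longleftrightarrow> (\<exists>C::real. \<forall>c. of_int (zcount D (cball c 1) + pcount D (cball c 1)) < C)"

definition condC :: "(complex \<Rightarrow> int) \<Rightarrow> bool" where
  "condC D \<longleftrightarrow> (\<exists>R::real. \<forall>c. (\<exists>a\<in>ball c R. D a > 0) \<and> (\<exists>b\<in>ball c R. D b < 0))"

definition condD :: "(complex \<Rightarrow> int) \<Rightarrow> bool" where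
  "condD D \<longleftrightarrow> (\<exists>C::real. \<forall>c. \<forall>r>1.
     \<bar>integral {1..r} (\<lambda>t. (of_int (zcount D (ball c t)) - of_int (pcount D (ball c t))) / t)\<bar> < C)"

definition condE :: "(complex \<Rightarrow> int) \<Rightarrow> bool" where
  "condE D \<longleftrightarrow> (\<exists>C::real. \<forall>c. \<forall>r>1.
     cmod ((1 / r) *\<^sub>R integral {1..r}
        (\<lambda>t. (1 / t) *\<^sub>R (zsum D (ball c t) (\<lambda>z. z - c) - psum D (ball c t) (\<lambda>z. z - c)))) < C)"

definition condF :: "(complex \<Rightarrow> int) \<Rightarrow> bool" where
  "condF D \<longleftrightarrow> (\<exists>L::complex.
     ((\<lambda>r::real. zsum D {z. 1 \<le> cmod z \<and> cmod z < r} (\<lambda>z. 1 / z^2)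
                - psum D {z. 1 \<le> cmod z \<and> cmod z < r} (\<lambda>z. 1 / z^2)) \<longlongrightarrow> L) at_top)"

definition alpha_approx :: "(complex \<Rightarrow> int) \<Rightarrow> real \<Rightarrow> complex" where
  "alpha_approx D r = psum D (ball 0 r) (\<lambda>b. 1 / b - cnj b / of_real (r^2))
                    - zsum D (ball 0 r) (\<lambda>a. 1 / a - cnj a / of_real (r^2))"

definition zprod :: "(complex \<Rightarrow> int) \<Rightarrow> real \<Rightarrow> complex \<Rightarrow> complex" where
  "zprod D r z = (\<Prod>a\<in>{a\<in>ball 0 r. D a > 0}. ((1 - z / a) * exp (z / a)) ^ nat (D a))"

definition pprod :: "(complex \<Rightarrow> int) \<Rightarrow> real \<Rightarrow> complex \<Rightarrow> complex" where
  "pprod D r z = (\<Prod>b\<in>{b\<in>ball 0 r. D b < 0}. ((1 - z / b) * exp (z / b)) ^ nat (- D b))"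

definition prod_quot :: "(complex \<Rightarrow> int) \<Rightarrow> real \<Rightarrow> complex \<Rightarrow> complex option" where
  "prod_quot D r z = (if pprod D r z = 0 then None else Some (zprod D r z / pprod D r z))"

definition sphere_scale :: "complex \<Rightarrow> complex option \<Rightarrow> complex option" where
  "sphere_scale k u = map_option (\<lambda>w. k * w) u"

end

theory Submission
  imports Defs "HOL-Complex_Analysis.Complex_Analysis"
begin


text \<open>
  Everything passes through one estimate: a function \<open>f\<close> with divisor \<open>D\<close> satisfying (b) has \<^emph>\<open>controlled growth\<close> if
  \<open>ln \<bar>f(c)\<bar> = \<Sum> D(a) ln \<bar>c - a\<bar> + O(1)\<close>, the sum over \<open>\<bar>a - c\<bar> < 1\<close>, uniformly in \<open>c\<close>.

  A function of the first category has controlled growth, because it is uniformly continuous for the chordal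
  metric and cannot be uniformly close to 0 or to \<open>\<infinity>\<close> on small discs. Then \<open>\<bar>ln \<bar>f\<bar>\<bar>\<close> has bounded means over all
  circles of radius at least 1. Its Fourier coefficients of order 0, 1 and 2 on these circles are, by Jensen-type
  formulas, sums over the divisor, and yield (d), (e) and (f). If a large disc were free of poles, then (d) would make
  its center free of zeros as well, \<open>f\<close> would be bounded there, and translates would converge to a constant; this gives (c).

  Conversely, (e) at the origin gives \<open>\<alpha>\<close>, and (b) and (f) give convergence of the product. For the resulting \<open>f\<close> the mean of
  \<open>ln \<bar>f\<bar>\<close> over \<open>B(c, r)\<close> minus that over \<open>B(0, r)\<close> tends to 0 as \<open>r\<close> grows, while by (d) each of them differs boundedly
  from its value at a bounded radius; so \<open>f\<close> has controlled growth. With (a) this makes \<open>f\<close> uniformly Lipschitz for the chordal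
  metric, hence normal, and (c) excludes constant limits. Two functions of controlled growth with the same divisor have
  a bounded entire quotient, whence uniqueness.
\<close>

section \<open>The chordal metric\<close>

text \<open>Condition (b) still allows about r points of the divisor near a circle of radius r.
  Jensen's kernel ln(r/|a|) vanishes only to first order at |a| = r, so moving the centre of a
  circle mean changes the contribution of each such point by O(1/r), and the total error need not
  tend to 0. Recovering ln |f(c)| from means near infinity therefore uses discs instead of circles:
  their kernel vanishes to second order, and the total error is O(1/r). For the remaining points |a
  - c|^2 = |a|^2 + |c|^2 - 2 Re (c cnj a), and the mixed term, divided by r^2, is exactly the
  correction cnj a / r^2 in the definition of \<alpha>. Condition (b) makes the sum of |a|^-3
  converge absolutely, but not that of |a|^-2. Factors of genus one thus leave a quadratic term that
  converges only conditionally, and (f) states this convergence. In the same way (e), after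
  integration by parts, replaces the missing convergence of the sum of 1/a.\<close>

definition stereo :: "complex option \<Rightarrow> complex \<times> real" where
  "stereo u = (case u of None \<Rightarrow> (0, 1)
     | Some z \<Rightarrow> (2 * z / of_real (1 + (cmod z)\<^sup>2), ((cmod z)\<^sup>2 - 1) / ((cmod z)\<^sup>2 + 1)))"

text \<open>Inversion u -> 1/u of the sphere. It is a chordal isometry and exchanges zeros and
  poles, so that each one-sided estimate is proved for zeros or for bounded values only and then
  applied to the inverted function.\<close>

definition sinv :: "complex option \<Rightarrow> complex option" where
  "sinv u = (case u of None \<Rightarrow> Some 0 | Some z \<Rightarrow> if z = 0 then None else Some (1 / z))"

lemma sinv_simps [simp]:
  "sinv None = Some 0" "sinv (Some 0) = None" "z \<noteq> 0 \<Longrightarrow> sinv (Some z) = Some (1 / z)"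
  "sinv (sinv u) = u" "sinv u = None \<longleftrightarrow> u = Some 0" "sinv u = Some 0 \<longleftrightarrow> u = None"
  by (auto simp: sinv_def split: option.splits if_splits)

lemma sqrt_one_plus_pos [simp]: "sqrt (1 + (cmod z)\<^sup>2) > 0" "1 + (cmod z)\<^sup>2 > 0"
  "1 + (cmod z)\<^sup>2 \<noteq> 0" "(cmod z)\<^sup>2 + 1 \<noteq> 0" "(cmod z)\<^sup>2 + 1 > 0"
proof -
  show "1 + (cmod z)\<^sup>2 > 0" by (smt (verit) zero_le_power2)
  then show "sqrt (1 + (cmod z)\<^sup>2) > 0" "1 + (cmod z)\<^sup>2 \<noteq> 0"
    "(cmod z)\<^sup>2 + 1 \<noteq> 0" "(cmod z)\<^sup>2 + 1 > 0" by auto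
qed

lemma cmod_minus_square:
  "(cmod (z - w))\<^sup>2 = (cmod z)\<^sup>2 + (cmod w)\<^sup>2 - 2 * Re (z * cnj w)"
  by (simp add: cmod_power2) (simp add: algebra_simps power2_eq_square)

text \<open>Stereographic projection turns \<open>chordal\<close> into a Euclidean distance. This
  gives the triangle inequality at once, and later provides the bounded vector-valued functions that
  Arzela-Ascoli needs.\<close>

lemma chordal_stereo: "chordal u v = dist (stereo u) (stereo v)"
proof -
  have SS: "(2 * cmod (z - w) / sqrt ((1 + (cmod z)\<^sup>2) * (1 + (cmod w)\<^sup>2)))\<^sup>2
      = (dist (stereo (Some z)) (stereo (Some w)))\<^sup>2" for z w
  proof -
    define A B where "A = (cmod z)\<^sup>2" and "B = (cmod w)\<^sup>2"
    have AB: "1 + A > 0" "1 + B > 0" "A + 1 \<noteq> 0" "B + 1 \<noteq> 0" "1 + A \<noteq> 0" "1 + B \<noteq> 0"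
      using sqrt_one_plus_pos(2)[of z] sqrt_one_plus_pos(2)[of w] by (auto simp: A_def B_def)
    have "2 * z / of_real (1 + A) - 2 * w / of_real (1 + B)
        = (2 / ((1 + A) * (1 + B))) *\<^sub>R ((1 + B) *\<^sub>R z - (1 + A) *\<^sub>R w)"
    proof -
      have "complex_of_real (1 + A) \<noteq> 0" "complex_of_real (1 + B) \<noteq> 0"
        using AB by (simp_all only: of_real_eq_0_iff not_False_eq_True)
      then show ?thesis
        by (simp add: scaleR_conv_of_real field_simps)
    qed
    then have n1: "(cmod (2 * z / of_real (1 + A) - 2 * w / of_real (1 + B)))\<^sup>2
        = (2 / ((1 + A) * (1 + B)))\<^sup>2 * (cmod ((1 + B) *\<^sub>R z - (1 + A) *\<^sub>R w))\<^sup>2"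
      by (simp only: norm_scaleR power_mult_distrib power2_abs)
    have n2: "(cmod ((1 + B) *\<^sub>R z - (1 + A) *\<^sub>R w))\<^sup>2
        = (1 + B)\<^sup>2 * A + (1 + A)\<^sup>2 * B - 2 * (1 + A) * (1 + B) * Re (z * cnj w)"
      unfolding cmod_minus_square norm_scaleR power_mult_distrib power2_abs A_def[symmetric] B_def[symmetric]
      by simp
    have n3: "(cmod (z - w))\<^sup>2 = A + B - 2 * Re (z * cnj w)"
      unfolding cmod_minus_square A_def B_def by simp
    have n4: "2 / ((1 + A) * (1 + B)) * ((1 + A) * (1 + B)) = 2"
      using AB by simp
    have "(dist (stereo (Some z)) (stereo (Some w)))\<^sup>2
       = (2 / ((1 + A) * (1 + B)))\<^sup>2 * ((1 + B)\<^sup>2 * A + (1 + A)\<^sup>2 * B - 2 * (1 + A) * (1 + B) * Re (z * cnj w))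
         + ((A - 1) / (A + 1) - (B - 1) / (B + 1))\<^sup>2"
      unfolding n2[symmetric] n1[symmetric] stereo_def dist_norm norm_prod_def
      by (simp add: A_def B_def)
    also have "(A - 1) / (A + 1) - (B - 1) / (B + 1) = 2 * (A - B) / ((1 + A) * (1 + B))"
      using AB by (simp add: divide_simps) (simp add: algebra_simps)
    also have "(2 / ((1 + A) * (1 + B)))\<^sup>2 * ((1 + B)\<^sup>2 * A + (1 + A)\<^sup>2 * B - 2 * (1 + A) * (1 + B) * Re (z * cnj w))
         + (2 * (A - B) / ((1 + A) * (1 + B)))\<^sup>2
        = 4 * ((1 + A) * (1 + B) * (A + B - 2 * Re (z * cnj w))) / ((1 + A) * (1 + B))\<^sup>2"
      by (simp add: power_divide add_divide_distrib [symmetric]) (simp add: algebra_simps power2_eq_square)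
    also have "\<dots> = 4 * (cmod (z - w))\<^sup>2 / ((1 + A) * (1 + B))"
      unfolding n3 using AB by (simp add: divide_simps power2_eq_square)
    also have "\<dots> = (2 * cmod (z - w) / sqrt ((1 + A) * (1 + B)))\<^sup>2"
      using AB by (simp add: power_divide power_mult_distrib)
    finally show ?thesis by (simp add: A_def B_def)
  qed
  have SN: "(2 / sqrt (1 + (cmod z)\<^sup>2))\<^sup>2 = (dist (stereo (Some z)) (stereo None))\<^sup>2" for z
  proof -
    define A where "A = (cmod z)\<^sup>2"
    have AB: "1 + A > 0" "A + 1 \<noteq> 0" "1 + A \<noteq> 0" "A + 1 > 0"
      using sqrt_one_plus_pos(2)[of z] by (auto simp: A_def)
    have "(dist (stereo (Some z)) (stereo None))\<^sup>2 =
       (cmod (2 * z / of_real (1 + A)))\<^sup>2 + ((A - 1) / (A + 1) - 1)\<^sup>2"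
      by (simp add: stereo_def dist_norm norm_prod_def A_def) (rule power2_commute)
    also have "cmod (2 * z / of_real (1 + A)) = 2 * cmod z / (1 + A)"
      using AB unfolding norm_divide norm_of_real norm_mult by simp
    also have "((A - 1) / (A + 1) - 1)\<^sup>2 = (2 / (1 + A))\<^sup>2"
    proof -
      have "(A - 1) / (A + 1) - 1 = - (2 / (1 + A))"
        using AB by (simp add: divide_simps)
      then show ?thesis by simp
    qed
    also have "(2 * cmod z / (1 + A))\<^sup>2 = 4 * A / (1 + A)\<^sup>2"
      by (simp add: power_divide power_mult_distrib A_def)
    also have "4 * A / (1 + A)\<^sup>2 + (2 / (1 + A))\<^sup>2 = 4 / (1 + A)"
    proof -
      have "4 * A / (1 + A)\<^sup>2 + (2 / (1 + A))\<^sup>2 = 4 * (1 + A) / (1 + A)\<^sup>2"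
        by (simp add: power_divide add_divide_distrib[symmetric])
      also have "\<dots> = 4 / (1 + A)"
        unfolding power2_eq_square using AB(3) by (rule nonzero_mult_divide_mult_cancel_right)
      finally show ?thesis .
    qed
    also have "4 / (1 + A) = (2 / sqrt (1 + A))\<^sup>2"
      using AB by (simp add: power_divide)
    finally show ?thesis by (simp add: A_def)
  qed
  have eqI: "x = dist p q" if "x\<^sup>2 = (dist p q)\<^sup>2" "x \<ge> 0" for x and p q :: "complex \<times> real"
    using that by (metis power2_eq_imp_eq zero_le_dist)
  show ?thesis
  proof (cases u)
    case None
    show ?thesis
    proof (cases v)
      case (Some w)
      show ?thesis unfolding None Some chordal_def
        by (simp, subst dist_commute, rule eqI[OF SN]) simp
    qed (simp add: None chordal_def)
  next
    case (Some z)
    show ?thesis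
    proof (cases v)
      case None
      show ?thesis unfolding None Some chordal_def
        by (simp, rule eqI[OF SN]) simp
    next
      case Some': (Some w)
      have nn: "2 * cmod (z - w) / sqrt ((1 + (cmod z)\<^sup>2) * (1 + (cmod w)\<^sup>2)) \<ge> 0" by simp
      show ?thesis unfolding Some Some' chordal_def
        using eqI[OF SS nn] by simp
    qed
  qed
qed

lemma chordal_self [simp]: "chordal u u = 0" by (simp add: chordal_stereo)
lemma chordal_nonneg [simp]: "chordal u v \<ge> 0" by (simp add: chordal_stereo)
lemma chordal_commute: "chordal u v = chordal v u" by (simp add: chordal_stereo dist_commute)
lemma chordal_triangle: "chordal u w \<le> chordal u v + chordal v w"
  by (simp add: chordal_stereo dist_triangle)

lemma chordal_Some: "chordal (Some z) (Some w) = 2 * cmod (z - w) / (sqrt (1 + (cmod z)\<^sup>2) * sqrt (1 + (cmod w)\<^sup>2))"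
  by (simp add: chordal_def real_sqrt_mult)

lemma chordal_Some_None: "chordal (Some z) None = 2 / sqrt (1 + (cmod z)\<^sup>2)"
  by (simp add: chordal_def)

lemma chordal_Some_le: "chordal (Some z) (Some w) \<le> 2 * cmod (z - w)"
proof -
  have "1 * 1 \<le> sqrt (1 + (cmod z)\<^sup>2) * sqrt (1 + (cmod w)\<^sup>2)"
    by (intro mult_mono) auto
  moreover have "0 \<le> 2 * cmod (z - w)" by simp
  ultimately show ?thesis unfolding chordal_Some
    using divide_left_mono[of 1 "sqrt (1 + (cmod z)\<^sup>2) * sqrt (1 + (cmod w)\<^sup>2)" "2 * cmod (z - w)"]
    by simp
qed

lemma norm_stereo: "norm (stereo u) = 1"
proof -
  have "norm (stereo u) ^ 2 = 1"
  proof (cases u)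
    case (Some z)
    define A where "A = (cmod z)\<^sup>2"
    have AB: "1 + A > 0" "A + 1 \<noteq> 0" "1 + A \<noteq> 0" "A + 1 > 0"
      using sqrt_one_plus_pos(2)[of z] by (auto simp: A_def)
    have "norm (stereo u) ^ 2 = (cmod (2 * z / of_real (1 + A)))\<^sup>2 + ((A - 1) / (A + 1))\<^sup>2"
      by (simp add: Some stereo_def norm_prod_def A_def power_divide)
    also have "cmod (2 * z / of_real (1 + A)) = 2 * cmod z / (1 + A)"
      using AB unfolding norm_divide norm_of_real norm_mult by simp
    also have "(2 * cmod z / (1 + A))\<^sup>2 = 4 * A / (1 + A)\<^sup>2"
      by (simp add: power_divide power_mult_distrib A_def)
    also have "4 * A / (1 + A)\<^sup>2 + ((A - 1) / (A + 1))\<^sup>2 = 1"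
      using AB by (simp add: power_divide add.commute add_divide_distrib[symmetric])
        (simp add: power2_eq_square algebra_simps)
    finally show ?thesis .
  qed (simp add: stereo_def)
  then show ?thesis using power2_eq_1_iff[of "norm (stereo u)"] norm_ge_zero[of "stereo u"] by linarith
qed

lemma chordal_sinv [simp]: "chordal (sinv u) (sinv v) = chordal u v"
proof -
  have sq: "sqrt (1 + (1 / cmod z)\<^sup>2) = sqrt (1 + (cmod z)\<^sup>2) / cmod z" if "z \<noteq> 0" for z :: complex
  proof -
    have "1 + (1 / cmod z)\<^sup>2 = (1 + (cmod z)\<^sup>2) / (cmod z)\<^sup>2"
      using that by (simp add: power_divide divide_simps)
    then have "sqrt (1 + (1 / cmod z)\<^sup>2) = sqrt (1 + (cmod z)\<^sup>2) / sqrt ((cmod z)\<^sup>2)"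
      by (simp only: real_sqrt_divide)
    then show ?thesis by (simp only: real_sqrt_abs abs_norm_cancel)
  qed
  have A: "chordal (sinv (Some z)) (sinv (Some w)) = chordal (Some z) (Some w)" if "z \<noteq> 0" "w \<noteq> 0" for z w
  proof -
    have "1 / z - 1 / w = (w - z) / (z * w)" using that by (simp add: divide_simps)
    then have "cmod (1 / z - 1 / w) = cmod (z - w) / (cmod z * cmod w)"
      by (simp add: norm_divide norm_mult norm_minus_commute)
    then show ?thesis using that by (simp add: chordal_Some sq norm_divide)
  qed
  have B: "chordal (sinv (Some z)) (sinv (Some 0)) = chordal (Some z) (Some 0)" if "z \<noteq> 0" for z
    using that by (simp add: chordal_Some chordal_Some_None sq norm_divide)
  have C: "chordal (sinv (Some z)) (sinv None) = chordal (Some z) None" if "z \<noteq> 0" for z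
    using that by (simp add: chordal_Some chordal_Some_None sq norm_divide)
  have D: "chordal (sinv (Some 0)) (sinv None) = chordal (Some 0) None"
    by (simp add: chordal_commute)
  have D': "chordal (Some 0) (Some 0) = 0" by simp
  consider "u = None" | "u = Some 0" | z where "u = Some z" "z \<noteq> 0" by (cases u) auto
  note cu = this
  consider "v = None" | "v = Some 0" | z where "v = Some z" "z \<noteq> 0" by (cases v) auto
  then show ?thesis
    using A B C D by (cases rule: cu; cases rule: cu) (metis chordal_commute chordal_self)+
qed

lemma chordal_Some_0: "chordal (Some z) (Some 0) = 2 * cmod z / sqrt (1 + (cmod z)\<^sup>2)"
  by (simp add: chordal_Some)

lemma chordal_0_None: "chordal (Some 0) None = 2"
  by (simp add: chordal_Some_None)

text \<open>The unit disc lies within chordal distance sqrt 2 of 0, while |w| = 2 is at distance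
  sqrt 3.2. The gap exceeds 1/3, which fixes the oscillation 1/3 and the bound 2 used for local
  boundedness below.\<close>

lemma chordal_le_imp_cmod_le_2:
  assumes "cmod z \<le> 1" "chordal u (Some z) < 1/3"
  obtains w where "u = Some w" "cmod w \<le> 2"
proof -
  have z0: "chordal (Some z) (Some 0) \<le> sqrt 2"
  proof -
    define x where "x = (cmod z)\<^sup>2"
    have x: "0 \<le> x" "x \<le> 1" using assms(1) by (auto simp: x_def power_le_one)
    have "(chordal (Some z) (Some 0))\<^sup>2 = 4 * x / (1 + x)"
      using x by (simp add: chordal_Some_0 power_divide power_mult_distrib x_def)
    also have "\<dots> \<le> 2" using x by (simp add: divide_simps)
    finally show ?thesis by (metis real_le_rsqrt)
  qed
  have s2: "sqrt 2 < 1.42" by (rule real_less_lsqrt) (auto simp: power2_eq_square)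
  have u: "chordal u (Some 0) < 1.76"
    using chordal_triangle[of u "Some 0" "Some z"] assms(2) z0 s2 by simp
  have "u \<noteq> None"
  proof
    assume "u = None"
    then show False using u chordal_0_None chordal_commute[of None "Some 0"] by simp
  qed
  then obtain w where w: "u = Some w" by auto
  have "cmod w \<le> 2"
  proof (rule ccontr)
    assume "\<not> cmod w \<le> 2"
    then have g: "cmod w > 2" by simp
    define x where "x = (cmod w)\<^sup>2"
    have x: "x > 4" using g power_strict_mono[of 2 "cmod w" 2] by (simp add: x_def)
    have "(chordal (Some w) (Some 0))\<^sup>2 = 4 * x / (1 + x)"
      using x by (simp add: chordal_Some_0 power_divide power_mult_distrib x_def)
    also have "\<dots> > 3.2" using x by (simp add: divide_simps)
    finally have "3.2 < (chordal (Some w) (Some 0))\<^sup>2" .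
    moreover have "(chordal (Some w) (Some 0))\<^sup>2 \<le> 1.76\<^sup>2"
      using u w by (intro power_mono) auto
    ultimately show False by (simp add: power2_eq_square)
  qed
  with w that show thesis by blast
qed


section \<open>Divisors and local factorizations\<close>

definition locally_finite :: "(complex \<Rightarrow> int) \<Rightarrow> bool" where
  "locally_finite D \<longleftrightarrow> (\<forall>r. finite {z. D z \<noteq> 0 \<and> cmod z \<le> r})"

lemma locally_finite_bounded:
  assumes "locally_finite D" "bounded S"
  shows "finite {z\<in>S. D z \<noteq> 0}"
proof -
  obtain r where "\<forall>z\<in>S. cmod z \<le> r" using assms(2) by (auto simp: bounded_iff)
  then have "{z\<in>S. D z \<noteq> 0} \<subseteq> {z. D z \<noteq> 0 \<and> cmod z \<le> r}" by auto
  then show ?thesis using assms(1) finite_subset by (auto simp: locally_finite_def)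
qed

lemma locally_finite_isolated:
  assumes "locally_finite D" "\<rho>0 > 0"
  obtains \<rho> where "\<rho> > 0" "\<rho> \<le> \<rho>0" "\<And>z. z \<in> ball z0 \<rho> \<Longrightarrow> z \<noteq> z0 \<Longrightarrow> D z = 0"
proof -
  have "finite {z\<in>ball z0 1. D z \<noteq> 0}" using locally_finite_bounded[OF assms(1) bounded_ball] .
  then obtain d where d: "d > 0" "\<forall>x\<in>{z\<in>ball z0 1. D z \<noteq> 0}. x \<noteq> z0 \<longrightarrow> d \<le> dist z0 x"
    using finite_set_avoid[of "{z\<in>ball z0 1. D z \<noteq> 0}" z0] by metis
  show thesis
    by (rule that[of "min \<rho>0 (min 1 d)"]) (use assms(2) d in \<open>force+\<close>)
qed

lemma mer_orderE:
  assumes "mer_order f z0 k" "\<rho>0 > 0"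
  obtains r g where "r > 0" "r \<le> \<rho>0" "g holomorphic_on ball z0 r" "\<And>z. z \<in> ball z0 r \<Longrightarrow> g z \<noteq> 0"
    "\<And>z. z \<in> ball z0 r \<Longrightarrow> z \<noteq> z0 \<Longrightarrow> f z = Some ((z - z0) powi k * g z)"
    "k < 0 \<Longrightarrow> f z0 = None" "k = 0 \<Longrightarrow> f z0 = Some (g z0)" "k > 0 \<Longrightarrow> f z0 = Some 0"
proof -
  obtain r g where r: "r > 0" "g holomorphic_on ball z0 r" "g z0 \<noteq> 0"
      "\<forall>z\<in>ball z0 r - {z0}. f z = Some ((z - z0) powi k * g z)"
      "f z0 = (if k < 0 then None else Some ((z0 - z0) ^ nat k * g z0))"
    using assms(1) unfolding mer_order_def by blast
  have "continuous (at z0) g"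
    using r(1,2) by (meson centre_in_ball continuous_on_eq_continuous_at holomorphic_on_imp_continuous_on open_ball)
  then obtain e where e: "e > 0" "\<And>z. dist z0 z < e \<Longrightarrow> g z \<noteq> 0"
    using continuous_at_avoid[of z0 g 0] r(3) by blast
  show thesis
    by (rule that[of "min \<rho>0 (min r e)" g])
       (use r e assms(2) in \<open>auto intro: holomorphic_on_subset\<close>)
qed

lemma mer_order_None_iff: "mer_order f z0 k \<Longrightarrow> f z0 = None \<longleftrightarrow> k < 0"
  by (auto simp: mer_order_def split: if_splits)

lemma mer_order_zero_iff: "mer_order f z0 k \<Longrightarrow> f z0 = Some 0 \<longleftrightarrow> k > 0"
  unfolding mer_order_def by (cases k "0::int" rule: linorder_cases) auto

lemma mer_order_nonneg:
  assumes "mer_order f z0 k" "k \<ge> 0"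
  obtains r h where "r > 0" "h holomorphic_on ball z0 r" "\<And>z. z \<in> ball z0 r \<Longrightarrow> f z = Some (h z)"
proof -
  obtain r g where r: "r > 0" "g holomorphic_on ball z0 r" 
      "\<forall>z\<in>ball z0 r - {z0}. f z = Some ((z - z0) powi k * g z)"
      "f z0 = (if k < 0 then None else Some ((z0 - z0) ^ nat k * g z0))"
    using assms(1) unfolding mer_order_def by blast
  show thesis
  proof (rule that[of r "\<lambda>z. (z - z0) ^ nat k * g z"])
    show "(\<lambda>z. (z - z0) ^ nat k * g z) holomorphic_on ball z0 r"
      by (intro holomorphic_intros r)
    fix z assume "z \<in> ball z0 r"
    then show "f z = Some ((z - z0) ^ nat k * g z)"
      using r assms(2) by (cases "z = z0") (auto simp: power_int_def)
  qed (use r in auto)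
qed

lemma mer_order_sinv:
  assumes "mer_order f z0 k"
  shows "mer_order (\<lambda>z. sinv (f z)) z0 (- k)"
proof -
  obtain r g where r: "r > 0" "g holomorphic_on ball z0 r" "\<And>z. z \<in> ball z0 r \<Longrightarrow> g z \<noteq> 0"
    "\<And>z. z \<in> ball z0 r \<Longrightarrow> z \<noteq> z0 \<Longrightarrow> f z = Some ((z - z0) powi k * g z)"
    "k < 0 \<Longrightarrow> f z0 = None" "k = 0 \<Longrightarrow> f z0 = Some (g z0)" "k > 0 \<Longrightarrow> f z0 = Some 0"
    by (rule mer_orderE[OF assms, of 1]) auto
  show ?thesis unfolding mer_order_def
  proof (intro exI[of _ r] exI[of _ "\<lambda>z. 1 / g z"] conjI ballI)
    show "(\<lambda>z. 1 / g z) holomorphic_on ball z0 r"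
      by (intro holomorphic_intros r)
    show "1 / g z0 \<noteq> 0" using r by auto
    fix z assume "z \<in> ball z0 r - {z0}"
    then show "sinv (f z) = Some ((z - z0) powi - k * (1 / g z))"
      using r by (simp add: power_int_minus divide_simps)
  next
    show "sinv (f z0) = (if - k < 0 then None else Some ((z0 - z0) ^ nat (- k) * (1 / g z0)))"
      using r by (cases k "0::int" rule: linorder_cases) auto
  qed (use r in auto)
qed

lemma holomorphic_the:
  assumes mo: "\<And>z. mer_order f z (D z)" and "\<And>z. z \<in> S \<Longrightarrow> f z \<noteq> None"
  shows "(\<lambda>z. the (f z)) holomorphic_on S"
  unfolding holomorphic_on_def
proof
  fix z0 assume "z0 \<in> S"
  then have "D z0 \<ge> 0" using assms mer_order_None_iff[OF mo] by force
  then obtain r h where r: "r > 0" "h holomorphic_on ball z0 r" "\<And>z. z \<in> ball z0 r \<Longrightarrow> f z = Some (h z)"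
    using mer_order_nonneg[OF mo] by metis
  have "(\<lambda>z. the (f z)) holomorphic_on ball z0 r"
    using holomorphic_cong[of "ball z0 r" "ball z0 r" "\<lambda>z. the (f z)" h] r by simp
  then have "(\<lambda>z. the (f z)) field_differentiable at z0"
    using r(1) by (meson centre_in_ball holomorphic_on_imp_differentiable_at open_ball)
  then show "(\<lambda>z. the (f z)) field_differentiable at z0 within S"
    using field_differentiable_at_within by blast
qed

lemma divisor_of_intro:
  assumes lf: "locally_finite D" and mo: "\<And>z. mer_order f z (D z)"
  shows "divisor_of D f"
proof -
  let ?P = "{z. D z < 0}"
  have "meromorphic_C f" unfolding meromorphic_C_def
  proof (intro exI[of _ ?P] conjI allI ballI)
    fix r
    have "?P \<inter> cball 0 r \<subseteq> {z\<in>cball 0 r. D z \<noteq> 0}" by auto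
    then show "finite (?P \<inter> cball 0 r)"
      using finite_subset locally_finite_bounded[OF lf, of "cball 0 r"] by auto
  next
    fix z show "f z = None \<longleftrightarrow> z \<in> ?P" using mer_order_None_iff[OF mo] by simp
  next
    show "(\<lambda>z. the (f z)) holomorphic_on - ?P"
      using mer_order_None_iff[OF mo] by (intro holomorphic_the[OF mo]) auto
  next
    fix p assume "p \<in> ?P"
    then have neg: "D p < 0" by simp
    obtain r g where r: "r > 0" "g holomorphic_on ball p r" "\<And>z. z \<in> ball p r \<Longrightarrow> g z \<noteq> 0"
      "\<And>z. z \<in> ball p r \<Longrightarrow> z \<noteq> p \<Longrightarrow> f z = Some ((z - p) powi (D p) * g z)"
      by (rule mer_orderE[OF mo[of p], of 1]) auto
    \<comment> \<open>\<open>u\<close> is the reciprocal of \<open>f\<close> near the pole; it is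
      holomorphic with a zero at \<open>p\<close>, so its inverse tends to infinity.\<close>
    define u where "u = (\<lambda>z. (z - p) ^ nat (- D p) * (1 / g z))"
    have "u holomorphic_on ball p r" unfolding u_def by (intro holomorphic_intros r)
    then have "continuous (at p) u"
      using r(1) by (meson centre_in_ball continuous_on_eq_continuous_at holomorphic_on_imp_continuous_on open_ball)
    moreover have "u p = 0" using neg by (simp add: u_def)
    ultimately have lim: "u \<midarrow>p\<rightarrow> 0" by (simp add: isCont_def)
    have ev: "\<forall>\<^sub>F z in at p. z \<in> ball p r - {p}"
      using r(1) by (intro eventually_at_in_open) auto
    have "\<forall>\<^sub>F z in at p. u z \<noteq> 0"
      using ev by eventually_elim (use r(3) in \<open>auto simp: u_def\<close>)
    then have "filterlim u (at 0) (at p)" using lim by (simp add: filterlim_at)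
    then have L: "filterlim (\<lambda>z. inverse (u z)) at_infinity (at p)"
      by (rule filterlim_compose[OF filterlim_inverse_at_infinity])
    show "filterlim (\<lambda>z. the (f z)) at_infinity (at p)"
    proof (rule filterlim_mono_eventually[OF L])
      show "\<forall>\<^sub>F z in at p. inverse (u z) = the (f z)"
        using ev
      proof eventually_elim
        case (elim z)
        then show ?case using r(4)[of z] neg by (simp add: u_def power_int_def field_simps)
      qed
    qed auto
  qed
  then show ?thesis using mo by (simp add: divisor_of_def)
qed

lemma divisor_of_sinv:
  assumes "locally_finite D" "divisor_of D f"
  shows "divisor_of (\<lambda>z. - D z) (\<lambda>z. sinv (f z))"
  using assms by (intro divisor_of_intro mer_order_sinv) (auto simp: divisor_of_def locally_finite_def)

text \<open>In general a rational function, with divisor \<open>D\<close> on \<open>S\<close>. At a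
  pole the factor \<open>0 powi k\<close> with \<open>k < 0\<close> evaluates to 0 and not to
  infinity, so factorizations through \<open>divpoly\<close> are claimed only where
  \<open>D z \<ge> 0\<close>.\<close>

definition divpoly :: "(complex \<Rightarrow> int) \<Rightarrow> complex set \<Rightarrow> complex \<Rightarrow> complex" where
  "divpoly D S z = (\<Prod>a\<in>{a\<in>S. D a \<noteq> 0}. (z - a) powi D a)"

lemma divpoly_nonzero:
  assumes "D z = 0" "finite {a\<in>S. D a \<noteq> 0}" shows "divpoly D S z \<noteq> 0"
  using assms by (auto simp: divpoly_def prod_zero_iff power_int_eq_0_iff)

lemma holomorphic_divpoly [holomorphic_intros]:
  assumes "\<And>a. a \<in> S \<Longrightarrow> D a \<noteq> 0 \<Longrightarrow> a \<notin> A"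
  shows "divpoly D S holomorphic_on A"
  unfolding divpoly_def using assms by (auto intro!: holomorphic_intros)

lemma divpoly_split:
  assumes "finite {a\<in>S. D a \<noteq> 0}" "z0 \<in> S"
  shows "divpoly D S z = (z - z0) powi D z0 * divpoly D (S - {z0}) z"
proof (cases "D z0 = 0")
  case True
  then have "{a\<in>S. D a \<noteq> 0} = {a\<in>S - {z0}. D a \<noteq> 0}" by auto
  then show ?thesis using True by (simp add: divpoly_def)
next
  case False
  have "{a\<in>S - {z0}. D a \<noteq> 0} = {a\<in>S. D a \<noteq> 0} - {z0}" by auto
  then show ?thesis unfolding divpoly_def
    using prod.remove[OF assms(1), of z0] assms(2) False by simp
qed

text \<open>Dividing a function by the rational function with the same zeros and poles leaves
  removable singularities only. The quotient is glued from the local cofactors that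
  \<open>mer_order\<close> provides at each point.\<close>

lemma divisor_factor:
  assumes mer: "\<And>z. mer_order f z (D z)" and lf: "locally_finite D"
    and U: "open U" "bounded U"
  obtains F where "F holomorphic_on U" "\<And>z. z \<in> U \<Longrightarrow> F z \<noteq> 0"
    "\<And>z. z \<in> U \<Longrightarrow> D z \<ge> 0 \<Longrightarrow> f z = Some (F z * divpoly D U z)"
proof -
  have fin: "finite {a\<in>U. D a \<noteq> 0}" by (rule locally_finite_bounded[OF lf U(2)])
  have fin': "finite {a\<in>U - A. D a \<noteq> 0}" for A
    by (rule finite_subset[OF _ fin]) auto
  have "\<forall>z0. \<exists>r g. r > 0 \<and> g holomorphic_on ball z0 r \<and> (\<forall>z\<in>ball z0 r. g z \<noteq> 0) \<and>
     (\<forall>z\<in>ball z0 r. z \<noteq> z0 \<longrightarrow> f z = Some ((z - z0) powi D z0 * g z)) \<and>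
     (D z0 = 0 \<longrightarrow> f z0 = Some (g z0))"
  proof
    fix z0
    obtain r g where "r > 0" "g holomorphic_on ball z0 r" "\<And>z. z \<in> ball z0 r \<Longrightarrow> g z \<noteq> 0"
      "\<And>z. z \<in> ball z0 r \<Longrightarrow> z \<noteq> z0 \<Longrightarrow> f z = Some ((z - z0) powi D z0 * g z)"
      "D z0 = 0 \<Longrightarrow> f z0 = Some (g z0)"
      by (rule mer_orderE[OF mer[of z0], of 1]) auto
    then show "\<exists>r g. r > 0 \<and> g holomorphic_on ball z0 r \<and> (\<forall>z\<in>ball z0 r. g z \<noteq> 0) \<and>
     (\<forall>z\<in>ball z0 r. z \<noteq> z0 \<longrightarrow> f z = Some ((z - z0) powi D z0 * g z)) \<and>
     (D z0 = 0 \<longrightarrow> f z0 = Some (g z0))" by blast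
  qed
  then have "\<exists>rr gg. \<forall>z0. rr z0 > 0 \<and> gg z0 holomorphic_on ball z0 (rr z0) \<and> (\<forall>z\<in>ball z0 (rr z0). gg z0 z \<noteq> 0) \<and>
     (\<forall>z\<in>ball z0 (rr z0). z \<noteq> z0 \<longrightarrow> f z = Some ((z - z0) powi D z0 * gg z0 z)) \<and>
     (D z0 = 0 \<longrightarrow> f z0 = Some (gg z0 z0))"
    by metis
  then obtain rr gg where rg: "\<And>z0. rr z0 > 0" "\<And>z0. gg z0 holomorphic_on ball z0 (rr z0)"
     "\<And>z0 z. z\<in>ball z0 (rr z0) \<Longrightarrow> gg z0 z \<noteq> 0"
     "\<And>z0 z. z\<in>ball z0 (rr z0) \<Longrightarrow> z \<noteq> z0 \<Longrightarrow> f z = Some ((z - z0) powi D z0 * gg z0 z)"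
     "\<And>z0. D z0 = 0 \<Longrightarrow> f z0 = Some (gg z0 z0)" by metis
  \<comment> \<open>The factor belonging to \<open>z\<close> itself is left out, so no division by
    zero occurs. Near any \<open>z0\<close> this pointwise definition agrees with the single
    holomorphic quotient built from the data at \<open>z0\<close>, because the other points of a
    small disc carry no divisor.\<close>
  define F where "F = (\<lambda>z. gg z z / divpoly D (U - {z}) z)"
  show thesis
  proof (rule that[of F])
    show "F holomorphic_on U" unfolding holomorphic_on_def
    proof
      fix z0 assume z0: "z0 \<in> U"
      obtain e where e: "e > 0" "ball z0 e \<subseteq> U" using U z0 openE by blast
      have "min e (rr z0) > 0" using e rg by simp
      then obtain \<rho> where \<rho>: "\<rho> > 0" "\<rho> \<le> min e (rr z0)" "\<And>z. z \<in> ball z0 \<rho> \<Longrightarrow> z \<noteq> z0 \<Longrightarrow> D z = 0"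
        using locally_finite_isolated[OF lf] by metis
      have eq: "F z = gg z0 z / divpoly D (U - {z0}) z" if z: "z \<in> ball z0 \<rho>" for z
      proof (cases "z = z0")
        case False
        have D: "D z = 0" using \<rho> z False by blast
        have zU: "z \<in> U" using z e \<rho> by auto
        have "gg z z = (z - z0) powi D z0 * gg z0 z"
          using rg(4)[of z z0] rg(5)[OF D] z \<rho> False by auto
        moreover have "divpoly D (U - {z}) z = divpoly D U z"
          using divpoly_split[OF fin zU, of z] D by simp
        moreover have "divpoly D U z = (z - z0) powi D z0 * divpoly D (U - {z0}) z"
          by (rule divpoly_split[OF fin z0])
        ultimately show ?thesis using False by (simp add: F_def)
      qed (simp add: F_def)
      have "(\<lambda>z. gg z0 z / divpoly D (U - {z0}) z) holomorphic_on ball z0 \<rho>"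
      proof (intro holomorphic_intros)
        show "gg z0 holomorphic_on ball z0 \<rho>"
          using rg(2)[of z0] \<rho> by (auto elim: holomorphic_on_subset)
        show "divpoly D (U - {z0}) z \<noteq> 0" if "z \<in> ball z0 \<rho>" for z
        proof (cases "z = z0")
          case True
          then show ?thesis using fin'[of "{z0}"]
            by (auto simp: divpoly_def prod_zero_iff power_int_eq_0_iff)
        next
          case False
          then have "D z = 0" using \<rho>(3) that by blast
          then show ?thesis using fin' by (rule divpoly_nonzero)
        qed
      qed (use \<rho> in auto)
      then have "F holomorphic_on ball z0 \<rho>"
        using eq holomorphic_cong by (metis (no_types, lifting))
      then have "F field_differentiable at z0"
        using \<rho>(1) by (meson centre_in_ball holomorphic_on_imp_differentiable_at open_ball)
      then show "F field_differentiable at z0 within U"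
        using field_differentiable_at_within by blast
    qed
    fix z assume z: "z \<in> U"
    show "F z \<noteq> 0" using fin'[of "{z}"] rg(1,3)[of z]
      by (auto simp: F_def divpoly_def prod_zero_iff power_int_eq_0_iff)
    assume D0: "D z \<ge> 0"
    show "f z = Some (F z * divpoly D U z)"
    proof (cases "D z = 0")
      case D: True
      have "divpoly D (U - {z}) z = divpoly D U z"
        using divpoly_split[OF fin z, of z] D by simp
      then show ?thesis
        using rg(5)[OF D] divpoly_nonzero[OF D fin] by (simp add: F_def)
    next
      case False
      then have "f z = Some 0" using D0 mer_order_zero_iff[OF mer, of z] by simp
      moreover have "divpoly D U z = 0" using divpoly_split[OF fin z, of z] False by simp
      ultimately show ?thesis by simp
    qed
  qed
qed

text \<open>Converse of \<open>divisor_factor\<close>; it reads off the divisor of the limit of the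
  infinite product.\<close>

lemma mer_order_of_factor:
  assumes lf: "locally_finite D" and U: "open U" "bounded U" "z0 \<in> U"
    and F: "F holomorphic_on U" "\<And>z. z \<in> U \<Longrightarrow> F z \<noteq> 0"
    and f: "\<And>z. z \<in> U \<Longrightarrow> D z \<ge> 0 \<Longrightarrow> f z = Some (F z * divpoly D U z)"
       "\<And>z. z \<in> U \<Longrightarrow> D z < 0 \<Longrightarrow> f z = None"
  shows "mer_order f z0 (D z0)"
proof -
  have fin: "finite {a\<in>U. D a \<noteq> 0}" by (rule locally_finite_bounded[OF lf U(2)])
  obtain e where e: "e > 0" "ball z0 e \<subseteq> U" using U openE by blast
  obtain \<rho> where \<rho>: "\<rho> > 0" "\<rho> \<le> e" "\<And>z. z \<in> ball z0 \<rho> \<Longrightarrow> z \<noteq> z0 \<Longrightarrow> D z = 0"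
    using locally_finite_isolated[OF lf e(1)] by metis
  have fin': "finite {a\<in>U - {z0}. D a \<noteq> 0}"
    by (rule finite_subset[OF _ fin]) auto
  show ?thesis unfolding mer_order_def
  proof (intro exI[of _ \<rho>] exI[of _ "\<lambda>z. F z * divpoly D (U - {z0}) z"] conjI ballI)
    show "(\<lambda>z. F z * divpoly D (U - {z0}) z) holomorphic_on ball z0 \<rho>"
      by (intro holomorphic_intros) (use F \<rho> e in \<open>force intro: holomorphic_on_subset\<close>)+
    show nz: "F z0 * divpoly D (U - {z0}) z0 \<noteq> 0"
      using F U(3) fin' by (auto simp: divpoly_def prod_zero_iff power_int_eq_0_iff)
    fix z assume z: "z \<in> ball z0 \<rho> - {z0}"
    then have "D z = 0" "z \<in> U" using \<rho> e by auto
    then show "f z = Some ((z - z0) powi D z0 * (F z * divpoly D (U - {z0}) z))"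
      using f(1) divpoly_split[OF fin U(3), of z] by simp
  next
    show "f z0 = (if D z0 < 0 then None else Some ((z0 - z0) ^ nat (D z0) * (F z0 * divpoly D (U - {z0}) z0)))"
      using f(1)[of z0] f(2)[of z0] U(3) divpoly_split[OF fin U(3), of z0]
      by (auto simp: power_int_def)
  qed (use \<rho> in auto)
qed

section \<open>Sums over a divisor\<close>

definition dsum :: "(complex \<Rightarrow> int) \<Rightarrow> complex set \<Rightarrow> (complex \<Rightarrow> 'a::real_normed_field) \<Rightarrow> 'a" where
  "dsum D S \<phi> = (\<Sum>a\<in>{a\<in>S. D a \<noteq> 0}. of_int (D a) * \<phi> a)"

definition dabs :: "(complex \<Rightarrow> int) \<Rightarrow> complex set \<Rightarrow> real" where
  "dabs D S = (\<Sum>a\<in>{a\<in>S. D a \<noteq> 0}. real_of_int \<bar>D a\<bar>)"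

lemma dabs_nonneg [simp]: "dabs D S \<ge> 0" by (auto simp: dabs_def intro!: sum_nonneg)

lemma dabs_mono:
  assumes "locally_finite D" "bounded T" "S \<subseteq> T" shows "dabs D S \<le> dabs D T"
  unfolding dabs_def using assms(3) by (intro sum_mono2 locally_finite_bounded assms) auto

lemma dabs_Un_le:
  assumes "locally_finite D" "bounded S" "bounded T" shows "dabs D (S \<union> T) \<le> dabs D S + dabs D T"
proof -
  have "{a\<in>S \<union> T. D a \<noteq> 0} = {a\<in>S. D a \<noteq> 0} \<union> {a\<in>T. D a \<noteq> 0}" by auto
  then show ?thesis unfolding dabs_def
    using sum_Un[of "{a\<in>S. D a \<noteq> 0}" "{a\<in>T. D a \<noteq> 0}" "\<lambda>a. real_of_int \<bar>D a\<bar>"] 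
      locally_finite_bounded[OF assms(1,2)] locally_finite_bounded[OF assms(1,3)]
    by (simp add: sum_nonneg)
qed

lemma dabs_UN_le:
  assumes "locally_finite D" "finite K" "\<And>k. k \<in> K \<Longrightarrow> bounded (S k)"
  shows "dabs D (\<Union>k\<in>K. S k) \<le> (\<Sum>k\<in>K. dabs D (S k))"
  using assms(2,3)
proof (induction K rule: finite_induct)
  case empty then show ?case by (simp add: dabs_def)
next
  case (insert k K)
  have "dabs D (\<Union>k\<in>insert k K. S k) \<le> dabs D (S k) + dabs D (\<Union>k\<in>K. S k)"
    using dabs_Un_le[OF assms(1), of "S k" "\<Union>k\<in>K. S k"] insert by auto
  then show ?case using insert by simp
qed

lemma norm_dsum_le:
  assumes "\<And>a. a \<in> S \<Longrightarrow> D a \<noteq> 0 \<Longrightarrow> norm (\<phi> a) \<le> B"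
  shows "norm (dsum D S \<phi>) \<le> dabs D S * B"
proof -
  have "norm (dsum D S \<phi>) \<le> (\<Sum>a\<in>{a\<in>S. D a \<noteq> 0}. norm (of_int (D a) * \<phi> a))"
    unfolding dsum_def by (rule norm_sum)
  also have "\<dots> \<le> (\<Sum>a\<in>{a\<in>S. D a \<noteq> 0}. real_of_int \<bar>D a\<bar> * B)"
    using assms by (intro sum_mono) (auto simp: norm_mult intro!: mult_left_mono)
  finally show ?thesis by (simp add: dabs_def sum_distrib_right)
qed

lemma dsum_diff:
  assumes "locally_finite D" "bounded T" "S \<subseteq> T"
  shows "dsum D T \<phi> = dsum D S \<phi> + dsum D (T - S) \<phi>"
proof -
  have "{a\<in>T. D a \<noteq> 0} = {a\<in>S. D a \<noteq> 0} \<union> {a\<in>T-S. D a \<noteq> 0}" using assms by auto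
  then show ?thesis unfolding dsum_def
    using locally_finite_bounded[OF assms(1,2)] 
    by (simp only:) (subst sum.union_disjoint, auto)
qed

lemma dsum_minus_divisor: "dsum (\<lambda>z. - D z) S \<phi> = - dsum D S \<phi>"
  by (simp add: dsum_def sum_negf)

lemma dabs_minus_divisor: "dabs (\<lambda>z. - D z) S = dabs D S"
  by (simp add: dabs_def)

lemma dsum_add: "dsum D S (\<lambda>a. \<phi> a + \<psi> a) = dsum D S \<phi> + dsum D S \<psi>"
  by (simp add: dsum_def sum.distrib algebra_simps)

lemma dsum_sub: "dsum D S (\<lambda>a. \<phi> a - \<psi> a) = dsum D S \<phi> - dsum D S \<psi>"
  by (simp add: dsum_def sum_subtractf algebra_simps)

lemma dsum_cmult: "dsum D S (\<lambda>a. c * \<phi> a) = c * dsum D S \<phi>"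
  by (simp add: dsum_def sum_distrib_left algebra_simps)

lemma dsum_cong:
  assumes "\<And>a. a \<in> S \<Longrightarrow> D a \<noteq> 0 \<Longrightarrow> \<phi> a = \<psi> a" shows "dsum D S \<phi> = dsum D S \<psi>"
  unfolding dsum_def using assms by (intro sum.cong) auto

definition growth :: "(complex \<Rightarrow> int) \<Rightarrow> (complex \<Rightarrow> complex option) \<Rightarrow> real \<Rightarrow> bool" where
  "growth D f C \<longleftrightarrow> (\<forall>z. D z = 0 \<longrightarrow>
     (\<exists>w. w \<noteq> 0 \<and> f z = Some w \<and> \<bar>ln (cmod w) - dsum D (ball z 1) (\<lambda>a. ln (cmod (z - a)))\<bar> \<le> C))"


section \<open>Functions of the first category have controlled growth\<close>

lemma mer_order_continuous:
  assumes "mer_order f z0 k" "e > 0"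
  obtains d where "d > 0" "\<And>z. dist z z0 < d \<Longrightarrow> chordal (f z) (f z0) < e"
proof -
  have nonneg: "\<exists>d>0. \<forall>z. dist z z0 < d \<longrightarrow> chordal (f z) (f z0) < e" if mk: "mer_order f z0 k" "k \<ge> 0" for f k
  proof -
    obtain r h where r: "r > 0" "h holomorphic_on ball z0 r" "\<And>z. z \<in> ball z0 r \<Longrightarrow> f z = Some (h z)"
      using mer_order_nonneg[OF mk] by metis
    have "continuous (at z0) h"
      using r(1,2) by (meson centre_in_ball continuous_on_eq_continuous_at holomorphic_on_imp_continuous_on open_ball)
    then obtain d where d: "d > 0" "\<And>z. dist z z0 < d \<Longrightarrow> dist (h z) (h z0) < e / 2"
      unfolding continuous_at_eps_delta using assms(2) by (metis half_gt_zero dist_commute)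
    show ?thesis
    proof (intro exI[of _ "min r d"] conjI allI impI)
      fix z assume z: "dist z z0 < min r d"
      then have "f z = Some (h z)" "f z0 = Some (h z0)" using r by (auto simp: dist_commute)
      moreover have "cmod (h z - h z0) < e / 2" using d z by (auto simp: dist_norm)
      ultimately show "chordal (f z) (f z0) < e"
        using chordal_Some_le[of "h z" "h z0"] by simp
    qed (use r d in auto)
  qed
  show thesis
  proof (cases "k \<ge> 0")
    case True
    then show ?thesis using nonneg[OF assms(1)] that by blast
  next
    case False
    then have "\<exists>d>0. \<forall>z. dist z z0 < d \<longrightarrow> chordal (sinv (f z)) (sinv (f z0)) < e"
      using nonneg[OF mer_order_sinv[OF assms(1)]] by simp
    then show ?thesis using that by auto
  qed
qed

text \<open>Along pairs violating uniform continuity, normality makes the translates by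
  \<open>x n\<close> uniformly close on the unit disc to one fixed translate. That one is continuous
  at the origin, which forces the values of each late pair together.\<close>

lemma normal_uniformly_continuous:
  assumes "normal_fun f" and mo: "\<And>z. mer_order f z (D z)" and e: "e > 0"
  obtains d where "d > 0" "\<And>z w. dist z w < d \<Longrightarrow> chordal (f z) (f w) < e"
proof -
  have "\<exists>d>0. \<forall>z w. dist z w < d \<longrightarrow> chordal (f z) (f w) < e"
  proof (rule ccontr)
    assume "\<not> ?thesis"
    then have "\<forall>n::nat. \<exists>z w. dist z w < 1 / real (Suc n) \<and> chordal (f z) (f w) \<ge> e"
      by (metis not_less zero_less_divide_1_iff of_nat_0_less_iff zero_less_Suc)
    then obtain x y where xy: "\<And>n. dist (x n) (y n) < 1 / real (Suc n)" "\<And>n. chordal (f (x n)) (f (y n)) \<ge> e"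
      by metis
    obtain s where s: "strict_mono s" "chordal_cauchy_seq (\<lambda>n z. f (z + x (s n)))"
      using assms(1) unfolding normal_fun_def by blast
    have "e / 3 > 0" using e by simp
    then obtain N where N: "\<And>n m z. n \<ge> N \<Longrightarrow> m \<ge> N \<Longrightarrow> z \<in> cball 0 1 \<Longrightarrow> chordal (f (z + x (s n))) (f (z + x (s m))) < e / 3"
      using s(2) compact_cball[of "0::complex" 1] unfolding chordal_cauchy_seq_def by metis
    obtain d where d: "d > 0" "\<And>z. dist z (x (s N)) < d \<Longrightarrow> chordal (f z) (f (x (s N))) < e / 3"
      using mer_order_continuous[OF mo \<open>e / 3 > 0\<close>] by metis
    obtain n0 :: nat where n0: "1 / real (Suc n0) < d" using d(1) nat_approx_posE by blast
    define n where "n = max N n0"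
    have sn: "s n \<ge> n" using s(1) strict_mono_imp_increasing by blast
    define w where "w = y (s n) - x (s n)"
    have "cmod w < 1 / real (Suc (s n))" using xy(1)[of "s n"] by (simp add: w_def dist_norm norm_minus_commute)
    also have "\<dots> \<le> 1 / real (Suc n0)" using sn by (auto simp: n_def divide_simps)
    finally have w1: "cmod w < d" using n0 by simp
    have "cmod w < 1 / real (Suc (s n))" using xy(1)[of "s n"] by (simp add: w_def dist_norm norm_minus_commute)
    also have "\<dots> \<le> 1" by simp
    finally have w2: "w \<in> cball 0 1" by simp
    have nN: "n \<ge> N" by (simp add: n_def)
    have a1: "chordal (f (w + x (s n))) (f (w + x (s N))) < e / 3" by (rule N[OF nN order_refl w2])
    have a2: "chordal (f (w + x (s N))) (f (x (s N))) < e / 3" by (rule d(2)) (simp add: dist_norm w1)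
    have a3: "chordal (f (x (s N))) (f (x (s n))) < e / 3" using N[OF order_refl nN, of 0] by simp
    have "chordal (f (y (s n))) (f (x (s n))) < e"
      using a1 a2 a3 chordal_triangle[of "f (w + x (s n))" "f (x (s n))" "f (w + x (s N))"]
        chordal_triangle[of "f (w + x (s N))" "f (x (s n))" "f (x (s N))"] by (simp add: w_def)
    then show False using xy(2)[of "s n"] by (simp add: chordal_commute)
  qed
  then show thesis using that by blast
qed

section \<open>Local boundedness of the function or of its reciprocal\<close>

definition bounded2 :: "(complex \<Rightarrow> complex option) \<Rightarrow> complex \<Rightarrow> real \<Rightarrow> bool" where
  "bounded2 f c \<delta> \<longleftrightarrow> (\<forall>z\<in>ball c \<delta>. \<exists>w. f z = Some w \<and> cmod w \<le> 2)"

text \<open>At the centre either |f| or |1/f| is at most 1, and an oscillation below 1/3 keeps that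
  function below 2 on the whole disc.\<close>

lemma bounded2_dichotomy:
  assumes "\<And>z w. dist z w < \<delta> \<Longrightarrow> chordal (f z) (f w) < 1/3"
  shows "bounded2 f c \<delta> \<or> bounded2 (\<lambda>z. sinv (f z)) c \<delta>"
proof -
  have *: "bounded2 f c \<delta>" if "f c = Some w" "cmod w \<le> 1" "\<And>z w. dist z w < \<delta> \<Longrightarrow> chordal (f z) (f w) < 1/3" for w f
    unfolding bounded2_def
  proof
    fix z assume "z \<in> ball c \<delta>"
    then have "chordal (f z) (Some w) < 1/3" using that by (metis dist_commute mem_ball)
    then show "\<exists>w. f z = Some w \<and> cmod w \<le> 2" using chordal_le_imp_cmod_le_2[OF that(2)] by metis
  qed
  show ?thesis
  proof (cases "\<exists>w. f c = Some w \<and> cmod w \<le> 1")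
    case True then show ?thesis using * assms by blast
  next
    case False
    have "\<exists>w. sinv (f c) = Some w \<and> cmod w \<le> 1"
    proof (cases "f c")
      case (Some w)
      then have "w \<noteq> 0" "cmod w > 1" using False by auto
      then show ?thesis using Some by (intro exI[of _ "1 / w"]) (simp add: norm_divide divide_simps)
    qed auto
    then show ?thesis using *[of "\<lambda>z. sinv (f z)"] assms by auto
  qed
qed

text \<open>A qualitative form of the three circles theorem, obtained by compactness: recentred
  counterexamples would have, by Montel, a limit that vanishes on \<open>ball 0 s\<close>, hence on
  \<open>ball 0 (4 * s)\<close>, while staying away from 0 somewhere in
  \<open>cball 0 (2 * s)\<close>.\<close>

lemma two_circle_bound:
  fixes s e :: real
  assumes s: "s > 0" and e: "e > 0"
  obtains \<eta> where "\<eta> > 0" "\<And>h c z. h holomorphic_on ball c (4 * s) \<Longrightarrow> (\<And>z. z \<in> ball c (4 * s) \<Longrightarrow> cmod (h z) \<le> 2) \<Longrightarrow>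
     (\<And>z. z \<in> ball c s \<Longrightarrow> cmod (h z) \<le> \<eta>) \<Longrightarrow> z \<in> ball c (2 * s) \<Longrightarrow> cmod (h z) < e"
proof -
  have "\<exists>\<eta>>0. \<forall>h c z. h holomorphic_on ball c (4 * s) \<longrightarrow> (\<forall>z\<in>ball c (4 * s). cmod (h z) \<le> 2) \<longrightarrow>
     (\<forall>z\<in>ball c s. cmod (h z) \<le> \<eta>) \<longrightarrow> z \<in> ball c (2 * s) \<longrightarrow> cmod (h z) < e"
  proof (rule ccontr)
    assume neg: "\<not> ?thesis"
    have "\<forall>n. \<exists>h c z. h holomorphic_on ball c (4 * s) \<and> (\<forall>z\<in>ball c (4 * s). cmod (h z) \<le> 2) \<and>
     (\<forall>z\<in>ball c s. cmod (h z) \<le> 1 / real (Suc n)) \<and> z \<in> ball c (2 * s) \<and> \<not> cmod (h z) < e"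
    proof
      fix n :: nat
      have "1 / real (Suc n) > 0" by simp
      then show "\<exists>h c z. h holomorphic_on ball c (4 * s) \<and> (\<forall>z\<in>ball c (4 * s). cmod (h z) \<le> 2) \<and>
     (\<forall>z\<in>ball c s. cmod (h z) \<le> 1 / real (Suc n)) \<and> z \<in> ball c (2 * s) \<and> \<not> cmod (h z) < e"
        using neg by blast
    qed
    then obtain h c \<zeta> where h: "\<And>n. h n holomorphic_on ball (c n) (4 * s)"
      "\<And>n z. z \<in> ball (c n) (4 * s) \<Longrightarrow> cmod (h n z) \<le> 2"
      "\<And>n z. z \<in> ball (c n) s \<Longrightarrow> cmod (h n z) \<le> 1 / real (Suc n)"
      "\<And>n. \<zeta> n \<in> ball (c n) (2 * s)" "\<And>n. cmod (h n (\<zeta> n)) \<ge> e" by (metis not_less)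
    define H where "H = (\<lambda>n z. h n (c n + z))"
    define F where "F = {u. u holomorphic_on ball 0 (4 * s) \<and> (\<forall>z\<in>ball 0 (4 * s). cmod (u z) \<le> 2)}"
    have HF: "H n \<in> F" for n
    proof -
      have "(h n \<circ> (\<lambda>z. c n + z)) holomorphic_on ball 0 (4 * s)"
        by (rule holomorphic_on_compose_gen[OF _ h(1)]) (auto intro!: holomorphic_intros simp: dist_norm)
      then show ?thesis using h(2)[of "c n + _" n] by (auto simp: F_def H_def o_def dist_norm)
    qed
    obtain g r where g: "g holomorphic_on ball 0 (4 * s)" "strict_mono (r :: nat \<Rightarrow> nat)"
          "\<And>x. x \<in> ball 0 (4 * s) \<Longrightarrow> ((\<lambda>n. H (r n) x) \<longlongrightarrow> g x) sequentially"
          "\<And>K. \<lbrakk>compact K; K \<subseteq> ball 0 (4 * s)\<rbrakk> \<Longrightarrow> uniform_limit K (H \<circ> r) g sequentially"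
    proof (rule Montel[of "ball 0 (4 * s)" F H])
      show "\<exists>B. \<forall>h\<in>F. \<forall>z\<in>K. cmod (h z) \<le> B" if "compact K" "K \<subseteq> ball 0 (4 * s)" for K
        using that by (intro exI[of _ 2]) (auto simp: F_def)
    qed (use HF in \<open>auto simp: F_def\<close>)
    have g0: "g z = 0" if "z \<in> ball 0 s" for z
    proof -
      have "(\<lambda>n. H (r n) z) \<longlonglongrightarrow> 0"
      proof (rule Lim_null_comparison)
        show "\<forall>\<^sub>F n in sequentially. cmod (H (r n) z) \<le> 1 / real (Suc n)"
        proof (intro always_eventually allI)
          fix n
          have "cmod (H (r n) z) \<le> 1 / real (Suc (r n))" unfolding H_def by (rule h(3)) (use that in \<open>auto simp: dist_norm\<close>)
          also have "\<dots> \<le> 1 / real (Suc n)" using strict_mono_imp_increasing[OF g(2), of n] by (simp add: divide_simps)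
          finally show "cmod (H (r n) z) \<le> 1 / real (Suc n)" .
        qed
        show "(\<lambda>n. 1 / real (Suc n)) \<longlonglongrightarrow> 0" using LIMSEQ_inverse_real_of_nat by (simp add: inverse_eq_divide)
      qed
      moreover have "(\<lambda>n. H (r n) z) \<longlonglongrightarrow> g z" using g(3)[of z] that s by auto
      ultimately show ?thesis using LIMSEQ_unique by blast
    qed
    have g00: "g z = 0" if "z \<in> ball 0 (4 * s)" for z
      by (rule analytic_continuation[OF g(1), of "ball 0 s" 0]) (use s g0 that in \<open>auto simp: mem_interior islimpt_ball\<close>)
    have "uniform_limit (cball 0 (2 * s)) (H \<circ> r) g sequentially" by (rule g(4)) (use s in auto)
    then obtain n where n: "\<And>z. z \<in> cball 0 (2 * s) \<Longrightarrow> dist (H (r n) z) (g z) < e"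
      unfolding uniform_limit_iff eventually_sequentially using e by (metis comp_apply order_refl)
    have z: "\<zeta> (r n) - c (r n) \<in> ball 0 (2 * s)" using h(4)[of "r n"] by (simp add: dist_norm norm_minus_commute)
    then have "dist (H (r n) (\<zeta> (r n) - c (r n))) 0 < e" using n[of "\<zeta> (r n) - c (r n)"] g00 s by auto
    then show False using h(5)[of "r n"] by (simp add: H_def)
  qed
  then show thesis using that by blast
qed

text \<open>If |1/f| were at most 2 at the centre, then \<open>f c\<close> would have chordal
  distance at least 2/3 from 0. Closeness to 0 thus decides the dichotomy.\<close>

lemma chordal_0_cases:
  assumes "bounded2 f c \<delta> \<or> bounded2 (\<lambda>z. sinv (f z)) c \<delta>" "chordal (f c) (Some 0) < 1/2" "\<delta> > 0"
  shows "bounded2 f c \<delta>"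
proof (rule ccontr)
  assume "\<not> ?thesis"
  then have "bounded2 (\<lambda>z. sinv (f z)) c \<delta>" using assms by blast
  then obtain w where w: "sinv (f c) = Some w" "cmod w \<le> 2"
    using assms(3) unfolding bounded2_def by (meson centre_in_ball)
  have "chordal (f c) (Some 0) = chordal (Some w) None"
    using w chordal_sinv[of "f c" "Some 0"] by simp
  also have "\<dots> = 2 / sqrt (1 + (cmod w)\<^sup>2)" by (simp add: chordal_Some_None)
  also have "\<dots> \<ge> 2 / 3"
  proof -
    have "(cmod w)\<^sup>2 \<le> 2\<^sup>2" using w by (intro power_mono) auto
    then have "sqrt (1 + (cmod w)\<^sup>2) \<le> 3" by (intro real_le_lsqrt) auto
    then show ?thesis by (intro divide_left_mono) (auto intro: mult_pos_pos)
  qed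
  finally show False using assms by simp
qed

lemma cmod_le_chordal_0:
  assumes "cmod w \<le> 2" shows "cmod w \<le> 3/2 * chordal (Some w) (Some 0)"
proof -
  have "(cmod w)\<^sup>2 \<le> 2\<^sup>2" using assms by (intro power_mono) auto
  then have s: "sqrt (1 + (cmod w)\<^sup>2) \<le> 3" by (intro real_le_lsqrt) auto
  have "2 * cmod w / 3 \<le> 2 * cmod w / sqrt (1 + (cmod w)\<^sup>2)"
    using s by (intro divide_left_mono) (auto intro: mult_pos_pos)
  then show ?thesis by (simp add: chordal_Some_0)
qed

text \<open>Smallness on one disc propagates to every larger concentric disc by the two-circle bound, so without such an
  \<open>\<eta>\<close> some sequence of translates would converge to the constant 0.\<close>
lemma N1_not_small:
  assumes "N1 f" and mo: "\<And>z. mer_order f z (D z)" and \<rho>: "\<rho> > 0"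
  obtains \<eta> where "\<eta> > 0" "\<And>c. \<exists>z\<in>ball c \<rho>. chordal (f z) (Some 0) \<ge> \<eta>"
proof -
  have "\<exists>\<eta>>0. \<forall>c. \<exists>z\<in>ball c \<rho>. chordal (f z) (Some 0) \<ge> \<eta>"
  proof (rule ccontr)
    assume neg: "\<not> ?thesis"
    have "\<forall>n. \<exists>c. \<forall>z\<in>ball c \<rho>. chordal (f z) (Some 0) < 1 / real (Suc n)"
    proof
      fix n :: nat
      have "1 / real (Suc n) > 0" by simp
      then show "\<exists>c. \<forall>z\<in>ball c \<rho>. chordal (f z) (Some 0) < 1 / real (Suc n)"
        using neg by (meson not_le)
    qed
    then obtain c where c: "\<And>n z. z \<in> ball (c n) \<rho> \<Longrightarrow> chordal (f z) (Some 0) < 1 / real (Suc n)" by metis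
    have norm: "normal_fun f" using assms(1) by (simp add: N1_def)
    obtain \<delta> where \<delta>: "\<delta> > 0" "\<And>z w. dist z w < \<delta> \<Longrightarrow> chordal (f z) (f w) < 1/3"
      using normal_uniformly_continuous[OF norm mo, of "1/3"] by auto
    have dich: "bounded2 f c \<delta> \<or> bounded2 (\<lambda>z. sinv (f z)) c \<delta>" for c
      using bounded2_dichotomy[of \<delta> f c] \<delta>(2) by blast
    define s where "s = min \<rho> (\<delta> / 4)"
    have s: "s > 0" "s \<le> \<rho>" "4 * s \<le> \<delta>" using \<rho> \<delta> by (auto simp: s_def)
    define P where "P = (\<lambda>R. \<forall>e>0. \<exists>N. \<forall>n\<ge>N. \<forall>z\<in>ball (c n) R. chordal (f z) (Some 0) < e)"
    have P0: "P \<rho>" unfolding P_def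
    proof (intro allI impI)
      fix e :: real assume "e > 0"
      then obtain N where N: "1 / real (Suc N) < e" using nat_approx_posE by blast
      have "chordal (f z) (Some 0) < e" if "n \<ge> N" "z \<in> ball (c n) \<rho>" for n z
      proof -
        have "1 / real (Suc n) \<le> 1 / real (Suc N)" using that by (simp add: divide_simps)
        then show ?thesis using c[OF that(2)] N by simp
      qed
      then show "\<exists>N. \<forall>n\<ge>N. \<forall>z\<in>ball (c n) \<rho>. chordal (f z) (Some 0) < e" by blast
    qed
    have Pstep: "P (R + s)" if PR: "P R" and R: "R \<ge> s" for R unfolding P_def
    proof (intro allI impI)
      fix e :: real assume e: "e > 0"
      then have "e / 2 > 0" by simp
      obtain \<eta> where \<eta>: "\<eta> > 0" "\<And>h c z. h holomorphic_on ball c (4 * s) \<Longrightarrow> (\<And>z. z \<in> ball c (4 * s) \<Longrightarrow> cmod (h z) \<le> 2) \<Longrightarrow>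
        (\<And>z. z \<in> ball c s \<Longrightarrow> cmod (h z) \<le> \<eta>) \<Longrightarrow> z \<in> ball c (2 * s) \<Longrightarrow> cmod (h z) < e / 2"
        using two_circle_bound[OF s(1) \<open>e / 2 > 0\<close>] by metis
      \<comment> \<open>1/2 is the threshold of \<open>chordal_0_cases\<close>; the factor 2/3
        undoes the 3/2 lost in \<open>cmod_le_chordal_0\<close>.\<close>
      have "min (1/2) (\<eta> * 2/3) > 0" using \<eta> by simp
      then obtain N where N: "\<And>n z. n \<ge> N \<Longrightarrow> z \<in> ball (c n) R \<Longrightarrow> chordal (f z) (Some 0) < min (1/2) (\<eta> * 2/3)"
        using PR unfolding P_def by meson
      have "chordal (f z) (Some 0) < e" if n: "n \<ge> N" and z: "z \<in> ball (c n) (R + s)" for n z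
      proof -
        define t where "t = (R - s) / (R + s)"
        have t: "0 \<le> t" "t \<le> 1" "t * (R + s) = R - s" "(1 - t) * (R + s) = 2 * s"
          using R s by (auto simp: t_def field_simps)
        \<comment> \<open>Contracting \<open>z\<close> towards the centre by \<open>t\<close> gives
          a point whose \<open>s\<close>-disc lies in the disc already known to be small, while
          \<open>z\<close> is still within \<open>2 * s\<close> of it.\<close>
        define z' where "z' = c n + t *\<^sub>R (z - c n)"
        have zc: "cmod (z - c n) < R + s" using z by (simp add: dist_norm norm_minus_commute)
        have z'c: "cmod (z' - c n) \<le> R - s"
        proof -
          have "cmod (z' - c n) = t * cmod (z - c n)" using t by (simp add: z'_def)
          also have "\<dots> \<le> t * (R + s)" using t zc by (intro mult_left_mono) auto
          finally show ?thesis using t by simp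
        qed
        have zz': "cmod (z - z') < 2 * s"
        proof -
          have "z - z' = (1 - t) *\<^sub>R (z - c n)" by (simp add: z'_def algebra_simps)
          then have "cmod (z - z') = (1 - t) * cmod (z - c n)" using t by simp
          also have "\<dots> < (1 - t) * (R + s)" using zc t s R by (intro mult_strict_left_mono) (auto simp: t_def field_simps)
          finally show ?thesis using t by simp
        qed
        have sub: "x \<in> ball (c n) R" if "x \<in> ball z' s" for x
        proof -
          have "cmod (x - c n) \<le> cmod (x - z') + cmod (z' - c n)" using norm_triangle_ineq[of "x - z'" "z' - c n"] by simp
          then show ?thesis using that z'c by (simp add: dist_norm norm_minus_commute)
        qed
        have "chordal (f z') (Some 0) < 1/2" using N[OF n sub[of z']] s by simp
        then have b2: "bounded2 f z' \<delta>" using chordal_0_cases[OF dich] \<delta>(1) by blast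
        have b2': "f x = Some (the (f x)) \<and> cmod (the (f x)) \<le> 2" if "x \<in> ball z' (4 * s)" for x
        proof -
          have "x \<in> ball z' \<delta>" using that s by auto
          then show ?thesis using b2 unfolding bounded2_def by (metis option.sel)
        qed
        have "cmod (the (f z)) < e / 2"
        proof (rule \<eta>(2)[of "\<lambda>z. the (f z)" z'])
          show "(\<lambda>z. the (f z)) holomorphic_on ball z' (4 * s)"
            using b2' by (intro holomorphic_the[OF mo]) force
          show "z \<in> ball z' (2 * s)" using zz' by (simp add: dist_norm norm_minus_commute)
          fix x assume x: "x \<in> ball z' s"
          then have "x \<in> ball z' (4 * s)" using s by auto
          then have "cmod (the (f x)) \<le> 3/2 * chordal (f x) (Some 0)" using b2' cmod_le_chordal_0 by metis
          then show "cmod (the (f x)) \<le> \<eta>" using N[OF n sub[OF x]] by simp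
        qed (use b2' in auto)
        moreover have "f z = Some (the (f z))" using b2' zz' s by (auto simp: dist_norm norm_minus_commute)
        ultimately show ?thesis using chordal_Some_le[of "the (f z)" 0] by simp
      qed
      then show "\<exists>N. \<forall>n\<ge>N. \<forall>z\<in>ball (c n) (R + s). chordal (f z) (Some 0) < e" by blast
    qed
    have Pk: "P (\<rho> + real k * s)" for k
    proof (induction k)
      case (Suc k)
      have "\<rho> + real k * s \<ge> s" using s by (simp add: add_increasing2)
      from Pstep[OF Suc this] show ?case by (simp add: algebra_simps)
    qed (simp add: P0)
    have "chordal_lim_seq (\<lambda>n z. f (z + c n)) (\<lambda>_. Some 0)" unfolding chordal_lim_seq_def
    proof (intro allI impI)
      fix K :: "complex set" and e :: real assume K: "compact K" and e: "e > 0"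
      obtain B where B: "\<forall>z\<in>K. cmod z \<le> B" using compact_imp_bounded[OF K] by (auto simp: bounded_iff)
      obtain k :: nat where "real k * s > B" using reals_Archimedean3[OF s(1)] by blast
      then have k: "\<forall>z\<in>K. cmod z < \<rho> + real k * s" using B \<rho> by force
      obtain N where "\<And>n z. n \<ge> N \<Longrightarrow> z \<in> ball (c n) (\<rho> + real k * s) \<Longrightarrow> chordal (f z) (Some 0) < e"
        using Pk[of k] e unfolding P_def by meson
      then show "\<exists>N. \<forall>n\<ge>N. \<forall>z\<in>K. chordal (f (z + c n)) (Some 0) < e"
        using k by (intro exI[of _ N]) (auto simp: dist_norm)
    qed
    then show False using assms(1) unfolding N1_def by blast
  qed
  then show thesis using that by blast
qed

lemma N1_sinv:
  assumes "N1 f" "divisor_of D f" "locally_finite D"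
  shows "N1 (\<lambda>z. sinv (f z))"
proof -
  have m: "meromorphic_C (\<lambda>z. sinv (f z))"
    using divisor_of_sinv[OF assms(3,2)] by (simp add: divisor_of_def)
  have eq: "chordal (sinv u) c = chordal u (sinv c)" for u c
    using chordal_sinv[of u "sinv c"] by simp
  show ?thesis using assms(1) m
    unfolding N1_def normal_fun_def chordal_cauchy_seq_def chordal_lim_seq_def by (simp add: eq)
qed

text \<open>ln M - ln |G| is a positive harmonic function on the disc, and at half the radius
  Harnack's constant is (1 + 1/2) / (1 - 1/2) = 3. The inequality is derived from the Schwarz lemma
  for a holomorphic function with this real part.\<close>

lemma Harnack_lower_bound:
  assumes G: "G holomorphic_on ball z0 R" "\<And>z. z \<in> ball z0 R \<Longrightarrow> G z \<noteq> 0"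
    and M: "\<And>z. z \<in> ball z0 R \<Longrightarrow> cmod (G z) < M" and z: "dist z0 z \<le> R / 2" and R: "R > 0"
  shows "ln (cmod (G z)) \<ge> ln M - 3 * (ln M - ln (cmod (G z0)))"
proof -
  obtain H where H: "H holomorphic_on ball z0 R" "\<And>z. z \<in> ball z0 R \<Longrightarrow> G z = exp (H z)"
    using contractible_imp_holomorphic_log[OF G(1) convex_imp_contractible[OF convex_ball] G(2)] by metis
  have Mpos: "M > 0" using M[of z0] R by (smt (verit) centre_in_ball norm_ge_zero)
  define w where "w = (\<lambda>u. of_real (ln M) - H (z0 + of_real R * u))"
  have inb: "z0 + of_real R * u \<in> ball z0 R" if "cmod u < 1" for u
    using that R by (simp add: dist_norm norm_mult)
  have lnG: "ln (cmod (G z)) = Re (H z)" if "z \<in> ball z0 R" for z using H(2)[OF that] by simp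
  have Rew: "Re (w u) > 0" if "cmod u < 1" for u
  proof -
    have "exp (Re (H (z0 + of_real R * u))) < M" using M[OF inb[OF that]] H(2)[OF inb[OF that]] by simp
    then show ?thesis using Mpos by (simp add: w_def ln_exp[symmetric] del: ln_exp) (metis exp_gt_zero ln_exp ln_less_cancel_iff)
  qed
  have holw: "w holomorphic_on ball 0 1"
  proof -
    have "(H \<circ> (\<lambda>u. z0 + of_real R * u)) holomorphic_on ball 0 1"
      by (rule holomorphic_on_compose_gen[OF _ H(1)]) (use inb in \<open>auto intro!: holomorphic_intros\<close>)
    then show ?thesis unfolding w_def by (auto simp: o_def intro!: holomorphic_intros)
  qed
  \<comment> \<open>Cayley transform of the right half-plane onto the unit disc sending
    \<open>w 0\<close> to 0, so that the Schwarz lemma applies.\<close>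
  define \<phi> where "\<phi> = (\<lambda>u. (w u - w 0) / (w u + cnj (w 0)))"
  have den: "Re (w u + cnj (w 0)) > 0" if "cmod u < 1" for u using Rew[OF that] Rew[of 0] by simp
  have den0: "w u + cnj (w 0) \<noteq> 0" if "cmod u < 1" for u using den[OF that] by (metis order_less_irrefl zero_complex.sel(1))
  have cmp: "(cmod (a - b))\<^sup>2 < (cmod (a + cnj b))\<^sup>2" if "Re a > 0" "Re b > 0" for a b
  proof -
    have "(cmod (a + cnj b))\<^sup>2 - (cmod (a - b))\<^sup>2 = 4 * (Re a * Re b)"
      by (simp only: cmod_power2) (simp add: power2_eq_square algebra_simps)
    then show ?thesis using that by (smt (verit) mult_pos_pos)
  qed
  have phi1: "cmod (\<phi> u) < 1" if "cmod u < 1" for u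
  proof -
    have "cmod (w u - w 0) < cmod (w u + cnj (w 0))"
      using cmp[OF Rew[OF that] Rew[of 0]] by (simp add: power2_less_imp_less)
    then show ?thesis using den0[OF that] by (simp add: \<phi>_def norm_divide)
  qed
  have holphi: "\<phi> holomorphic_on ball 0 1"
    unfolding \<phi>_def using den0 by (intro holomorphic_intros holw) auto
  define u where "u = (z - z0) / of_real R"
  have u: "cmod u \<le> 1/2" using z R by (simp add: u_def norm_divide dist_norm norm_minus_commute field_simps)
  have zu: "z0 + of_real R * u = z" using R by (simp add: u_def)
  have u1: "cmod u < 1" using u by simp
  have "cmod (\<phi> u) \<le> cmod u"
    by (rule Schwarz_Lemma(1)[OF holphi _ phi1]) (use u1 in \<open>auto simp: \<phi>_def\<close>)
  then have "cmod (\<phi> u) \<le> 1/2" using u by simp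
  then have "cmod (w u - w 0) \<le> 1/2 * cmod (w u + cnj (w 0))"
    using den0[OF u1] by (simp add: \<phi>_def norm_divide divide_simps split: if_splits)
  then have "(cmod (w u - w 0))\<^sup>2 \<le> (1/2 * cmod (w u + cnj (w 0)))\<^sup>2" by (intro power_mono) auto
  then have "(Re (w u) - Re (w 0))\<^sup>2 + (Im (w u) - Im (w 0))\<^sup>2 \<le> 1/4 * ((Re (w u) + Re (w 0))\<^sup>2 + (Im (w u) - Im (w 0))\<^sup>2)"
    by (simp only: power_mult_distrib cmod_power2) (simp add: power2_eq_square)
  then have "(Re (w u) - Re (w 0))\<^sup>2 \<le> ((Re (w u) + Re (w 0)) / 2)\<^sup>2"
    by (simp add: power_divide) (smt (verit) zero_le_power2)
  then have "\<bar>Re (w u) - Re (w 0)\<bar> \<le> (Re (w u) + Re (w 0)) / 2"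
    using Rew[OF u1] Rew[of 0] by (metis abs_le_square_iff abs_of_pos add_pos_pos half_gt_zero norm_zero zero_less_one)
  then have "Re (w u) - Re (w 0) \<le> (Re (w u) + Re (w 0)) / 2" by (rule abs_le_D1)
  then have "(Re (w u) - Re (w 0)) * 2 \<le> Re (w u) + Re (w 0)" by (subst (asm) pos_le_divide_eq) simp_all
  then have "Re (w u) \<le> 3 * Re (w 0)" by (simp add: algebra_simps)
  moreover have "Re (w u) = ln M - ln (cmod (G z))"
    using lnG[of z] inb[OF u1] zu by (simp add: w_def)
  moreover have "Re (w 0) = ln M - ln (cmod (G z0))"
    using lnG[of z0] R by (simp add: w_def)
  ultimately show ?thesis by simp
qed

lemma divpoly_bounds:
  assumes "\<And>a. a \<in> S \<Longrightarrow> D a \<ge> 0" "finite {a\<in>S. D a \<noteq> 0}"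
  shows "x \<ge> 0 \<Longrightarrow> (\<And>a. a \<in> S \<Longrightarrow> D a \<noteq> 0 \<Longrightarrow> x \<le> cmod (z - a)) \<Longrightarrow> x ^ nat (\<Sum>a\<in>{a\<in>S. D a \<noteq> 0}. D a) \<le> cmod (divpoly D S z)"
    and "(\<And>a. a \<in> S \<Longrightarrow> D a \<noteq> 0 \<Longrightarrow> cmod (z - a) \<le> x) \<Longrightarrow> cmod (divpoly D S z) \<le> x ^ nat (\<Sum>a\<in>{a\<in>S. D a \<noteq> 0}. D a)"
proof -
  have n: "nat (\<Sum>a\<in>{a\<in>S. D a \<noteq> 0}. D a) = (\<Sum>a\<in>{a\<in>S. D a \<noteq> 0}. nat (D a))"
  proof -
    have "(\<Sum>a\<in>{a\<in>S. D a \<noteq> 0}. D a) = int (\<Sum>a\<in>{a\<in>S. D a \<noteq> 0}. nat (D a))"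
      unfolding of_nat_sum using assms(1) by (intro sum.cong) auto
    then show ?thesis by (simp only: nat_int)
  qed
  have p: "cmod (divpoly D S z) = (\<Prod>a\<in>{a\<in>S. D a \<noteq> 0}. cmod (z - a) ^ nat (D a))"
    unfolding divpoly_def prod_norm[symmetric] using assms(1)
    by (intro prod.cong) (auto simp: norm_power power_int_def)
  show "x ^ nat (\<Sum>a\<in>{a\<in>S. D a \<noteq> 0}. D a) \<le> cmod (divpoly D S z)"
    if "x \<ge> 0" "\<And>a. a \<in> S \<Longrightarrow> D a \<noteq> 0 \<Longrightarrow> x \<le> cmod (z - a)"
    unfolding n p power_sum using that by (intro prod_mono) (auto intro!: power_mono)
  show "cmod (divpoly D S z) \<le> x ^ nat (\<Sum>a\<in>{a\<in>S. D a \<noteq> 0}. D a)"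
    if "\<And>a. a \<in> S \<Longrightarrow> D a \<noteq> 0 \<Longrightarrow> cmod (z - a) \<le> x"
    unfolding n p power_sum using that by (intro prod_mono) (auto intro!: power_mono)
qed

lemma ln_power_int_pos:
  fixes x :: real assumes "x > 0" shows "ln (x powi k) = of_int k * ln x"
proof -
  have "x powi k = x powr of_int k" using assms by (simp add: powr_real_of_int')
  then show ?thesis using assms by (simp add: ln_powr)
qed

lemma ln_divpoly:
  assumes "finite {a\<in>S. D a \<noteq> 0}" "D z = 0"
  shows "ln (cmod (divpoly D S z)) = dsum D S (\<lambda>a. ln (cmod (z - a)))"
proof -
  have "ln (cmod (divpoly D S z)) = (\<Sum>a\<in>{a\<in>S. D a \<noteq> 0}. ln (cmod (z - a) powi D a))"
    unfolding divpoly_def prod_norm[symmetric] norm_power_int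
    by (subst ln_prod) (use assms in \<open>auto simp: zero_less_power_int\<close>)
  also have "\<dots> = (\<Sum>a\<in>{a\<in>S. D a \<noteq> 0}. of_int (D a) * ln (cmod (z - a)))"
  proof (intro sum.cong refl)
    fix a assume "a \<in> {a\<in>S. D a \<noteq> 0}"
    then have "z \<noteq> a" using assms(2) by auto
    then show "ln (cmod (z - a) powi D a) = of_int (D a) * ln (cmod (z - a))" by (subst ln_power_int_pos) auto
  qed
  finally show ?thesis by (simp add: dsum_def)
qed


text \<open>On a disc where \<open>\<bar>f\<bar> \<le> 2\<close>, a point with \<open>\<bar>f\<bar> \<ge> \<eta>\<close> bounds the number of zeros by the maximum principle,
  and Harnack's inequality for the zero-free factor turns it into a lower bound for \<open>\<bar>f\<bar>\<close> up to the zeros.\<close>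
lemma local_growth:
  assumes \<delta>: "0 < \<delta>" "\<delta> \<le> 1" and \<eta>: "\<eta> > 0"
  obtains N C where "\<And>f D c z0 w0. locally_finite D \<Longrightarrow> (\<And>z. mer_order f z (D z)) \<Longrightarrow> bounded2 f c \<delta> \<Longrightarrow>
      z0 \<in> ball c (\<delta> / 16) \<Longrightarrow> f z0 = Some w0 \<Longrightarrow> \<eta> \<le> cmod w0 \<Longrightarrow>
      dabs D (ball c (\<delta> / 8)) \<le> N \<and>
      (D c = 0 \<longrightarrow> (\<exists>w. w \<noteq> 0 \<and> f c = Some w \<and> \<bar>ln (cmod w) - dsum D (ball c (\<delta> / 8)) (\<lambda>a. ln (cmod (c - a)))\<bar> \<le> C))"
proof -
  \<comment> \<open>Each zero near \<open>z0\<close> costs a factor 2, the ratio of \<delta>/2 (its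
    least distance from the outer circle) to \<delta>/4 (its greatest distance from
    \<open>z0\<close>). Since |f| \<le> 2 on that circle and |f| \<ge> \<eta> at \<open>z0\<close>,
    the count \<open>m\<close> satisfies 2^m \<le> 2/\<eta>. The 3 in \<open>M\<close> stands in
    place of a 2 to make the later bound strict.\<close>
  obtain n :: nat where n: "2 ^ n > 2 / \<eta>" using real_arch_pow[of 2 "2/\<eta>"] by auto
  define M where "M = 3 * (2 / \<delta>) ^ n"
  define N where "N = real n"
  define C1 where "C1 = \<bar>ln M\<bar> + 3 * (ln M - ln \<eta>)"
  define C where "C = C1 + N * ln (8 / \<delta>)"
  show thesis
  proof (rule that[of N C])
    fix f D c z0 w0
    assume lf: "locally_finite D" and mo: "\<And>z. mer_order f z (D z)" and b2: "bounded2 f c \<delta>"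
      and z0: "z0 \<in> ball c (\<delta> / 16)" and w0: "f z0 = Some w0" "\<eta> \<le> cmod w0"
    have cz0: "dist c z0 < \<delta> / 16" using z0 by simp
    have inb: "z \<in> ball c \<delta>" if "dist z0 z < 7/8 * \<delta>" for z
      using that cz0 dist_triangle[of c z z0] \<delta> by simp
    have fz: "\<exists>w. f z = Some w \<and> cmod w \<le> 2" if "z \<in> ball c \<delta>" for z using b2 that by (simp add: bounded2_def)
    have Dnn: "D z \<ge> 0" if "z \<in> ball c \<delta>" for z
      using fz[OF that] mer_order_None_iff[OF mo, of z] by force
    define U where "U = ball z0 (7/8 * \<delta>)"
    define B where "B = ball z0 (\<delta>/4)"
    have BU: "B \<subseteq> U" using \<delta> by (auto simp: B_def U_def)
    have Uc: "z \<in> ball c \<delta>" if "z \<in> U" for z using inb that by (simp add: U_def)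
    obtain F where F: "F holomorphic_on U" "\<And>z. z \<in> U \<Longrightarrow> F z \<noteq> 0"
      "\<And>z. z \<in> U \<Longrightarrow> D z \<ge> 0 \<Longrightarrow> f z = Some (F z * divpoly D U z)"
      using divisor_factor[OF mo lf, of U] by (metis U_def bounded_ball open_ball)
    have finU: "finite {a\<in>U. D a \<noteq> 0}" by (rule locally_finite_bounded[OF lf]) (simp add: U_def)
    have finB: "finite {a\<in>B. D a \<noteq> 0}" by (rule locally_finite_bounded[OF lf]) (simp add: B_def)
    define m where "m = nat (\<Sum>a\<in>{a\<in>B. D a \<noteq> 0}. D a)"
    have spl: "divpoly D U z = divpoly D B z * divpoly D (U - B) z" for z
    proof -
      have "{a\<in>U. D a \<noteq> 0} = {a\<in>B. D a \<noteq> 0} \<union> {a\<in>U - B. D a \<noteq> 0}" using BU by auto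
      then show ?thesis unfolding divpoly_def using finU
        by (simp only:) (subst prod.union_disjoint, auto)
    qed
    \<comment> \<open>Only the zeros in \<open>B\<close> are divided out: \<open>G\<close> must be
      zero-free on \<open>B\<close> for Harnack's inequality, while its zeros outside
      \<open>B\<close> do no harm to the maximum principle.\<close>
    define G where "G = (\<lambda>z. F z * divpoly D (U - B) z)"
    have holG: "G holomorphic_on U"
      unfolding G_def divpoly_def using Dnn Uc by (auto intro!: holomorphic_intros F)
    have fG: "f z = Some (G z * divpoly D B z)" if "z \<in> U" for z
      using F(3)[OF that Dnn[OF Uc[OF that]]] by (simp add: G_def spl mult.commute mult.left_commute)
    have Gnz: "G z \<noteq> 0" if "z \<in> B" for z
    proof -
      have "finite {a\<in>U - B. D a \<noteq> 0}" by (rule finite_subset[OF _ finU]) auto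
      then have "divpoly D (U - B) z \<noteq> 0" using that
        by (auto simp: divpoly_def prod_zero_iff power_int_eq_0_iff)
      then show ?thesis using F(2) BU that by (auto simp: G_def)
    qed
    have DB: "D a \<ge> 0" if "a \<in> B" for a using Dnn Uc BU that by blast
    \<comment> \<open>On the circle of radius 3\<delta>/4 every zero in \<open>B\<close> is at
      distance at least \<delta>/2, so dividing by \<open>divpoly\<close> costs a controlled factor;
      the maximum principle carries the bound inward.\<close>
    have Gle: "cmod (G z) \<le> 2 / (\<delta> / 2) ^ m" if z: "z \<in> cball z0 (3/4 * \<delta>)" for z
    proof (rule maximum_modulus_frontier[of G "cball z0 (3/4 * \<delta>)"])
      have sub: "cball z0 (3/4 * \<delta>) \<subseteq> U" using \<delta> by (auto simp: U_def)
      show "G holomorphic_on interior (cball z0 (3/4 * \<delta>))" 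
        using holG sub interior_subset by (meson holomorphic_on_subset order_trans)
      show "continuous_on (closure (cball z0 (3/4 * \<delta>))) G"
        using holomorphic_on_imp_continuous_on[OF holG] sub continuous_on_subset by auto
      fix x assume "x \<in> frontier (cball z0 (3/4 * \<delta>))"
      then have x: "dist z0 x = 3/4 * \<delta>" using \<delta> by (simp add: frontier_cball)
      have xU: "x \<in> U" using x \<delta> by (simp add: U_def)
      have "(\<delta> / 2) ^ m \<le> cmod (divpoly D B x)" unfolding m_def
      proof (rule divpoly_bounds(1)[OF DB finB])
        fix a assume "a \<in> B"
        then have "dist z0 a < \<delta> / 4" by (simp add: B_def)
        then show "\<delta> / 2 \<le> cmod (x - a)" using x dist_triangle[of z0 x a] by (simp add: dist_norm norm_minus_commute)
      qed (use \<delta> in auto)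
      moreover have "cmod (G x * divpoly D B x) \<le> 2" using fz[OF Uc[OF xU]] fG[OF xU] by auto
      ultimately have "cmod (G x) * (\<delta> / 2) ^ m \<le> 2"
        using mult_left_mono[of "(\<delta> / 2) ^ m" "cmod (divpoly D B x)" "cmod (G x)"] by (simp add: norm_mult)
      then show "cmod (G x) \<le> 2 / (\<delta> / 2) ^ m" using \<delta> by (simp add: field_simps)
    qed (use z in auto)
    have z0U: "z0 \<in> U" "z0 \<in> B" using \<delta> by (auto simp: U_def B_def)
    have "cmod (divpoly D B z0) \<le> (\<delta> / 4) ^ m" unfolding m_def
      by (rule divpoly_bounds(2)[OF DB finB]) (auto simp: B_def dist_norm)
    moreover have "\<eta> \<le> cmod (G z0) * cmod (divpoly D B z0)" using fG[OF z0U(1)] w0 by (simp add: norm_mult)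
    ultimately have Gz0: "\<eta> \<le> cmod (G z0) * (\<delta> / 4) ^ m"
      by (meson norm_ge_zero mult_left_mono order_trans)
    have "cmod (G z0) * (\<delta> / 4) ^ m \<le> 2 / (\<delta> / 2) ^ m * (\<delta> / 4) ^ m"
      using Gle[of z0] \<delta> by (intro mult_right_mono) auto
    also have "\<dots> = 2 / 2 ^ m"
    proof -
      have "(\<delta> / 2) ^ m = 2 ^ m * (\<delta> / 4) ^ m" by (simp add: power_mult_distrib[symmetric])
      then show ?thesis using \<delta> by simp
    qed
    finally have "\<eta> \<le> 2 / 2 ^ m" using Gz0 by simp
    then have "2 ^ m \<le> 2 / \<eta>" using \<eta> by (simp add: field_simps)
    then have "(2::real) ^ m < 2 ^ n" using n by (rule order_le_less_trans)
    then have mn: "m < n" by (rule power_less_imp_less_exp[rotated]) simp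
    have "(\<delta> / 4) ^ m \<le> 1" using \<delta> by (intro power_le_one) auto
    then have Gz0': "\<eta> \<le> cmod (G z0)"
      using Gz0 by (meson norm_ge_zero mult_left_le order_trans)
    have Mbd: "cmod (G z) < M" if "z \<in> ball z0 (\<delta> / 4)" for z
    proof -
      have "cmod (G z) \<le> 2 / (\<delta> / 2) ^ m" using that \<delta> by (intro Gle) auto
      also have "\<dots> = 2 * (2 / \<delta>) ^ m" by (simp add: power_divide)
      also have "\<dots> \<le> 2 * (2 / \<delta>) ^ n" using \<delta> mn by (intro mult_left_mono power_increasing) auto
      also have "\<dots> < M" using \<delta> by (simp add: M_def)
      finally show ?thesis .
    qed
    have Mpos: "M > 0" using \<delta> by (simp add: M_def)
    have eM: "\<eta> < M" using Mbd[of z0] Gz0' \<delta> by simp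
    have sub8: "ball c (\<delta> / 8) \<subseteq> B"
    proof
      fix x assume "x \<in> ball c (\<delta> / 8)"
      then show "x \<in> B" using cz0 dist_triangle[of z0 x c] \<delta> by (simp add: B_def dist_commute)
    qed
    have dB: "dabs D B \<le> N"
    proof -
      have "dabs D B = real_of_int (\<Sum>a\<in>{a\<in>B. D a \<noteq> 0}. D a)"
        unfolding dabs_def of_int_sum using DB by (intro sum.cong) auto
      also have "\<dots> \<le> real m" unfolding m_def by linarith
      finally show ?thesis using mn by (simp add: N_def)
    qed
    have bB: "bounded B" by (simp add: B_def)
    show "dabs D (ball c (\<delta> / 8)) \<le> N \<and>
      (D c = 0 \<longrightarrow> (\<exists>w. w \<noteq> 0 \<and> f c = Some w \<and> \<bar>ln (cmod w) - dsum D (ball c (\<delta> / 8)) (\<lambda>a. ln (cmod (c - a)))\<bar> \<le> C))"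
    proof (intro conjI impI)
      show "dabs D (ball c (\<delta> / 8)) \<le> N" using dabs_mono[OF lf bB sub8] dB by simp
      assume Dc: "D c = 0"
      have cB: "c \<in> B" using sub8 \<delta> by auto
      have fc: "f c = Some (G c * divpoly D B c)" using fG BU cB by blast
      have nz: "divpoly D B c \<noteq> 0" by (rule divpoly_nonzero[OF Dc finB])
      have Gc: "G c \<noteq> 0" by (rule Gnz[OF cB])
      have "ln (cmod (G c)) \<ge> ln M - 3 * (ln M - ln (cmod (G z0)))"
        by (rule Harnack_lower_bound[of G z0 "\<delta>/4"])
          (use holG BU Gnz Mbd cz0 \<delta> in \<open>auto simp: B_def dist_commute elim: holomorphic_on_subset\<close>)
      moreover have "ln (cmod (G z0)) \<ge> ln \<eta>" using Gz0' \<eta> by (subst ln_le_cancel_iff) auto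
      moreover have "ln (cmod (G c)) \<le> ln M" using Mbd[of c] cB Gc Mpos by (subst ln_le_cancel_iff) (auto simp: B_def less_imp_le)
      moreover have "ln \<eta> \<le> ln M" using eM \<eta> by simp
      ultimately have lnG: "\<bar>ln (cmod (G c))\<bar> \<le> C1"
        using abs_ge_self[of "ln M"] abs_ge_minus_self[of "ln M"] unfolding C1_def abs_le_iff
        by (simp add: algebra_simps)
      have e1: "ln (cmod (G c * divpoly D B c)) = ln (cmod (G c)) + dsum D B (\<lambda>a. ln (cmod (c - a)))"
        using Gc nz ln_divpoly[OF finB Dc] by (simp add: norm_mult ln_mult)
      have e2: "dsum D B (\<lambda>a. ln (cmod (c - a))) = dsum D (ball c (\<delta> / 8)) (\<lambda>a. ln (cmod (c - a)))
          + dsum D (B - ball c (\<delta> / 8)) (\<lambda>a. ln (cmod (c - a)))"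
        by (rule dsum_diff[OF lf bB sub8])
      \<comment> \<open>The zeros of \<open>B\<close> outside the small disc about \<open>c\<close>
        have distance between \<delta>/8 and 1 from \<open>c\<close>, so each changes the
        logarithmic sum by at most ln (8/\<delta>).\<close>
      have "norm (dsum D (B - ball c (\<delta> / 8)) (\<lambda>a. ln (cmod (c - a)))) \<le> dabs D (B - ball c (\<delta> / 8)) * ln (8 / \<delta>)"
      proof (rule norm_dsum_le)
        fix a assume a: "a \<in> B - ball c (\<delta> / 8)"
        then have l: "cmod (c - a) \<ge> \<delta> / 8" by (simp add: dist_norm)
        have "cmod (c - a) < \<delta> / 16 + \<delta> / 4"
          using a cz0 dist_triangle[of c a z0] by (simp add: B_def dist_norm)
        then have u: "cmod (c - a) \<le> 1" using \<delta> by simp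
        have pos: "cmod (c - a) > 0" using l \<delta> by linarith
        have "ln (\<delta> / 8) \<le> ln (cmod (c - a))" using l \<delta> pos by (subst ln_le_cancel_iff) auto
        moreover have "ln (8 / \<delta>) = - ln (\<delta> / 8)" using \<delta> by (simp add: ln_div)
        moreover have "ln (cmod (c - a)) \<le> 0" using u pos by simp
        ultimately show "norm (ln (cmod (c - a))) \<le> ln (8 / \<delta>)" by simp
      qed
      also have "\<dots> \<le> N * ln (8 / \<delta>)"
        using dabs_mono[OF lf bB, of "B - ball c (\<delta> / 8)"] dB \<delta> by (intro mult_right_mono) auto
      finally have "\<bar>ln (cmod (G c * divpoly D B c)) - dsum D (ball c (\<delta> / 8)) (\<lambda>a. ln (cmod (c - a)))\<bar> \<le> C"
        using e1 e2 lnG unfolding C_def by simp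
      then show "\<exists>w. w \<noteq> 0 \<and> f c = Some w \<and> \<bar>ln (cmod w) - dsum D (ball c (\<delta> / 8)) (\<lambda>a. ln (cmod (c - a)))\<bar> \<le> C"
        using fc nz Gc by auto
    qed
  qed
qed

text \<open>The dichotomy decides whether \<open>local_growth\<close> is applied to \<open>f\<close>
  or to its inversion; \<open>N1_not_small\<close>, used for both, supplies near every centre a
  point where the bounded one is not small. Both cases give the same statement about
  \<open>D\<close>, since inversion changes the sign of the logarithm and of the divisor.\<close>

lemma N1_growth:
  assumes N1: "N1 f" and div: "divisor_of D f" and lf: "locally_finite D"
  obtains N C where "\<And>c. dabs D (cball c 1) \<le> N" "growth D f C"
proof -
  have mo: "\<And>z. mer_order f z (D z)" using div by (simp add: divisor_of_def)
  have N1': "N1 (\<lambda>z. sinv (f z))" by (rule N1_sinv[OF N1 div lf])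
  have mo': "\<And>z. mer_order (\<lambda>z. sinv (f z)) z (- D z)" using mo mer_order_sinv by blast
  have lf': "locally_finite (\<lambda>z. - D z)" using lf by (simp add: locally_finite_def)
  have norm: "normal_fun f" using N1 by (simp add: N1_def)
  obtain \<delta>0 where \<delta>0: "\<delta>0 > 0" "\<And>z w. dist z w < \<delta>0 \<Longrightarrow> chordal (f z) (f w) < 1/3"
    using normal_uniformly_continuous[OF norm mo, of "1/3"] by auto
  define \<delta> where "\<delta> = min \<delta>0 1"
  have \<delta>: "0 < \<delta>" "\<delta> \<le> 1" using \<delta>0 by (auto simp: \<delta>_def)
  have dich: "bounded2 f c \<delta> \<or> bounded2 (\<lambda>z. sinv (f z)) c \<delta>" for c
    using bounded2_dichotomy[of \<delta> f c] \<delta>0(2) unfolding \<delta>_def by (meson min_less_iff_conj)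
  have d16: "\<delta> / 16 > 0" using \<delta> by simp
  obtain \<eta>1 where \<eta>1: "\<eta>1 > 0" "\<And>c. \<exists>z\<in>ball c (\<delta> / 16). chordal (f z) (Some 0) \<ge> \<eta>1"
    using N1_not_small[OF N1 mo d16] by metis
  obtain \<eta>2 where \<eta>2: "\<eta>2 > 0" "\<And>c. \<exists>z\<in>ball c (\<delta> / 16). chordal (sinv (f z)) (Some 0) \<ge> \<eta>2"
    using N1_not_small[OF N1' mo' d16] by metis
  \<comment> \<open>The halving compensates \<open>chordal_Some_le\<close>: a chordal distance of at
    least 2\<eta> from 0 gives modulus at least \<eta>.\<close>
  define \<eta> where "\<eta> = min \<eta>1 \<eta>2 / 2"
  have \<eta>: "\<eta> > 0" using \<eta>1 \<eta>2 by (simp add: \<eta>_def)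
  obtain N C where loc: "\<And>f D c z0 w0. locally_finite D \<Longrightarrow> (\<And>z. mer_order f z (D z)) \<Longrightarrow> bounded2 f c \<delta> \<Longrightarrow>
      z0 \<in> ball c (\<delta> / 16) \<Longrightarrow> f z0 = Some w0 \<Longrightarrow> \<eta> \<le> cmod w0 \<Longrightarrow>
      dabs D (ball c (\<delta> / 8)) \<le> N \<and>
      (D c = 0 \<longrightarrow> (\<exists>w. w \<noteq> 0 \<and> f c = Some w \<and> \<bar>ln (cmod w) - dsum D (ball c (\<delta> / 8)) (\<lambda>a. ln (cmod (c - a)))\<bar> \<le> C))"
    using local_growth[OF \<delta> \<eta>] by blast
  have pick: "\<exists>z0\<in>ball c (\<delta> / 16). \<exists>w0. h z0 = Some w0 \<and> \<eta> \<le> cmod w0"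
    if hb: "bounded2 h c \<delta>" and hz: "\<exists>z\<in>ball c (\<delta> / 16). chordal (h z) (Some 0) \<ge> 2 * \<eta>" for h c
  proof -
    obtain z where z: "z \<in> ball c (\<delta> / 16)" "chordal (h z) (Some 0) \<ge> 2 * \<eta>" using hz by blast
    have "z \<in> ball c \<delta>" using z(1) \<delta> by auto
    then obtain w where w: "h z = Some w" using hb unfolding bounded2_def by blast
    have "2 * \<eta> \<le> 2 * cmod w" using z(2) w chordal_Some_le[of w 0] by simp
    then show ?thesis using z w by auto
  qed
  have e12: "2 * \<eta> \<le> \<eta>1" "2 * \<eta> \<le> \<eta>2" by (auto simp: \<eta>_def)
  have all: "dabs D (ball c (\<delta> / 8)) \<le> N \<and>
      (D c = 0 \<longrightarrow> (\<exists>w. w \<noteq> 0 \<and> f c = Some w \<and> \<bar>ln (cmod w) - dsum D (ball c (\<delta> / 8)) (\<lambda>a. ln (cmod (c - a)))\<bar> \<le> C))" for c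
    using dich[of c]
  proof
    assume b: "bounded2 f c \<delta>"
    have "\<exists>z\<in>ball c (\<delta> / 16). chordal (f z) (Some 0) \<ge> 2 * \<eta>" using \<eta>1(2)[of c] e12 by (meson order_trans)
    then obtain z0 w0 where "z0 \<in> ball c (\<delta> / 16)" "f z0 = Some w0" "\<eta> \<le> cmod w0" using pick[OF b] by blast
    then show ?thesis using loc[OF lf mo b] by blast
  next
    assume b: "bounded2 (\<lambda>z. sinv (f z)) c \<delta>"
    have "\<exists>z\<in>ball c (\<delta> / 16). chordal (sinv (f z)) (Some 0) \<ge> 2 * \<eta>" using \<eta>2(2)[of c] e12 by (meson order_trans)
    then obtain z0 w0 where "z0 \<in> ball c (\<delta> / 16)" "sinv (f z0) = Some w0" "\<eta> \<le> cmod w0" using pick[OF b] by blast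
    then have "dabs (\<lambda>z. - D z) (ball c (\<delta> / 8)) \<le> N \<and>
      (- D c = 0 \<longrightarrow> (\<exists>w. w \<noteq> 0 \<and> sinv (f c) = Some w \<and> \<bar>ln (cmod w) - dsum (\<lambda>z. - D z) (ball c (\<delta> / 8)) (\<lambda>a. ln (cmod (c - a)))\<bar> \<le> C))"
      using loc[OF lf' mo' b] by blast
    then have L: "dabs D (ball c (\<delta> / 8)) \<le> N"
      "D c = 0 \<Longrightarrow> \<exists>w. w \<noteq> 0 \<and> sinv (f c) = Some w \<and> \<bar>ln (cmod w) + dsum D (ball c (\<delta> / 8)) (\<lambda>a. ln (cmod (c - a)))\<bar> \<le> C"
      by (simp_all add: dsum_minus_divisor dabs_minus_divisor)
    show ?thesis
    proof (intro conjI impI L(1))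
      assume "D c = 0"
      then obtain w where w: "w \<noteq> 0" "sinv (f c) = Some w" "\<bar>ln (cmod w) + dsum D (ball c (\<delta> / 8)) (\<lambda>a. ln (cmod (c - a)))\<bar> \<le> C"
        using L(2) by blast
      have "f c = Some (1 / w)" using w(1,2) sinv_simps(3,4) by metis
      moreover have "ln (cmod (1 / w)) = - ln (cmod w)" using w(1) by (simp add: norm_divide ln_div)
      then have "\<bar>ln (cmod (1 / w)) - dsum D (ball c (\<delta> / 8)) (\<lambda>a. ln (cmod (c - a)))\<bar> \<le> C"
        using w(3) by linarith
      moreover have "1 / w \<noteq> 0" using w(1) by simp
      ultimately show "\<exists>w. w \<noteq> 0 \<and> f c = Some w \<and> \<bar>ln (cmod w) - dsum D (ball c (\<delta> / 8)) (\<lambda>a. ln (cmod (c - a)))\<bar> \<le> C"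
        by (intro exI[of _ "1 / w"] conjI)
    qed
  qed
  \<comment> \<open>One finite cover of the unit disc by small discs serves, after translation, for
    all centres and makes the count uniform.\<close>
  obtain K where K: "finite K" "cball (0::complex) 1 \<subseteq> (\<Union>k\<in>K. ball k (\<delta> / 8))"
  proof -
    have "cball (0::complex) 1 \<subseteq> (\<Union>k\<in>cball 0 1. ball k (\<delta> / 8))" using \<delta> by force
    then show thesis
    proof (rule compactE_image[OF compact_cball, rotated])
      show "open (ball k (\<delta> / 8))" for k :: complex by simp
    qed (use that in blast)
  qed
  define N' where "N' = real (card K) * N"
  have N': "dabs D (cball c 1) \<le> N'" for c
  proof -
    have "cball c 1 \<subseteq> (\<Union>k\<in>K. ball (c + k) (\<delta> / 8))"
    proof
      fix z assume "z \<in> cball c 1"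
      then have "z - c \<in> cball 0 1" by (simp add: dist_norm norm_minus_commute)
      then obtain k where "k \<in> K" "dist k (z - c) < \<delta> / 8" using K(2) by auto
      then show "z \<in> (\<Union>k\<in>K. ball (c + k) (\<delta> / 8))" by (auto simp: dist_norm algebra_simps)
    qed
    then have "dabs D (cball c 1) \<le> dabs D (\<Union>k\<in>K. ball (c + k) (\<delta> / 8))"
      using K(1) by (intro dabs_mono[OF lf]) auto
    also have "\<dots> \<le> (\<Sum>k\<in>K. dabs D (ball (c + k) (\<delta> / 8)))" by (rule dabs_UN_le[OF lf K(1)]) auto
    also have "\<dots> \<le> (\<Sum>k\<in>K. N)" using all by (intro sum_mono) blast
    finally show ?thesis by (simp add: N'_def)
  qed
  \<comment> \<open>Enlarging the radius of the local sum from \<delta>/8 to 1 adds at most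
    \<open>N'\<close> terms, each at most ln (8/\<delta>).\<close>
  define C' where "C' = C + N' * ln (8 / \<delta>)"
  have "growth D f C'" unfolding growth_def
  proof (intro allI impI)
    fix c assume "D c = 0"
    then obtain w where w: "w \<noteq> 0" "f c = Some w" "\<bar>ln (cmod w) - dsum D (ball c (\<delta> / 8)) (\<lambda>a. ln (cmod (c - a)))\<bar> \<le> C"
      using all by blast
    have sub: "ball c (\<delta> / 8) \<subseteq> ball c 1" using \<delta> by auto
    have "norm (dsum D (ball c 1 - ball c (\<delta> / 8)) (\<lambda>a. ln (cmod (c - a)))) \<le> dabs D (ball c 1 - ball c (\<delta> / 8)) * ln (8 / \<delta>)"
    proof (rule norm_dsum_le)
      fix a assume a: "a \<in> ball c 1 - ball c (\<delta> / 8)"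
      then have l: "cmod (c - a) \<ge> \<delta> / 8" and u: "cmod (c - a) \<le> 1" by (auto simp add: dist_norm)
      have pos: "cmod (c - a) > 0" using l \<delta> by linarith
      have "ln (\<delta> / 8) \<le> ln (cmod (c - a))" using l \<delta> pos by (subst ln_le_cancel_iff) auto
      moreover have "ln (8 / \<delta>) = - ln (\<delta> / 8)" using \<delta> by (simp add: ln_div)
      moreover have "ln (cmod (c - a)) \<le> 0" using u pos by simp
      ultimately show "norm (ln (cmod (c - a))) \<le> ln (8 / \<delta>)" by simp
    qed
    also have "\<dots> \<le> N' * ln (8 / \<delta>)"
    proof (intro mult_right_mono)
      have "ball c 1 - ball c (\<delta> / 8) \<subseteq> cball c 1" by auto
      then show "dabs D (ball c 1 - ball c (\<delta> / 8)) \<le> N'"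
        using dabs_mono[OF lf bounded_cball] N' order_trans by blast
    qed (use \<delta> in auto)
    finally have "\<bar>ln (cmod w) - dsum D (ball c 1) (\<lambda>a. ln (cmod (c - a)))\<bar> \<le> C'"
      using w(3) dsum_diff[OF lf bounded_ball sub, of "\<lambda>a. ln (cmod (c - a))"] by (simp add: C'_def)
    then show "\<exists>w. w \<noteq> 0 \<and> f c = Some w \<and> \<bar>ln (cmod w) - dsum D (ball c 1) (\<lambda>a. ln (cmod (c - a)))\<bar> \<le> C'"
      using w by blast
  qed
  with N' that show thesis by blast
qed


section \<open>Counting points in rings\<close>

lemma norm_exp_i_diff_le: "cmod (exp (\<i> * of_real s) - exp (\<i> * of_real t)) \<le> \<bar>s - t\<bar>"
proof -
  have "exp (\<i> * of_real s) - exp (\<i> * of_real t) = exp (\<i> * of_real t) * (exp (\<i> * of_real (s - t)) - 1)"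
    by (simp add: algebra_simps flip: exp_add)
  then have "cmod (exp (\<i> * of_real s) - exp (\<i> * of_real t)) = 2 * \<bar>sin ((s - t) / 2)\<bar>"
    by (simp only: norm_mult norm_exp_i_times dist_exp_i_1)
  also have "\<dots> \<le> \<bar>s - t\<bar>" using abs_sin_x_le_abs_x[of "(s - t) / 2"] by simp
  finally show ?thesis .
qed

text \<open>The ring is covered by unit discs centred on its middle circle. Their number grows like
  the circumference, so the linear bound is of the right order under a bound per unit disc.\<close>

lemma ring_count:
  assumes lf: "locally_finite D" and N: "\<And>c. dabs D (cball c 1) \<le> N" and \<rho>: "\<rho> \<ge> 1"
  shows "dabs D {z. \<rho> \<le> cmod (z - c) \<and> cmod (z - c) \<le> \<rho> + 1} \<le> 25 * N * \<rho>"
proof -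
  \<comment> \<open>A point of the ring is radially within 1/2 of the middle circle, and
    \<open>n\<close> \<ge> 4\<pi>\<sigma> centres leave an arc of at most 1/2 to the chosen one.
    With \<pi> < 4 this takes at most 16\<rho> + 9 \<le> 25\<rho> discs.\<close>
  define \<sigma> where "\<sigma> = \<rho> + 1/2"
  have \<sigma>: "\<sigma> > 0" using \<rho> by (simp add: \<sigma>_def)
  define n where "n = nat \<lceil>4 * pi * \<sigma>\<rceil>"
  have n1: "real n \<ge> 4 * pi * \<sigma>" unfolding n_def by linarith
  have n2: "real n \<le> 4 * pi * \<sigma> + 1" unfolding n_def using \<sigma> by (simp add: of_nat_ceiling)
  have npos: "real n > 0" using n1 \<sigma> by (smt (verit) mult_pos_pos pi_gt_zero)
  have "4 * pi * \<sigma> \<le> 16 * \<sigma>" using pi_less_4 \<sigma> by (intro mult_right_mono) auto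
  then have n3: "real n \<le> 25 * \<rho>" using n2 \<rho> by (simp add: \<sigma>_def)
  have Npos: "N \<ge> 0" using N[of 0] dabs_nonneg order_trans by blast
  define p where "p = (\<lambda>j::nat. c + of_real \<sigma> * exp (\<i> * of_real (2 * pi * real j / real n)))"
  have "{z. \<rho> \<le> cmod (z - c) \<and> cmod (z - c) \<le> \<rho> + 1} \<subseteq> (\<Union>j\<in>{..<n}. cball (p j) 1)"
  proof
    fix z assume "z \<in> {z. \<rho> \<le> cmod (z - c) \<and> cmod (z - c) \<le> \<rho> + 1}"
    then have z: "\<rho> \<le> cmod (z - c)" "cmod (z - c) \<le> \<rho> + 1" by auto
    define \<theta> where "\<theta> = Arg2pi (z - c)"
    have \<theta>: "0 \<le> \<theta>" "\<theta> < 2 * pi" by (auto simp: \<theta>_def Arg2pi_ge_0 Arg2pi_lt_2pi)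
    have zc: "z - c = of_real (cmod (z - c)) * exp (\<i> * of_real \<theta>)" unfolding \<theta>_def by (rule Arg2pi_eq)
    define x where "x = \<theta> * real n / (2 * pi)"
    have x: "0 \<le> x" "x < real n" using \<theta> npos by (auto simp: x_def divide_simps)
    define j where "j = nat \<lfloor>x\<rfloor>"
    have jn: "j < n" using x unfolding j_def by linarith
    have jx: "\<bar>x - real j\<bar> \<le> 1" using x unfolding j_def by linarith
    define \<phi> where "\<phi> = 2 * pi * real j / real n"
    have "\<theta> - \<phi> = (x - real j) * (2 * pi / real n)" using npos by (simp add: x_def \<phi>_def field_simps)
    then have "\<bar>\<theta> - \<phi>\<bar> = \<bar>x - real j\<bar> * (2 * pi / real n)" using npos by (simp add: abs_mult)
    also have "\<dots> \<le> 1 * (2 * pi / real n)" using jx npos by (intro mult_right_mono) auto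
    finally have "\<bar>\<theta> - \<phi>\<bar> \<le> 2 * pi / real n" by simp
    then have "\<sigma> * \<bar>\<theta> - \<phi>\<bar> \<le> \<sigma> * (2 * pi / real n)" using \<sigma> by (intro mult_left_mono) auto
    also have "\<dots> \<le> 1/2" using n1 npos by (simp add: field_simps)
    finally have d2: "\<sigma> * \<bar>\<theta> - \<phi>\<bar> \<le> 1/2" .
    have "z - p j = of_real (cmod (z - c) - \<sigma>) * exp (\<i> * of_real \<theta>)
        + of_real \<sigma> * (exp (\<i> * of_real \<theta>) - exp (\<i> * of_real \<phi>))"
      using zc by (simp add: p_def \<phi>_def algebra_simps)
    then have "cmod (z - p j) \<le> cmod (of_real (cmod (z - c) - \<sigma>) * exp (\<i> * of_real \<theta>))
        + cmod (of_real \<sigma> * (exp (\<i> * of_real \<theta>) - exp (\<i> * of_real \<phi>)))"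
      by (metis norm_triangle_ineq)
    also have "\<dots> = \<bar>cmod (z - c) - \<sigma>\<bar> + \<sigma> * cmod (exp (\<i> * of_real \<theta>) - exp (\<i> * of_real \<phi>))"
      using \<sigma> by (simp add: norm_mult del: of_real_diff)
    finally have zp: "cmod (z - p j) \<le> \<bar>cmod (z - c) - \<sigma>\<bar> + \<sigma> * cmod (exp (\<i> * of_real \<theta>) - exp (\<i> * of_real \<phi>))" .
    have "\<bar>cmod (z - c) - \<sigma>\<bar> \<le> 1/2" using z by (intro abs_leI) (simp_all add: \<sigma>_def)
    then have "\<bar>cmod (z - c) - \<sigma>\<bar> + \<sigma> * cmod (exp (\<i> * of_real \<theta>) - exp (\<i> * of_real \<phi>)) \<le> 1/2 + \<sigma> * \<bar>\<theta> - \<phi>\<bar>"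
      using z \<sigma> norm_exp_i_diff_le[of \<theta> \<phi>] by (intro add_mono mult_left_mono) auto
    then have "cmod (z - p j) \<le> 1" using d2 zp by simp
    then show "z \<in> (\<Union>j\<in>{..<n}. cball (p j) 1)" using jn by (auto simp: dist_norm norm_minus_commute)
  qed
  then have "dabs D {z. \<rho> \<le> cmod (z - c) \<and> cmod (z - c) \<le> \<rho> + 1} \<le> dabs D (\<Union>j\<in>{..<n}. cball (p j) 1)"
    by (intro dabs_mono[OF lf]) auto
  also have "\<dots> \<le> (\<Sum>j\<in>{..<n}. dabs D (cball (p j) 1))" by (rule dabs_UN_le[OF lf]) auto
  also have "\<dots> \<le> (\<Sum>j\<in>{..<n}. N)" using N by (intro sum_mono) auto
  also have "\<dots> = real n * N" by simp
  also have "\<dots> \<le> 25 * \<rho> * N" using n3 Npos by (intro mult_right_mono) auto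
  finally show ?thesis by (simp add: mult.commute mult.left_commute)
qed

lemma unit_annulus_count:
  assumes lf: "locally_finite D" and N: "\<And>c. dabs D (cball c 1) \<le> N" and r: "r \<ge> 1"
  shows "dabs D (ball 0 (r + 1) - ball 0 r) \<le> 25 * N * r"
proof -
  have "bounded {z. r \<le> cmod (z - 0) \<and> cmod (z - 0) \<le> r + 1}" by (rule bounded_subset[of "cball 0 (r + 1)"]) auto
  then have "dabs D (ball 0 (r + 1) - ball 0 r) \<le> dabs D {z. r \<le> cmod (z - 0) \<and> cmod (z - 0) \<le> r + 1}"
    by (rule dabs_mono[OF lf]) auto
  then show ?thesis using ring_count[OF lf N r, of 0] by simp
qed

text \<open>For \<open>r\<close> below 2 the inner radius drops under 1, where
  \<open>ring_count\<close> does not apply; the unit disc covers that part. The constant is 51 = 1 +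
  25 + 25.\<close>

lemma wide_ring_count:
  assumes lf: "locally_finite D" and N: "\<And>c. dabs D (cball c 1) \<le> N" and r: "r \<ge> 1"
  shows "dabs D {z. r - 1 \<le> cmod (z - c) \<and> cmod (z - c) \<le> r + 1} \<le> 51 * N * r"
proof -
  let ?R = "\<lambda>\<rho>. {z. \<rho> \<le> cmod (z - c) \<and> cmod (z - c) \<le> \<rho> + 1}"
  have b: "bounded (?R \<rho>)" for \<rho>
    by (rule bounded_subset[of "cball c (\<rho> + 1)"]) (auto simp: dist_norm norm_minus_commute)
  have Npos: "N \<ge> 0" using N[of 0] dabs_nonneg order_trans by blast
  have "{z. r - 1 \<le> cmod (z - c) \<and> cmod (z - c) \<le> r + 1} \<subseteq> (cball c 1 \<union> ?R (max 1 (r - 1))) \<union> ?R r"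
    by (auto simp: dist_norm norm_minus_commute)
  then have "dabs D {z. r - 1 \<le> cmod (z - c) \<and> cmod (z - c) \<le> r + 1} \<le> dabs D ((cball c 1 \<union> ?R (max 1 (r - 1))) \<union> ?R r)"
    using b by (intro dabs_mono[OF lf] bounded_Un[THEN iffD2] conjI bounded_cball)
  also have "\<dots> \<le> dabs D (cball c 1) + dabs D (?R (max 1 (r - 1))) + dabs D (?R r)"
  proof -
    have "dabs D ((cball c 1 \<union> ?R (max 1 (r - 1))) \<union> ?R r) \<le> dabs D (cball c 1 \<union> ?R (max 1 (r - 1))) + dabs D (?R r)"
      by (rule dabs_Un_le[OF lf _ b]) (intro bounded_Un[THEN iffD2] conjI bounded_cball b)
    moreover have "dabs D (cball c 1 \<union> ?R (max 1 (r - 1))) \<le> dabs D (cball c 1) + dabs D (?R (max 1 (r - 1)))"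
      by (rule dabs_Un_le[OF lf bounded_cball b])
    ultimately show ?thesis by linarith
  qed
  also have "\<dots> \<le> N + 25 * N * max 1 (r - 1) + 25 * N * r"
    using N ring_count[OF lf N, of "max 1 (r-1)" c] ring_count[OF lf N r, of c] by (intro add_mono) auto
  also have "\<dots> \<le> N * r + 25 * N * r + 25 * N * r"
    using r Npos by (intro add_mono mult_left_mono) (auto simp: mult_le_cancel_left1)
  finally show ?thesis by simp
qed

section \<open>Means over circles\<close>

text \<open>The parametrization is that of \<open>circlepath 0 1\<close>, so Cauchy's formulas
  become statements about means. As a relation it carries integrability along with the
  value.\<close>

definition has_cmean :: "(complex \<Rightarrow> complex) \<Rightarrow> complex \<Rightarrow> bool" where
  "has_cmean h v \<longleftrightarrow> ((\<lambda>t. h (exp (2 * of_real pi * \<i> * of_real t))) has_integral v) {0..1}"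

lemma has_cmean_unique: "has_cmean h v \<Longrightarrow> has_cmean h w \<Longrightarrow> v = w"
  unfolding has_cmean_def using has_integral_unique by blast

lemma has_cmean_add: "has_cmean h v \<Longrightarrow> has_cmean k w \<Longrightarrow> has_cmean (\<lambda>\<zeta>. h \<zeta> + k \<zeta>) (v + w)"
  unfolding has_cmean_def by (rule has_integral_add)

lemma has_cmean_diff: "has_cmean h v \<Longrightarrow> has_cmean k w \<Longrightarrow> has_cmean (\<lambda>\<zeta>. h \<zeta> - k \<zeta>) (v - w)"
  unfolding has_cmean_def by (rule has_integral_diff)

lemma has_cmean_cmult: "has_cmean h v \<Longrightarrow> has_cmean (\<lambda>\<zeta>. c * h \<zeta>) (c * v)"
  unfolding has_cmean_def by (rule has_integral_mult_right)

lemma has_cmean_sum: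
  "finite S \<Longrightarrow> (\<And>a. a \<in> S \<Longrightarrow> has_cmean (h a) (v a)) \<Longrightarrow> has_cmean (\<lambda>\<zeta>. \<Sum>a\<in>S. h a \<zeta>) (\<Sum>a\<in>S. v a)"
  unfolding has_cmean_def by (rule has_integral_sum)

lemma has_cmean_cnj: "has_cmean h v \<Longrightarrow> has_cmean (\<lambda>\<zeta>. cnj (h \<zeta>)) (cnj v)"
  unfolding has_cmean_def by (subst (asm) has_integral_cnj[symmetric]) (simp add: o_def)

lemma norm_exp_2pi [simp]: "cmod (exp (2 * of_real pi * \<i> * of_real t)) = 1"
  by (simp add: norm_exp_eq_Re)

lemma has_cmean_cong:
  assumes "has_cmean h v" "\<And>\<zeta>. cmod \<zeta> = 1 \<Longrightarrow> h \<zeta> = k \<zeta>" shows "has_cmean k v"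
  using assms(1) unfolding has_cmean_def
  by (rule has_integral_eq[rotated]) (simp add: assms(2))

lemma has_cmean_const: "has_cmean (\<lambda>\<zeta>. c) c"
  unfolding has_cmean_def using has_integral_const_real[of c 0 1] by simp

lemma has_cmean_continuous:
  assumes "continuous_on (sphere 0 1) h" obtains v where "has_cmean h v"
proof -
  have "continuous_on {0..1} (\<lambda>t. h (exp (2 * of_real pi * \<i> * of_real t)))"
    by (rule continuous_on_compose2[OF assms]) (auto intro!: continuous_intros)
  then show thesis using that integrable_continuous_real unfolding has_cmean_def by blast
qed

lemma has_cmean_norm_le:
  assumes "has_cmean h v" "has_cmean (\<lambda>\<zeta>. of_real (u \<zeta>)) (of_real w)"
    "\<And>\<zeta>. cmod \<zeta> = 1 \<Longrightarrow> cmod (h \<zeta>) \<le> u \<zeta>"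
  shows "cmod v \<le> w"
proof -
  have h: "((\<lambda>t. h (exp (2 * of_real pi * \<i> * of_real t))) has_integral v) {0..1}" using assms(1) by (simp add: has_cmean_def)
  have u: "((\<lambda>t. u (exp (2 * of_real pi * \<i> * of_real t))) has_integral w) {0..1}"
    using has_integral_Re[OF assms(2)[unfolded has_cmean_def]] by simp
  have "norm (integral {0..1} (\<lambda>t. h (exp (2 * of_real pi * \<i> * of_real t)))) \<le> integral {0..1} (\<lambda>t. u (exp (2 * of_real pi * \<i> * of_real t)))"
    using h u assms(3) by (intro integral_norm_bound_integral) auto
  then show ?thesis using h u by (simp add: integral_unique)
qed

lemma has_cmean_mono:
  assumes "has_cmean (\<lambda>\<zeta>. of_real (u \<zeta>)) (of_real v)" "has_cmean (\<lambda>\<zeta>. of_real (u' \<zeta>)) (of_real w)"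
    "\<And>\<zeta>. cmod \<zeta> = 1 \<Longrightarrow> u \<zeta> \<le> u' \<zeta>"
  shows "v \<le> w"
proof -
  have u: "((\<lambda>t. u (exp (2 * of_real pi * \<i> * of_real t))) has_integral v) {0..1}"
    using has_integral_Re[OF assms(1)[unfolded has_cmean_def]] by simp
  have u': "((\<lambda>t. u' (exp (2 * of_real pi * \<i> * of_real t))) has_integral w) {0..1}"
    using has_integral_Re[OF assms(2)[unfolded has_cmean_def]] by simp
  show ?thesis by (rule has_integral_le[OF u u']) (use assms(3) in auto)
qed

lemma cnj_unit_power:
  assumes "cmod \<zeta> = 1" shows "cnj \<zeta> ^ k = 1 / \<zeta> ^ k"
proof -
  have "\<zeta> * cnj \<zeta> = 1" using assms by (simp add: complex_norm_square[symmetric])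
  then have "\<zeta> ^ k * cnj \<zeta> ^ k = 1" by (simp add: power_mult_distrib[symmetric])
  moreover have "\<zeta> ^ k \<noteq> 0" using assms by auto
  ultimately show ?thesis by (simp add: field_simps)
qed

lemma has_cmean_holomorphic:
  assumes H: "H holomorphic_on ball 0 R" "R > 1"
  shows "has_cmean (\<lambda>\<zeta>. H \<zeta> * cnj \<zeta> ^ k) ((deriv ^^ k) H 0 / fact k)"
proof -
  have "((\<lambda>u. H u / (u - 0) ^ (Suc k)) has_contour_integral ((2 * pi * \<i>) / (fact k) * (deriv ^^ k) H 0)) (circlepath 0 1)"
    using H by (intro Cauchy_has_contour_integral_higher_derivative_circlepath)
      (auto intro!: holomorphic_on_imp_continuous_on elim: holomorphic_on_subset)
  then have "((\<lambda>x. H (circlepath 0 1 x) / (circlepath 0 1 x) ^ (Suc k) * (2 * of_real pi * \<i> * exp (2 * of_real pi * \<i> * of_real x)))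
       has_integral ((2 * pi * \<i>) / (fact k) * (deriv ^^ k) H 0)) {0..1}"
    unfolding has_contour_integral by (simp add: vector_derivative_circlepath)
  then have "((\<lambda>x. (2 * of_real pi * \<i>) * (H (exp (2 * of_real pi * \<i> * of_real x)) * cnj (exp (2 * of_real pi * \<i> * of_real x)) ^ k))
       has_integral ((2 * of_real pi * \<i>) * ((deriv ^^ k) H 0 / fact k))) {0..1}"
    by (simp add: cnj_unit_power circlepath field_simps)
  from has_integral_mult_right[OF this, of "1 / (2 * of_real pi * \<i>)"] show ?thesis
    unfolding has_cmean_def by simp
qed

lemma has_cmean_holomorphic_0:
  assumes H: "H holomorphic_on ball 0 R" "R > 1" and k: "k > 0"
  shows "has_cmean (\<lambda>\<zeta>. H \<zeta> * \<zeta> ^ k) 0"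
proof -
  have "(\<lambda>\<zeta>. H \<zeta> * \<zeta> ^ k) holomorphic_on ball 0 R" by (intro holomorphic_intros H)
  from has_cmean_holomorphic[OF this H(2), of 0] show ?thesis using k by (simp add: power_0_left)
qed

text \<open>Write Re H = (H + cnj H) / 2. By Cauchy's formula the conjugate part has no Fourier
  coefficient of positive order, so it contributes for \<open>k = 0\<close> only.\<close>

lemma has_cmean_Re_holomorphic:
  assumes H: "H holomorphic_on ball 0 R" "R > 1"
  shows "has_cmean (\<lambda>\<zeta>. of_real (Re (H \<zeta>)) * cnj \<zeta> ^ k)
    (if k = 0 then of_real (Re (H 0)) else (deriv ^^ k) H 0 / fact k / 2)"
proof -
  have 1: "has_cmean (\<lambda>\<zeta>. H \<zeta> * cnj \<zeta> ^ k) ((deriv ^^ k) H 0 / fact k)" by (rule has_cmean_holomorphic[OF H])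
  have 2: "has_cmean (\<lambda>\<zeta>. cnj (H \<zeta> * \<zeta> ^ k)) (if k = 0 then cnj (H 0) else 0)"
    using has_cmean_cnj[OF has_cmean_holomorphic_0[OF H, of k]] has_cmean_cnj[OF has_cmean_holomorphic[OF H, of 0]] by auto
  have "has_cmean (\<lambda>\<zeta>. 1/2 * (H \<zeta> * cnj \<zeta> ^ k + cnj (H \<zeta> * \<zeta> ^ k)))
      (1/2 * ((deriv ^^ k) H 0 / fact k + (if k = 0 then cnj (H 0) else 0)))"
    by (intro has_cmean_cmult has_cmean_add 1 2)
  moreover have "1/2 * (H \<zeta> * cnj \<zeta> ^ k + cnj (H \<zeta> * \<zeta> ^ k)) = of_real (Re (H \<zeta>)) * cnj \<zeta> ^ k" for \<zeta>
  proof -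
    have "H \<zeta> * cnj \<zeta> ^ k + cnj (H \<zeta> * \<zeta> ^ k) = (H \<zeta> + cnj (H \<zeta>)) * cnj \<zeta> ^ k" by (simp add: algebra_simps)
    then show ?thesis by (simp add: complex_add_cnj)
  qed
  moreover have "1/2 * ((deriv ^^ k) H 0 / fact k + (if k = 0 then cnj (H 0) else 0))
     = (if k = 0 then of_real (Re (H 0)) else (deriv ^^ k) H 0 / fact k / 2)"
    by (auto simp: complex_add_cnj)
  ultimately show ?thesis by simp
qed

section \<open>Fourier coefficients of logarithms of linear factors\<close>

lemma one_minus_Re_pos: "cmod w < 1 \<Longrightarrow> Re (1 - w) > 0"
  using complex_Re_le_cmod[of w] by simp

lemma holomorphic_Ln_one_minus:
  assumes "cmod b < 1"
  obtains R where "R > 1" "(\<lambda>\<zeta>. Ln (1 - b * \<zeta>)) holomorphic_on ball 0 R" "\<And>\<zeta>. \<zeta> \<in> ball 0 R \<Longrightarrow> cmod (b * \<zeta>) < 1"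
proof -
  define R where "R = (if b = 0 then 2 else 1 / cmod b)"
  have R: "R > 1" using assms by (auto simp: R_def)
  have b: "cmod (b * \<zeta>) < 1" if "\<zeta> \<in> ball 0 R" for \<zeta>
    using that by (auto simp: R_def norm_mult field_simps split: if_splits)
  show thesis
  proof (rule that[OF R _ b])
    show "(\<lambda>\<zeta>. Ln (1 - b * \<zeta>)) holomorphic_on ball 0 R"
    proof (intro holomorphic_intros)
      fix \<zeta> :: complex assume "\<zeta> \<in> ball 0 R"
      then have "Re (1 - b * \<zeta>) > 0" using b one_minus_Re_pos by blast
      then show "1 - b * \<zeta> \<notin> \<real>\<^sub>\<le>\<^sub>0" by (simp add: complex_nonpos_Reals_iff)
    qed
  qed
qed

lemma Ln_one_minus_coeff:
  assumes b: "cmod b < 1"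
  shows "(deriv ^^ 1) (\<lambda>\<zeta>. Ln (1 - b * \<zeta>)) 0 = - b"
    and "(deriv ^^ 2) (\<lambda>\<zeta>. Ln (1 - b * \<zeta>)) 0 = - (b\<^sup>2)"
proof -
  obtain R where R: "R > 1" "\<And>\<zeta>::complex. \<zeta> \<in> ball 0 R \<Longrightarrow> cmod (b * \<zeta>) < 1"
    using holomorphic_Ln_one_minus[OF b] by metis
  have pos: "1 - b * \<zeta> \<notin> \<real>\<^sub>\<le>\<^sub>0" "1 - b * \<zeta> \<noteq> 0" if "\<zeta> \<in> ball 0 R" for \<zeta> :: complex
    using one_minus_Re_pos[OF R(2)[OF that]] by (auto simp: complex_nonpos_Reals_iff complex_eq_iff)
  have d1: "deriv (\<lambda>\<zeta>. Ln (1 - b * \<zeta>)) \<zeta> = - b / (1 - b * \<zeta>)" if "\<zeta> \<in> ball 0 R" for \<zeta> :: complex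
    by (rule DERIV_imp_deriv) (use pos[OF that] in \<open>auto intro!: derivative_eq_intros simp: field_simps\<close>)
  show "(deriv ^^ 1) (\<lambda>\<zeta>. Ln (1 - b * \<zeta>)) 0 = - b" using d1[of 0] R(1) by simp
  have "deriv (deriv (\<lambda>\<zeta>. Ln (1 - b * \<zeta>))) 0 = deriv (\<lambda>\<zeta>. - b / (1 - b * \<zeta>)) 0"
    by (rule complex_derivative_transform_within_open[of _ "ball 0 R"])
      (use R pos d1 in \<open>auto intro!: holomorphic_intros holomorphic_deriv\<close>)
  also have "\<dots> = - (b\<^sup>2)"
    by (rule DERIV_imp_deriv) (auto intro!: derivative_eq_intros simp: power2_eq_square)
  finally show "(deriv ^^ 2) (\<lambda>\<zeta>. Ln (1 - b * \<zeta>)) 0 = - (b\<^sup>2)" by (simp add: numeral_2_eq_2)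
qed

lemma has_cmean_ln_one_minus:
  assumes b: "cmod b < 1" and k: "k = 1 \<or> k = 2"
  shows "has_cmean (\<lambda>\<zeta>. of_real (ln (cmod (1 - b * \<zeta>)))) 0"
    and "has_cmean (\<lambda>\<zeta>. of_real (ln (cmod (1 - b * \<zeta>))) * cnj \<zeta> ^ k) (- (b ^ k) / (2 * of_nat k))"
proof -
  obtain R where R: "R > 1" "(\<lambda>\<zeta>. Ln (1 - b * \<zeta>)) holomorphic_on ball 0 R" "\<And>\<zeta>. \<zeta> \<in> ball 0 R \<Longrightarrow> cmod (b * \<zeta>) < 1"
    using holomorphic_Ln_one_minus[OF b] by metis
  have e: "Re (Ln (1 - b * \<zeta>)) = ln (cmod (1 - b * \<zeta>))" if "cmod \<zeta> = 1" for \<zeta>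
  proof (rule Re_Ln)
    have "cmod (b * \<zeta>) < 1" using b that by (simp add: norm_mult)
    then show "1 - b * \<zeta> \<noteq> 0" using one_minus_Re_pos by fastforce
  qed
  have m: "has_cmean (\<lambda>\<zeta>. of_real (ln (cmod (1 - b * \<zeta>))) * cnj \<zeta> ^ k)
    (if k = 0 then of_real (Re (Ln (1 - b * 0))) else (deriv ^^ k) (\<lambda>\<zeta>. Ln (1 - b * \<zeta>)) 0 / fact k / 2)" for k
    by (rule has_cmean_cong[OF has_cmean_Re_holomorphic[OF R(2,1)]]) (simp add: e)
  show "has_cmean (\<lambda>\<zeta>. of_real (ln (cmod (1 - b * \<zeta>)))) 0" using m[of 0] by simp
  show "has_cmean (\<lambda>\<zeta>. of_real (ln (cmod (1 - b * \<zeta>))) * cnj \<zeta> ^ k) (- (b ^ k) / (2 * of_nat k))"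
    using m[of k] k Ln_one_minus_coeff[OF b] by auto
qed

text \<open>The number b of modulus below 1 with |r\<zeta> - a| = max r |a| * |1 - b\<zeta>| on the
  unit circle. For a inside the circle it arises by reflection in the circle. The form 1 - b\<zeta>
  has a holomorphic logarithm on a disc of radius above 1.\<close>

definition bcoeff :: "real \<Rightarrow> complex \<Rightarrow> complex" where
  "bcoeff r a = (if cmod a < r then cnj a / of_real r else of_real r / a)"

lemma ln_dist_circle:
  assumes "r > 0" "cmod a \<noteq> r" "cmod \<zeta> = 1"
  shows "ln (cmod (of_real r * \<zeta> - a)) = ln (max r (cmod a)) + ln (cmod (1 - bcoeff r a * \<zeta>))"
    and "cmod (bcoeff r a) < 1"
proof -
  show b: "cmod (bcoeff r a) < 1" using assms by (auto simp: bcoeff_def norm_divide divide_less_eq)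
  have "cmod (bcoeff r a * \<zeta>) < 1" using b assms by (simp add: norm_mult)
  then have nz: "1 - bcoeff r a * \<zeta> \<noteq> 0" using one_minus_Re_pos by fastforce
  have z1: "cnj \<zeta> * \<zeta> = 1" using assms by (metis complex_norm_square mult.commute of_real_1 one_power2)
  have "cmod (of_real r * \<zeta> - a) = max r (cmod a) * cmod (1 - bcoeff r a * \<zeta>)"
  proof (cases "cmod a < r")
    case True
    have "of_real r * \<zeta> - a = of_real r * \<zeta> * cnj (1 - bcoeff r a * \<zeta>)"
      using True assms z1 by (simp add: bcoeff_def algebra_simps)
    then have "cmod (of_real r * \<zeta> - a) = r * cmod (1 - bcoeff r a * \<zeta>)"
      using assms by (simp only: norm_mult complex_mod_cnj norm_of_real)
    then show ?thesis using True by simp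
  next
    case False
    then have a: "cmod a > r" "a \<noteq> 0" using assms by auto
    have "of_real r * \<zeta> - a = - a * (1 - bcoeff r a * \<zeta>)"
      using a by (simp add: bcoeff_def algebra_simps)
    then show ?thesis using a by (simp add: norm_mult)
  qed
  then show "ln (cmod (of_real r * \<zeta> - a)) = ln (max r (cmod a)) + ln (cmod (1 - bcoeff r a * \<zeta>))"
    using nz assms(1) ln_mult[of "max r (cmod a)" "cmod (1 - bcoeff r a * \<zeta>)"] by (simp only: zero_less_norm_iff) auto
qed

lemma has_cmean_monomial:
  assumes k: "k = 1 \<or> k = 2" shows "has_cmean (\<lambda>\<zeta>. c * cnj \<zeta> ^ k) 0"
  using has_cmean_cmult[OF has_cmean_cnj[OF has_cmean_holomorphic_0[of "\<lambda>_. 1" 2 k]], of c] k by auto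

lemma has_cmean_ln_dist:
  assumes "r > 0" "cmod a \<noteq> r"
  shows "has_cmean (\<lambda>\<zeta>. of_real (ln (cmod (of_real r * \<zeta> - a)))) (of_real (ln (max r (cmod a))))"
    and "k = 1 \<or> k = 2 \<Longrightarrow> has_cmean (\<lambda>\<zeta>. of_real (ln (cmod (of_real r * \<zeta> - a))) * cnj \<zeta> ^ k) (- (bcoeff r a ^ k) / (2 * of_nat k))"
proof -
  note e = ln_dist_circle[OF assms]
  have b: "cmod (bcoeff r a) < 1" using e(2)[of 1] by simp
  show "has_cmean (\<lambda>\<zeta>. of_real (ln (cmod (of_real r * \<zeta> - a)))) (of_real (ln (max r (cmod a))))"
    by (rule has_cmean_cong[OF has_cmean_add[OF has_cmean_const[of "of_real (ln (max r (cmod a)))"] has_cmean_ln_one_minus(1)[OF b, of 1], simplified]])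
      (simp add: e(1))
  assume k: "k = 1 \<or> k = 2"
  show "has_cmean (\<lambda>\<zeta>. of_real (ln (cmod (of_real r * \<zeta> - a))) * cnj \<zeta> ^ k) (- (bcoeff r a ^ k) / (2 * of_nat k))"
  proof (rule has_cmean_cong)
    show "has_cmean (\<lambda>\<zeta>. of_real (ln (max r (cmod a))) * cnj \<zeta> ^ k + of_real (ln (cmod (1 - bcoeff r a * \<zeta>))) * cnj \<zeta> ^ k)
      (- (bcoeff r a ^ k) / (2 * of_nat k))"
      using has_cmean_add[OF has_cmean_monomial[OF k] has_cmean_ln_one_minus(2)[OF b k]] by simp
  qed (simp add: e(1) distrib_right)
qed

text \<open>The logarithmic singularity of \<open>ln \<bar>r \<zeta> - a\<bar>\<close> is compared with \<open>ln (1 + \<bar>r \<zeta> - a\<bar>\<^sup>2) / 2\<close>,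
  whose circle mean is again explicit because \<open>1 + \<bar>r \<zeta> - a\<bar>\<^sup>2 = \<bar>p - q \<zeta>'\<bar>\<^sup>2\<close> for a rotation \<open>\<zeta>'\<close> of \<open>\<zeta>\<close>.\<close>
lemma has_cmean_neg_ln_dist:
  assumes r: "r \<ge> 1" and a: "cmod a \<noteq> r" "r - 1 < cmod a" "cmod a < r + 1"
  obtains v where "v \<le> 2 / r" "has_cmean (\<lambda>\<zeta>. of_real (max 0 (- ln (cmod (of_real r * \<zeta> - a))))) (of_real v)"
proof -
  define \<rho> where "\<rho> = cmod a"
  have \<rho>: "\<rho> > 0" using r a unfolding \<rho>_def by linarith
  have a0: "a \<noteq> 0" using \<rho> by (auto simp: \<rho>_def)
  \<comment> \<open>\<open>s1\<close> and \<open>s2\<close> are the extreme values of sqrt (1 +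
    |r\<zeta> - a|^2) on the circle. With p - q = s1 and p + q = s2, the function |p - q\<zeta>'|
    has the same extremes, which is what the identities for pq and p^2 + q^2 express.\<close>
  define s1 where "s1 = sqrt (1 + (r - \<rho>)\<^sup>2)"
  define s2 where "s2 = sqrt (1 + (r + \<rho>)\<^sup>2)"
  define p where "p = (s1 + s2) / 2"
  define q where "q = (s2 - s1) / 2"
  have s: "s1\<^sup>2 = 1 + (r - \<rho>)\<^sup>2" "s2\<^sup>2 = 1 + (r + \<rho>)\<^sup>2" "s1 > 0" "s2 > 0"
    by (auto simp: s1_def s2_def add_pos_nonneg)
  have "(r - \<rho>)\<^sup>2 < (r + \<rho>)\<^sup>2" using r \<rho> by (simp add: power2_eq_square algebra_simps)
  then have s12: "s1 < s2" by (simp add: s1_def s2_def)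
  have pq: "p > 0" "q > 0" "q < p" using s s12 by (auto simp: p_def q_def)
  have pq1: "p * q = r * \<rho>"
  proof -
    have "p * q = (s2\<^sup>2 - s1\<^sup>2) / 4" by (simp add: p_def q_def power2_eq_square algebra_simps)
    also have "\<dots> = r * \<rho>" unfolding s by (simp add: power2_eq_square algebra_simps)
    finally show ?thesis .
  qed
  have pq2: "p\<^sup>2 + q\<^sup>2 = 1 + r\<^sup>2 + \<rho>\<^sup>2"
  proof -
    have "p\<^sup>2 + q\<^sup>2 = (s1\<^sup>2 + s2\<^sup>2) / 2" by (simp add: p_def q_def power2_eq_square field_simps)
    also have "\<dots> = 1 + r\<^sup>2 + \<rho>\<^sup>2" unfolding s by (simp add: power2_eq_square algebra_simps)
    finally show ?thesis .
  qed
  define \<mu> where "\<mu> = max r \<rho>"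
  have \<mu>: "\<mu> \<ge> 1" "r \<le> \<mu>" "\<rho> \<le> \<mu>" using r by (auto simp: \<mu>_def)
  have "s1 \<le> 2"
  proof -
    have "\<bar>r - \<rho>\<bar> \<le> 1" using a by (auto simp: \<rho>_def)
    then have "(r - \<rho>)\<^sup>2 \<le> 1" by (simp add: abs_square_le_1)
    then show ?thesis unfolding s1_def by (intro real_le_lsqrt) auto
  qed
  moreover have "s2 \<le> 2 * \<mu> + 1"
  proof -
    have "(r + \<rho>)\<^sup>2 \<le> (2 * \<mu>)\<^sup>2" using \<mu> r \<rho> by (intro power_mono) auto
    then have "1 + (r + \<rho>)\<^sup>2 \<le> (2 * \<mu> + 1)\<^sup>2" using \<mu> by (simp add: power2_eq_square algebra_simps)
    then show ?thesis unfolding s2_def using \<mu> by (intro real_le_lsqrt) auto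
  qed
  ultimately have p\<mu>: "p \<le> \<mu> + 2" by (simp add: p_def)
  \<comment> \<open>The unimodular factor rotates \<zeta> so that the direction of \<open>a\<close>
    becomes the positive axis.\<close>
  define b where "b = of_real (q / p) * (cnj a / of_real \<rho>)"
  have b1: "cmod b < 1" using pq \<rho> by (simp add: b_def norm_mult norm_divide \<rho>_def)
  have key: "ln (1 + (cmod (of_real r * \<zeta> - a))\<^sup>2) / 2 = ln p + ln (cmod (1 - b * \<zeta>))" if "cmod \<zeta> = 1" for \<zeta>
  proof -
    have "cmod (b * \<zeta>) < 1" using b1 that by (simp add: norm_mult)
    then have nz: "1 - b * \<zeta> \<noteq> 0" using one_minus_Re_pos by fastforce
    have "(cmod (of_real r * \<zeta> - a))\<^sup>2 = r\<^sup>2 + \<rho>\<^sup>2 - 2 * r * Re (\<zeta> * cnj a)"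
      unfolding cmod_minus_square using that r by (simp add: norm_mult \<rho>_def power_mult_distrib algebra_simps)
    moreover have "(cmod (1 - b * \<zeta>))\<^sup>2 = 1 + (q / p)\<^sup>2 - 2 * (q / p / \<rho>) * Re (\<zeta> * cnj a)"
    proof -
      have "cmod (b * \<zeta>) = q / p" using that pq \<rho> by (simp add: b_def norm_mult norm_divide \<rho>_def)
      moreover have "Re (1 * cnj (b * \<zeta>)) = (q / p / \<rho>) * Re (\<zeta> * cnj a)"
      proof -
        have "b * \<zeta> = of_real (q / p / \<rho>) * (\<zeta> * cnj a)" by (simp add: b_def)
        then have "Re (b * \<zeta>) = (q / p / \<rho>) * Re (\<zeta> * cnj a)"
          by (simp only: times_complex.sel(1)[of "of_real _"] Re_complex_of_real Im_complex_of_real)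
        then show ?thesis by simp
      qed
      ultimately show ?thesis unfolding cmod_minus_square by simp
    qed
    ultimately have "p\<^sup>2 * (cmod (1 - b * \<zeta>))\<^sup>2 = 1 + (cmod (of_real r * \<zeta> - a))\<^sup>2"
    proof -
      assume A: "(cmod (of_real r * \<zeta> - a))\<^sup>2 = r\<^sup>2 + \<rho>\<^sup>2 - 2 * r * Re (\<zeta> * cnj a)"
        and B: "(cmod (1 - b * \<zeta>))\<^sup>2 = 1 + (q / p)\<^sup>2 - 2 * (q / p / \<rho>) * Re (\<zeta> * cnj a)"
      have "p\<^sup>2 * (cmod (1 - b * \<zeta>))\<^sup>2 = p\<^sup>2 + q\<^sup>2 - 2 * (p * q / \<rho>) * Re (\<zeta> * cnj a)"
        unfolding B using pq \<rho> by (simp add: field_simps power2_eq_square)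
      also have "\<dots> = 1 + (cmod (of_real r * \<zeta> - a))\<^sup>2"
        unfolding A pq1 pq2 using \<rho> by simp
      finally show ?thesis .
    qed
    then have "1 + (cmod (of_real r * \<zeta> - a))\<^sup>2 = (p * cmod (1 - b * \<zeta>))\<^sup>2" by (simp add: power_mult_distrib)
    then have "ln (1 + (cmod (of_real r * \<zeta> - a))\<^sup>2) = 2 * ln (p * cmod (1 - b * \<zeta>))"
      using pq nz by (simp add: ln_realpow)
    then show ?thesis using pq nz by (simp add: ln_mult)
  qed
  have m1: "has_cmean (\<lambda>\<zeta>. of_real (ln p + ln (cmod (1 - b * \<zeta>)))) (of_real (ln p))"
    using has_cmean_add[OF has_cmean_const[of "of_real (ln p)"] has_cmean_ln_one_minus(1)[OF b1, of 1]] by simp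
  have m2: "has_cmean (\<lambda>\<zeta>. of_real (ln (cmod (of_real r * \<zeta> - a)))) (of_real (ln \<mu>))"
    using has_cmean_ln_dist(1)[of r a] r a by (simp add: \<mu>_def \<rho>_def)
  have m3: "has_cmean (\<lambda>\<zeta>. of_real (ln p + ln (cmod (1 - b * \<zeta>)) - ln (cmod (of_real r * \<zeta> - a)))) (of_real (ln p - ln \<mu>))"
    using has_cmean_diff[OF m1 m2] by (simp only: of_real_diff)
  have nz: "of_real r * \<zeta> - a \<noteq> 0" if "cmod \<zeta> = 1" for \<zeta>
  proof
    assume "of_real r * \<zeta> - a = 0"
    then have "cmod a = cmod (of_real r * \<zeta>)" by simp
    then show False using that a r by (simp add: norm_mult)
  qed
  have "continuous_on (sphere 0 1) (\<lambda>\<zeta>. complex_of_real (max 0 (- ln (cmod (of_real r * \<zeta> - a)))))"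
    using nz by (intro continuous_intros) auto
  then obtain w where w: "has_cmean (\<lambda>\<zeta>. of_real (max 0 (- ln (cmod (of_real r * \<zeta> - a))))) w"
    using has_cmean_continuous by blast
  have "Im w = 0"
    using has_integral_Im[OF w[unfolded has_cmean_def]] has_integral_0 has_integral_unique by fastforce
  then have w': "w = of_real (Re w)" by (simp add: complex_eq_iff)
  have wr: "has_cmean (\<lambda>\<zeta>. of_real (max 0 (- ln (cmod (of_real r * \<zeta> - a))))) (of_real (Re w))"
    by (subst w'[symmetric]) (rule w)
  \<comment> \<open>Pointwise, the larger of 0 and -ln x is at most ln (1 + x^2) / 2 - ln x. The
    right side has an explicit mean, and p exceeds the larger of r and |a| by at most 2.\<close>
  have "Re w \<le> ln p - ln \<mu>"
  proof (rule has_cmean_mono[OF wr m3])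
    fix \<zeta> :: complex assume z: "cmod \<zeta> = 1"
    define x where "x = cmod (of_real r * \<zeta> - a)"
    have x: "x > 0" using nz[OF z] by (simp add: x_def)
    have "ln x = ln (x\<^sup>2) / 2" using x by (simp add: ln_realpow)
    also have "\<dots> \<le> ln (1 + x\<^sup>2) / 2"
    proof -
      have "0 < x\<^sup>2" using x by simp
      then have "ln (x\<^sup>2) \<le> ln (1 + x\<^sup>2)" by (intro ln_mono) auto
      then show ?thesis by simp
    qed
    finally have "ln x \<le> ln (1 + x\<^sup>2) / 2" .
    moreover have "0 \<le> ln (1 + x\<^sup>2) / 2" by simp
    ultimately show "max 0 (- ln (cmod (of_real r * \<zeta> - a))) \<le> ln p + ln (cmod (1 - b * \<zeta>)) - ln (cmod (of_real r * \<zeta> - a))"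
      using key[OF z] by (simp add: x_def)
  qed
  also have "\<dots> = ln (p / \<mu>)" using pq \<mu> by (simp add: ln_div)
  also have "\<dots> \<le> p / \<mu> - 1" using pq \<mu> by (intro ln_le_minus_one) auto
  also have "\<dots> \<le> 2 / \<mu>"
  proof -
    have "p / \<mu> \<le> (\<mu> + 2) / \<mu>" using p\<mu> \<mu> by (intro divide_right_mono) auto
    then show ?thesis using \<mu> by (simp add: add_divide_distrib)
  qed
  also have "\<dots> \<le> 2 / r" using \<mu> r by (intro divide_left_mono) auto
  finally have "Re w \<le> 2 / r" .
  then show thesis using wr by (rule that)
qed


section \<open>Circle means of the logarithm of a function of the first category\<close>

definition generic :: "(complex \<Rightarrow> int) \<Rightarrow> real \<Rightarrow> bool" where
  "generic D r \<longleftrightarrow> (\<forall>a. D a \<noteq> 0 \<longrightarrow> cmod a \<noteq> r)"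

text \<open>On the unit circle cnj \<zeta>^k is \<zeta>^-k, so the circle mean is the
  \<open>k\<close>-th Fourier coefficient of ln |f| on the circle of radius
  \<open>r\<close>.\<close>

definition logmom :: "(complex \<Rightarrow> complex option) \<Rightarrow> real \<Rightarrow> nat \<Rightarrow> complex \<Rightarrow> complex" where
  "logmom f r k \<zeta> = of_real (ln (cmod (the (f (of_real r * \<zeta>))))) * cnj \<zeta> ^ k"

lemma cnj_dsum: "cnj (dsum D S \<phi>) = dsum D S (\<lambda>a. cnj (\<phi> a))"
  by (simp add: dsum_def)

text \<open>O(r) points of the divisor lie within distance 1 of the circle, and the logarithmic
  singularity of each has mean at most 2/r; the products balance to a constant independent of
  \<open>r\<close>. Since |\<zeta>| = 1, the order of the coefficient does not matter.\<close>

lemma circle_moment_bound: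
  assumes lf: "locally_finite D" and gr: "growth D f C"
    and K: "\<And>r. r \<ge> 1 \<Longrightarrow> dabs D {z. r - 1 \<le> cmod z \<and> cmod z \<le> r + 1} \<le> K * r"
    and r: "r \<ge> 1" "generic D r" and v: "has_cmean (logmom f r k) v"
  shows "cmod v \<le> C + 2 * K"
proof -
  define S where "S = {a\<in>{z. r - 1 < cmod z \<and> cmod z < r + 1}. D a \<noteq> 0}"
  have fin: "finite S" unfolding S_def
    by (rule locally_finite_bounded[OF lf bounded_subset[of "cball 0 (r+1)"]]) auto
  define l where "l = (\<lambda>a \<zeta>. max 0 (- ln (cmod (of_real r * \<zeta> - a))))"
  have "\<forall>a\<in>S. \<exists>v. v \<le> 2 / r \<and> has_cmean (\<lambda>\<zeta>. of_real (l a \<zeta>)) (of_real v)"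
  proof
    fix a assume "a \<in> S"
    then have a: "cmod a \<noteq> r" "r - 1 < cmod a" "cmod a < r + 1" using r(2) by (auto simp: S_def generic_def)
    show "\<exists>v. v \<le> 2 / r \<and> has_cmean (\<lambda>\<zeta>. of_real (l a \<zeta>)) (of_real v)"
      using has_cmean_neg_ln_dist[OF r(1) a] unfolding l_def by metis
  qed
  then obtain m where m: "\<And>a. a \<in> S \<Longrightarrow> m a \<le> 2 / r" "\<And>a. a \<in> S \<Longrightarrow> has_cmean (\<lambda>\<zeta>. of_real (l a \<zeta>)) (of_real (m a))"
    by metis
  have "has_cmean (\<lambda>\<zeta>. of_real C + (\<Sum>a\<in>S. of_real \<bar>of_int (D a)\<bar> * of_real (l a \<zeta>)))
      (of_real C + (\<Sum>a\<in>S. of_real \<bar>of_int (D a)\<bar> * of_real (m a)))"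
    by (intro has_cmean_add has_cmean_const has_cmean_sum fin has_cmean_cmult m)
  then have mu: "has_cmean (\<lambda>\<zeta>. of_real (C + (\<Sum>a\<in>S. \<bar>of_int (D a)\<bar> * l a \<zeta>)))
      (of_real (C + (\<Sum>a\<in>S. \<bar>of_int (D a)\<bar> * m a)))" by simp
  have "cmod v \<le> C + (\<Sum>a\<in>S. \<bar>of_int (D a)\<bar> * m a)"
  proof (rule has_cmean_norm_le[OF v mu])
    fix \<zeta> :: complex assume z: "cmod \<zeta> = 1"
    define x where "x = of_real r * \<zeta>"
    have cx: "cmod x = r" using z r by (simp add: x_def norm_mult)
    then have "D x = 0" using r(2) by (auto simp: generic_def)
    then obtain w where w: "f x = Some w" "\<bar>ln (cmod w) - dsum D (ball x 1) (\<lambda>a. ln (cmod (x - a)))\<bar> \<le> C"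
      using gr unfolding growth_def by blast
    have fin': "finite {a\<in>ball x 1. D a \<noteq> 0}" by (rule locally_finite_bounded[OF lf bounded_ball])
    have "\<bar>dsum D (ball x 1) (\<lambda>a. ln (cmod (x - a)))\<bar> \<le> (\<Sum>a\<in>{a\<in>ball x 1. D a \<noteq> 0}. \<bar>of_int (D a) * ln (cmod (x - a))\<bar>)"
      unfolding dsum_def by (rule sum_abs)
    also have "\<dots> \<le> (\<Sum>a\<in>{a\<in>ball x 1. D a \<noteq> 0}. \<bar>of_int (D a)\<bar> * l a \<zeta>)"
    proof (intro sum_mono)
      fix a assume a: "a \<in> {a\<in>ball x 1. D a \<noteq> 0}"
      have "x \<noteq> a" using a \<open>D x = 0\<close> by auto
      then have "ln (cmod (x - a)) \<le> 0" using a by (simp add: dist_norm)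
      then have "\<bar>ln (cmod (x - a))\<bar> = l a \<zeta>" by (simp add: l_def x_def)
      then show "\<bar>of_int (D a) * ln (cmod (x - a))\<bar> \<le> \<bar>of_int (D a)\<bar> * l a \<zeta>" by (simp add: abs_mult)
    qed
    also have "\<dots> \<le> (\<Sum>a\<in>S. \<bar>of_int (D a)\<bar> * l a \<zeta>)"
    proof (intro sum_mono2[OF fin])
      show "{a\<in>ball x 1. D a \<noteq> 0} \<subseteq> S"
      proof
        fix a assume a: "a \<in> {a\<in>ball x 1. D a \<noteq> 0}"
        then have "cmod (x - a) < 1" by (simp add: dist_norm)
        then show "a \<in> S" using a cx norm_triangle_ineq2[of x a] norm_triangle_ineq2[of a x]
          by (simp add: S_def norm_minus_commute)
      qed
    qed (auto simp: l_def)
    finally have "\<bar>ln (cmod w)\<bar> \<le> C + (\<Sum>a\<in>S. \<bar>of_int (D a)\<bar> * l a \<zeta>)" using w(2) by linarith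
    then show "cmod (logmom f r k \<zeta>) \<le> C + (\<Sum>a\<in>S. \<bar>of_int (D a)\<bar> * l a \<zeta>)"
      using w(1) z by (simp add: logmom_def x_def norm_mult norm_power)
  qed
  also have "(\<Sum>a\<in>S. \<bar>of_int (D a)\<bar> * m a) \<le> (\<Sum>a\<in>S. \<bar>of_int (D a)\<bar> * (2 / r))"
    using m by (intro sum_mono mult_left_mono) auto
  also have "\<dots> = dabs D {z. r - 1 < cmod z \<and> cmod z < r + 1} * (2 / r)"
    unfolding dabs_def sum_distrib_right S_def by simp
  also have "\<dots> \<le> (K * r) * (2 / r)"
  proof (intro mult_right_mono)
    have "dabs D {z. r - 1 < cmod z \<and> cmod z < r + 1} \<le> dabs D {z. r - 1 \<le> cmod z \<and> cmod z \<le> r + 1}"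
      by (rule dabs_mono[OF lf bounded_subset[of "cball 0 (r+1)"]]) auto
    then show "dabs D {z. r - 1 < cmod z \<and> cmod z < r + 1} \<le> K * r" using K[OF r(1)] by simp
  qed (use r in auto)
  finally show ?thesis using r by (simp add: algebra_simps)
qed

text \<open>Near the larger closed disc f = exp L times a rational function, so each Fourier
  coefficient of ln |f| is a Taylor term of \<open>L\<close> plus explicit divisor terms. Divided by
  the \<open>k\<close>-th power of the radius, the Taylor term is the same on both circles, and
  subtraction removes the unknown \<open>L\<close>. For \<open>k = 0\<close> this is Jensen's
  formula.\<close>

lemma two_radii:
  assumes mo: "\<And>z. mer_order f z (D z)" and lf: "locally_finite D"
    and r: "0 < r0" "r0 < r" "generic D r0" "generic D r"
  shows "\<exists>v v0. has_cmean (logmom f r 0) (of_real v) \<and> has_cmean (logmom f r0 0) (of_real v0) \<and>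
       v - v0 = dsum D (ball 0 r) (\<lambda>a. ln (r / max r0 (cmod a)))"
    and "k = 1 \<or> k = 2 \<Longrightarrow> \<exists>v v0. has_cmean (logmom f r k) v \<and> has_cmean (logmom f r0 k) v0 \<and>
       v / of_real r ^ k - v0 / of_real r0 ^ k =
         dsum D (ball 0 r) (\<lambda>a. cnj a ^ k * of_real (1 / max r0 (cmod a) ^ (2 * k) - 1 / r ^ (2 * k))) / (2 * of_nat k)"
proof -
  \<comment> \<open>\<open>R'\<close> is chosen beyond \<open>r\<close> but before the next point of
    the divisor: \<open>L\<close> then lives on a neighbourhood of the circle, while the divisor
    sums do not change.\<close>
  define X where "X = insert (r + 1) (cmod ` {a\<in>cball 0 (r + 1). D a \<noteq> 0 \<and> cmod a > r})"
  have "finite {a\<in>cball 0 (r + 1). D a \<noteq> 0 \<and> cmod a > r}"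
    by (rule finite_subset[OF _ locally_finite_bounded[OF lf bounded_cball[of 0 "r+1"]]]) auto
  then have finX: "finite X" by (simp add: X_def)
  define R' where "R' = Min X"
  have R': "R' > r" unfolding R'_def using finX by (subst Min_gr_iff) (auto simp: X_def)
  have R'le: "R' \<le> r + 1" unfolding R'_def using finX by (intro Min_le) (auto simp: X_def)
  define U where "U = ball (0::complex) R'"
  have supp: "a \<in> U \<longleftrightarrow> a \<in> ball 0 r" if "D a \<noteq> 0" for a
  proof -
    have "cmod a < r" if "cmod a < R'"
    proof (rule ccontr)
      assume "\<not> cmod a < r"
      then have "cmod a > r" using r(4) \<open>D a \<noteq> 0\<close> by (auto simp: generic_def)
      then have "cmod a \<in> X" using that R'le \<open>D a \<noteq> 0\<close> by (auto simp: X_def)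
      then have "R' \<le> cmod a" unfolding R'_def using finX by simp
      then show False using that by simp
    qed
    then show ?thesis using R' by (auto simp: U_def)
  qed
  obtain F where F: "F holomorphic_on U" "\<And>z. z \<in> U \<Longrightarrow> F z \<noteq> 0"
      "\<And>z. z \<in> U \<Longrightarrow> D z \<ge> 0 \<Longrightarrow> f z = Some (F z * divpoly D U z)"
    using divisor_factor[OF mo lf, of U] by (metis U_def bounded_ball open_ball)
  have finU: "finite {a\<in>U. D a \<noteq> 0}" by (rule locally_finite_bounded[OF lf]) (simp add: U_def)
  obtain L where L: "L holomorphic_on U" "\<And>z. z \<in> U \<Longrightarrow> F z = exp (L z)"
    using contractible_imp_holomorphic_log[OF F(1) _ F(2)] convex_imp_contractible[OF convex_ball] unfolding U_def by metis
  have lm: "of_real (Re (L (of_real \<rho> * \<zeta>))) * cnj \<zeta> ^ k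
        + (\<Sum>a\<in>{a\<in>U. D a \<noteq> 0}. of_int (D a) * (of_real (ln (cmod (of_real \<rho> * \<zeta> - a))) * cnj \<zeta> ^ k)) = logmom f \<rho> k \<zeta>"
    if \<rho>: "0 < \<rho>" "\<rho> < R'" "generic D \<rho>" and z: "cmod \<zeta> = 1" for \<rho> \<zeta> k
  proof -
    define x where "x = of_real \<rho> * \<zeta>"
    have cx: "cmod x = \<rho>" using z \<rho> by (simp add: x_def norm_mult)
    have Dx: "D x = 0" using \<rho>(3) cx by (auto simp: generic_def)
    have xU: "x \<in> U" using cx \<rho> by (simp add: U_def)
    have "f x = Some (F x * divpoly D U x)" using F(3)[OF xU] Dx by simp
    moreover have "ln (cmod (F x * divpoly D U x)) = Re (L x) + dsum D U (\<lambda>a. ln (cmod (x - a)))"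
      using divpoly_nonzero[OF Dx finU] L(2)[OF xU] ln_divpoly[OF finU Dx] by (simp add: norm_mult ln_mult)
    ultimately have "logmom f \<rho> k \<zeta> = of_real (Re (L x) + dsum D U (\<lambda>a. ln (cmod (x - a)))) * cnj \<zeta> ^ k"
      by (simp add: logmom_def x_def)
    also have "\<dots> = of_real (Re (L x)) * cnj \<zeta> ^ k + (\<Sum>a\<in>{a\<in>U. D a \<noteq> 0}. of_int (D a) * (of_real (ln (cmod (x - a))) * cnj \<zeta> ^ k))"
      by (simp add: dsum_def distrib_right sum_distrib_right mult.assoc)
    finally show ?thesis by (simp add: x_def)
  qed
  have reL: "has_cmean (\<lambda>\<zeta>. of_real (Re (L (of_real \<rho> * \<zeta>))) * cnj \<zeta> ^ k)
      (if k = 0 then of_real (Re (L 0)) else of_real \<rho> ^ k * (deriv ^^ k) L 0 / fact k / 2)"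
    if \<rho>: "0 < \<rho>" "\<rho> < R'" for \<rho> k
  proof -
    have sub: "of_real \<rho> * w \<in> U" if "w \<in> ball 0 (R' / \<rho>)" for w
      using that \<rho> by (simp add: U_def norm_mult field_simps)
    have "(L \<circ> (\<lambda>\<zeta>. of_real \<rho> * \<zeta>)) holomorphic_on ball 0 (R' / \<rho>)"
      by (rule holomorphic_on_compose_gen[OF _ L(1)]) (use sub in \<open>auto intro!: holomorphic_intros\<close>)
    then have h: "(\<lambda>\<zeta>. L (of_real \<rho> * \<zeta>)) holomorphic_on ball 0 (R' / \<rho>)" by (simp add: o_def)
    have "(deriv ^^ k) (\<lambda>\<zeta>. L (of_real \<rho> * \<zeta>)) 0 = of_real \<rho> ^ k * (deriv ^^ k) L (of_real \<rho> * 0)"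
      by (rule higher_deriv_compose_linear[OF L(1), of "ball 0 (R' / \<rho>)"]) (use sub \<rho> in \<open>auto simp: U_def\<close>)
    then have dd: "(deriv ^^ k) (\<lambda>\<zeta>. L (of_real \<rho> * \<zeta>)) 0 = of_real \<rho> ^ k * (deriv ^^ k) L 0" by simp
    have gt: "1 < R' / \<rho>" using \<rho> by (simp add: field_simps)
    show ?thesis using has_cmean_Re_holomorphic[OF h gt, of k] by (simp only: dd mult_zero_right)
  qed
  have m0: "has_cmean (logmom f \<rho> 0) (of_real (Re (L 0) + dsum D (ball 0 r) (\<lambda>a. ln (max \<rho> (cmod a)))))"
    if \<rho>: "0 < \<rho>" "\<rho> < R'" "generic D \<rho>" for \<rho>
  proof -
    have "has_cmean (\<lambda>\<zeta>. of_real (Re (L (of_real \<rho> * \<zeta>))) * cnj \<zeta> ^ 0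
        + (\<Sum>a\<in>{a\<in>U. D a \<noteq> 0}. of_int (D a) * (of_real (ln (cmod (of_real \<rho> * \<zeta> - a))) * cnj \<zeta> ^ 0)))
       ((if (0::nat) = 0 then of_real (Re (L 0)) else of_real \<rho> ^ 0 * (deriv ^^ 0) L 0 / fact 0 / 2) +
        (\<Sum>a\<in>{a\<in>U. D a \<noteq> 0}. of_int (D a) * of_real (ln (max \<rho> (cmod a)))))"
      using \<rho> by (intro has_cmean_add reL has_cmean_sum finU has_cmean_cmult) (auto simp: generic_def intro!: has_cmean_ln_dist(1))
    then have "has_cmean (logmom f \<rho> 0) (of_real (Re (L 0)) + (\<Sum>a\<in>{a\<in>U. D a \<noteq> 0}. of_int (D a) * of_real (ln (max \<rho> (cmod a)))))"
      using has_cmean_cong[OF _ lm[OF \<rho>]] by simp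
    moreover have "{a\<in>U. D a \<noteq> 0} = {a\<in>ball 0 r. D a \<noteq> 0}" using supp by auto
    ultimately show ?thesis by (simp add: dsum_def)
  qed
  have mk: "has_cmean (logmom f \<rho> k) (of_real \<rho> ^ k * (deriv ^^ k) L 0 / fact k / 2 + dsum D (ball 0 r) (\<lambda>a. - (bcoeff \<rho> a ^ k) / (2 * of_nat k)))"
    if \<rho>: "0 < \<rho>" "\<rho> < R'" "generic D \<rho>" and k: "k = 1 \<or> k = 2" for \<rho> k
  proof -
    have "has_cmean (\<lambda>\<zeta>. of_real (Re (L (of_real \<rho> * \<zeta>))) * cnj \<zeta> ^ k
        + (\<Sum>a\<in>{a\<in>U. D a \<noteq> 0}. of_int (D a) * (of_real (ln (cmod (of_real \<rho> * \<zeta> - a))) * cnj \<zeta> ^ k)))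
       ((if k = 0 then of_real (Re (L 0)) else of_real \<rho> ^ k * (deriv ^^ k) L 0 / fact k / 2) +
        (\<Sum>a\<in>{a\<in>U. D a \<noteq> 0}. of_int (D a) * (- (bcoeff \<rho> a ^ k) / (2 * of_nat k))))"
      using \<rho> k by (intro has_cmean_add reL has_cmean_sum finU has_cmean_cmult has_cmean_ln_dist(2)) (auto simp: generic_def)
    then have "has_cmean (logmom f \<rho> k) ((if k = 0 then of_real (Re (L 0)) else of_real \<rho> ^ k * (deriv ^^ k) L 0 / fact k / 2) +
        (\<Sum>a\<in>{a\<in>U. D a \<noteq> 0}. of_int (D a) * (- (bcoeff \<rho> a ^ k) / (2 * of_nat k))))"
      using has_cmean_cong[OF _ lm[OF \<rho>]] by simp
    moreover have "{a\<in>U. D a \<noteq> 0} = {a\<in>ball 0 r. D a \<noteq> 0}" using supp by auto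
    ultimately show ?thesis using k by (auto simp: dsum_def)
  qed
  have r0R: "r0 < R'" "r > 0" using r R' by auto
  show "\<exists>v v0. has_cmean (logmom f r 0) (of_real v) \<and> has_cmean (logmom f r0 0) (of_real v0) \<and>
       v - v0 = dsum D (ball 0 r) (\<lambda>a. ln (r / max r0 (cmod a)))"
  proof (intro exI conjI)
    show "has_cmean (logmom f r 0) (of_real (Re (L 0) + dsum D (ball 0 r) (\<lambda>a. ln (max r (cmod a)))))"
      by (rule m0[OF r0R(2) R' r(4)])
    show "has_cmean (logmom f r0 0) (of_real (Re (L 0) + dsum D (ball 0 r) (\<lambda>a. ln (max r0 (cmod a)))))"
      by (rule m0[OF r(1) r0R(1) r(3)])
    have "dsum D (ball 0 r) (\<lambda>a. ln (max r (cmod a))) - dsum D (ball 0 r) (\<lambda>a. ln (max r0 (cmod a)))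
       = dsum D (ball 0 r) (\<lambda>a. ln (r / max r0 (cmod a)))"
      unfolding dsum_sub[symmetric] using r by (intro dsum_cong) (auto simp: ln_div max_def)
    then show "Re (L 0) + dsum D (ball 0 r) (\<lambda>a. ln (max r (cmod a))) - (Re (L 0) + dsum D (ball 0 r) (\<lambda>a. ln (max r0 (cmod a))))
       = dsum D (ball 0 r) (\<lambda>a. ln (r / max r0 (cmod a)))" by simp
  qed
  assume k: "k = 1 \<or> k = 2"
  show "\<exists>v v0. has_cmean (logmom f r k) v \<and> has_cmean (logmom f r0 k) v0 \<and>
       v / of_real r ^ k - v0 / of_real r0 ^ k =
         dsum D (ball 0 r) (\<lambda>a. cnj a ^ k * of_real (1 / max r0 (cmod a) ^ (2 * k) - 1 / r ^ (2 * k))) / (2 * of_nat k)"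
  proof (intro exI conjI)
    show "has_cmean (logmom f r k) (of_real r ^ k * (deriv ^^ k) L 0 / fact k / 2 + dsum D (ball 0 r) (\<lambda>a. - (bcoeff r a ^ k) / (2 * of_nat k)))"
      by (rule mk[OF r0R(2) R' r(4) k])
    show "has_cmean (logmom f r0 k) (of_real r0 ^ k * (deriv ^^ k) L 0 / fact k / 2 + dsum D (ball 0 r) (\<lambda>a. - (bcoeff r0 a ^ k) / (2 * of_nat k)))"
      by (rule mk[OF r(1) r0R(1) r(3) k])
    \<comment> \<open>The two branches of \<open>bcoeff\<close> merge after normalization, because
      1/a = cnj a / |a|^2.\<close>
    have bc: "bcoeff \<rho> a ^ k / of_real \<rho> ^ k = cnj a ^ k * of_real (1 / max \<rho> (cmod a) ^ (2 * k))" if "\<rho> > 0" for \<rho> a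
    proof (cases "cmod a < \<rho>")
      case True
      then have "max \<rho> (cmod a) = \<rho>" by simp
      then show ?thesis using True that by (simp add: bcoeff_def power_divide power_mult power2_eq_square power_mult_distrib)
    next
      case False
      then have a: "a \<noteq> 0" "max \<rho> (cmod a) = cmod a" using that by auto
      have "cnj a * of_real (1 / (cmod a)\<^sup>2) = 1 / a"
      proof -
        have "cnj a * of_real (1 / (cmod a)\<^sup>2) = cnj a / of_real ((cmod a)\<^sup>2)" by simp
        also have "\<dots> = 1 / a" unfolding complex_norm_square using a by simp
        finally show ?thesis .
      qed
      then have "cnj a ^ k * of_real (1 / (cmod a)\<^sup>2) ^ k = 1 / a ^ k"
        by (simp add: power_mult_distrib[symmetric] power_one_over del: of_real_divide)
      then show ?thesis using False a that by (simp add: bcoeff_def power_divide power_mult)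
    qed
    define l where "l = (deriv ^^ k) L 0 / fact k / 2"
    have e: "(of_real \<rho> ^ k * (deriv ^^ k) L 0 / fact k / 2 + dsum D (ball 0 r) (\<lambda>a. - (bcoeff \<rho> a ^ k) / (2 * of_nat k))) / of_real \<rho> ^ k
       = l - dsum D (ball 0 r) (\<lambda>a. cnj a ^ k * of_real (1 / max \<rho> (cmod a) ^ (2 * k))) / (2 * of_nat k)" if "\<rho> > 0" for \<rho>
    proof -
      have "dsum D (ball 0 r) (\<lambda>a. - (bcoeff \<rho> a ^ k) / (2 * of_nat k)) / of_real \<rho> ^ k
          = dsum D (ball 0 r) (\<lambda>a. - 1 / (2 * of_nat k) * (cnj a ^ k * of_real (1 / max \<rho> (cmod a) ^ (2 * k))))"
        unfolding dsum_def sum_divide_distrib bc[OF that, symmetric] by (simp add: field_simps)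
      also have "\<dots> = - 1 / (2 * of_nat k) * dsum D (ball 0 r) (\<lambda>a. cnj a ^ k * of_real (1 / max \<rho> (cmod a) ^ (2 * k)))"
        by (rule dsum_cmult)
      finally show ?thesis using that by (simp add: add_divide_distrib l_def)
    qed
    have mx: "dsum D (ball 0 r) (\<lambda>a. cnj a ^ k * of_real (1 / max r (cmod a) ^ (2 * k))) = dsum D (ball 0 r) (\<lambda>a. cnj a ^ k * of_real (1 / r ^ (2 * k)))"
      by (rule dsum_cong) (auto simp: max_def)
    show "(of_real r ^ k * (deriv ^^ k) L 0 / fact k / 2 + dsum D (ball 0 r) (\<lambda>a. - (bcoeff r a ^ k) / (2 * of_nat k))) / of_real r ^ k
      - (of_real r0 ^ k * (deriv ^^ k) L 0 / fact k / 2 + dsum D (ball 0 r) (\<lambda>a. - (bcoeff r0 a ^ k) / (2 * of_nat k))) / of_real r0 ^ k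
      = dsum D (ball 0 r) (\<lambda>a. cnj a ^ k * of_real (1 / max r0 (cmod a) ^ (2 * k) - 1 / r ^ (2 * k))) / (2 * of_nat k)"
      unfolding e[OF r(1)] e[OF r0R(2)] mx of_real_diff right_diff_distrib dsum_sub by (simp add: diff_divide_distrib)
  qed
qed

section \<open>From generic radii to all radii\<close>

lemma exists_generic:
  assumes lf: "locally_finite D" and "x < y"
  obtains r where "x < r" "r < y" "generic D r"
proof -
  have "finite (cmod ` {a\<in>cball 0 y. D a \<noteq> 0})" by (intro finite_imageI locally_finite_bounded[OF lf bounded_cball])
  moreover have "infinite {x<..<y}" using assms(2) by simp
  ultimately obtain r where "r \<in> {x<..<y}" "r \<notin> cmod ` {a\<in>cball 0 y. D a \<noteq> 0}"
    by (meson finite_subset subsetI)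
  then show thesis by (intro that[of r]) (auto simp: generic_def)
qed

text \<open>Left limits suit open balls: points on the circle of radius \<open>r\<close> are not
  counted by \<open>ball 0 r\<close>, hence radii slightly below \<open>r\<close> see the same
  divisor and avoid it.\<close>

lemma eventually_at_left_support:
  assumes lf: "locally_finite D"
  shows "\<forall>\<^sub>F s in at_left r. generic D s \<and> {a\<in>ball 0 s. D a \<noteq> 0} = {a\<in>ball 0 r. D a \<noteq> 0}"
proof -
  define X where "X = insert (r - 1) (cmod ` {a\<in>ball 0 r. D a \<noteq> 0})"
  have finX: "finite X"
    unfolding X_def by (intro finite_insert[THEN iffD2] finite_imageI locally_finite_bounded[OF lf bounded_ball])
  have lt: "Max X < r" using finX by (subst Max_less_iff) (auto simp: X_def)
  have "\<forall>\<^sub>F s in at_left r. s \<in> {Max X<..<r}" by (rule eventually_at_left_real[OF lt])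
  then show ?thesis
  proof eventually_elim
    case (elim s)
    have "cmod a < s" if "D a \<noteq> 0" "cmod a < r" for a
    proof -
      have "cmod a \<le> Max X" using that finX by (intro Max_ge) (auto simp: X_def)
      then show ?thesis using elim by simp
    qed
    then show ?case using elim by (force simp: generic_def)
  qed
qed

text \<open>Circle means are only used on circles free of zeros and poles; left continuity removes the exception.\<close>
lemma dsum_left_bound:
  fixes g :: "complex \<Rightarrow> real \<Rightarrow> 'a::real_normed_field"
  assumes lf: "locally_finite D" and r: "r0 < r"
    and g: "\<And>a. isCont (g a) r" and B: "isCont B r"
    and bd: "\<And>s. r0 < s \<Longrightarrow> generic D s \<Longrightarrow> norm (dsum D (ball 0 s) (\<lambda>a. g a s) + q) \<le> B s"
  shows "norm (dsum D (ball 0 r) (\<lambda>a. g a r) + q) \<le> B r"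
proof (rule tendsto_le[of "at_left r"])
  show "(B \<longlongrightarrow> B r) (at_left r)" using B by (simp add: isCont_def filterlim_at_split)
  have g': "(g a \<longlongrightarrow> g a r) (at_left r)" for a using g[of a] by (simp add: isCont_def filterlim_at_split)
  show "((\<lambda>s. norm (dsum D (ball 0 r) (\<lambda>a. g a s) + q)) \<longlongrightarrow> norm (dsum D (ball 0 r) (\<lambda>a. g a r) + q)) (at_left r)"
    unfolding dsum_def by (intro tendsto_intros g')
  have "\<forall>\<^sub>F s in at_left r. s \<in> {r0<..<r}" by (rule eventually_at_left_real[OF r])
  with eventually_at_left_support[OF lf, of r]
  show "\<forall>\<^sub>F s in at_left r. norm (dsum D (ball 0 r) (\<lambda>a. g a s) + q) \<le> B s"
  proof eventually_elim
    case (elim s)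
    then have "norm (dsum D (ball 0 s) (\<lambda>a. g a s) + q) \<le> B s" using bd by auto
    then show ?case using elim by (simp add: dsum_def)
  qed
qed auto

text \<open>The inner radius has to avoid the divisor, so it is picked between 1 and 2 instead of
  being 1. The constant 102 N is 2K in \<open>circle_moment_bound\<close> with K = 51 N from
  \<open>wide_ring_count\<close>.\<close>

lemma moment_estimates:
  assumes mo: "\<And>z. mer_order f z (D z)" and lf: "locally_finite D" and gr: "growth D f C"
    and N: "\<And>c. dabs D (cball c 1) \<le> N"
  obtains r0 where "1 < r0" "r0 < 2"
    "\<And>r. r > r0 \<Longrightarrow> \<bar>dsum D (ball 0 r) (\<lambda>a. ln (r / max r0 (cmod a)))\<bar> \<le> 2 * (C + 102 * N)"
    "\<And>k. k = 1 \<or> k = 2 \<Longrightarrow> \<exists>q. cmod q \<le> C + 102 * N \<and> (\<forall>r>r0.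
       cmod (dsum D (ball 0 r) (\<lambda>a. cnj a ^ k * of_real (1 / max r0 (cmod a) ^ (2 * k) - 1 / r ^ (2 * k)) / (2 * of_nat k)) + q) \<le> (C + 102 * N) / r ^ k)"
proof -
  define B where "B = C + 102 * N"
  obtain r0 where r0: "1 < r0" "r0 < 2" "generic D r0" using exists_generic[OF lf, of 1 2] by auto
  have cb: "cmod v \<le> B" if "r \<ge> 1" "generic D r" "has_cmean (logmom f r k) v" for r k v
  proof -
    have "dabs D {z. r - 1 \<le> cmod z \<and> cmod z \<le> r + 1} \<le> (51 * N) * r" if "r \<ge> 1" for r
      using wide_ring_count[OF lf N that, of 0] by simp
    from circle_moment_bound[OF lf gr this that] show ?thesis by (simp add: B_def)
  qed
  show thesis
  proof (rule that[OF r0(1,2)])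
    fix r assume r: "r > r0"
    have "norm (dsum D (ball 0 r) (\<lambda>a. ln (r / max r0 (cmod a))) + 0) \<le> 2 * B"
    proof (rule dsum_left_bound[OF lf r, where B = "\<lambda>_. 2 * B"])
      fix a show "isCont (\<lambda>r. ln (r / max r0 (cmod a))) r" using r0 r by (intro continuous_intros) (auto simp: max_def)
    next
      fix s assume s: "r0 < s" "generic D s"
      obtain v v0 where v: "has_cmean (logmom f s 0) (of_real v)" "has_cmean (logmom f r0 0) (of_real v0)"
        "v - v0 = dsum D (ball 0 s) (\<lambda>a. ln (s / max r0 (cmod a)))"
        using two_radii(1)[OF mo lf _ s(1) r0(3) s(2)] r0 by auto
      have "\<bar>v\<bar> \<le> B" "\<bar>v0\<bar> \<le> B" using cb[OF _ s(2) v(1)] cb[OF _ r0(3) v(2)] r0 s by auto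
      then show "norm (dsum D (ball 0 s) (\<lambda>a. ln (s / max r0 (cmod a))) + 0) \<le> 2 * B"
        unfolding v(3)[symmetric] using abs_triangle_ineq4[of v v0] by simp
    qed simp
    then show "\<bar>dsum D (ball 0 r) (\<lambda>a. ln (r / max r0 (cmod a)))\<bar> \<le> 2 * (C + 102 * N)" by (simp add: B_def)
  next
    fix k :: nat assume k: "k = 1 \<or> k = 2"
    have ex: "\<exists>v v0. has_cmean (logmom f s k) v \<and> has_cmean (logmom f r0 k) v0 \<and>
       v / of_real s ^ k - v0 / of_real r0 ^ k =
         dsum D (ball 0 s) (\<lambda>a. cnj a ^ k * of_real (1 / max r0 (cmod a) ^ (2 * k) - 1 / s ^ (2 * k))) / (2 * of_nat k)"
      if "r0 < s" "generic D s" for s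
      using two_radii(2)[OF mo lf _ that(1) r0(3) that(2) k] r0 by auto
    \<comment> \<open>\<open>two_radii\<close> delivers the coefficient on the inner circle only
      together with one at a second radius; any generic one serves, and by uniqueness the
      coefficient does not depend on it.\<close>
    obtain s1 where "r0 < s1" "generic D s1" using exists_generic[OF lf, of r0 "r0 + 1"] by auto
    then obtain v0 where v0: "has_cmean (logmom f r0 k) v0" using ex by blast
    define q where "q = v0 / of_real r0 ^ k"
    have "cmod q \<le> cmod v0" using r0 by (simp add: q_def norm_divide norm_power divide_le_eq mult_le_cancel_left1)
    moreover have "cmod v0 \<le> B" using cb[OF _ r0(3) v0] r0 by simp
    ultimately have qB: "cmod q \<le> B" by simp
    have "cmod (dsum D (ball 0 r) (\<lambda>a. cnj a ^ k * of_real (1 / max r0 (cmod a) ^ (2 * k) - 1 / r ^ (2 * k)) / (2 * of_nat k)) + q) \<le> B / r ^ k"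
      if r: "r > r0" for r
    proof (rule dsum_left_bound[OF lf r, where B = "\<lambda>s. B / s ^ k"])
      fix a show "isCont (\<lambda>r. cnj a ^ k * of_real (1 / max r0 (cmod a) ^ (2 * k) - 1 / r ^ (2 * k)) / (2 * of_nat k)) r"
        using r0 r k by (intro continuous_intros) auto
    next
      show "isCont (\<lambda>s. B / s ^ k) r" using r0 r by (intro continuous_intros) auto
      fix s assume s: "r0 < s" "generic D s"
      obtain v w where v: "has_cmean (logmom f s k) v" "has_cmean (logmom f r0 k) w"
        "v / of_real s ^ k - w / of_real r0 ^ k =
         dsum D (ball 0 s) (\<lambda>a. cnj a ^ k * of_real (1 / max r0 (cmod a) ^ (2 * k) - 1 / s ^ (2 * k))) / (2 * of_nat k)"
        using ex[OF s] by blast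
      have w: "w = v0" by (rule has_cmean_unique[OF v(2) v0])
      have "dsum D (ball 0 s) (\<lambda>a. cnj a ^ k * of_real (1 / max r0 (cmod a) ^ (2 * k) - 1 / s ^ (2 * k)) / (2 * of_nat k)) + q = v / of_real s ^ k"
        using v(3) unfolding w q_def dsum_def sum_divide_distrib by (simp add: algebra_simps)
      moreover have "cmod (v / of_real s ^ k) \<le> B / s ^ k"
        using cb[OF _ s(2) v(1)] s r0 by (simp add: norm_divide norm_power divide_right_mono)
      ultimately show "norm (dsum D (ball 0 s) (\<lambda>a. cnj a ^ k * of_real (1 / max r0 (cmod a) ^ (2 * k) - 1 / s ^ (2 * k)) / (2 * of_nat k)) + q) \<le> B / s ^ k"
        by simp
    qed
    then show "\<exists>q. cmod q \<le> C + 102 * N \<and> (\<forall>r>r0.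
       cmod (dsum D (ball 0 r) (\<lambda>a. cnj a ^ k * of_real (1 / max r0 (cmod a) ^ (2 * k) - 1 / r ^ (2 * k)) / (2 * of_nat k)) + q) \<le> (C + 102 * N) / r ^ k)"
      using qB by (auto simp: B_def)
  qed
qed

section \<open>Integrals of divisor sums\<close>

text \<open>A point \<open>a\<close> enters \<open>ball c t\<close> as soon as t exceeds |a - c|, so
  it contributes the integral of \<open>h a\<close> from that value (or from \<open>r0\<close>) to
  \<open>r\<close>. This is partial integration of counting functions, done point by point.\<close>

lemma dsum_has_integral:
  fixes \<phi> :: "complex \<Rightarrow> 'a::{real_normed_field, euclidean_space}"
  assumes lf: "locally_finite D" and r: "0 < r0" "r0 \<le> r"
    and H: "\<And>a t. t \<ge> r0 \<Longrightarrow> (H a has_real_derivative h a t) (at t)"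
  shows "((\<lambda>t. dsum D (ball c t) (\<lambda>a. \<phi> a * of_real (h a t))) has_integral
     dsum D (ball c r) (\<lambda>a. \<phi> a * of_real (H a r - H a (max r0 (cmod (a - c)))))) {r0..r}"
proof -
  let ?S = "{a\<in>ball c r. D a \<noteq> 0}"
  have fin: "finite ?S" by (rule locally_finite_bounded[OF lf bounded_ball])
  have one: "((\<lambda>t. if cmod (a - c) < t then of_int (D a) * (\<phi> a * of_real (h a t)) else 0) has_integral
     of_int (D a) * (\<phi> a * of_real (H a r - H a (max r0 (cmod (a - c)))))) {r0..r}" if a: "a \<in> ?S" for a
  proof -
    define m where "m = max r0 (cmod (a - c))"
    have m: "r0 \<le> m" "m \<le> r" using a r by (auto simp: m_def dist_norm norm_minus_commute)
    have "(h a has_integral (H a r - H a m)) {m..r}"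
      by (rule fundamental_theorem_of_calculus[OF m(2)])
        (use H m in \<open>auto simp: has_real_derivative_iff_has_vector_derivative[symmetric] intro: has_field_derivative_at_within\<close>)
    then have "((\<lambda>t. of_int (D a) * (\<phi> a * of_real (h a t))) has_integral (of_int (D a) * (\<phi> a * of_real (H a r - H a m)))) {m..r}"
      by (intro has_integral_mult_right has_integral_of_real)
    then have 1: "((\<lambda>t. if cmod (a - c) < t then of_int (D a) * (\<phi> a * of_real (h a t)) else 0) has_integral (of_int (D a) * (\<phi> a * of_real (H a r - H a m)))) {m..r}"
      \<comment> \<open>At t = m the point lies on the boundary and may not belong to the open ball;
        a single value of t does not affect the integral.\<close>
      by (rule has_integral_spike_finite[of "{m}", rotated 2]) (auto simp: m_def)
    have 2: "((\<lambda>t. if cmod (a - c) < t then of_int (D a) * (\<phi> a * of_real (h a t)) else 0) has_integral 0) {r0..m}"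
    proof (cases "cmod (a - c) \<le> r0")
      case True
      then have "m = r0" by (simp add: m_def)
      then show ?thesis using has_integral_refl(2)[of _ r0] by (simp add: cbox_interval[symmetric])
    next
      case False
      then have "m = cmod (a - c)" by (simp add: m_def)
      then show ?thesis by (intro has_integral_is_0) auto
    qed
    show ?thesis using has_integral_combine[OF m 2 1] by (simp add: m_def)
  qed
  have "((\<lambda>t. \<Sum>a\<in>?S. if cmod (a - c) < t then of_int (D a) * (\<phi> a * of_real (h a t)) else 0) has_integral
     (\<Sum>a\<in>?S. of_int (D a) * (\<phi> a * of_real (H a r - H a (max r0 (cmod (a - c))))))) {r0..r}"
    by (rule has_integral_sum[OF fin one])
  then show ?thesis unfolding dsum_def
  proof (rule has_integral_eq[rotated])
    fix t assume t: "t \<in> {r0..r}"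
    have "{a\<in>ball c t. D a \<noteq> 0} = {a\<in>?S. cmod (a - c) < t}"
      using t by (auto simp: dist_norm norm_minus_commute)
    then show "(\<Sum>a\<in>?S. if cmod (a - c) < t then of_int (D a) * (\<phi> a * of_real (h a t)) else 0)
      = (\<Sum>a\<in>{a\<in>ball c t. D a \<noteq> 0}. of_int (D a) * (\<phi> a * of_real (h a t)))"
      using sum.inter_filter[OF fin, of "\<lambda>a. of_int (D a) * (\<phi> a * of_real (h a t))" "\<lambda>a. cmod (a - c) < t"] by simp
  qed
qed


section \<open>Necessity of the conditions\<close>

lemma norm_diff_diff_le: "norm (x - y - z) \<le> norm x + norm y + norm z"
  for x :: "'a::real_normed_vector"
  using norm_triangle_ineq4[of "x - y" z] norm_triangle_ineq4[of x y] by simp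

lemma zsum_minus_psum:
  assumes "locally_finite D" "bounded S"
  shows "zsum D S \<phi> - psum D S \<phi> = dsum D S \<phi>"
proof -
  have fin: "finite {z\<in>S. D z \<noteq> 0}" by (rule locally_finite_bounded[OF assms])
  have "{z\<in>S. D z \<noteq> 0} = {z\<in>S. D z > 0} \<union> {z\<in>S. D z < 0}" by auto
  then have "dsum D S \<phi> = (\<Sum>z\<in>{z\<in>S. D z > 0}. of_int (D z) * \<phi> z) + (\<Sum>z\<in>{z\<in>S. D z < 0}. of_int (D z) * \<phi> z)"
    unfolding dsum_def using fin by (simp only:) (rule sum.union_disjoint, auto)
  then show ?thesis by (simp add: zsum_def psum_def sum_negf)
qed

lemma zcount_minus_pcount:
  assumes "locally_finite D" "bounded S"
  shows "real_of_int (zcount D S) - real_of_int (pcount D S) = dsum D S (\<lambda>_. 1)"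
proof -
  have fin: "finite {z\<in>S. D z \<noteq> 0}" by (rule locally_finite_bounded[OF assms])
  have "{z\<in>S. D z \<noteq> 0} = {z\<in>S. D z > 0} \<union> {z\<in>S. D z < 0}" by auto
  then have "dsum D S (\<lambda>_. 1::real) = (\<Sum>z\<in>{z\<in>S. D z > 0}. of_int (D z)) + (\<Sum>z\<in>{z\<in>S. D z < 0}. of_int (D z))"
    unfolding dsum_def using fin by (simp only: mult_1_right) (rule sum.union_disjoint, auto)
  then show ?thesis by (simp add: zcount_def pcount_def sum_negf)
qed

lemma zcount_plus_pcount:
  assumes "locally_finite D" "bounded S"
  shows "real_of_int (zcount D S + pcount D S) = dabs D S"
proof -
  have fin: "finite {z\<in>S. D z \<noteq> 0}" by (rule locally_finite_bounded[OF assms])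
  have "{z\<in>S. D z \<noteq> 0} = {z\<in>S. D z > 0} \<union> {z\<in>S. D z < 0}" by auto
  then have "dabs D S = (\<Sum>z\<in>{z\<in>S. D z > 0}. real_of_int \<bar>D z\<bar>) + (\<Sum>z\<in>{z\<in>S. D z < 0}. real_of_int \<bar>D z\<bar>)"
    unfolding dabs_def using fin by (simp only:) (rule sum.union_disjoint, auto)
  then show ?thesis by (simp add: zcount_def pcount_def)
qed

section \<open>Translation of divisor and function\<close>

lemma locally_finite_shift: assumes "locally_finite D" shows "locally_finite (\<lambda>z. D (z + c))"
  unfolding locally_finite_def
proof
  fix r
  have "(\<lambda>z. z + c) ` {z. D (z + c) \<noteq> 0 \<and> cmod z \<le> r} \<subseteq> {z\<in>cball c r. D z \<noteq> 0}"
    by (auto simp: dist_norm)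
  then have "finite ((\<lambda>z. z + c) ` {z. D (z + c) \<noteq> 0 \<and> cmod z \<le> r})"
    using locally_finite_bounded[OF assms bounded_cball] finite_subset by blast
  then show "finite {z. D (z + c) \<noteq> 0 \<and> cmod z \<le> r}" by (rule finite_imageD) (simp add: inj_on_def)
qed

lemma dsum_shift: "dsum (\<lambda>z. D (z + c)) (ball w r) \<phi> = dsum D (ball (w + c) r) (\<lambda>a. \<phi> (a - c))"
  unfolding dsum_def
  by (rule sum.reindex_bij_witness[of _ "\<lambda>a. a - c" "\<lambda>a. a + c"]) (auto simp: dist_norm algebra_simps)

lemma dabs_shift: "dabs (\<lambda>z. D (z + c)) (cball w r) = dabs D (cball (w + c) r)"
  unfolding dabs_def
  by (rule sum.reindex_bij_witness[of _ "\<lambda>a. a - c" "\<lambda>a. a + c"]) (auto simp: dist_norm algebra_simps)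

lemma mer_order_shift: assumes "mer_order f (z + c) k" shows "mer_order (\<lambda>z. f (z + c)) z k"
proof -
  obtain r g where r: "r > 0" "g holomorphic_on ball (z + c) r" "g (z + c) \<noteq> 0"
      "\<forall>w\<in>ball (z + c) r - {z + c}. f w = Some ((w - (z + c)) powi k * g w)"
      "f (z + c) = (if k < 0 then None else Some ((z + c - (z + c)) ^ nat k * g (z + c)))"
    using assms unfolding mer_order_def by blast
  have "(g \<circ> (\<lambda>w. w + c)) holomorphic_on ball z r"
    by (rule holomorphic_on_compose_gen[OF _ r(2)]) (auto intro!: holomorphic_intros simp: dist_norm)
  then show ?thesis unfolding mer_order_def
    using r by (intro exI[of _ r] exI[of _ "\<lambda>w. g (w + c)"]) (auto simp: o_def dist_norm)
qed

lemma growth_shift: assumes "growth D f C" shows "growth (\<lambda>z. D (z + c)) (\<lambda>z. f (z + c)) C"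
  unfolding growth_def
proof (intro allI impI)
  fix z assume "D (z + c) = 0"
  then obtain w where "w \<noteq> 0" "f (z + c) = Some w" "\<bar>ln (cmod w) - dsum D (ball (z + c) 1) (\<lambda>a. ln (cmod (z + c - a)))\<bar> \<le> C"
    using assms unfolding growth_def by blast
  moreover have "dsum (\<lambda>z. D (z + c)) (ball z 1) (\<lambda>a. ln (cmod (z - a))) = dsum D (ball (z + c) 1) (\<lambda>a. ln (cmod (z + c - a)))"
    unfolding dsum_shift by (simp add: algebra_simps)
  ultimately show "\<exists>w. w \<noteq> 0 \<and> f (z + c) = Some w \<and> \<bar>ln (cmod w) - dsum (\<lambda>z. D (z + c)) (ball z 1) (\<lambda>a. ln (cmod (z - a)))\<bar> \<le> C"
    by metis
qed

section \<open>Moment bounds with inner radius 1\<close>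

lemma dabs_ball_2:
  assumes lf: "locally_finite D" and N: "\<And>c. dabs D (cball c 1) \<le> N"
  shows "dabs D (ball 0 2) \<le> 26 * N"
proof -
  let ?R = "{z. 1 \<le> cmod (z - 0) \<and> cmod (z - 0) \<le> 1 + 1}"
  have b: "bounded ?R" by (rule bounded_subset[of "cball 0 2"]) auto
  have "dabs D (ball 0 2) \<le> dabs D (cball 0 1 \<union> ?R)"
    by (rule dabs_mono[OF lf]) (use b in auto)
  also have "\<dots> \<le> dabs D (cball 0 1) + dabs D ?R" by (rule dabs_Un_le[OF lf bounded_cball b])
  also have "\<dots> \<le> N + 25 * N * 1" using N[of 0] ring_count[OF lf N, of 1 0] by (intro add_mono) auto
  finally show ?thesis by simp
qed

text \<open>Conditions (d) and (e) start at radius 1, the moment estimates at \<open>r0\<close>.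
  Only points with |a| < 2 notice the difference, at most 26 N of them, and each logarithm changes
  by at most ln 2 < 1.\<close>

lemma dsum_ln_radius_change:
  fixes \<psi> :: "complex \<Rightarrow> 'a::{real_normed_field}"
  assumes lf: "locally_finite D" and N: "\<And>c. dabs D (cball c 1) \<le> N"
    and r: "1 < r0" "r0 < 2" "r > 1" and \<psi>: "\<And>a. cmod a < 2 \<Longrightarrow> norm (\<psi> a) \<le> M"
  shows "r > r0 \<Longrightarrow> norm (dsum D (ball 0 r) (\<lambda>a. \<psi> a * of_real (ln (r / max 1 (cmod a)))) - dsum D (ball 0 r) (\<lambda>a. \<psi> a * of_real (ln (r / max r0 (cmod a))))) \<le> 26 * N * M"
    and "r \<le> r0 \<Longrightarrow> norm (dsum D (ball 0 r) (\<lambda>a. \<psi> a * of_real (ln (r / max 1 (cmod a))))) \<le> 26 * N * M"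
proof -
  have M: "M \<ge> 0" using order_trans[OF norm_ge_zero \<psi>[of 0]] by simp
  have ln2: "ln 2 \<le> (1::real)" using ln_2_less_1 by simp
  have b: "dabs D (ball 0 \<rho>) \<le> 26 * N" if "\<rho> \<le> 2" for \<rho>
    using dabs_mono[OF lf bounded_ball, of "ball 0 \<rho>" 0 2] dabs_ball_2[OF lf N] that by (simp add: subset_ball)
  show "norm (dsum D (ball 0 r) (\<lambda>a. \<psi> a * of_real (ln (r / max 1 (cmod a)))) - dsum D (ball 0 r) (\<lambda>a. \<psi> a * of_real (ln (r / max r0 (cmod a))))) \<le> 26 * N * M"
    if rr: "r > r0"
  proof -
    let ?g = "\<lambda>a. \<psi> a * of_real (ln (max r0 (cmod a) / max 1 (cmod a)))"
    have "dsum D (ball 0 r) (\<lambda>a. \<psi> a * of_real (ln (r / max 1 (cmod a)))) - dsum D (ball 0 r) (\<lambda>a. \<psi> a * of_real (ln (r / max r0 (cmod a))))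
       = dsum D (ball 0 r) ?g"
      unfolding dsum_sub[symmetric] right_diff_distrib[symmetric] of_real_diff[symmetric]
    proof (intro dsum_cong arg_cong2[where f = "(*)"] arg_cong[where f = of_real] refl)
      fix a :: complex
      have "max r0 (cmod a) \<noteq> 0" "max 1 (cmod a) \<noteq> 0" "r \<noteq> 0" using r by (auto simp: max_def)
      then show "ln (r / max 1 (cmod a)) - ln (r / max r0 (cmod a)) = ln (max r0 (cmod a) / max 1 (cmod a))"
        by (simp add: ln_div)
    qed
    also have "\<dots> = dsum D (ball 0 r0) ?g + dsum D (ball 0 r - ball 0 r0) ?g"
      by (rule dsum_diff[OF lf]) (use rr in auto)
    also have "dsum D (ball 0 r - ball 0 r0) ?g = dsum D (ball 0 r - ball 0 r0) (\<lambda>_. 0)"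
      using r by (intro dsum_cong) auto
    also have "dsum D (ball 0 r - ball 0 r0) (\<lambda>_. 0 :: 'a) = 0" by (simp add: dsum_def)
    also have "norm (dsum D (ball 0 r0) ?g + 0) \<le> dabs D (ball 0 r0) * (M * 1)"
      unfolding add_0_right
    proof (rule norm_dsum_le)
      fix a :: complex assume "a \<in> ball 0 r0"
      then have a: "cmod a < r0" "cmod a < 2" using r by auto
      have x: "1 \<le> max r0 (cmod a) / max 1 (cmod a)" "max r0 (cmod a) / max 1 (cmod a) \<le> 2"
        using a r by (auto simp: max_def divide_simps)
      have "ln (max r0 (cmod a) / max 1 (cmod a)) \<le> ln 2" using x by (subst ln_le_cancel_iff) auto
      moreover have "0 \<le> ln (max r0 (cmod a) / max 1 (cmod a))" using x(1) by (rule ln_ge_zero)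
      ultimately have "\<bar>ln (max r0 (cmod a) / max 1 (cmod a))\<bar> \<le> 1" using ln2 by linarith
      then show "norm (?g a) \<le> M * 1" using \<psi>[OF a(2)] M by (simp only: norm_mult norm_of_real) (intro mult_mono, auto)
    qed
    also have "\<dots> \<le> 26 * N * M" using b[of r0] r M by (simp add: mult_right_mono)
    finally show ?thesis .
  qed
  show "norm (dsum D (ball 0 r) (\<lambda>a. \<psi> a * of_real (ln (r / max 1 (cmod a))))) \<le> 26 * N * M" if rr: "r \<le> r0"
  proof -
    have "norm (dsum D (ball 0 r) (\<lambda>a. \<psi> a * of_real (ln (r / max 1 (cmod a))))) \<le> dabs D (ball 0 r) * (M * 1)"
    proof (rule norm_dsum_le)
      fix a :: complex assume "a \<in> ball 0 r"
      then have a: "cmod a < r" "cmod a < 2" using r rr by auto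
      have x: "1 \<le> r / max 1 (cmod a)" "r / max 1 (cmod a) \<le> 2"
        using a r rr by (auto simp: max_def divide_simps)
      have "ln (r / max 1 (cmod a)) \<le> ln 2" using x by (subst ln_le_cancel_iff) auto
      moreover have "0 \<le> ln (r / max 1 (cmod a))" using x(1) by (rule ln_ge_zero)
      ultimately have "\<bar>ln (r / max 1 (cmod a))\<bar> \<le> 1" using ln2 by linarith
      then show "norm (\<psi> a * of_real (ln (r / max 1 (cmod a)))) \<le> M * 1"
        using \<psi>[OF a(2)] M by (simp only: norm_mult norm_of_real) (intro mult_mono, auto)
    qed
    also have "\<dots> \<le> 26 * N * M" using b[of r] r rr M by (simp add: mult_right_mono)
    finally show ?thesis .
  qed
qed

lemma Jensen_estimate:
  assumes mo: "\<And>z. mer_order f z (D z)" and lf: "locally_finite D" and gr: "growth D f C"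
    and N: "\<And>c. dabs D (cball c 1) \<le> N" and r: "r > 1"
  shows "\<bar>dsum D (ball 0 r) (\<lambda>a. ln (r / max 1 (cmod a)))\<bar> \<le> 2 * (C + 102 * N) + 26 * N"
proof -
  obtain r0 where r0: "1 < r0" "r0 < 2"
    "\<And>r. r > r0 \<Longrightarrow> \<bar>dsum D (ball 0 r) (\<lambda>a. ln (r / max r0 (cmod a)))\<bar> \<le> 2 * (C + 102 * N)"
    using moment_estimates[OF mo lf gr N] by metis
  note ch = dsum_ln_radius_change[OF lf N r0(1,2) r, of "\<lambda>_. 1::real" 1, simplified]
  have nn: "2 * (C + 102 * N) \<ge> 0" using r0(3)[of 2] r0(2) by (meson abs_ge_zero order_trans)
  show ?thesis
  proof (cases "r > r0")
    case True
    have "\<bar>dsum D (ball 0 r) (\<lambda>a. ln (r / max 1 (cmod a))) - dsum D (ball 0 r) (\<lambda>a. ln (r / max r0 (cmod a)))\<bar> \<le> 26 * N"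
      using ch(1)[OF True] by simp
    then show ?thesis using r0(3)[OF True] by linarith
  next
    case False
    then show ?thesis using ch(2) nn by simp
  qed
qed

text \<open>The first Fourier coefficient controls a sum with kernel (1/m^2 - 1/r^2)/2, whereas (e)
  has the kernel ln (r/m). Integrating 2t times the former over t yields the latter up to r^2 times
  the former. The factor 7 collects B r, 2 B r and 4 B \<le> 4 B r.\<close>

lemma second_moment_estimate:
  assumes mo: "\<And>z. mer_order f z (D z)" and lf: "locally_finite D" and gr: "growth D f C"
    and N: "\<And>c. dabs D (cball c 1) \<le> N" and r: "r > 1"
  shows "cmod (dsum D (ball 0 r) (\<lambda>a. a * of_real (ln (r / max 1 (cmod a))))) \<le> (7 * (C + 102 * N) + 52 * N) * r"
proof -
  define B where "B = C + 102 * N"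
  obtain r0 where r0: "1 < r0" "r0 < 2" and q0: "\<exists>q. cmod q \<le> B \<and> (\<forall>r>r0.
       cmod (dsum D (ball 0 r) (\<lambda>a. cnj a ^ 1 * of_real (1 / max r0 (cmod a) ^ (2 * 1) - 1 / r ^ (2 * 1)) / (2 * of_nat 1)) + q) \<le> B / r ^ 1)"
  proof (rule moment_estimates[OF mo lf gr N], goal_cases)
    case (1 r0)
    show ?case using that[of r0] 1(2,3) 1(5)[of 1] unfolding B_def by simp
  qed
  define q1 where "q1 = (\<lambda>r. dsum D (ball 0 r) (\<lambda>a. cnj a * of_real ((1 / (max r0 (cmod a))\<^sup>2 - 1 / r\<^sup>2) / 2)))"
  obtain q where q: "cmod q \<le> B" "\<And>r. r > r0 \<Longrightarrow> cmod (q1 r + q) \<le> B / r"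
    using q0 unfolding q1_def by auto
  have B: "B \<ge> 0" using q(1) norm_ge_zero order_trans by blast
  have Npos: "N \<ge> 0" using N[of 0] dabs_nonneg order_trans by blast
  define A where "A = (\<lambda>r. dsum D (ball 0 r) (\<lambda>a. cnj a * of_real (ln (r / max r0 (cmod a)))))"
  have Ab: "cmod (A r) \<le> 7 * B * r" if r: "r > r0" for r
  proof -
    \<comment> \<open>A primitive of 2t times the kernel (1/m^2 - 1/t^2)/2, so that \<open>X\<close>
      is the integral of 2t \<open>q1 t\<close>.\<close>
    define H where "H = (\<lambda>a t. t\<^sup>2 / (2 * (max r0 (cmod a))\<^sup>2) - ln t)"
    define h where "h = (\<lambda>a t. t / (max r0 (cmod a))\<^sup>2 - 1 / t)"
    define X where "X = dsum D (ball 0 r) (\<lambda>a. cnj a * of_real (H a r - H a (max r0 (cmod (a - 0)))))"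
    have mpos: "max r0 (cmod a) > 0" for a using r0 by auto
    have "((\<lambda>t. dsum D (ball 0 t) (\<lambda>a. cnj a * of_real (h a t))) has_integral X) {r0..r}"
      unfolding X_def
    proof (rule dsum_has_integral[OF lf])
      fix a t assume "t \<ge> r0"
      then show "(H a has_real_derivative h a t) (at t)"
        unfolding H_def h_def using r0 mpos[of a] by (auto intro!: derivative_eq_intros simp: field_simps power2_eq_square)
    qed (use r0 r in auto)
    moreover have "dsum D (ball 0 t) (\<lambda>a. cnj a * of_real (h a t)) = of_real (2 * t) * q1 t" if "t \<in> {r0..r}" for t
    proof -
      have "cnj a * of_real (h a t) = of_real (2 * t) * (cnj a * of_real ((1 / (max r0 (cmod a))\<^sup>2 - 1 / t\<^sup>2) / 2))" for a
      proof -
        have "h a t = (2 * t) * ((1 / (max r0 (cmod a))\<^sup>2 - 1 / t\<^sup>2) / 2)"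
          using that r0 unfolding h_def by (simp add: right_diff_distrib power2_eq_square)
        then show ?thesis by (simp only: of_real_mult) (simp add: mult_ac)
      qed
      then show ?thesis unfolding q1_def dsum_cmult[symmetric] by (simp only:)
    qed
    ultimately have iX: "((\<lambda>t. of_real (2 * t) * q1 t) has_integral X) {r0..r}"
      by (rule has_integral_eq[rotated])
    have "((\<lambda>t. 2 * t) has_integral (r\<^sup>2 - r0\<^sup>2)) {r0..r}"
      by (rule fundamental_theorem_of_calculus)
        (use r in \<open>auto intro!: derivative_eq_intros simp: has_real_derivative_iff_has_vector_derivative[symmetric]\<close>)
    then have "((\<lambda>t. of_real (2 * t) * q) has_integral (of_real (r\<^sup>2 - r0\<^sup>2) * q)) {r0..r}"
      by (intro has_integral_mult_left has_integral_of_real)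
    from has_integral_add[OF iX this]
    have iY: "((\<lambda>t. of_real (2 * t) * (q1 t + q)) has_integral (X + of_real (r\<^sup>2 - r0\<^sup>2) * q)) {r0..r}"
      by (simp add: distrib_left)
    have Y: "cmod (X + of_real (r\<^sup>2 - r0\<^sup>2) * q) \<le> 2 * B * r"
    proof -
      have "cmod (X + of_real (r\<^sup>2 - r0\<^sup>2) * q) \<le> (2 * B) * measure lborel {r0..r}"
      proof (rule has_integral_bound_real[OF _ _ iY])
        show "finite {r0}" by simp
        fix t assume "t \<in> {r0..r} - {r0}"
        then have t: "t > r0" "t > 0" using r0 by auto
        have "cmod (of_real (2 * t) * (q1 t + q)) \<le> 2 * t * (B / t)"
          using q(2)[OF t(1)] t by (simp only: norm_mult norm_of_real) (intro mult_mono, auto)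
        then show "cmod (of_real (2 * t) * (q1 t + q)) \<le> 2 * B" using t by simp
      qed (use B in auto)
      also have "\<dots> \<le> 2 * B * r" using r r0 B by (intro mult_left_mono) auto
      finally show ?thesis .
    qed
    have "A r = of_real (r\<^sup>2) * q1 r - X"
      unfolding A_def q1_def X_def dsum_cmult[symmetric] dsum_sub[symmetric]
    proof (rule dsum_cong)
      fix a
      define m where "m = max r0 (cmod a)"
      have m: "m > 0" using mpos by (simp add: m_def)
      have rp: "r > 0" using r r0 by simp
      have "ln (r / m) = r\<^sup>2 * ((1 / m\<^sup>2 - 1 / r\<^sup>2) / 2) - ((r\<^sup>2 / (2 * m\<^sup>2) - ln r) - (m\<^sup>2 / (2 * m\<^sup>2) - ln m))"
        using m rp by (simp add: ln_div field_simps)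
      then have "ln (r / m) = r\<^sup>2 * ((1 / m\<^sup>2 - 1 / r\<^sup>2) / 2) - (H a r - H a m)"
        by (simp add: H_def m_def)
      then have "cnj a * of_real (ln (r / m)) = cnj a * (of_real (r\<^sup>2) * of_real ((1 / m\<^sup>2 - 1 / r\<^sup>2) / 2) - of_real (H a r - H a m))"
        by (simp only: of_real_diff of_real_mult)
      then show "cnj a * of_real (ln (r / max r0 (cmod a))) = of_real (r\<^sup>2) * (cnj a * of_real ((1 / (max r0 (cmod a))\<^sup>2 - 1 / r\<^sup>2) / 2))
          - cnj a * of_real (H a r - H a (max r0 (cmod (a - 0))))"
        unfolding m_def by (simp only: right_diff_distrib mult.left_commute diff_zero)
    qed
    \<comment> \<open>The unknown constant \<open>q\<close> may be inserted freely because r^2 -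
      (r^2 - r0^2) - r0^2 = 0; it replaces \<open>q1\<close> by \<open>q1 + q\<close>, which is
      small.\<close>
    then have "A r = of_real (r\<^sup>2) * (q1 r + q) - (X + of_real (r\<^sup>2 - r0\<^sup>2) * q) - of_real (r0\<^sup>2) * q"
      by (simp add: algebra_simps)
    then have "cmod (A r) \<le> cmod (of_real (r\<^sup>2) * (q1 r + q)) + cmod (X + of_real (r\<^sup>2 - r0\<^sup>2) * q) + cmod (of_real (r0\<^sup>2) * q)"
      by (simp only: norm_diff_diff_le)
    also have "cmod (of_real (r\<^sup>2) * (q1 r + q)) \<le> r\<^sup>2 * (B / r)"
      using q(2)[OF r] by (simp only: norm_mult norm_of_real) (intro mult_mono, auto)
    also have "r\<^sup>2 * (B / r) = B * r" using r r0 by (simp add: power2_eq_square)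
    also have "cmod (of_real (r0\<^sup>2) * q) \<le> 4 * B"
    proof -
      have "r0\<^sup>2 \<le> 2\<^sup>2" using r0 by (intro power_mono) auto
      then show ?thesis using q(1) B by (simp only: norm_mult norm_of_real) (intro mult_mono, auto)
    qed
    also have "B * r + cmod (X + of_real (r\<^sup>2 - r0\<^sup>2) * q) + 4 * B \<le> B * r + 2 * B * r + 4 * (B * r)"
      using Y r r0 B by (intro add_mono) (auto simp: mult_le_cancel_left1)
    finally show ?thesis by simp
  qed
  have b2: "cmod (cnj a) \<le> 2" if "cmod a < 2" for a using that by simp
  note ch = dsum_ln_radius_change[OF lf N r0 r, where \<psi> = cnj and M = 2, OF b2]
  \<comment> \<open>The Fourier coefficient involves cnj a and (e) involves a; since the weights are
    real, the sums are conjugate.\<close>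
  have e: "cmod (dsum D (ball 0 r) (\<lambda>a. a * of_real (ln (r / max 1 (cmod a))))) = cmod (dsum D (ball 0 r) (\<lambda>a. cnj a * of_real (ln (r / max 1 (cmod a)))))"
    by (subst complex_mod_cnj[symmetric], subst cnj_dsum) simp
  have N1: "52 * N \<le> 52 * N * r" using r Npos by (simp add: mult_le_cancel_left1)
  show ?thesis
  proof (cases "r > r0")
    case True
    have "cmod (dsum D (ball 0 r) (\<lambda>a. cnj a * of_real (ln (r / max 1 (cmod a)))) - A r) \<le> 26 * N * 2"
      using ch(1)[OF _ True] unfolding A_def by simp
    then have "cmod (dsum D (ball 0 r) (\<lambda>a. cnj a * of_real (ln (r / max 1 (cmod a))))) \<le> 52 * N + cmod (A r)"
      using norm_triangle_sub[of "dsum D (ball 0 r) (\<lambda>a. cnj a * of_real (ln (r / max 1 (cmod a))))" "A r"] by simp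
    then show ?thesis using Ab[OF True] N1 unfolding e by (simp add: B_def algebra_simps)
  next
    case False
    then have "cmod (dsum D (ball 0 r) (\<lambda>a. cnj a * of_real (ln (r / max 1 (cmod a))))) \<le> 52 * N" using ch(2) by simp
    moreover have "0 \<le> 7 * B * r" using B r by simp
    ultimately show ?thesis using N1 unfolding e by (simp add: B_def algebra_simps)
  qed
qed


section \<open>The integrals in (d) and (e) as divisor sums\<close>

lemma condD_integral:
  assumes lf: "locally_finite D" and r: "r > 1"
  shows "((\<lambda>t. (of_int (zcount D (ball c t)) - of_int (pcount D (ball c t))) / t) has_integral
     dsum D (ball c r) (\<lambda>a. ln (r / max 1 (cmod (a - c))))) {1..r}"
proof -
  have "((\<lambda>t. dsum D (ball c t) (\<lambda>a. (\<lambda>_. 1::real) a * of_real ((\<lambda>_ t. 1 / t) a t))) has_integral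
     dsum D (ball c r) (\<lambda>a. (\<lambda>_. 1) a * of_real ((\<lambda>_. ln) a r - (\<lambda>_. ln) a (max 1 (cmod (a - c)))))) {1..r}"
    by (rule dsum_has_integral[OF lf]) (use r in \<open>auto intro!: derivative_eq_intros\<close>)
  moreover have "dsum D (ball c r) (\<lambda>a. (\<lambda>_. 1) a * of_real ((\<lambda>_. ln) a r - (\<lambda>_. ln) a (max 1 (cmod (a - c)))))
     = dsum D (ball c r) (\<lambda>a. ln (r / max 1 (cmod (a - c))))"
    using r by (intro dsum_cong) (auto simp: ln_div max_def)
  moreover have "dsum D (ball c t) (\<lambda>a. (\<lambda>_. 1::real) a * of_real ((\<lambda>_ t. 1 / t) a t))
     = (of_int (zcount D (ball c t)) - of_int (pcount D (ball c t))) / t" for t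
  proof -
    have "dsum D (ball c t) (\<lambda>a. 1 / t) = 1 / t * dsum D (ball c t) (\<lambda>_. 1)"
      using dsum_cmult[of D "ball c t" "1 / t" "\<lambda>_. 1"] by simp
    then show ?thesis using zcount_minus_pcount[OF lf bounded_ball, of c t] by simp
  qed
  ultimately show ?thesis by simp
qed

lemma condE_integral:
  assumes lf: "locally_finite D" and r: "r > 1"
  shows "((\<lambda>t. (1 / t) *\<^sub>R (zsum D (ball c t) (\<lambda>z. z - c) - psum D (ball c t) (\<lambda>z. z - c))) has_integral
     dsum D (ball c r) (\<lambda>a. (a - c) * of_real (ln (r / max 1 (cmod (a - c)))))) {1..r}"
proof -
  have "((\<lambda>t. dsum D (ball c t) (\<lambda>a. (a - c) * of_real ((\<lambda>_ t. 1 / t) a t))) has_integral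
     dsum D (ball c r) (\<lambda>a. (a - c) * of_real ((\<lambda>_. ln) a r - (\<lambda>_. ln) a (max 1 (cmod (a - c)))))) {1..r}"
    by (rule dsum_has_integral[OF lf]) (use r in \<open>auto intro!: derivative_eq_intros\<close>)
  moreover have "dsum D (ball c r) (\<lambda>a. (a - c) * of_real ((\<lambda>_. ln) a r - (\<lambda>_. ln) a (max 1 (cmod (a - c)))))
     = dsum D (ball c r) (\<lambda>a. (a - c) * of_real (ln (r / max 1 (cmod (a - c)))))"
    using r by (intro dsum_cong) (auto simp: ln_div max_def)
  moreover have "dsum D (ball c t) (\<lambda>a. (a - c) * of_real ((\<lambda>_ t. 1 / t) a t))
     = (1 / t) *\<^sub>R (zsum D (ball c t) (\<lambda>z. z - c) - psum D (ball c t) (\<lambda>z. z - c))" for t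
  proof -
    have "dsum D (ball c t) (\<lambda>a. (a - c) * of_real (1 / t)) = of_real (1 / t) * dsum D (ball c t) (\<lambda>a. a - c)"
      using dsum_cmult[of D "ball c t" "of_real (1 / t)" "\<lambda>a. a - c"] by (simp add: mult.commute)
    then show ?thesis using zsum_minus_psum[OF lf bounded_ball, of c t "\<lambda>z. z - c"] by (simp add: scaleR_conv_of_real)
  qed
  ultimately show ?thesis by simp
qed

lemma Jensen_estimate_at:
  assumes mo: "\<And>z. mer_order f z (D z)" and lf: "locally_finite D" and gr: "growth D f C"
    and N: "\<And>c. dabs D (cball c 1) \<le> N" and r: "r > 1"
  shows "\<bar>dsum D (ball c r) (\<lambda>a. ln (r / max 1 (cmod (a - c))))\<bar> \<le> 2 * (C + 102 * N) + 26 * N"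
proof -
  have "\<bar>dsum (\<lambda>z. D (z + c)) (ball 0 r) (\<lambda>a. ln (r / max 1 (cmod a)))\<bar> \<le> 2 * (C + 102 * N) + 26 * N"
    by (rule Jensen_estimate[OF mer_order_shift[OF mo] locally_finite_shift[OF lf] growth_shift[OF gr] _ r])
      (use N dabs_shift[of D c] in auto)
  then show ?thesis by (simp add: dsum_shift)
qed

lemma necessity_condD:
  assumes mo: "\<And>z. mer_order f z (D z)" and lf: "locally_finite D" and gr: "growth D f C"
    and N: "\<And>c. dabs D (cball c 1) \<le> N"
  shows "condD D"
  unfolding condD_def
proof (intro exI[of _ "2 * (C + 102 * N) + 26 * N + 1"] allI impI)
  fix c :: complex and r :: real assume r: "r > 1"
  have "\<bar>integral {1..r} (\<lambda>t. (of_int (zcount D (ball c t)) - of_int (pcount D (ball c t))) / t)\<bar>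
     = \<bar>dsum D (ball c r) (\<lambda>a. ln (r / max 1 (cmod (a - c))))\<bar>"
    using integral_unique[OF condD_integral[OF lf r]] by simp
  then show "\<bar>integral {1..r} (\<lambda>t. (of_int (zcount D (ball c t)) - of_int (pcount D (ball c t))) / t)\<bar> < 2 * (C + 102 * N) + 26 * N + 1"
    using Jensen_estimate_at[OF mo lf gr N r, of c] by linarith
qed

lemma necessity_condE:
  assumes mo: "\<And>z. mer_order f z (D z)" and lf: "locally_finite D" and gr: "growth D f C"
    and N: "\<And>c. dabs D (cball c 1) \<le> N"
  shows "condE D"
  unfolding condE_def
proof (intro exI[of _ "7 * (C + 102 * N) + 52 * N + 1"] allI impI)
  fix c :: complex and r :: real assume r: "r > 1"
  let ?I = "dsum D (ball c r) (\<lambda>a. (a - c) * of_real (ln (r / max 1 (cmod (a - c)))))"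
  have "cmod (dsum (\<lambda>z. D (z + c)) (ball 0 r) (\<lambda>a. a * of_real (ln (r / max 1 (cmod a))))) \<le> (7 * (C + 102 * N) + 52 * N) * r"
    by (rule second_moment_estimate[OF mer_order_shift[OF mo] locally_finite_shift[OF lf] growth_shift[OF gr] _ r])
      (use N dabs_shift[of D c] in auto)
  then have "cmod ?I \<le> (7 * (C + 102 * N) + 52 * N) * r" by (simp add: dsum_shift)
  then have "cmod ((1 / r) *\<^sub>R ?I) \<le> 7 * (C + 102 * N) + 52 * N"
    using r by (simp add: divide_le_eq)
  then show "cmod ((1 / r) *\<^sub>R integral {1..r} (\<lambda>t. (1 / t) *\<^sub>R (zsum D (ball c t) (\<lambda>z. z - c) - psum D (ball c t) (\<lambda>z. z - c)))) < 7 * (C + 102 * N) + 52 * N + 1"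
    unfolding integral_unique[OF condE_integral[OF lf r]] by linarith
qed

text \<open>The moment estimate controls the averages \<open>W(r) = r\<^sup>-\<^sup>4 \<integral>\<^sub>0\<^sup>r 4 t\<^sup>3 T(t) dt\<close> of the partial sums \<open>T\<close>;
  comparing \<open>W(r + 1)\<close> with \<open>W(r)\<close> and using that a ring of width 1 carries only \<open>O(r)\<close> points recovers \<open>T\<close> itself.\<close>
lemma necessity_condF:
  assumes mo: "\<And>z. mer_order f z (D z)" and lf: "locally_finite D" and gr: "growth D f C"
    and N: "\<And>c. dabs D (cball c 1) \<le> N"
  shows "condF D"
proof -
  define B where "B = C + 102 * N"
  obtain r0 q where r0: "1 < r0" "r0 < 2" and q0: "cmod q \<le> B" "\<forall>r>r0.
       cmod (dsum D (ball 0 r) (\<lambda>a. cnj a ^ 2 * of_real (1 / max r0 (cmod a) ^ (2 * 2) - 1 / r ^ (2 * 2)) / (2 * of_nat 2)) + q) \<le> B / r ^ 2"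
  proof (rule moment_estimates[OF mo lf gr N], goal_cases)
    case (1 r0)
    show ?case using that[of r0] 1(2,3) 1(5)[of 2] unfolding B_def by auto
  qed
  have B: "B \<ge> 0" using q0(1) norm_ge_zero order_trans by blast
  have Npos: "N \<ge> 0" using N[of 0] dabs_nonneg order_trans by blast
  define m where "m = (\<lambda>a. max r0 (cmod a))"
  have m: "m a > 0" for a using r0 by (auto simp: m_def)
  define W where "W = (\<lambda>r. dsum D (ball 0 r) (\<lambda>a. cnj a ^ 2 * of_real (1 / m a ^ 4 - 1 / r ^ 4)))"
  define T where "T = (\<lambda>r. dsum D (ball 0 r) (\<lambda>a. cnj a ^ 2 * of_real (1 / m a ^ 4)))"
  have W: "cmod (W r + 4 * q) \<le> 4 * B / r\<^sup>2" if "r > r0" for r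
  proof -
    have "W r = 4 * dsum D (ball 0 r) (\<lambda>a. cnj a ^ 2 * of_real (1 / max r0 (cmod a) ^ (2 * 2) - 1 / r ^ (2 * 2)) / (2 * of_nat 2))"
      unfolding dsum_cmult[symmetric] W_def m_def by (rule dsum_cong) simp
    then have "W r + 4 * q = 4 * (dsum D (ball 0 r) (\<lambda>a. cnj a ^ 2 * of_real (1 / max r0 (cmod a) ^ (2 * 2) - 1 / r ^ (2 * 2)) / (2 * of_nat 2)) + q)"
      by (simp add: distrib_left)
    then have "cmod (W r + 4 * q) = 4 * cmod (dsum D (ball 0 r) (\<lambda>a. cnj a ^ 2 * of_real (1 / max r0 (cmod a) ^ (2 * 2) - 1 / r ^ (2 * 2)) / (2 * of_nat 2)) + q)"
      by (simp only: norm_mult) simp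
    also have "\<dots> \<le> 4 * (B / r\<^sup>2)" using q0(2) that by (intro mult_left_mono) auto
    finally show ?thesis by simp
  qed
  have T: "cmod (T r + 4 * q) \<le> (5 * B + 100 * N) / r" if r: "r > 2" for r
  proof -
    \<comment> \<open>Since r^4 \<open>W r\<close> is linear in r^4 for a fixed set of points, its
      increment from r to r + 1 is \<Delta> \<open>T r\<close> plus the contribution
      \<open>R\<close> of the new points. The two terms with \<open>W\<close> are O(r^2) against
      \<Delta> \<ge> 4r^3, and \<open>R\<close> is O(\<Delta>/r).\<close>
    define \<Delta> where "\<Delta> = (r + 1) ^ 4 - r ^ 4"
    have \<Delta>eq: "\<Delta> = 4 * r ^ 3 + 6 * r ^ 2 + 4 * r + 1" by (simp add: \<Delta>_def power4_eq_xxxx power3_eq_cube power2_eq_square algebra_simps)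
    have \<Delta>: "\<Delta> \<ge> 4 * r ^ 3" unfolding \<Delta>eq using r by simp
    have r3: "r ^ 3 > 0" using r by simp
    then have \<Delta>pos: "\<Delta> > 0" using \<Delta> by linarith
    define R where "R = dsum D (ball 0 (r + 1) - ball 0 r) (\<lambda>a. cnj a ^ 2 * of_real ((r + 1) ^ 4 / m a ^ 4 - 1))"
    have e1: "of_real ((r + 1) ^ 4) * W (r + 1) = dsum D (ball 0 (r + 1)) (\<lambda>a. cnj a ^ 2 * of_real ((r + 1) ^ 4 / m a ^ 4 - 1))"
    proof -
      have "(r + 1) ^ 4 * (1 / m a ^ 4 - 1 / (r + 1) ^ 4) = (r + 1) ^ 4 / m a ^ 4 - 1" for a
        using r by (simp add: right_diff_distrib)
      then have "of_real ((r + 1) ^ 4) * (cnj a ^ 2 * of_real (1 / m a ^ 4 - 1 / (r + 1) ^ 4)) = cnj a ^ 2 * of_real ((r + 1) ^ 4 / m a ^ 4 - 1)" for a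
        by (metis (no_types, lifting) mult.left_commute of_real_mult)
      then show ?thesis unfolding W_def dsum_cmult[symmetric] by (simp only:)
    qed
    have e2: "of_real (r ^ 4) * W r = dsum D (ball 0 r) (\<lambda>a. cnj a ^ 2 * of_real (r ^ 4 / m a ^ 4 - 1))"
    proof -
      have "r ^ 4 * (1 / m a ^ 4 - 1 / r ^ 4) = r ^ 4 / m a ^ 4 - 1" for a
        using r by (simp add: right_diff_distrib)
      then have "of_real (r ^ 4) * (cnj a ^ 2 * of_real (1 / m a ^ 4 - 1 / r ^ 4)) = cnj a ^ 2 * of_real (r ^ 4 / m a ^ 4 - 1)" for a
        by (metis (no_types, lifting) mult.left_commute of_real_mult)
      then show ?thesis unfolding W_def dsum_cmult[symmetric] by (simp only:)
    qed
    have e3: "of_real ((r + 1) ^ 4) * W (r + 1) = dsum D (ball 0 r) (\<lambda>a. cnj a ^ 2 * of_real ((r + 1) ^ 4 / m a ^ 4 - 1)) + R"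
      unfolding e1 R_def by (rule dsum_diff[OF lf]) auto
    have "dsum D (ball 0 r) (\<lambda>a. cnj a ^ 2 * of_real ((r + 1) ^ 4 / m a ^ 4 - 1)) - dsum D (ball 0 r) (\<lambda>a. cnj a ^ 2 * of_real (r ^ 4 / m a ^ 4 - 1))
       = of_real \<Delta> * T r"
      unfolding T_def dsum_cmult[symmetric] dsum_sub[symmetric]
    proof (rule dsum_cong)
      fix a
      have "((r + 1) ^ 4 / m a ^ 4 - 1) - (r ^ 4 / m a ^ 4 - 1) = \<Delta> * (1 / m a ^ 4)"
        by (simp add: \<Delta>_def diff_divide_distrib)
      then show "cnj a ^ 2 * of_real ((r + 1) ^ 4 / m a ^ 4 - 1) - cnj a ^ 2 * of_real (r ^ 4 / m a ^ 4 - 1) = of_real \<Delta> * (cnj a ^ 2 * of_real (1 / m a ^ 4))"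
        by (metis (no_types, lifting) mult.left_commute of_real_mult of_real_diff right_diff_distrib)
    qed
    then have "of_real \<Delta> * (T r + 4 * q) = of_real ((r + 1) ^ 4) * (W (r + 1) + 4 * q) - of_real (r ^ 4) * (W r + 4 * q) - R"
      using e2 e3 by (simp add: \<Delta>_def algebra_simps)
    then have "\<Delta> * cmod (T r + 4 * q) = cmod (of_real ((r + 1) ^ 4) * (W (r + 1) + 4 * q) - of_real (r ^ 4) * (W r + 4 * q) - R)"
      using \<Delta>pos by (metis norm_mult norm_of_real abs_of_pos)
    also have "\<dots> \<le> cmod (of_real ((r + 1) ^ 4) * (W (r + 1) + 4 * q)) + cmod (of_real (r ^ 4) * (W r + 4 * q)) + cmod R"
      by (rule norm_diff_diff_le)
    also have "cmod (of_real ((r + 1) ^ 4) * (W (r + 1) + 4 * q)) \<le> 16 * B * r\<^sup>2"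
    proof -
      have "cmod (of_real ((r + 1) ^ 4) * (W (r + 1) + 4 * q)) \<le> (r + 1) ^ 4 * (4 * B / (r + 1)\<^sup>2)"
        using W[of "r + 1"] r r0 by (simp only: norm_mult norm_of_real) (intro mult_mono, auto)
      also have "\<dots> = 4 * B * (r + 1)\<^sup>2" using r by (simp add: power4_eq_xxxx power2_eq_square)
      also have "\<dots> \<le> 4 * B * (2 * r)\<^sup>2" using r B by (intro mult_left_mono power_mono) auto
      finally show ?thesis by (simp add: power_mult_distrib)
    qed
    also have "cmod (of_real (r ^ 4) * (W r + 4 * q)) \<le> 4 * B * r\<^sup>2"
    proof -
      have "cmod (of_real (r ^ 4) * (W r + 4 * q)) \<le> r ^ 4 * (4 * B / r\<^sup>2)"
        using W[of r] r r0 by (simp only: norm_mult norm_of_real) (intro mult_mono, auto)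
      also have "\<dots> = 4 * B * r\<^sup>2" using r by (simp add: power4_eq_xxxx power2_eq_square)
      finally show ?thesis .
    qed
    also have "cmod R \<le> 100 * N * \<Delta> / r"
    proof -
      \<comment> \<open>New points have r \<le> |a| < r + 1, so the bracket is at most \<Delta>/r^4.
        Together with |a|^2 \<le> 4r^2 and 25 N r points this gives 100 N \<Delta>/r.\<close>
      have "cmod R \<le> dabs D (ball 0 (r + 1) - ball 0 r) * ((2 * r)\<^sup>2 * (\<Delta> / r ^ 4))"
        unfolding R_def
      proof (rule norm_dsum_le)
        fix a :: complex assume "a \<in> ball 0 (r + 1) - ball 0 r"
        then have a: "r \<le> cmod a" "cmod a < r + 1" by auto
        then have ma: "m a = cmod a" using r r0 by (simp add: m_def)
        have ca: "cmod a > 0" using a r by linarith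
        have r4: "r ^ 4 \<le> cmod a ^ 4" "cmod a ^ 4 \<le> (r + 1) ^ 4" using a r by (auto intro!: power_mono)
        have "(r + 1) ^ 4 / m a ^ 4 - 1 = ((r + 1) ^ 4 - cmod a ^ 4) / cmod a ^ 4" using ca by (simp add: ma diff_divide_distrib)
        moreover have "\<dots> \<le> \<Delta> / r ^ 4" unfolding \<Delta>_def using r4 r by (intro frac_le) auto
        moreover have "0 \<le> ((r + 1) ^ 4 - cmod a ^ 4) / cmod a ^ 4" using r4 by simp
        ultimately have "\<bar>(r + 1) ^ 4 / m a ^ 4 - 1\<bar> \<le> \<Delta> / r ^ 4" by linarith
        moreover have "(cmod a)\<^sup>2 \<le> (2 * r)\<^sup>2" using a r by (intro power_mono) auto
        ultimately show "cmod (cnj a ^ 2 * of_real ((r + 1) ^ 4 / m a ^ 4 - 1)) \<le> (2 * r)\<^sup>2 * (\<Delta> / r ^ 4)"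
          by (simp only: norm_mult norm_of_real norm_power complex_mod_cnj) (intro mult_mono, auto)
      qed
      also have "\<dots> \<le> (25 * N * r) * ((2 * r)\<^sup>2 * (\<Delta> / r ^ 4))"
      proof (intro mult_right_mono)
        show "dabs D (ball 0 (r + 1) - ball 0 r) \<le> 25 * N * r" using r by (intro unit_annulus_count[OF lf N]) auto
      qed (use r \<Delta>pos in auto)
      also have "\<dots> = 100 * N * \<Delta> / r" using r by (simp add: power2_eq_square power4_eq_xxxx)
      finally show ?thesis .
    qed
    finally have "\<Delta> * cmod (T r + 4 * q) \<le> 20 * B * r\<^sup>2 + 100 * N * \<Delta> / r" by simp
    then have "cmod (T r + 4 * q) \<le> (20 * B * r\<^sup>2 + 100 * N * \<Delta> / r) / \<Delta>"
      using \<Delta>pos by (simp add: pos_le_divide_eq mult.commute)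
    also have "\<dots> = 20 * B * r\<^sup>2 / \<Delta> + 100 * N / r" using \<Delta>pos by (simp add: add_divide_distrib)
    also have "20 * B * r\<^sup>2 / \<Delta> \<le> 20 * B * r\<^sup>2 / (4 * r ^ 3)"
      using \<Delta> r3 \<Delta>pos B by (intro divide_left_mono) auto
    also have "20 * B * r\<^sup>2 / (4 * r ^ 3) = 5 * B / r" using r by (simp add: power2_eq_square power3_eq_cube)
    finally show ?thesis by (simp add: add_divide_distrib)
  qed
  have lim0: "((\<lambda>r. (5 * B + 100 * N) / r) \<longlongrightarrow> 0) at_top"
    by (rule tendsto_divide_0[OF tendsto_const filterlim_at_top_imp_at_infinity[OF filterlim_ident]])
  have "((\<lambda>r. T r + 4 * q) \<longlongrightarrow> 0) at_top"
    by (rule Lim_null_comparison[OF _ lim0]) (use T in \<open>auto intro!: eventually_mono[OF eventually_gt_at_top[of 2]]\<close>)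
  then have Tlim: "(T \<longlongrightarrow> - (4 * q)) at_top"
    using tendsto_add[of "\<lambda>r. T r + 4 * q" 0 at_top "\<lambda>_. - (4 * q)"] by simp
  let ?S = "\<lambda>r. {z. 1 \<le> cmod z \<and> cmod z < r}"
  have bS: "bounded (?S r)" for r by (rule bounded_subset[of "ball 0 r"]) auto
  \<comment> \<open>\<open>K\<close> absorbs the points with |a| < 2, where \<open>m a\<close> may
    differ from |a|; beyond them cnj a^2 / |a|^4 is 1/a^2.\<close>
  define K where "K = dsum D (?S 2) (\<lambda>z. 1 / z\<^sup>2) - T 2"
  have Keq: "zsum D (?S r) (\<lambda>z. 1 / z\<^sup>2) - psum D (?S r) (\<lambda>z. 1 / z\<^sup>2) = T r + K" if r: "r \<ge> 2" for r
  proof -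
    have "zsum D (?S r) (\<lambda>z. 1 / z\<^sup>2) - psum D (?S r) (\<lambda>z. 1 / z\<^sup>2) = dsum D (?S r) (\<lambda>z. 1 / z\<^sup>2)"
      by (rule zsum_minus_psum[OF lf bS])
    also have "\<dots> = dsum D (?S 2) (\<lambda>z. 1 / z\<^sup>2) + dsum D (?S r - ?S 2) (\<lambda>z. 1 / z\<^sup>2)"
      by (rule dsum_diff[OF lf bS]) (use r in auto)
    also have "?S r - ?S 2 = ball 0 r - ball 0 2" by auto
    also have "dsum D (ball 0 r - ball 0 2) (\<lambda>z. 1 / z\<^sup>2) = dsum D (ball 0 r - ball 0 2) (\<lambda>a. cnj a ^ 2 * of_real (1 / m a ^ 4))"
    proof (rule dsum_cong)
      fix a :: complex assume "a \<in> ball 0 r - ball 0 2"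
      then have a: "m a = cmod a" "a \<noteq> 0" using r0 by (auto simp: m_def)
      have "cnj a ^ 2 * of_real (1 / m a ^ 4) = cnj a ^ 2 / (of_real ((cmod a)\<^sup>2))\<^sup>2"
        by (simp add: a power4_eq_xxxx power2_eq_square)
      also have "\<dots> = 1 / a\<^sup>2" unfolding complex_norm_square using a by (simp add: power_mult_distrib)
      finally show "1 / a\<^sup>2 = cnj a ^ 2 * of_real (1 / m a ^ 4)" by simp
    qed
    also have "\<dots> = T r - T 2" unfolding T_def
      using dsum_diff[OF lf bounded_ball, of "ball 0 2" 0 r "\<lambda>a. cnj a ^ 2 * of_real (1 / m a ^ 4)"] r by (simp add: subset_ball)
    finally show ?thesis by (simp add: K_def)
  qed
  have "((\<lambda>r. T r + K) \<longlongrightarrow> - (4 * q) + K) at_top" by (intro tendsto_add Tlim tendsto_const)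
  then have "((\<lambda>r. zsum D (?S r) (\<lambda>z. 1 / z\<^sup>2) - psum D (?S r) (\<lambda>z. 1 / z\<^sup>2)) \<longlongrightarrow> - (4 * q) + K) at_top"
  proof (rule filterlim_cong[THEN iffD1, OF refl refl, rotated])
    show "\<forall>\<^sub>F r in at_top. T r + K = zsum D (?S r) (\<lambda>z. 1 / z\<^sup>2) - psum D (?S r) (\<lambda>z. 1 / z\<^sup>2)"
      using eventually_ge_at_top[of 2] by eventually_elim (simp add: Keq)
  qed
  then show ?thesis unfolding condF_def by blast
qed

text \<open>Cauchy's estimate for the derivative. With \<rho> fixed it gives equicontinuity on small
  discs; with \<rho> growing it becomes Liouville's argument.\<close>

lemma bounded_holomorphic_Lipschitz:
  assumes h: "h holomorphic_on ball c R" "\<And>z. z \<in> ball c R \<Longrightarrow> cmod (h z) \<le> M"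
    and \<rho>: "\<rho> > 0" "2 * \<rho> < R" and z: "cmod (z - c) \<le> \<rho>"
  shows "cmod (h z - h c) \<le> M / \<rho> * cmod (z - c)"
proof (rule field_differentiable_bound[of "cball c \<rho>" h "deriv h"])
  fix x assume x: "x \<in> cball c \<rho>"
  have "x \<in> ball c R" using x \<rho> by simp
  then show "(h has_field_derivative deriv h x) (at x within cball c \<rho>)"
    using h(1) holomorphic_derivI[of h "ball c R" x] by (simp add: has_field_derivative_at_within)
  have sub: "cball x \<rho> \<subseteq> ball c R"
  proof
    fix y assume "y \<in> cball x \<rho>"
    then show "y \<in> ball c R" using x \<rho> dist_triangle[of c y x] by simp
  qed
  have "cmod ((deriv ^^ 1) h x) \<le> fact 1 * M / \<rho> ^ 1"
  proof (rule Cauchy_inequality)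
    show "h holomorphic_on ball x \<rho>" using h(1) sub ball_subset_cball by (meson holomorphic_on_subset order_trans)
    show "continuous_on (cball x \<rho>) h" using holomorphic_on_imp_continuous_on[OF h(1)] sub continuous_on_subset by blast
    fix y assume "cmod (x - y) = \<rho>"
    then have "y \<in> ball c R" using sub by (auto simp: dist_norm)
    then show "cmod (h y) \<le> M" by (rule h(2))
  qed (use \<rho> in auto)
  then show "cmod (deriv h x) \<le> M / \<rho>" by simp
qed (use z \<rho> in \<open>auto simp: dist_norm norm_minus_commute\<close>)

text \<open>A pole in the middle of a large disc without zeros would make the Jensen sum very
  negative. Discs without zeros therefore contain large discs without any divisor; there
  \<open>f\<close> is bounded, and the translates flatten out to a constant. Inversion gives the
  same for poles.\<close>

lemma zeros_relatively_dense:
  assumes N1: "N1 f" and mo: "\<And>z. mer_order f z (D z)" and lf: "locally_finite D" and gr: "growth D f C"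
    and N: "\<And>c. dabs D (cball c 1) \<le> N"
  obtains R where "\<And>c. \<exists>a\<in>ball c R. D a > 0"
proof -
  have "\<exists>R. \<forall>c. \<exists>a\<in>ball c R. D a > 0"
  proof (rule ccontr)
    assume neg: "\<not> ?thesis"
    define J where "J = 2 * (C + 102 * N) + 26 * N"
    \<comment> \<open>Makes ln r1 exceed |J|: a single pole at the centre already breaks the Jensen
      bound.\<close>
    define r1 where "r1 = exp (\<bar>J\<bar> + 1)"
    have r1: "r1 > 1" by (simp add: r1_def)
    have nopole: "\<not> D b < 0" if no: "\<And>a. a \<in> ball b r1 \<Longrightarrow> \<not> D a > 0" for b
    proof
      assume b: "D b < 0"
      have fin: "finite {a\<in>ball b r1. D a \<noteq> 0}" by (rule locally_finite_bounded[OF lf bounded_ball])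
      have "dsum D (ball b r1) (\<lambda>a. ln (r1 / max 1 (cmod (a - b)))) \<le> (\<Sum>a\<in>{b}. of_int (D a) * ln (r1 / max 1 (cmod (a - b))))"
      proof -
        have "(\<Sum>a\<in>{b}. of_int (- D a) * ln (r1 / max 1 (cmod (a - b)))) \<le> (\<Sum>a\<in>{a\<in>ball b r1. D a \<noteq> 0}. of_int (- D a) * ln (r1 / max 1 (cmod (a - b))))"
        proof (rule sum_mono2[OF fin])
          show "{b} \<subseteq> {a \<in> ball b r1. D a \<noteq> 0}" using b r1 by auto
          fix a assume a: "a \<in> {a \<in> ball b r1. D a \<noteq> 0} - {b}"
          then have "D a \<le> 0" using no by force
          moreover have "ln (r1 / max 1 (cmod (a - b))) \<ge> 0"
            using a r1 by (auto simp: max_def dist_norm norm_minus_commute divide_simps)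
          ultimately show "0 \<le> of_int (- D a) * ln (r1 / max 1 (cmod (a - b)))" by (intro mult_nonneg_nonneg) auto
        qed
        then show ?thesis by (simp add: dsum_def sum_negf)
      qed
      also have "\<dots> = of_int (D b) * ln r1" by simp
      also have "\<dots> \<le> -1 * ln r1" using b r1 by (intro mult_right_mono) auto
      also have "\<dots> = - (\<bar>J\<bar> + 1)" by (simp add: r1_def)
      finally have "dsum D (ball b r1) (\<lambda>a. ln (r1 / max 1 (cmod (a - b)))) < - J" by linarith
      then show False using Jensen_estimate_at[OF mo lf gr N r1, of b] unfolding J_def by linarith
    qed
    have "\<forall>n::nat. \<exists>c. \<forall>a\<in>ball c (real n). \<not> D a > 0" using neg by blast
    then obtain c where c: "\<And>n a. a \<in> ball (c n) (real n) \<Longrightarrow> \<not> D a > 0" by metis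
    have D0: "D a = 0" if "dist (c n) a < real n - r1" for a n
    proof -
      have "\<not> D a > 0" using that r1 by (intro c[of a n]) auto
      moreover have "\<not> D a < 0"
      proof (rule nopole)
        fix x assume "x \<in> ball a r1"
        then show "\<not> D x > 0" using that dist_triangle[of "c n" x a] by (intro c[of x n]) auto
      qed
      ultimately show ?thesis by simp
    qed
    have fb: "f z \<noteq> None \<and> cmod (the (f z)) \<le> exp C" if "dist (c n) z < real n - r1 - 1" for z n
    proof -
      have "D z = 0" using that by (intro D0[of n]) auto
      then obtain w where w: "w \<noteq> 0" "f z = Some w" "\<bar>ln (cmod w) - dsum D (ball z 1) (\<lambda>a. ln (cmod (z - a)))\<bar> \<le> C"
        using gr unfolding growth_def by blast
      have "dsum D (ball z 1) (\<lambda>a. ln (cmod (z - a))) = 0"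
      proof -
        have "D a = 0" if "a \<in> ball z 1" for a
          using that \<open>dist (c n) z < real n - r1 - 1\<close> dist_triangle[of "c n" a z] by (intro D0[of n]) auto
        then show ?thesis by (auto simp: dsum_def intro!: sum.neutral)
      qed
      then have "ln (cmod w) \<le> C" using w(3) by linarith
      then have "cmod w \<le> exp C" using w(1) by (metis exp_le_cancel_iff exp_ln zero_less_norm_iff)
      then show ?thesis using w(2) by simp
    qed
    define h where "h = (\<lambda>n z. the (f (z + c n)))"
    have hb: "f (z + c n) = Some (h n z) \<and> cmod (h n z) \<le> exp C" if "cmod z < real n - r1 - 1" for z n
      using fb[of n "z + c n"] that by (auto simp: h_def dist_norm)
    have holh: "h n holomorphic_on ball 0 (real n - r1 - 1)" for n
    proof -
      have "f (z + c n) \<noteq> None" if "z \<in> ball 0 (real n - r1 - 1)" for z using hb[of z n] that by auto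
      then show ?thesis unfolding h_def
        by (intro holomorphic_the[where D = "\<lambda>z. D (z + c n)"] mer_order_shift mo) auto
    qed
    \<comment> \<open>The Lipschitz constant exp C / \<rho> tends to 0 because the discs, and with
      them the admissible \<rho>, grow with \<open>n\<close>.\<close>
    have close: "cmod (h n z - h n 0) \<le> exp C / \<rho> * cmod z" if \<rho>: "\<rho> > 0" "2 * \<rho> < real n - r1 - 1" and z: "cmod z \<le> \<rho>" for n z \<rho>
      using bounded_holomorphic_Lipschitz[OF holh _ \<rho>, of "exp C" z] hb z by simp
    obtain n0 :: nat where n0: "real n0 > r1 + 1" using reals_Archimedean2 by blast
    have "bounded (range (\<lambda>n. h (n + n0) 0))"
    proof (rule boundedI)
      fix x assume "x \<in> range (\<lambda>n. h (n + n0) 0)"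
      then show "cmod x \<le> exp C" using hb[of 0] n0 by auto
    qed
    then obtain \<kappa> s where s: "strict_mono s" "((\<lambda>n. h (n + n0) 0) \<circ> s) \<longlonglongrightarrow> \<kappa>"
      using bounded_imp_convergent_subsequence by blast
    define \<tau> where "\<tau> = (\<lambda>n. s n + n0)"
    have \<tau>: "\<tau> n \<ge> n" "\<tau> n \<ge> n0" for n using strict_mono_imp_increasing[OF s(1), of n] by (auto simp: \<tau>_def)
    have lim: "(\<lambda>n. h (\<tau> n) 0) \<longlonglongrightarrow> \<kappa>" using s(2) by (simp add: o_def \<tau>_def)
    have "chordal_lim_seq (\<lambda>n z. f (z + c (\<tau> n))) (\<lambda>_. Some \<kappa>)" unfolding chordal_lim_seq_def
    proof (intro allI impI)
      fix K :: "complex set" and e :: real assume K: "compact K" and e: "e > 0"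
      obtain b where b: "b > 0" "\<forall>z\<in>K. cmod z \<le> b" using compact_imp_bounded[OF K] by (auto simp: bounded_pos)
      \<comment> \<open>Chosen so that the oscillation exp C * b / \<rho> on \<open>K\<close> is at
        most e/8.\<close>
      define \<rho> where "\<rho> = max b (8 * exp C * b / e)"
      have \<rho>: "\<rho> > 0" "b \<le> \<rho>" "8 * exp C * b / e \<le> \<rho>" using b by (auto simp: \<rho>_def)
      obtain n1 :: nat where n1: "real n1 > 2 * \<rho> + r1 + 1" using reals_Archimedean2 by blast
      have "e / 8 > 0" using e by simp
      then obtain n2 where n2: "\<And>n. n \<ge> n2 \<Longrightarrow> dist (h (\<tau> n) 0) \<kappa> < e / 8"
        using lim unfolding lim_sequentially by blast
      have "chordal (f (z + c (\<tau> n))) (Some \<kappa>) < e" if n: "n \<ge> max n1 n2" and z: "z \<in> K" for n z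
      proof -
        have tn: "2 * \<rho> < real (\<tau> n) - r1 - 1" using n n1 \<tau>(1)[of n] by linarith
        have zb: "cmod z \<le> b" using b z by blast
        have "cmod (h (\<tau> n) z - h (\<tau> n) 0) \<le> exp C / \<rho> * cmod z"
          by (rule close[OF \<rho>(1) tn]) (use zb \<rho> in auto)
        also have "\<dots> \<le> exp C / \<rho> * b" using zb \<rho> by (intro mult_left_mono) auto
        also have "\<dots> \<le> e / 8" using \<rho> e by (simp add: field_simps)
        finally have "cmod (h (\<tau> n) z - \<kappa>) \<le> e / 8 + e / 8"
          using n2[of n] n norm_triangle_ineq[of "h (\<tau> n) z - h (\<tau> n) 0" "h (\<tau> n) 0 - \<kappa>"] by (simp add: dist_norm)
        moreover have "f (z + c (\<tau> n)) = Some (h (\<tau> n) z)" using hb[of z "\<tau> n"] zb \<rho> tn by simp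
        ultimately show ?thesis using chordal_Some_le[of "h (\<tau> n) z" \<kappa>] e by simp
      qed
      then show "\<exists>N. \<forall>n\<ge>N. \<forall>z\<in>K. chordal (f (z + c (\<tau> n))) (Some \<kappa>) < e" by blast
    qed
    then have "\<exists>h cc. chordal_lim_seq (\<lambda>n z. f (z + h n)) (\<lambda>_. cc)"
      by (intro exI[of _ "\<lambda>n. c (\<tau> n)"] exI[of _ "Some \<kappa>"])
    then show False using N1 unfolding N1_def by blast
  qed
  then show thesis using that by blast
qed

lemma N1_imp_conditions:
  assumes N1: "N1 f" and div: "divisor_of D f" and lf: "locally_finite D"
  shows "condA D \<and> condB D \<and> condC D \<and> condD D \<and> condE D \<and> condF D"
proof -
  have mo: "\<And>z. mer_order f z (D z)" using div by (simp add: divisor_of_def)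
  obtain N C where N: "\<And>c. dabs D (cball c 1) \<le> N" and gr: "growth D f C" using N1_growth[OF N1 div lf] by blast
  have lf': "locally_finite (\<lambda>z. - D z)" using lf by (simp add: locally_finite_def)
  have div': "divisor_of (\<lambda>z. - D z) (\<lambda>z. sinv (f z))" by (rule divisor_of_sinv[OF lf div])
  have N1': "N1 (\<lambda>z. sinv (f z))" by (rule N1_sinv[OF N1 div lf])
  have mo': "\<And>z. mer_order (\<lambda>z. sinv (f z)) z (- D z)" using div' by (simp add: divisor_of_def)
  obtain N' C' where N': "\<And>c. dabs (\<lambda>z. - D z) (cball c 1) \<le> N'" and gr': "growth (\<lambda>z. - D z) (\<lambda>z. sinv (f z)) C'"
    using N1_growth[OF N1' div' lf'] by blast
  have A: "condA D"
  proof -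
    have norm: "normal_fun f" using N1 by (simp add: N1_def)
    obtain d where d: "d > 0" "\<And>z w. dist z w < d \<Longrightarrow> chordal (f z) (f w) < 1"
      using normal_uniformly_continuous[OF norm mo, of 1] by auto
    have "d \<le> cmod (a - b)" if "D a > 0" "D b < 0" for a b
    proof (rule ccontr)
      assume "\<not> ?thesis"
      then have "chordal (f a) (f b) < 1" using d by (simp add: dist_norm)
      moreover have "f a = Some 0" "f b = None" using that mer_order_zero_iff[OF mo] mer_order_None_iff[OF mo] by auto
      ultimately show False using chordal_0_None by simp
    qed
    then show ?thesis using d(1) unfolding condA_def by blast
  qed
  have B: "condB D" unfolding condB_def
  proof (intro exI[of _ "N + 1"] allI)
    fix c show "of_int (zcount D (cball c 1) + pcount D (cball c 1)) < N + 1"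
      using zcount_plus_pcount[OF lf bounded_cball, of c 1] N[of c] by simp
  qed
  have Cc: "condC D"
  proof -
    obtain R where R: "\<And>c. \<exists>a\<in>ball c R. D a > 0" using zeros_relatively_dense[OF N1 mo lf gr N] by blast
    obtain R' where R': "\<And>c. \<exists>a\<in>ball c R'. - D a > 0" using zeros_relatively_dense[OF N1' mo' lf' gr' N'] by blast
    have "\<exists>a\<in>ball c (max R R'). D a > 0" "\<exists>a\<in>ball c (max R R'). D a < 0" for c
      using R[of c] R'[of c] by (auto simp: less_max_iff_disj)
    then show ?thesis unfolding condC_def by blast
  qed
  show ?thesis using A B Cc necessity_condD[OF mo lf gr N] necessity_condE[OF mo lf gr N] necessity_condF[OF mo lf gr N] by blast
qed


section \<open>Convergence of the product\<close>

lemma Cauchy_at_top_convergent: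
  fixes f :: "real \<Rightarrow> 'a::banach"
  assumes "\<And>e. e > 0 \<Longrightarrow> \<exists>R. \<forall>r\<ge>R. \<forall>s\<ge>R. dist (f r) (f s) < e"
  obtains l where "(f \<longlongrightarrow> l) at_top"
proof -
  have "Cauchy (\<lambda>n. f (real n))" unfolding metric_Cauchy_iff2
  proof
    fix j
    have "inverse (real (Suc j)) > 0" by simp
    then obtain R where R: "\<And>r s. r \<ge> R \<Longrightarrow> s \<ge> R \<Longrightarrow> dist (f r) (f s) < inverse (real (Suc j))" using assms by meson
    obtain M :: nat where "real M \<ge> R" using real_arch_simple by blast
    then have "R \<le> real m" if "m \<ge> M" for m using that by linarith
    then show "\<exists>M. \<forall>m\<ge>M. \<forall>n\<ge>M. dist (f (real m)) (f (real n)) < inverse (real (Suc j))"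
      using R by blast
  qed
  then obtain l where l: "(\<lambda>n. f (real n)) \<longlonglongrightarrow> l" using Cauchy_convergent_iff convergent_def by blast
  have "(f \<longlongrightarrow> l) at_top" unfolding tendsto_iff
  proof (intro allI impI)
    fix e :: real assume "e > 0"
    then have e: "e / 2 > 0" by simp
    obtain R where R: "\<And>r s. r \<ge> R \<Longrightarrow> s \<ge> R \<Longrightarrow> dist (f r) (f s) < e / 2" using assms[OF e] by meson
    obtain M where M: "\<And>n. n \<ge> M \<Longrightarrow> dist (f (real n)) l < e / 2" using l e unfolding lim_sequentially by blast
    obtain M' :: nat where M': "real M' \<ge> R" using real_arch_simple by blast
    define n where "n = max M M'"
    have n: "real n \<ge> R" "n \<ge> M" using M' by (auto simp: n_def)
    have "dist (f r) l < e" if "r \<ge> R" for r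
      using R[OF that n(1)] M[OF n(2)] dist_triangle[of "f r" l "f (real n)"] by simp
    then show "\<forall>\<^sub>F r in at_top. dist (f r) l < e" by (auto simp: eventually_at_top_linorder)
  qed
  then show thesis by (rule that)
qed

lemma Cauchy_at_top_uniform:
  fixes f :: "real \<Rightarrow> 'b \<Rightarrow> 'a::banach"
  assumes "\<And>e. e > 0 \<Longrightarrow> \<exists>R. \<forall>r\<ge>R. \<forall>s\<ge>R. \<forall>z\<in>K. dist (f r z) (f s z) < e"
  obtains l where "uniform_limit K f l at_top"
proof -
  have "\<forall>z\<in>K. \<exists>l. ((\<lambda>r. f r z) \<longlongrightarrow> l) at_top"
  proof
    fix z assume "z \<in> K"
    then have "\<exists>R. \<forall>r\<ge>R. \<forall>s\<ge>R. dist (f r z) (f s z) < e" if "e > 0" for e using assms[OF that] by blast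
    then show "\<exists>l. ((\<lambda>r. f r z) \<longlongrightarrow> l) at_top" using Cauchy_at_top_convergent by metis
  qed
  then obtain l where l: "\<And>z. z \<in> K \<Longrightarrow> ((\<lambda>r. f r z) \<longlongrightarrow> l z) at_top" by metis
  have "uniform_limit K f l at_top" unfolding uniform_limit_iff
  proof (intro allI impI)
    fix e :: real assume "e > 0"
    then have e: "e / 2 > 0" by simp
    obtain R where R: "\<And>r s z. r \<ge> R \<Longrightarrow> s \<ge> R \<Longrightarrow> z \<in> K \<Longrightarrow> dist (f r z) (f s z) < e / 2" using assms[OF e] by meson
    have "dist (f r z) (l z) < e" if "r \<ge> R" "z \<in> K" for r z
    proof -
      have "((\<lambda>s. dist (f r z) (f s z)) \<longlongrightarrow> dist (f r z) (l z)) at_top" by (intro tendsto_intros l that)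
      moreover have "\<forall>\<^sub>F s in at_top. dist (f r z) (f s z) \<le> e / 2"
        using R that by (intro eventually_at_top_linorderI[of R]) (auto intro: less_imp_le)
      ultimately have "dist (f r z) (l z) \<le> e / 2" using tendsto_upperbound trivial_limit_at_top_linorder by blast
      then show ?thesis using e by simp
    qed
    then show "\<forall>\<^sub>F r in at_top. \<forall>z\<in>K. dist (f r z) (l z) < e" by (auto simp: eventually_at_top_linorder)
  qed
  then show thesis by (rule that)
qed

text \<open>Partial integration expresses the sum of 1/a - cnj a / r^2 through A(r)/r^2 and the
  integral of 2 A(t)/t^3, where A is the conjugate of the sum in (e) at the origin. As A(t) = O(t),
  the first tends to 0 and the integral converges absolutely.\<close>

lemma alpha_converges:
  assumes lf: "locally_finite D" and D0: "D 0 = 0"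
    and E: "\<And>r. r > 1 \<Longrightarrow> cmod (dsum D (ball 0 r) (\<lambda>a. a * of_real (ln (r / max 1 (cmod a))))) \<le> C * r"
  obtains \<alpha> where "(alpha_approx D \<longlongrightarrow> \<alpha>) at_top"
proof -
  define A where "A = (\<lambda>r. dsum D (ball 0 r) (\<lambda>a. cnj a * of_real (ln (r / max 1 (cmod a)))))"
  have A: "cmod (A r) \<le> C * r" if "r > 1" for r
    using E[OF that] unfolding A_def by (subst complex_mod_cnj[symmetric], subst cnj_dsum) simp
  have "0 \<le> C * 2" using order_trans[OF norm_ge_zero A[of 2]] by simp
  then have C: "C \<ge> 0" by simp
  \<comment> \<open>A primitive of \<open>h\<close>, chosen so that ln (r/m)/r^2 + H(r) - H(m) =
    (1/m^2 - 1/r^2)/2; for m = |a| multiplication by 2 cnj a gives the summand of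
    \<open>alpha_approx\<close> up to sign.\<close>
  define H where "H = (\<lambda>a t. - ln (t / max 1 (cmod a)) / t\<^sup>2 - 1 / (2 * t\<^sup>2))"
  define h where "h = (\<lambda>a t. 2 * ln (t / max 1 (cmod a)) / t ^ 3)"
  define X where "X = (\<lambda>r. dsum D (ball 0 r) (\<lambda>a. cnj a * of_real (H a r - H a (max 1 (cmod (a - 0))))))"
  have mpos: "max 1 (cmod a) > 0" for a :: complex by auto
  have iX: "((\<lambda>t. of_real (2 / t ^ 3) * A t) has_integral X r) {1..r}" if r: "r \<ge> 1" for r
  proof -
    have "((\<lambda>t. dsum D (ball 0 t) (\<lambda>a. cnj a * of_real (h a t))) has_integral X r) {1..r}"
      unfolding X_def
    proof (rule dsum_has_integral[OF lf])
      fix a :: complex and t :: real assume t: "t \<ge> 1"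
      define m where "m = max 1 (cmod a)"
      have m: "m > 0" using mpos by (simp add: m_def)
      have "((\<lambda>t. - ln (t / m) / t\<^sup>2 - 1 / (2 * t\<^sup>2)) has_real_derivative 2 * ln (t / m) / t ^ 3) (at t)"
        using t m by (auto intro!: derivative_eq_intros simp: field_simps power2_eq_square power3_eq_cube)
      then show "(H a has_real_derivative h a t) (at t)" by (simp add: H_def h_def m_def)
    qed (use r in auto)
    moreover have "dsum D (ball 0 t) (\<lambda>a. cnj a * of_real (h a t)) = of_real (2 / t ^ 3) * A t" for t
    proof -
      have "cnj a * of_real (h a t) = of_real (2 / t ^ 3) * (cnj a * of_real (ln (t / max 1 (cmod a))))" for a
        by (simp add: h_def)
      then show ?thesis unfolding A_def dsum_cmult[symmetric] by (simp only:)
    qed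
    ultimately show ?thesis by simp
  qed
  have Xdiff: "cmod (X s - X r) \<le> 2 * C / r" if rs: "1 < r" "r \<le> s" for r s
  proof -
    have i1: "(\<lambda>t. of_real (2 / t ^ 3) * A t) integrable_on {1..s}" using iX[of s] rs by auto
    have "integral {1..r} (\<lambda>t. of_real (2 / t ^ 3) * A t) + integral {r..s} (\<lambda>t. of_real (2 / t ^ 3) * A t)
       = integral {1..s} (\<lambda>t. of_real (2 / t ^ 3) * A t)"
      using rs by (intro Henstock_Kurzweil_Integration.integral_combine i1) auto
    then have e: "X s - X r = integral {r..s} (\<lambda>t. of_real (2 / t ^ 3) * A t)"
      using integral_unique[OF iX[of s]] integral_unique[OF iX[of r]] rs by (simp add: algebra_simps)
    have i2: "((\<lambda>t. 2 * C / t\<^sup>2) has_integral ((- (2 * C) / s) - (- (2 * C) / r))) {r..s}"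
      by (rule fundamental_theorem_of_calculus)
        (use rs in \<open>auto intro!: derivative_eq_intros simp: has_real_derivative_iff_has_vector_derivative[symmetric] power2_eq_square divide_simps\<close>)
    have "cmod (X s - X r) \<le> integral {r..s} (\<lambda>t. 2 * C / t\<^sup>2)"
      unfolding e
    proof (rule integral_norm_bound_integral)
      show "(\<lambda>t. of_real (2 / t ^ 3) * A t) integrable_on {r..s}"
        by (rule integrable_subinterval_real[OF i1]) (use rs in auto)
      show "(\<lambda>t. 2 * C / t\<^sup>2) integrable_on {r..s}" using i2 by blast
      fix t assume t: "t \<in> {r..s}"
      have "cmod (of_real (2 / t ^ 3) * A t) \<le> (2 / t ^ 3) * (C * t)"
        using A[of t] t rs by (simp only: norm_mult norm_of_real) (intro mult_mono, auto)
      also have "\<dots> = 2 * C / t\<^sup>2" using t rs by (simp add: power2_eq_square power3_eq_cube)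
      finally show "cmod (of_real (2 / t ^ 3) * A t) \<le> 2 * C / t\<^sup>2" .
    qed
    also have "\<dots> = 2 * C / r - 2 * C / s" using integral_unique[OF i2] by simp
    also have "\<dots> \<le> 2 * C / r" using C rs by simp
    finally show ?thesis .
  qed
  obtain x where x: "(X \<longlongrightarrow> x) at_top"
  proof (rule Cauchy_at_top_convergent[of X])
    fix e :: real assume e: "e > 0"
    define R where "R = max 2 (2 * C / e + 1)"
    have R: "R > 1" "2 * C / R < e"
    proof -
      have "2 * C / e < R" by (simp add: R_def less_max_iff_disj)
      then show "R > 1" "2 * C / R < e" using e by (auto simp: R_def field_simps)
    qed
    have le: "cmod (X s - X r) < e" if "R \<le> r" "r \<le> s" for r s
    proof -
      have "cmod (X s - X r) \<le> 2 * C / r" using Xdiff that R by simp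
      also have "\<dots> \<le> 2 * C / R" using that R C by (intro divide_left_mono) auto
      finally show ?thesis using R by simp
    qed
    show "\<exists>R. \<forall>r\<ge>R. \<forall>s\<ge>R. dist (X r) (X s) < e"
    proof (intro exI[of _ R] allI impI)
      fix r s assume "R \<le> r" "R \<le> s"
      then show "dist (X r) (X s) < e" using le[of r s] le[of s r] by (cases "r \<le> s") (auto simp: dist_norm norm_minus_commute)
    qed
  qed
  have A2: "((\<lambda>r. A r / of_real (r\<^sup>2)) \<longlongrightarrow> 0) at_top"
  proof (rule Lim_null_comparison)
    show "((\<lambda>r. C / r) \<longlongrightarrow> 0) at_top"
      by (rule tendsto_divide_0[OF tendsto_const filterlim_at_top_imp_at_infinity[OF filterlim_ident]])
    show "\<forall>\<^sub>F r in at_top. cmod (A r / of_real (r\<^sup>2)) \<le> C / r"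
      using eventually_gt_at_top[of 1]
    proof eventually_elim
      case (elim r)
      have "cmod (A r / of_real (r\<^sup>2)) \<le> (C * r) / r\<^sup>2"
        using A[of r] elim by (simp only: norm_divide norm_of_real) (intro divide_mono, auto)
      then show ?case using elim by (simp add: power2_eq_square)
    qed
  qed
  \<comment> \<open>For |a| < 1 the logarithm uses 1 in place of |a|; the resulting correction does
    not depend on r > 1.\<close>
  define K where "K = dsum D (ball 0 1) (\<lambda>a. 1 / a - cnj a)"
  have ev: "alpha_approx D r = - (2 * (A r / of_real (r\<^sup>2) + X r) + K)" if r: "r > 1" for r
  proof -
    have "alpha_approx D r = - (zsum D (ball 0 r) (\<lambda>a. 1 / a - cnj a / of_real (r\<^sup>2)) - psum D (ball 0 r) (\<lambda>a. 1 / a - cnj a / of_real (r\<^sup>2)))"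
      by (simp add: alpha_approx_def)
    also have "\<dots> = - dsum D (ball 0 r) (\<lambda>a. 1 / a - cnj a / of_real (r\<^sup>2))"
      by (simp only: zsum_minus_psum[OF lf bounded_ball])
    also have "dsum D (ball 0 r) (\<lambda>a. 1 / a - cnj a / of_real (r\<^sup>2))
       = dsum D (ball 0 r) (\<lambda>a. 2 * (of_real (1 / r\<^sup>2) * (cnj a * of_real (ln (r / max 1 (cmod a)))) + cnj a * of_real (H a r - H a (max 1 (cmod (a - 0)))))
           + (if cmod a < 1 then 1 / a - cnj a else 0))"
    proof (rule dsum_cong)
      fix a assume a: "a \<in> ball 0 r" "D a \<noteq> 0"
      define m where "m = max 1 (cmod a)"
      have m: "m > 0" using mpos by (simp add: m_def)
      have "H a r - H a m = - ln (r / m) / r\<^sup>2 - 1 / (2 * r\<^sup>2) + 1 / (2 * m\<^sup>2)"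
        using m by (simp add: H_def m_def)
      then have "2 * (1 / r\<^sup>2 * ln (r / m) + (H a r - H a m)) = 1 / m\<^sup>2 - 1 / r\<^sup>2" by simp
      then have "cnj a * of_real (2 * (1 / r\<^sup>2 * ln (r / m) + (H a r - H a m))) = cnj a * of_real (1 / m\<^sup>2 - 1 / r\<^sup>2)" by simp
      then have e: "2 * (of_real (1 / r\<^sup>2) * (cnj a * of_real (ln (r / m))) + cnj a * of_real (H a r - H a m)) = cnj a / of_real (m\<^sup>2) - cnj a / of_real (r\<^sup>2)"
        by (simp add: algebra_simps)
      have a0: "a \<noteq> 0" using a D0 by auto
      have "cnj a / of_real ((cmod a)\<^sup>2) = 1 / a" unfolding complex_norm_square using a0 by simp
      then show "1 / a - cnj a / of_real (r\<^sup>2) = 2 * (of_real (1 / r\<^sup>2) * (cnj a * of_real (ln (r / max 1 (cmod a)))) + cnj a * of_real (H a r - H a (max 1 (cmod (a - 0)))))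
           + (if cmod a < 1 then 1 / a - cnj a else 0)"
        using e by (auto simp: m_def max_def)
    qed
    also have "\<dots> = 2 * (of_real (1 / r\<^sup>2) * A r + X r) + dsum D (ball 0 r) (\<lambda>a. if cmod a < 1 then 1 / a - cnj a else 0)"
      unfolding dsum_add dsum_cmult A_def X_def ..
    also have "dsum D (ball 0 r) (\<lambda>a. if cmod a < 1 then 1 / a - cnj a else 0) = K"
    proof -
      have "dsum D (ball 0 r) (\<lambda>a. if cmod a < 1 then 1 / a - cnj a else 0)
         = dsum D (ball 0 1) (\<lambda>a. if cmod a < 1 then 1 / a - cnj a else 0) + dsum D (ball 0 r - ball 0 1) (\<lambda>a. if cmod a < 1 then 1 / a - cnj a else 0)"
        by (rule dsum_diff[OF lf]) (use r in auto)
      also have "dsum D (ball 0 r - ball 0 1) (\<lambda>a. if cmod a < 1 then 1 / a - cnj a else 0) = 0"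
        by (auto simp: dsum_def intro!: sum.neutral)
      also have "dsum D (ball 0 1) (\<lambda>a. if cmod a < 1 then 1 / a - cnj a else 0) = K"
        unfolding K_def by (rule dsum_cong) auto
      finally show ?thesis by simp
    qed
    finally show ?thesis by simp
  qed
  have "((\<lambda>r. - (2 * (A r / of_real (r\<^sup>2) + X r) + K)) \<longlongrightarrow> - (2 * (0 + x) + K)) at_top"
    by (intro tendsto_intros A2 x)
  then have "(alpha_approx D \<longlongrightarrow> - (2 * (0 + x) + K)) at_top"
  proof (rule filterlim_cong[THEN iffD1, OF refl refl, rotated])
    show "\<forall>\<^sub>F r in at_top. - (2 * (A r / of_real (r\<^sup>2) + X r) + K) = alpha_approx D r"
      using eventually_gt_at_top[of 1] by eventually_elim (simp add: ev)
  qed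
  then show thesis by (rule that)
qed

text \<open>The ring from k to k + 1 carries O(k) points, so the sum is dominated by that of 1/k^2,
  which telescopes through 1/k^2 \<le> 2/k - 2/(k + 1).\<close>

lemma dsum_tail_cube:
  assumes lf: "locally_finite D" and N: "\<And>c. dabs D (cball c 1) \<le> N" and n: "n \<ge> (1::nat)"
  shows "(\<Sum>a\<in>{a\<in>ball 0 r - ball 0 (real n). D a \<noteq> 0}. real_of_int \<bar>D a\<bar> / cmod a ^ 3) \<le> 50 * N / real n"
proof -
  have Npos: "N \<ge> 0" using N[of 0] dabs_nonneg order_trans by blast
  define S where "S = (\<lambda>m. {a\<in>ball 0 (real (n + m)) - ball 0 (real n). D a \<noteq> 0})"
  have fin: "finite (S m)" for m
    unfolding S_def by (rule locally_finite_bounded[OF lf]) auto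
  have main: "(\<Sum>a\<in>S m. real_of_int \<bar>D a\<bar> / cmod a ^ 3) \<le> 25 * N * (2 / real n - 2 / real (n + m))" for m
  proof (induction m)
    case 0
    have "S 0 = {}" by (auto simp: S_def)
    then show ?case by simp
  next
    case (Suc m)
    define k where "k = real (n + m)"
    have k: "k \<ge> 1" using n by (simp add: k_def)
    define T where "T = {a\<in>ball 0 (k + 1) - ball 0 k. D a \<noteq> 0}"
    have ST: "S (Suc m) = S m \<union> T" "S m \<inter> T = {}" by (auto simp: S_def T_def k_def)
    have finT: "finite T" unfolding T_def by (rule locally_finite_bounded[OF lf]) auto
    have "(\<Sum>a\<in>T. real_of_int \<bar>D a\<bar> / cmod a ^ 3) \<le> (\<Sum>a\<in>T. real_of_int \<bar>D a\<bar> * (1 / k ^ 3))"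
    proof (rule sum_mono)
      fix a assume "a \<in> T"
      then have "k \<le> cmod a" by (auto simp: T_def)
      then have "k ^ 3 \<le> cmod a ^ 3" using k by (intro power_mono) auto
      then have "1 / cmod a ^ 3 \<le> 1 / k ^ 3" using k by (intro divide_left_mono) (auto intro!: mult_pos_pos simp: order.strict_trans2)
      then show "real_of_int \<bar>D a\<bar> / cmod a ^ 3 \<le> real_of_int \<bar>D a\<bar> * (1 / k ^ 3)"
        using mult_left_mono[of "1 / cmod a ^ 3" "1 / k ^ 3" "real_of_int \<bar>D a\<bar>"] by simp
    qed
    also have "\<dots> = dabs D (ball 0 (k + 1) - ball 0 k) * (1 / k ^ 3)" by (simp add: dabs_def T_def sum_divide_distrib)
    also have "\<dots> \<le> (25 * N * k) * (1 / k ^ 3)"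
    proof (rule mult_right_mono)
      show "dabs D (ball 0 (k + 1) - ball 0 k) \<le> 25 * N * k" by (rule unit_annulus_count[OF lf N k])
    qed (use k in auto)
    also have "\<dots> = 25 * N * (1 / k\<^sup>2)" using k by (simp add: power2_eq_square power3_eq_cube)
    also have "\<dots> \<le> 25 * N * (2 / k - 2 / (k + 1))"
    proof (rule mult_left_mono)
      have "2 / k - 2 / (k + 1) = 2 / (k * (k + 1))" using k by (simp add: field_simps)
      also have "\<dots> \<ge> 2 / (k * (2 * k))" using k by (intro divide_left_mono mult_left_mono) auto
      finally show "1 / k\<^sup>2 \<le> 2 / k - 2 / (k + 1)" by (simp add: power2_eq_square)
    qed (use Npos in simp)
    finally have T: "(\<Sum>a\<in>T. real_of_int \<bar>D a\<bar> / cmod a ^ 3) \<le> 25 * N * (2 / k - 2 / (k + 1))" .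
    have "(\<Sum>a\<in>S (Suc m). real_of_int \<bar>D a\<bar> / cmod a ^ 3) = (\<Sum>a\<in>S m. real_of_int \<bar>D a\<bar> / cmod a ^ 3) + (\<Sum>a\<in>T. real_of_int \<bar>D a\<bar> / cmod a ^ 3)"
      unfolding ST(1) by (rule sum.union_disjoint[OF fin finT ST(2)])
    also have "\<dots> \<le> 25 * N * (2 / real n - 2 / k) + 25 * N * (2 / k - 2 / (k + 1))" using Suc T by (simp add: k_def)
    finally show ?case by (simp add: k_def algebra_simps)
  qed
  obtain m :: nat where m: "real m \<ge> r" using real_arch_simple by blast
  have "(\<Sum>a\<in>{a\<in>ball 0 r - ball 0 (real n). D a \<noteq> 0}. real_of_int \<bar>D a\<bar> / cmod a ^ 3) \<le> (\<Sum>a\<in>S m. real_of_int \<bar>D a\<bar> / cmod a ^ 3)"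
    using m by (intro sum_mono2[OF fin]) (auto simp: S_def)
  also have "\<dots> \<le> 25 * N * (2 / real n - 2 / real (n + m))" by (rule main)
  also have "\<dots> \<le> 25 * N * (2 / real n)" using Npos by (intro mult_left_mono) auto
  finally show ?thesis by simp
qed

text \<open>The derivatives of the left-hand sides are -x/(1 - x) and -x^2/(1 - x), and |1 - x|
  \<ge> 1/2. The second bound serves the convergence of the product, the first the comparison of
  area means.\<close>

lemma Ln_one_minus_bounds:
  assumes w: "cmod w \<le> 1 / 2"
  shows "cmod (Ln (1 - w) + w) \<le> 2 * cmod w ^ 2"
    and "cmod (Ln (1 - w) + w + w\<^sup>2 / 2) \<le> 2 * cmod w ^ 3"
proof -
  have nz: "1 - x \<noteq> 0" "1 - x \<notin> \<real>\<^sub>\<le>\<^sub>0" "cmod (1 / (1 - x)) \<le> 2" if x: "x \<in> cball 0 (cmod w)" for x :: complex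
  proof -
    have cx: "cmod x \<le> 1 / 2" using x w by simp
    then have "Re (1 - x) > 0" by (intro one_minus_Re_pos) simp
    then show "1 - x \<noteq> 0" "1 - x \<notin> \<real>\<^sub>\<le>\<^sub>0" by (auto simp: complex_nonpos_Reals_iff)
    have "cmod (1 - x) \<ge> 1 / 2" using cx norm_triangle_ineq2[of 1 x] by simp
    then show "cmod (1 / (1 - x)) \<le> 2" by (simp add: norm_divide divide_le_eq)
  qed
  have "cmod ((Ln (1 - w) + w) - (Ln (1 - 0) + 0)) \<le> (2 * cmod w) * cmod (w - 0)"
  proof (rule field_differentiable_bound[of "cball 0 (cmod w)" _ "\<lambda>x. - x * (1 / (1 - x))"])
    fix x :: complex assume x: "x \<in> cball 0 (cmod w)"
    show "((\<lambda>x. Ln (1 - x) + x) has_field_derivative - x * (1 / (1 - x))) (at x within cball 0 (cmod w))"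
      using nz[OF x] by (auto intro!: derivative_eq_intros simp: field_simps)
    have "cmod (- x * (1 / (1 - x))) \<le> cmod w * 2"
      using nz(3)[OF x] x by (simp only: norm_mult norm_minus_cancel) (intro mult_mono, auto)
    then show "cmod (- x * (1 / (1 - x))) \<le> 2 * cmod w" by simp
  qed auto
  then show "cmod (Ln (1 - w) + w) \<le> 2 * cmod w ^ 2" by (simp add: power2_eq_square mult.assoc)
  have "cmod ((Ln (1 - w) + w + w\<^sup>2 / 2) - (Ln (1 - 0) + 0 + 0\<^sup>2 / 2)) \<le> (2 * cmod w ^ 2) * cmod (w - 0)"
  proof (rule field_differentiable_bound[of "cball 0 (cmod w)" _ "\<lambda>x. - (x ^ 2) * (1 / (1 - x))"])
    fix x :: complex assume x: "x \<in> cball 0 (cmod w)"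
    show "((\<lambda>x. Ln (1 - x) + x + x\<^sup>2 / 2) has_field_derivative - (x ^ 2) * (1 / (1 - x))) (at x within cball 0 (cmod w))"
      using nz[OF x] by (auto intro!: derivative_eq_intros simp: field_simps power2_eq_square)
    have "cmod (- (x ^ 2) * (1 / (1 - x))) \<le> cmod w ^ 2 * 2"
      using nz(3)[OF x] x by (simp only: norm_mult norm_minus_cancel norm_power) (intro mult_mono power_mono, auto)
    then show "cmod (- (x ^ 2) * (1 / (1 - x))) \<le> 2 * cmod w ^ 2" by simp
  qed auto
  then show "cmod (Ln (1 - w) + w + w\<^sup>2 / 2) \<le> 2 * cmod w ^ 3" by (simp add: power2_eq_square power3_eq_cube mult.assoc)
qed

text \<open>The partial product with signed exponents. At a pole its value is 0 by the convention
  for \<open>powi\<close>, unlike \<open>prod_quot\<close>, which gives \<open>None\<close> there;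
  the two are compared only off the poles.\<close>

definition sprod :: "(complex \<Rightarrow> int) \<Rightarrow> complex set \<Rightarrow> complex \<Rightarrow> complex" where
  "sprod D S z = (\<Prod>a\<in>{a\<in>S. D a \<noteq> 0}. ((1 - z / a) * exp (z / a)) powi D a)"

lemma prod_quot_sprod:
  assumes lf: "locally_finite D" and D0: "D 0 = 0" and z: "cmod z < r"
  shows "prod_quot D r z = (if D z < 0 then None else Some (sprod D (ball 0 r) z))"
proof -
  have fin: "finite {a\<in>ball 0 r. D a \<noteq> 0}" by (rule locally_finite_bounded[OF lf bounded_ball])
  have finm: "finite {a\<in>ball 0 r. D a < 0}" by (rule finite_subset[OF _ fin]) auto
  have "pprod D r z = 0 \<longleftrightarrow> (\<exists>a\<in>{a\<in>ball 0 r. D a < 0}. ((1 - z / a) * exp (z / a)) ^ nat (- D a) = 0)"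
    unfolding pprod_def using finm by (rule prod_zero_iff)
  also have "\<dots> \<longleftrightarrow> D z < 0"
  proof
    assume "\<exists>a\<in>{a\<in>ball 0 r. D a < 0}. ((1 - z / a) * exp (z / a)) ^ nat (- D a) = 0"
    then obtain a where a: "D a < 0" "1 - z / a = 0" by auto
    then have "a \<noteq> 0" using D0 by auto
    then show "D z < 0" using a by (simp add: field_simps)
  next
    assume neg: "D z < 0"
    then have "z \<noteq> 0" using D0 by auto
    then show "\<exists>a\<in>{a\<in>ball 0 r. D a < 0}. ((1 - z / a) * exp (z / a)) ^ nat (- D a) = 0"
      using neg z by (intro bexI[of _ z]) auto
  qed
  finally have p0: "pprod D r z = 0 \<longleftrightarrow> D z < 0" .
  have "{a\<in>ball 0 r. D a \<noteq> 0} = {a\<in>ball 0 r. D a > 0} \<union> {a\<in>ball 0 r. D a < 0}" by auto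
  then have "sprod D (ball 0 r) z = (\<Prod>a\<in>{a\<in>ball 0 r. D a > 0}. ((1 - z / a) * exp (z / a)) powi D a) * (\<Prod>a\<in>{a\<in>ball 0 r. D a < 0}. ((1 - z / a) * exp (z / a)) powi D a)"
    unfolding sprod_def using fin by (simp only:) (rule prod.union_disjoint, auto)
  also have "(\<Prod>a\<in>{a\<in>ball 0 r. D a > 0}. ((1 - z / a) * exp (z / a)) powi D a) = zprod D r z"
    unfolding zprod_def by (intro prod.cong refl) (auto simp: power_int_def)
  also have "(\<Prod>a\<in>{a\<in>ball 0 r. D a < 0}. ((1 - z / a) * exp (z / a)) powi D a) = inverse (pprod D r z)"
    unfolding pprod_def prod_inversef[symmetric] by (intro prod.cong refl) (auto simp: power_int_def power_inverse simp del: inverse_mult_distrib)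
  finally show ?thesis using p0 by (simp add: prod_quot_def divide_inverse)
qed

lemma sprod_extend:
  assumes lf: "locally_finite D" and D0: "D 0 = 0" and z: "cmod z < \<rho>" "\<rho> \<le> r"
  shows "sprod D (ball 0 r) z = sprod D (ball 0 \<rho>) z * exp (dsum D (ball 0 r - ball 0 \<rho>) (\<lambda>a. Ln (1 - z / a) + z / a))"
proof -
  have fin: "finite {a\<in>ball 0 r. D a \<noteq> 0}" by (rule locally_finite_bounded[OF lf bounded_ball])
  have "{a\<in>ball 0 r. D a \<noteq> 0} = {a\<in>ball 0 \<rho>. D a \<noteq> 0} \<union> {a\<in>ball 0 r - ball 0 \<rho>. D a \<noteq> 0}" using z by auto
  then have "sprod D (ball 0 r) z = sprod D (ball 0 \<rho>) z * (\<Prod>a\<in>{a\<in>ball 0 r - ball 0 \<rho>. D a \<noteq> 0}. ((1 - z / a) * exp (z / a)) powi D a)"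
    unfolding sprod_def using fin by (simp only:) (rule prod.union_disjoint, auto)
  also have "(\<Prod>a\<in>{a\<in>ball 0 r - ball 0 \<rho>. D a \<noteq> 0}. ((1 - z / a) * exp (z / a)) powi D a)
     = (\<Prod>a\<in>{a\<in>ball 0 r - ball 0 \<rho>. D a \<noteq> 0}. exp (of_int (D a) * (Ln (1 - z / a) + z / a)))"
  proof (intro prod.cong refl)
    fix a assume a: "a \<in> {a\<in>ball 0 r - ball 0 \<rho>. D a \<noteq> 0}"
    then have "z \<noteq> a" "a \<noteq> 0" using z D0 by auto
    then have "1 - z / a \<noteq> 0" by simp
    then have "exp (Ln (1 - z / a) + z / a) = (1 - z / a) * exp (z / a)" by (simp add: exp_add)
    then show "((1 - z / a) * exp (z / a)) powi D a = exp (of_int (D a) * (Ln (1 - z / a) + z / a))"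
      by (simp add: exp_power_int[symmetric] mult.commute)
  qed
  also have "\<dots> = exp (dsum D (ball 0 r - ball 0 \<rho>) (\<lambda>a. Ln (1 - z / a) + z / a))"
    unfolding dsum_def by (rule exp_sum[symmetric]) (rule finite_subset[OF _ fin], auto)
  finally show ?thesis .
qed

text \<open>With w = z/a one has Ln (1 - w) + w = -w^2/2 + O(|w|^3). The quadratic terms sum to
  -z^2/2 times a tail of the series in (f); the cubic remainders converge absolutely by
  \<open>dsum_tail_cube\<close>. Starting at |a| \<ge> 2n keeps |w| \<le> 1/2 and the logarithm
  holomorphic.\<close>

lemma sprod_tail_converges:
  assumes lf: "locally_finite D" and D0: "D 0 = 0" and N: "\<And>c. dabs D (cball c 1) \<le> N"
    and F: "((\<lambda>r. dsum D {z. 1 \<le> cmod z \<and> cmod z < r} (\<lambda>z. 1 / z\<^sup>2)) \<longlongrightarrow> L) at_top"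
    and n: "n \<ge> (1::nat)"
  obtains S where "uniform_limit (cball 0 (real n)) (\<lambda>r z. dsum D (ball 0 r - ball 0 (2 * real n)) (\<lambda>a. Ln (1 - z / a) + z / a)) S at_top"
    "S holomorphic_on ball 0 (real n)"
proof -
  have Npos: "N \<ge> 0" using N[of 0] dabs_nonneg order_trans by blast
  define T where "T = (\<lambda>r. dsum D {z. 1 \<le> cmod z \<and> cmod z < r} (\<lambda>z. 1 / z\<^sup>2))"
  define E where "E = (\<lambda>a z::complex. Ln (1 - z / a) + z / a)"
  define G where "G = (\<lambda>r z. dsum D (ball 0 r - ball 0 (2 * real n)) (\<lambda>a. E a z))"
  have Gdiff: "cmod (G s z - G r z) \<le> real n ^ 2 * cmod (T s - T r) + 100 * N * real n ^ 3 / real m"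
    if rs: "2 * real n \<le> r" "r \<le> s" "real m \<le> r" "m \<ge> 1" and z: "cmod z \<le> real n" for r s z m
  proof -
    let ?A = "ball (0::complex) s - ball 0 r"
    have "G s z - G r z = dsum D ?A (\<lambda>a. E a z)"
    proof -
      have "G s z = dsum D (ball 0 r - ball 0 (2 * real n)) (\<lambda>a. E a z) + dsum D ((ball 0 s - ball 0 (2 * real n)) - (ball 0 r - ball 0 (2 * real n))) (\<lambda>a. E a z)"
        unfolding G_def by (rule dsum_diff[OF lf]) (use rs in auto)
      moreover have "(ball 0 s - ball 0 (2 * real n)) - (ball 0 r - ball 0 (2 * real n)) = ?A" using rs by auto
      ultimately show ?thesis by (simp add: G_def)
    qed
    also have "\<dots> = dsum D ?A (\<lambda>a. - (z\<^sup>2 / 2) * (1 / a\<^sup>2) + (E a z + (z / a)\<^sup>2 / 2))"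
      by (rule dsum_cong) (simp add: power_divide)
    also have "\<dots> = - (z\<^sup>2 / 2) * dsum D ?A (\<lambda>a. 1 / a\<^sup>2) + dsum D ?A (\<lambda>a. E a z + (z / a)\<^sup>2 / 2)"
      unfolding dsum_add dsum_cmult ..
    also have "dsum D ?A (\<lambda>a. 1 / a\<^sup>2) = T s - T r"
    proof -
      have "T s = T r + dsum D ({z. 1 \<le> cmod z \<and> cmod z < s} - {z. 1 \<le> cmod z \<and> cmod z < r}) (\<lambda>z. 1 / z\<^sup>2)"
        unfolding T_def by (rule dsum_diff[OF lf bounded_subset[of "ball 0 s"]]) (use rs in auto)
      moreover have "{z. 1 \<le> cmod z \<and> cmod z < s} - {z. 1 \<le> cmod z \<and> cmod z < r} = ?A"
        using rs n by auto
      ultimately show ?thesis by simp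
    qed
    finally have "cmod (G s z - G r z) \<le> cmod (- (z\<^sup>2 / 2) * (T s - T r)) + cmod (dsum D ?A (\<lambda>a. E a z + (z / a)\<^sup>2 / 2))"
      by (simp only: norm_triangle_ineq)
    also have "cmod (- (z\<^sup>2 / 2) * (T s - T r)) \<le> real n ^ 2 * cmod (T s - T r)"
    proof -
      have "cmod z ^ 2 \<le> real n ^ 2" using z by (intro power_mono) auto
      then have "cmod z ^ 2 / 2 \<le> real n ^ 2" using zero_le_power2[of "real n"] by linarith
      then show ?thesis by (simp only: norm_mult norm_minus_cancel norm_divide norm_power) (intro mult_right_mono, auto)
    qed
    also have "cmod (dsum D ?A (\<lambda>a. E a z + (z / a)\<^sup>2 / 2)) \<le> 100 * N * real n ^ 3 / real m"
    proof -
      have "cmod (dsum D ?A (\<lambda>a. E a z + (z / a)\<^sup>2 / 2)) \<le> (\<Sum>a\<in>{a\<in>?A. D a \<noteq> 0}. cmod (of_int (D a) * (E a z + (z / a)\<^sup>2 / 2)))"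
        unfolding dsum_def by (rule norm_sum)
      also have "\<dots> \<le> (\<Sum>a\<in>{a\<in>?A. D a \<noteq> 0}. 2 * real n ^ 3 * (real_of_int \<bar>D a\<bar> / cmod a ^ 3))"
      proof (rule sum_mono)
        fix a assume "a \<in> {a\<in>?A. D a \<noteq> 0}"
        then have a: "r \<le> cmod a" by auto
        then have ca: "cmod a \<ge> 2 * real n" "cmod a > 0" using rs n by auto
        have "cmod (z / a) \<le> 1 / 2" using z ca by (simp add: norm_divide divide_le_eq)
        then have "cmod (E a z + (z / a)\<^sup>2 / 2) \<le> 2 * cmod (z / a) ^ 3" unfolding E_def by (rule Ln_one_minus_bounds(2))
        also have "\<dots> = 2 * cmod z ^ 3 / cmod a ^ 3" by (simp add: norm_divide power_divide)
        also have "\<dots> \<le> 2 * real n ^ 3 / cmod a ^ 3" using z by (intro divide_right_mono mult_left_mono power_mono) auto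
        finally have "\<bar>real_of_int (D a)\<bar> * cmod (E a z + (z / a)\<^sup>2 / 2) \<le> \<bar>real_of_int (D a)\<bar> * (2 * real n ^ 3 / cmod a ^ 3)"
          by (rule mult_left_mono) simp
        moreover have "cmod (of_int (D a) * (E a z + (z / a)\<^sup>2 / 2)) = \<bar>real_of_int (D a)\<bar> * cmod (E a z + (z / a)\<^sup>2 / 2)"
          by (simp only: norm_mult norm_of_int)
        ultimately show "cmod (of_int (D a) * (E a z + (z / a)\<^sup>2 / 2)) \<le> 2 * real n ^ 3 * (real_of_int \<bar>D a\<bar> / cmod a ^ 3)"
          by (simp add: mult_ac)
      qed
      also have "\<dots> = 2 * real n ^ 3 * (\<Sum>a\<in>{a\<in>?A. D a \<noteq> 0}. real_of_int \<bar>D a\<bar> / cmod a ^ 3)" by (simp add: sum_distrib_left)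
      finally have b1: "cmod (dsum D ?A (\<lambda>a. E a z + (z / a)\<^sup>2 / 2)) \<le> 2 * real n ^ 3 * (\<Sum>a\<in>{a\<in>?A. D a \<noteq> 0}. real_of_int \<bar>D a\<bar> / cmod a ^ 3)" .
      have "(\<Sum>a\<in>{a\<in>?A. D a \<noteq> 0}. real_of_int \<bar>D a\<bar> / cmod a ^ 3) \<le> (\<Sum>a\<in>{a\<in>ball 0 s - ball 0 (real m). D a \<noteq> 0}. real_of_int \<bar>D a\<bar> / cmod a ^ 3)"
        by (rule sum_mono2[OF locally_finite_bounded[OF lf]]) (use rs in auto)
      also have "\<dots> \<le> 50 * N / real m" by (rule dsum_tail_cube[OF lf N rs(4)])
      finally have "2 * real n ^ 3 * (\<Sum>a\<in>{a\<in>?A. D a \<noteq> 0}. real_of_int \<bar>D a\<bar> / cmod a ^ 3) \<le> 2 * real n ^ 3 * (50 * N / real m)"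
        by (rule mult_left_mono) simp
      with b1 show ?thesis by (simp add: mult_ac)
    qed
    finally show ?thesis by simp
  qed
  have cauchy: "\<exists>R. \<forall>r\<ge>R. \<forall>s\<ge>R. \<forall>z\<in>cball 0 (real n). dist (G r z) (G s z) < e" if e: "e > 0" for e
  proof -
    have e': "e / (4 * real n ^ 2) > 0" using e n by simp
    have "\<forall>\<^sub>F r in at_top. dist (T r) L < e / (4 * real n ^ 2) / 2"
      unfolding T_def by (rule tendstoD[OF F]) (use e' in simp)
    then obtain R1 where R1: "\<And>r. r \<ge> R1 \<Longrightarrow> dist (T r) L < e / (4 * real n ^ 2) / 2"
      by (auto simp: eventually_at_top_linorder)
    obtain m :: nat where m: "real m > 100 * N * real n ^ 3 * 2 / e + 1" using reals_Archimedean2 by blast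
    have nn: "0 \<le> 100 * N * real n ^ 3 * 2 / e" using Npos e by simp
    have m1: "m \<ge> 1" using m nn by linarith
    have m2: "100 * N * real n ^ 3 / real m \<le> e / 2"
    proof -
      have "100 * N * real n ^ 3 * 2 / e \<le> real m" using m by simp
      then show ?thesis using e m1 by (simp add: field_simps)
    qed
    define R where "R = max R1 (max (2 * real n) (real m))"
    have le: "cmod (G s z - G r z) < e" if "R \<le> r" "r \<le> s" "cmod z \<le> real n" for r s z
    proof -
      have "cmod (T s - T r) \<le> e / (4 * real n ^ 2)"
        using R1[of r] R1[of s] that dist_triangle2[of "T s" "T r" L] by (simp add: R_def dist_norm)
      then have "real n ^ 2 * cmod (T s - T r) \<le> e / 4" using n by (simp add: field_simps)
      then show ?thesis using Gdiff[of r s m z] that m1 m2 e by (simp add: R_def)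
    qed
    show ?thesis
    proof (intro exI[of _ R] allI impI ballI)
      fix r s z assume "R \<le> r" "R \<le> s" "z \<in> cball (0::complex) (real n)"
      then show "dist (G r z) (G s z) < e" using le[of r s z] le[of s r z]
        by (cases "r \<le> s") (auto simp: dist_norm norm_minus_commute)
    qed
  qed
  obtain S where S: "uniform_limit (cball 0 (real n)) G S at_top"
    using Cauchy_at_top_uniform[of "cball 0 (real n)" G] cauchy by blast
  have hol: "G r holomorphic_on ball 0 (2 * real n)" for r
    unfolding G_def dsum_def E_def
  proof (intro holomorphic_intros)
    fix a z :: complex assume a: "a \<in> {a\<in>ball 0 r - ball 0 (2 * real n). D a \<noteq> 0}" and z: "z \<in> ball 0 (2 * real n)"
    have "a \<noteq> 0" using a D0 by auto
    then have "cmod (z / a) < 1" using a z by (auto simp: norm_divide divide_less_eq)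
    then have "Re (1 - z / a) > 0" by (rule one_minus_Re_pos)
    then show "1 - z / a \<notin> \<real>\<^sub>\<le>\<^sub>0" by (simp add: complex_nonpos_Reals_iff)
    show "a \<noteq> 0" by fact
  next
    fix a :: complex assume a: "a \<in> {a\<in>ball 0 r - ball 0 (2 * real n). D a \<noteq> 0}"
    then show "a \<noteq> 0" using D0 by auto
  qed
  have sub: "cball 0 (real n) \<subseteq> ball (0::complex) (2 * real n)" using n by auto
  have "S holomorphic_on ball 0 (real n)"
  proof (rule holomorphic_uniform_limit[OF _ S])
    show "\<forall>\<^sub>F r in at_top. continuous_on (cball 0 (real n)) (G r) \<and> G r holomorphic_on ball 0 (real n)"
    proof (intro always_eventually allI conjI)
      fix r
      show "continuous_on (cball 0 (real n)) (G r)"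
        using holomorphic_on_imp_continuous_on[OF hol] sub continuous_on_subset by blast
      show "G r holomorphic_on ball 0 (real n)" using hol sub ball_subset_cball holomorphic_on_subset by (meson order_trans)
    qed
  qed auto
  with S show thesis unfolding G_def E_def by (intro that) auto
qed


text \<open>Multiplication by a factor near 1 moves all points of the sphere by a uniformly small
  amount, even near infinity. This turns uniform convergence of logarithms into spherical
  convergence up to the poles.\<close>

lemma chordal_mult_le: "chordal (Some (k * u)) (Some u) \<le> 2 * cmod (k - 1)"
proof -
  have "k * u - u = (k - 1) * u" by (simp add: algebra_simps)
  then have "chordal (Some (k * u)) (Some u) = 2 * cmod (k - 1) * (cmod u / sqrt (1 + (cmod u)\<^sup>2)) / sqrt (1 + (cmod (k * u))\<^sup>2)"
    by (simp only: chordal_Some norm_mult) (simp add: mult_ac)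
  also have "\<dots> \<le> 2 * cmod (k - 1) * 1 / 1"
  proof (rule frac_le)
    have "cmod u \<le> sqrt (1 + (cmod u)\<^sup>2)" by (intro real_le_rsqrt) simp
    then have "cmod u / sqrt (1 + (cmod u)\<^sup>2) \<le> 1" using sqrt_one_plus_pos(1)[of u] by (simp add: divide_le_eq)
    then show "2 * cmod (k - 1) * (cmod u / sqrt (1 + (cmod u)\<^sup>2)) \<le> 2 * cmod (k - 1) * 1" by (intro mult_left_mono) auto
  qed auto
  finally show ?thesis by simp
qed

text \<open>On the disc of radius n the partial products are one fixed finite product times the
  exponential of a uniformly convergent tail. Poles are common to the later partial products and the
  limit, so they cause no chordal error.\<close>

lemma product_limit:
  assumes lf: "locally_finite D" and D0: "D 0 = 0" and N: "\<And>c. dabs D (cball c 1) \<le> N"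
    and F: "((\<lambda>r. dsum D {z. 1 \<le> cmod z \<and> cmod z < r} (\<lambda>z. 1 / z\<^sup>2)) \<longlongrightarrow> L) at_top"
  obtains g where "chordal_lim_real (prod_quot D) g" "\<And>z. D z < 0 \<Longrightarrow> g z = None"
    "\<And>z. D z \<ge> 0 \<Longrightarrow> \<exists>w. g z = Some w \<and> ((\<lambda>r. sprod D (ball 0 r) z) \<longlongrightarrow> w) at_top"
    "\<And>n::nat. n \<ge> 1 \<Longrightarrow> \<exists>F. F holomorphic_on ball 0 (real n) \<and> (\<forall>z\<in>ball 0 (real n). F z \<noteq> 0) \<and>
       (\<forall>z\<in>ball 0 (real n). D z \<ge> 0 \<longrightarrow> g z = Some (F z * divpoly D (ball 0 (real n)) z))"
proof -
  define G where "G = (\<lambda>(n::nat) r z. dsum D (ball 0 r - ball 0 (2 * real n)) (\<lambda>a. Ln (1 - z / a) + z / a))"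
  have "\<forall>n. \<exists>S. n \<ge> 1 \<longrightarrow> uniform_limit (cball 0 (real n)) (G n) S at_top \<and> S holomorphic_on ball 0 (real n)"
  proof
    fix n :: nat
    show "\<exists>S. n \<ge> 1 \<longrightarrow> uniform_limit (cball 0 (real n)) (G n) S at_top \<and> S holomorphic_on ball 0 (real n)"
    proof (cases "n \<ge> 1")
      case True
      obtain S where "uniform_limit (cball 0 (real n)) (\<lambda>r z. dsum D (ball 0 r - ball 0 (2 * real n)) (\<lambda>a. Ln (1 - z / a) + z / a)) S at_top"
          "S holomorphic_on ball 0 (real n)"
        by (rule sprod_tail_converges[OF lf D0 N F True])
      then show ?thesis unfolding G_def by blast
    qed simp
  qed
  then obtain S where S: "\<And>n. n \<ge> 1 \<Longrightarrow> uniform_limit (cball 0 (real n)) (G n) (S n) at_top" "\<And>n. n \<ge> 1 \<Longrightarrow> S n holomorphic_on ball 0 (real n)"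
    by metis
  define g where "g = (\<lambda>z. if D z < 0 then None else Some (Lim at_top (\<lambda>r. sprod D (ball 0 r) z)))"
  have ext: "sprod D (ball 0 r) z = sprod D (ball 0 (2 * real n)) z * exp (G n r z)" if "n \<ge> 1" "cmod z \<le> real n" "r \<ge> 2 * real n" for n r z
    unfolding G_def by (rule sprod_extend[OF lf D0]) (use that in auto)
  have lim: "((\<lambda>r. sprod D (ball 0 r) z) \<longlongrightarrow> sprod D (ball 0 (2 * real n)) z * exp (S n z)) at_top"
    if n: "n \<ge> 1" "cmod z \<le> real n" for n z
  proof -
    have "((\<lambda>r. G n r z) \<longlongrightarrow> S n z) at_top" by (rule tendsto_uniform_limitI[OF S(1)]) (use n in auto)
    then have "((\<lambda>r. sprod D (ball 0 (2 * real n)) z * exp (G n r z)) \<longlongrightarrow> sprod D (ball 0 (2 * real n)) z * exp (S n z)) at_top"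
      by (intro tendsto_intros)
    then show ?thesis
    proof (rule filterlim_cong[THEN iffD1, OF refl refl, rotated])
      show "\<forall>\<^sub>F r in at_top. sprod D (ball 0 (2 * real n)) z * exp (G n r z) = sprod D (ball 0 r) z"
        using eventually_ge_at_top[of "2 * real n"] by eventually_elim (rule ext[OF n, symmetric])
    qed
  qed
  have gval: "g z = Some (sprod D (ball 0 (2 * real n)) z * exp (S n z))" if "n \<ge> 1" "cmod z \<le> real n" "D z \<ge> 0" for n z
    using tendsto_Lim[OF _ lim[OF that(1,2)]] that(3) by (simp add: g_def)
  show thesis
  proof (rule that[of g])
    show "chordal_lim_real (prod_quot D) g" unfolding chordal_lim_real_def
    proof (intro allI impI)
      fix K :: "complex set" and e :: real assume K: "compact K" and e: "e > 0"
      obtain b where b: "\<forall>z\<in>K. cmod z \<le> b" using compact_imp_bounded[OF K] by (auto simp: bounded_iff)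
      obtain n0 :: nat where n0: "b \<le> real n0" using real_arch_simple by blast
      define n where "n = Suc n0"
      have n: "n \<ge> 1" "\<And>z. z \<in> K \<Longrightarrow> cmod z \<le> real n" using b n0 by (auto simp: n_def intro: order_trans)
      have "isCont exp (0::complex)" by simp
      then obtain d where d: "d > 0" "\<And>u::complex. dist u 0 < d \<Longrightarrow> dist (exp u) (exp 0) < e / 2"
        using e unfolding continuous_at_eps_delta by (metis half_gt_zero)
      have "\<forall>\<^sub>F r in at_top. \<forall>z\<in>cball 0 (real n). dist (G n r z) (S n z) < d"
        using S(1)[OF n(1)] d(1) unfolding uniform_limit_iff by blast
      then obtain R where R: "\<And>r z. r \<ge> R \<Longrightarrow> z \<in> cball 0 (real n) \<Longrightarrow> dist (G n r z) (S n z) < d"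
        unfolding eventually_at_top_linorder by blast
      have "chordal (prod_quot D r z) (g z) < e" if r: "r \<ge> max R (2 * real n)" and z: "z \<in> K" for r z
      proof -
        have zn: "cmod z \<le> real n" using n z by blast
        have "cmod z < r" using zn r n(1) by simp
        note pq = prod_quot_sprod[OF lf D0 this]
        show ?thesis
        proof (cases "D z < 0")
          case True
          then show ?thesis using pq e by (simp add: g_def)
        next
          case False
          define k where "k = exp (G n r z - S n z)"
          have "sprod D (ball 0 r) z = k * (sprod D (ball 0 (2 * real n)) z * exp (S n z))"
            using ext[OF n(1) zn, of r] r by (simp add: k_def exp_diff)
          then have "chordal (prod_quot D r z) (g z) \<le> 2 * cmod (k - 1)"
            using pq False gval[OF n(1) zn] chordal_mult_le by simp
          moreover have "dist (exp (G n r z - S n z)) (exp 0) < e / 2"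
            by (rule d(2)) (use R[of r z] r zn in \<open>simp add: dist_norm\<close>)
          ultimately show ?thesis by (simp add: k_def dist_norm)
        qed
      qed
      then show "\<exists>R. \<forall>r\<ge>R. \<forall>z\<in>K. chordal (prod_quot D r z) (g z) < e" by blast
    qed
    show "g z = None" if "D z < 0" for z using that by (simp add: g_def)
    show "\<exists>w. g z = Some w \<and> ((\<lambda>r. sprod D (ball 0 r) z) \<longlongrightarrow> w) at_top" if D: "D z \<ge> 0" for z
    proof -
      obtain n0 :: nat where n0: "cmod z \<le> real n0" using real_arch_simple by blast
      have n: "Suc n0 \<ge> 1" "cmod z \<le> real (Suc n0)" using n0 by auto
      show ?thesis using lim[OF n] gval[OF n D] by blast
    qed
    fix n :: nat assume n: "n \<ge> 1"
    let ?B = "ball (0::complex) (real n)" and ?A = "ball (0::complex) (2 * real n)"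
    \<comment> \<open>By 1 - z/a = (-1/a)(z - a), the factors of points in \<open>?B\<close> split
      into a zero-free part and \<open>divpoly\<close>. The factors of points in
      \<open>?A - ?B\<close> and the tail have no zeros or poles in \<open>?B\<close>.\<close>
    define F where "F = (\<lambda>z. exp (S n z) * (sprod D (?A - ?B) z * (\<Prod>a\<in>{a\<in>?B. D a \<noteq> 0}. ((- 1 / a) * exp (z / a)) powi D a)))"
    have fin: "finite {a\<in>?A. D a \<noteq> 0}" by (rule locally_finite_bounded[OF lf bounded_ball])
    have finB: "finite {a\<in>?B. D a \<noteq> 0}" by (rule locally_finite_bounded[OF lf bounded_ball])
    have finAB: "finite {a\<in>?A - ?B. D a \<noteq> 0}" by (rule finite_subset[OF _ fin]) auto
    have nzA: "1 - z / a \<noteq> 0" "a \<noteq> 0" if "a \<in> {a\<in>?A - ?B. D a \<noteq> 0}" "z \<in> ?B" for a z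
    proof -
      show "a \<noteq> 0" using that D0 by auto
      moreover have "z \<noteq> a" using that by auto
      ultimately show "1 - z / a \<noteq> 0" by simp
    qed
    have nzB: "a \<noteq> 0" if "a \<in> {a\<in>?B. D a \<noteq> 0}" for a using that D0 by auto
    have "F holomorphic_on ?B" unfolding F_def sprod_def
      using nzA nzB by (intro holomorphic_intros S(2)[OF n]) auto
    moreover have "F z \<noteq> 0" if "z \<in> ?B" for z
    proof -
      have "sprod D (?A - ?B) z \<noteq> 0" unfolding sprod_def using nzA that
        by (subst prod_zero_iff[OF finAB]) (auto simp: power_int_eq_0_iff)
      moreover have "(\<Prod>a\<in>{a\<in>?B. D a \<noteq> 0}. ((- 1 / a) * exp (z / a)) powi D a) \<noteq> 0"
        using nzB by (subst prod_zero_iff[OF finB]) (auto simp: power_int_eq_0_iff)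
      ultimately show ?thesis by (simp add: F_def)
    qed
    moreover have "g z = Some (F z * divpoly D ?B z)" if z: "z \<in> ?B" and D: "D z \<ge> 0" for z
    proof -
      have "{a\<in>?A. D a \<noteq> 0} = {a\<in>?A - ?B. D a \<noteq> 0} \<union> {a\<in>?B. D a \<noteq> 0}" by auto
      then have "sprod D ?A z = sprod D (?A - ?B) z * (\<Prod>a\<in>{a\<in>?B. D a \<noteq> 0}. ((1 - z / a) * exp (z / a)) powi D a)"
        unfolding sprod_def using fin by (simp only:) (rule prod.union_disjoint, auto)
      also have "(\<Prod>a\<in>{a\<in>?B. D a \<noteq> 0}. ((1 - z / a) * exp (z / a)) powi D a)
         = (\<Prod>a\<in>{a\<in>?B. D a \<noteq> 0}. ((- 1 / a) * exp (z / a)) powi D a * (z - a) powi D a)"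
      proof (intro prod.cong refl)
        fix a assume "a \<in> {a\<in>?B. D a \<noteq> 0}"
        then have "a \<noteq> 0" by (rule nzB)
        then have "(1 - z / a) * exp (z / a) = ((- 1 / a) * exp (z / a)) * (z - a)" by (simp add: field_simps)
        then show "((1 - z / a) * exp (z / a)) powi D a = ((- 1 / a) * exp (z / a)) powi D a * (z - a) powi D a"
          by (simp only: power_int_mult_distrib)
      qed
      also have "\<dots> = (\<Prod>a\<in>{a\<in>?B. D a \<noteq> 0}. ((- 1 / a) * exp (z / a)) powi D a) * divpoly D ?B z"
        by (simp add: prod.distrib divpoly_def)
      finally have "sprod D ?A z * exp (S n z) = F z * divpoly D ?B z" by (simp add: F_def mult_ac)
      then show ?thesis using gval[OF n _ D] z by simp
    qed
    ultimately show "\<exists>F. F holomorphic_on ?B \<and> (\<forall>z\<in>?B. F z \<noteq> 0) \<and> (\<forall>z\<in>?B. D z \<ge> 0 \<longrightarrow> g z = Some (F z * divpoly D ?B z))"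
      by blast
  qed
qed

lemma factored_divisor:
  assumes lf: "locally_finite D" and None: "\<And>z. D z < 0 \<Longrightarrow> f z = None"
    and F: "\<And>n::nat. n \<ge> 1 \<Longrightarrow> \<exists>F. F holomorphic_on ball 0 (real n) \<and> (\<forall>z\<in>ball 0 (real n). F z \<noteq> 0) \<and>
       (\<forall>z\<in>ball 0 (real n). D z \<ge> 0 \<longrightarrow> f z = Some (F z * divpoly D (ball 0 (real n)) z))"
  shows "divisor_of D f"
proof (rule divisor_of_intro[OF lf])
  fix z
  obtain n0 :: nat where n0: "cmod z \<le> real n0" using real_arch_simple by blast
  obtain F where "F holomorphic_on ball 0 (real (Suc n0))" "\<forall>z\<in>ball 0 (real (Suc n0)). F z \<noteq> 0"
       "\<forall>z\<in>ball 0 (real (Suc n0)). D z \<ge> 0 \<longrightarrow> f z = Some (F z * divpoly D (ball 0 (real (Suc n0))) z)"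
    using F[of "Suc n0"] by auto
  then show "mer_order f z (D z)"
    using n0 None by (intro mer_order_of_factor[OF lf, of "ball 0 (real (Suc n0))" z F f]) auto
qed

section \<open>Growth of the product\<close>

text \<open>For 0 < x < r the mean of ln |z - a| over the disc of radius r about 0, with |a| = x, is
  ln r - (1 - x^2/r^2)/2; \<open>kern r x\<close> is this minus ln x. It vanishes to second order as
  x approaches r.\<close>

definition kern :: "real \<Rightarrow> real \<Rightarrow> real" where
  "kern r x = (if x < r then ln (r / x) - (1 - x\<^sup>2 / r\<^sup>2) / 2 else 0)"

text \<open>In terms of s = x^2/r^2 the kernel is (-ln s - (1 - s))/2, which is at most (1 -
  s)^2/(2s); and 1 - s = O(t/r).\<close>

lemma kern_bound:
  assumes r: "r > 0" and x: "x \<ge> r / 2" "x \<ge> r - t" "t \<ge> 0"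
  shows "\<bar>kern r x\<bar> \<le> 8 * t\<^sup>2 / r\<^sup>2"
proof (cases "x < r")
  case True
  have xpos: "x > 0" using r x by linarith
  define s where "s = x\<^sup>2 / r\<^sup>2"
  have s0: "s > 0" "s < 1" "s \<ge> 1/4"
  proof -
    show "s > 0" using r xpos by (simp add: s_def)
    have "x\<^sup>2 < r\<^sup>2" using True xpos by (intro power_strict_mono) auto
    then show "s < 1" using r by (simp add: s_def)
    have "(r / 2)\<^sup>2 \<le> x\<^sup>2" using x r by (intro power_mono) auto
    then show "s \<ge> 1/4" using r by (simp add: s_def power_divide field_simps)
  qed
  have st: "1 - s \<le> 2 * t / r"
  proof -
    have "1 - s = (r - x) * (r + x) / r\<^sup>2" using r by (simp add: s_def field_simps power2_eq_square)
    also have "\<dots> \<le> t * (2 * r) / r\<^sup>2" using True xpos x r by (intro divide_right_mono mult_mono) auto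
    finally show ?thesis using r by (simp add: power2_eq_square mult.commute)
  qed
  have k: "kern r x = (- ln s - (1 - s)) / 2"
  proof -
    have "ln s = 2 * ln x - 2 * ln r" using r xpos by (simp add: s_def ln_div ln_realpow)
    moreover have "kern r x = ln r - ln x - (1 - s) / 2" using True r xpos by (simp add: kern_def s_def ln_div)
    ultimately show ?thesis by (simp add: diff_divide_distrib)
  qed
  have "ln s \<le> s - 1" using s0 by (intro ln_le_minus_one)
  then have k0: "kern r x \<ge> 0" by (simp add: k)
  have "- ln s = ln (1 / s)" using s0 by (simp add: ln_div)
  also have "\<dots> \<le> 1 / s - 1" using s0 by (intro ln_le_minus_one) auto
  finally have "- ln s - (1 - s) \<le> 1 / s - 1 - (1 - s)" by simp
  also have "\<dots> = (1 - s)\<^sup>2 / s" using s0 by (simp add: field_simps power2_eq_square)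
  also have "\<dots> \<le> (1 - s)\<^sup>2 / (1/4)" using s0 by (intro divide_left_mono) auto
  also have "\<dots> \<le> (2 * t / r)\<^sup>2 / (1/4)" using st s0 by (intro divide_right_mono power_mono) auto
  finally have "kern r x \<le> 8 * t\<^sup>2 / r\<^sup>2" by (simp add: k power_divide power_mult_distrib)
  then show ?thesis using k0 by simp
next
  case False
  then show ?thesis by (simp add: kern_def)
qed

lemma dsum_extend:
  assumes "locally_finite D" "bounded V" "A \<subseteq> V" "\<And>a. a \<in> V - A \<Longrightarrow> D a \<noteq> 0 \<Longrightarrow> \<phi> a = 0"
  shows "dsum D A \<phi> = dsum D V \<phi>"
proof -
  have "dsum D (V - A) \<phi> = 0" unfolding dsum_def using assms(4) by (intro sum.neutral) auto
  then show ?thesis using dsum_diff[OF assms(1-3), of \<phi>] by simp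
qed

lemma wide_annulus_count:
  assumes lf: "locally_finite D" and N: "\<And>c. dabs D (cball c 1) \<le> N" and r: "r \<ge> 1 + real M"
  shows "dabs D (ball 0 (r + real M) - ball 0 (r - real M)) \<le> 100 * N * real M * r"
proof -
  have Npos: "N \<ge> 0" using N[of 0] dabs_nonneg order_trans by blast
  let ?R = "\<lambda>j::nat. {z. r - real M + real j \<le> cmod (z - 0) \<and> cmod (z - 0) \<le> r - real M + real j + 1}"
  have b: "bounded (?R j)" for j by (rule bounded_subset[of "cball 0 (r - real M + real j + 1)"]) auto
  have "ball 0 (r + real M) - ball 0 (r - real M) \<subseteq> (\<Union>j\<in>{..<2 * M}. ?R j)"
  proof
    fix z :: complex assume "z \<in> ball 0 (r + real M) - ball 0 (r - real M)"
    then have z: "r - real M \<le> cmod z" "cmod z < r + real M" by auto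
    define j where "j = nat \<lfloor>cmod z - (r - real M)\<rfloor>"
    have "real j \<le> cmod z - (r - real M)" "cmod z - (r - real M) < real j + 1" using z unfolding j_def by linarith+
    moreover from this have "j < 2 * M" using z by linarith
    ultimately show "z \<in> (\<Union>j\<in>{..<2 * M}. ?R j)" by (intro UN_I[of j]) auto
  qed
  then have "dabs D (ball 0 (r + real M) - ball 0 (r - real M)) \<le> dabs D (\<Union>j\<in>{..<2 * M}. ?R j)"
    using b by (intro dabs_mono[OF lf]) (auto simp: bounded_UN)
  also have "\<dots> \<le> (\<Sum>j\<in>{..<2 * M}. dabs D (?R j))" by (rule dabs_UN_le[OF lf _ b]) auto
  also have "\<dots> \<le> (\<Sum>j\<in>{..<2 * M}. 50 * N * r)"
  proof (rule sum_mono)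
    fix j assume j: "j \<in> {..<2 * M}"
    have "dabs D (?R j) \<le> 25 * N * (r - real M + real j)" using r by (intro ring_count[OF lf N]) simp
    also have "\<dots> \<le> 25 * N * (2 * r)" using j r Npos by (intro mult_left_mono) auto
    finally show "dabs D (?R j) \<le> 50 * N * r" by simp
  qed
  finally show ?thesis by (simp add: mult_ac)
qed

text \<open>Passing from r to r + 1 raises the Jensen sum by the net count times ln ((r + 1)/r),
  about 1/r, plus a bounded contribution of the ring. A bounded Jensen sum thus forces zeros and
  poles in a disc to balance up to O(r), although each may number about r^2.\<close>

lemma net_count_linear:
  assumes lf: "locally_finite D" and N: "\<And>c. dabs D (cball c 1) \<le> N"
    and I: "\<And>r. r > 1 \<Longrightarrow> \<bar>dsum D (ball 0 r) (\<lambda>a. ln (r / max 1 (cmod a)))\<bar> \<le> C" and r: "r > 1"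
  shows "\<bar>dsum D (ball 0 r) (\<lambda>_. 1::real)\<bar> \<le> (2 * C + 25 * N) * (r + 1)"
proof -
  have Npos: "N \<ge> 0" using N[of 0] dabs_nonneg order_trans by blast
  let ?A = "ball (0::complex) (r + 1) - ball 0 r" and ?l = "ln ((r + 1) / r)"
  have l: "?l \<ge> 1 / (r + 1)" "?l \<le> 1 / r"
  proof -
    have "ln (r / (r + 1)) \<le> r / (r + 1) - 1" using r by (intro ln_le_minus_one) auto
    also have "\<dots> = - (1 / (r + 1))" using r by (simp add: field_simps)
    finally show "?l \<ge> 1 / (r + 1)" using r by (simp add: ln_div)
    have "?l \<le> (r + 1) / r - 1" using r by (intro ln_le_minus_one) auto
    then show "?l \<le> 1 / r" using r by (simp add: field_simps)
  qed
  have lpos: "?l > 0" using l(1) r by (smt (verit) divide_pos_pos)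
  have "dsum D (ball 0 (r + 1)) (\<lambda>a. ln ((r + 1) / max 1 (cmod a))) = dsum D (ball 0 r) (\<lambda>a. ln ((r + 1) / max 1 (cmod a))) + dsum D ?A (\<lambda>a. ln ((r + 1) / max 1 (cmod a)))"
    by (rule dsum_diff[OF lf]) auto
  also have "dsum D (ball 0 r) (\<lambda>a. ln ((r + 1) / max 1 (cmod a))) = dsum D (ball 0 r) (\<lambda>a. ln (r / max 1 (cmod a)) + ?l * 1)"
    using r by (intro dsum_cong) (auto simp: ln_div max_def)
  also have "\<dots> = dsum D (ball 0 r) (\<lambda>a. ln (r / max 1 (cmod a))) + ?l * dsum D (ball 0 r) (\<lambda>_. 1)"
    unfolding dsum_add dsum_cmult ..
  finally have e: "?l * dsum D (ball 0 r) (\<lambda>_. 1) = dsum D (ball 0 (r + 1)) (\<lambda>a. ln ((r + 1) / max 1 (cmod a)))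
      - dsum D (ball 0 r) (\<lambda>a. ln (r / max 1 (cmod a))) - dsum D ?A (\<lambda>a. ln ((r + 1) / max 1 (cmod a)))" by simp
  have "norm (dsum D ?A (\<lambda>a. ln ((r + 1) / max 1 (cmod a)))) \<le> dabs D ?A * ?l"
  proof (rule norm_dsum_le)
    fix a :: complex assume "a \<in> ?A"
    then have a: "r \<le> cmod a" "cmod a < r + 1" by auto
    then have m: "max 1 (cmod a) = cmod a" using r by auto
    have "cmod a > 0" using a r by linarith
    then have "0 \<le> ln ((r + 1) / cmod a)" using a by (intro ln_ge_zero) (simp add: le_divide_eq)
    moreover have "ln ((r + 1) / cmod a) \<le> ?l"
      using a r by (subst ln_le_cancel_iff) (auto intro!: divide_left_mono divide_pos_pos mult_pos_pos)
    ultimately show "norm (ln ((r + 1) / max 1 (cmod a))) \<le> ?l" by (simp add: m)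
  qed
  also have "dabs D ?A * ?l \<le> (25 * N * r) * (1 / r)"
  proof (rule mult_mono)
    show "dabs D ?A \<le> 25 * N * r" using r by (intro unit_annulus_count[OF lf N]) auto
  qed (use l lpos Npos r in auto)
  finally have A: "\<bar>dsum D ?A (\<lambda>a. ln ((r + 1) / max 1 (cmod a)))\<bar> \<le> 25 * N" using r by simp
  have "\<bar>?l * dsum D (ball 0 r) (\<lambda>_. 1)\<bar> \<le> 2 * C + 25 * N"
    using e A I[OF r] I[of "r + 1"] r by linarith
  then have "?l * \<bar>dsum D (ball 0 r) (\<lambda>_. 1)\<bar> \<le> 2 * C + 25 * N" using lpos by (simp add: abs_mult)
  moreover have "1 / (r + 1) * \<bar>dsum D (ball 0 r) (\<lambda>_. 1)\<bar> \<le> ?l * \<bar>dsum D (ball 0 r) (\<lambda>_. 1)\<bar>"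
    using l by (intro mult_right_mono) auto
  ultimately have "\<bar>dsum D (ball 0 r) (\<lambda>_. 1)\<bar> / (r + 1) \<le> 2 * C + 25 * N" by simp
  then show ?thesis using r by (simp add: pos_divide_le_eq)
qed

text \<open>The sums with kernel \<open>kern r\<close> are area means of \<open>ln \<bar>f\<bar>\<close> minus its value at the center, so this says that the
  means over discs of radius \<open>r\<close> about \<open>c\<close> and about \<open>0\<close> agree in the limit.\<close>
lemma area_means_agree:
  assumes lf: "locally_finite D" and D0: "D 0 = 0" and N: "\<And>c. dabs D (cball c 1) \<le> N"
    and I: "\<And>r. r > 1 \<Longrightarrow> \<bar>dsum D (ball 0 r) (\<lambda>a. ln (r / max 1 (cmod a)))\<bar> \<le> C" and c: "D c = 0"
  shows "((\<lambda>r. dsum D (ball 0 r) (\<lambda>a. ln (cmod (1 - c / a)) + Re (c * cnj a) / r\<^sup>2)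
      + dsum D (ball c r) (\<lambda>a. kern r (cmod (a - c))) - dsum D (ball 0 r) (\<lambda>a. kern r (cmod a))) \<longlongrightarrow> 0) at_top"
proof -
  have Npos: "N \<ge> 0" using N[of 0] dabs_nonneg order_trans by blast
  have Cpos: "C \<ge> 0" using I[of 2] by linarith
  obtain M0 :: nat where "cmod c < real M0" using reals_Archimedean2 by blast
  define M where "M = Suc M0"
  have M: "cmod c < real M" "real M \<ge> 1" using \<open>cmod c < real M0\<close> by (auto simp: M_def)
  define t where "t = (\<lambda>r a. ln (cmod (1 - c / a)) + Re (c * cnj a) / r\<^sup>2)"
  \<comment> \<open>The total contribution of a single point, so that the three sums over different
    discs become one sum over \<open>?V\<close>.\<close>
  define b where "b = (\<lambda>r a. (if cmod a < r then t r a else 0) + kern r (cmod (a - c)) - kern r (cmod a))"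
  define \<Phi> where "\<Phi> = (\<lambda>r. dsum D (ball 0 r) (t r) + dsum D (ball c r) (\<lambda>a. kern r (cmod (a - c))) - dsum D (ball 0 r) (\<lambda>a. kern r (cmod a)))"
  define K where "K = (real M)\<^sup>2 * (2 * C + 25 * N) + 100 * N * real M * (52 * (real M)\<^sup>2)"
  have main: "\<bar>\<Phi> r\<bar> \<le> K / r" if r: "r \<ge> 4 * real M + 2" for r
  proof -
    have rpos: "r > 0" using r by simp
    let ?V = "ball (0::complex) (r + real M)" and ?W = "ball (0::complex) (r - real M)"
    have \<Phi>: "\<Phi> r = dsum D ?V (b r)"
    proof -
      have "dsum D (ball 0 r) (t r) = dsum D (ball 0 r) (\<lambda>a. if cmod a < r then t r a else 0)" by (rule dsum_cong) auto
      also have "\<dots> = dsum D ?V (\<lambda>a. if cmod a < r then t r a else 0)" by (rule dsum_extend[OF lf]) auto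
      finally have 1: "dsum D (ball 0 r) (t r) = dsum D ?V (\<lambda>a. if cmod a < r then t r a else 0)" .
      have 2: "dsum D (ball c r) (\<lambda>a. kern r (cmod (a - c))) = dsum D ?V (\<lambda>a. kern r (cmod (a - c)))"
      proof (rule dsum_extend[OF lf bounded_ball])
        show "ball c r \<subseteq> ?V"
        proof
          fix x assume "x \<in> ball c r"
          then show "x \<in> ?V" using M(1) dist_triangle[of 0 x c] by (simp add: dist_norm)
        qed
        fix a assume "a \<in> ?V - ball c r"
        then show "kern r (cmod (a - c)) = 0" by (simp add: kern_def dist_norm norm_minus_commute)
      qed
      have 3: "dsum D (ball 0 r) (\<lambda>a. kern r (cmod a)) = dsum D ?V (\<lambda>a. kern r (cmod a))"
        by (rule dsum_extend[OF lf]) (auto simp: kern_def)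
      show ?thesis unfolding \<Phi>_def 1 2 3 dsum_add[symmetric] dsum_sub[symmetric] b_def ..
    qed
    also have "\<dots> = dsum D ?W (b r) + dsum D (?V - ?W) (b r)" by (rule dsum_diff[OF lf]) auto
    \<comment> \<open>A point inside both discs, away from their boundaries, has its logarithms
      cancelled and keeps only |c|^2/(2r^2). This is independent of \<open>a\<close>, so the net
      count suffices and gives O(1/r).\<close>
    also have "dsum D ?W (b r) = dsum D ?W (\<lambda>_. (cmod c)\<^sup>2 / (2 * r\<^sup>2) * 1)"
    proof (rule dsum_cong)
      fix a assume a: "a \<in> ?W" "D a \<noteq> 0"
      have a0: "a \<noteq> 0" "a \<noteq> c" using a D0 c by auto
      have ar: "cmod a < r" "cmod (a - c) < r" using a M norm_triangle_ineq4[of a c] by auto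
      have "1 - c / a = (a - c) / a" using a0 by (simp add: field_simps)
      then have l: "ln (cmod (1 - c / a)) = ln (cmod (a - c)) - ln (cmod a)" using a0 by (simp add: norm_divide ln_div)
      have sq: "(cmod (a - c))\<^sup>2 = (cmod a)\<^sup>2 + (cmod c)\<^sup>2 - 2 * Re (c * cnj a)"
        unfolding cmod_minus_square by simp
      have "b r a = Re (c * cnj a) / r\<^sup>2 + (cmod (a - c))\<^sup>2 / (2 * r\<^sup>2) - (cmod a)\<^sup>2 / (2 * r\<^sup>2)"
      proof -
        have "kern r (cmod (a - c)) = ln r - ln (cmod (a - c)) - (1 - (cmod (a - c))\<^sup>2 / r\<^sup>2) / 2"
          "kern r (cmod a) = ln r - ln (cmod a) - (1 - (cmod a)\<^sup>2 / r\<^sup>2) / 2"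
          using ar a0 rpos by (simp_all add: kern_def ln_div)
        then show ?thesis using ar(1) by (simp add: b_def t_def l diff_divide_distrib)
      qed
      also have "\<dots> = (cmod c)\<^sup>2 / (2 * r\<^sup>2)" unfolding sq using rpos by (simp add: field_simps)
      finally show "b r a = (cmod c)\<^sup>2 / (2 * r\<^sup>2) * 1" by simp
    qed
    also have "\<dots> = (cmod c)\<^sup>2 / (2 * r\<^sup>2) * dsum D ?W (\<lambda>_. 1)" by (rule dsum_cmult)
    finally have \<Phi>2: "\<Phi> r = (cmod c)\<^sup>2 / (2 * r\<^sup>2) * dsum D ?W (\<lambda>_. 1) + dsum D (?V - ?W) (b r)" .
    have p1: "\<bar>(cmod c)\<^sup>2 / (2 * r\<^sup>2) * dsum D ?W (\<lambda>_. 1)\<bar> \<le> (real M)\<^sup>2 * (2 * C + 25 * N) / r"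
    proof -
      have "\<bar>dsum D ?W (\<lambda>_. 1::real)\<bar> \<le> (2 * C + 25 * N) * (r - real M + 1)"
        by (rule net_count_linear[OF lf N I]) (use r M in auto)
      also have "\<dots> \<le> (2 * C + 25 * N) * (2 * r)" using r Cpos Npos by (intro mult_left_mono) auto
      finally have "\<bar>dsum D ?W (\<lambda>_. 1::real)\<bar> \<le> (2 * C + 25 * N) * (2 * r)" .
      moreover have "(cmod c)\<^sup>2 / (2 * r\<^sup>2) \<le> (real M)\<^sup>2 / (2 * r\<^sup>2)" using M rpos by (intro divide_right_mono power_mono) auto
      ultimately have "(cmod c)\<^sup>2 / (2 * r\<^sup>2) * \<bar>dsum D ?W (\<lambda>_. 1)\<bar> \<le> (real M)\<^sup>2 / (2 * r\<^sup>2) * ((2 * C + 25 * N) * (2 * r))"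
        by (intro mult_mono) auto
      also have "\<dots> = (real M)\<^sup>2 * (2 * C + 25 * N) / r" using rpos by (simp add: power2_eq_square)
      finally show ?thesis by (simp add: abs_mult)
    qed
    have p2: "\<bar>dsum D (?V - ?W) (b r)\<bar> \<le> 100 * N * real M * (52 * (real M)\<^sup>2) / r"
    proof -
      \<comment> \<open>Near the boundary each of the three terms is O(1/r^2), with constants 12, 32
        and 8 adding up to 52, and there are O(r) points.\<close>
      have "norm (dsum D (?V - ?W) (b r)) \<le> dabs D (?V - ?W) * (52 * (real M)\<^sup>2 / r\<^sup>2)"
      proof (rule norm_dsum_le)
        fix a assume a': "a \<in> ?V - ?W" and Da: "D a \<noteq> 0"
        then have a: "r - real M \<le> cmod a" "cmod a < r + real M" by auto
        have a0: "a \<noteq> 0" "cmod a > 0" using Da D0 by auto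
        have ah: "r / 2 \<le> cmod a" using a r by simp
        have ac: "r - 2 * real M \<le> cmod (a - c)" using a M norm_triangle_ineq2[of a c] by linarith
        have k1: "\<bar>kern r (cmod (a - c))\<bar> \<le> 8 * (2 * real M)\<^sup>2 / r\<^sup>2"
          by (rule kern_bound[OF rpos]) (use ac r in auto)
        have k2: "\<bar>kern r (cmod a)\<bar> \<le> 8 * (real M)\<^sup>2 / r\<^sup>2"
          by (rule kern_bound[OF rpos]) (use a ah in auto)
        have k3: "\<bar>if cmod a < r then t r a else 0\<bar> \<le> 12 * (real M)\<^sup>2 / r\<^sup>2"
        proof (cases "cmod a < r")
          case True
          \<comment> \<open>ln |1 - u| = -Re u + O(|u|^2), and Re u = Re (c cnj a)/|a|^2 differs
            from Re (c cnj a)/r^2 by O(1/r^2) because |a| is close to r.\<close>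
          define u where "u = c / a"
          have uM: "cmod u \<le> 2 * real M / r"
          proof -
            have "cmod u \<le> real M / (r / 2)" unfolding u_def norm_divide using M ah rpos by (intro frac_le) auto
            then show ?thesis by (simp add: mult.commute)
          qed
          also have "\<dots> \<le> 1 / 2" using r rpos by (simp add: field_simps)
          finally have u2: "cmod u \<le> 1 / 2" .
          have "1 - u \<noteq> 0" using one_minus_Re_pos[of u] u2 by fastforce
          then have "ln (cmod (1 - u)) + Re u = Re (Ln (1 - u) + u)" by simp
          then have "\<bar>ln (cmod (1 - u)) + Re u\<bar> \<le> cmod (Ln (1 - u) + u)" using abs_Re_le_cmod by metis
          also have "\<dots> \<le> 2 * (cmod u)\<^sup>2" by (rule Ln_one_minus_bounds(1)[OF u2])
          also have "\<dots> \<le> 2 * (2 * real M / r)\<^sup>2" using uM by (intro mult_left_mono power_mono) auto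
          finally have q1: "\<bar>ln (cmod (1 - u)) + Re u\<bar> \<le> 8 * (real M)\<^sup>2 / r\<^sup>2" by (simp add: power_divide power_mult_distrib)
          have Reu: "Re u = Re (c * cnj a) / (cmod a)\<^sup>2" 
            unfolding u_def complex_div_cnj[of c a] by (simp only: of_real_power[symmetric] Re_divide_of_real)
          have "(r - cmod a) * (r + cmod a) \<le> real M * (2 * r)" using True a a0 rpos by (intro mult_mono) auto
          then have q3: "r\<^sup>2 - (cmod a)\<^sup>2 \<le> 2 * real M * r" by (simp add: power2_eq_square algebra_simps)
          have q4: "0 \<le> r\<^sup>2 - (cmod a)\<^sup>2" using True a0 by (simp add: power_mono)
          have "\<bar>Re (c * cnj a)\<bar> \<le> cmod c * cmod a" using abs_Re_le_cmod[of "c * cnj a"] by (simp add: norm_mult)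
          also have "\<dots> \<le> real M * cmod a" using M by (intro mult_right_mono) auto
          finally have q5: "\<bar>Re (c * cnj a)\<bar> \<le> real M * cmod a" .
          have "Re u - Re (c * cnj a) / r\<^sup>2 = Re (c * cnj a) * ((r\<^sup>2 - (cmod a)\<^sup>2) / ((cmod a)\<^sup>2 * r\<^sup>2))"
            unfolding Reu using a0(2) rpos by (simp add: field_simps)
          then have "\<bar>Re u - Re (c * cnj a) / r\<^sup>2\<bar> = \<bar>Re (c * cnj a)\<bar> * ((r\<^sup>2 - (cmod a)\<^sup>2) / ((cmod a)\<^sup>2 * r\<^sup>2))"
            using q4 by (simp add: abs_mult)
          also have "\<dots> \<le> (real M * cmod a) * (2 * real M * r / ((cmod a)\<^sup>2 * r\<^sup>2))"
            using q3 q4 q5 by (intro mult_mono divide_right_mono) auto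
          also have "\<dots> = 2 * (real M)\<^sup>2 / (cmod a * r)" using a0(2) rpos by (simp add: power2_eq_square)
          also have "\<dots> \<le> 2 * (real M)\<^sup>2 / ((r / 2) * r)" using ah rpos a0(2) by (intro divide_left_mono mult_right_mono mult_pos_pos) auto
          finally have q2: "\<bar>Re u - Re (c * cnj a) / r\<^sup>2\<bar> \<le> 4 * (real M)\<^sup>2 / r\<^sup>2" by (simp add: power2_eq_square)
          have "t r a = (ln (cmod (1 - u)) + Re u) - (Re u - Re (c * cnj a) / r\<^sup>2)" by (simp add: t_def u_def)
          then have "\<bar>t r a\<bar> \<le> 8 * (real M)\<^sup>2 / r\<^sup>2 + 4 * (real M)\<^sup>2 / r\<^sup>2"
            using q1 q2 abs_triangle_ineq4[of "ln (cmod (1 - u)) + Re u" "Re u - Re (c * cnj a) / r\<^sup>2"] by linarith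
          then show ?thesis using True by (simp add: add_divide_distrib[symmetric])
        qed simp
        have "\<bar>b r a\<bar> \<le> 12 * (real M)\<^sup>2 / r\<^sup>2 + 8 * (2 * real M)\<^sup>2 / r\<^sup>2 + 8 * (real M)\<^sup>2 / r\<^sup>2"
          using k1 k2 k3 unfolding b_def by linarith
        then show "norm (b r a) \<le> 52 * (real M)\<^sup>2 / r\<^sup>2" by (simp add: power_mult_distrib add_divide_distrib[symmetric])
      qed
      also have "\<dots> \<le> (100 * N * real M * r) * (52 * (real M)\<^sup>2 / r\<^sup>2)"
        using wide_annulus_count[OF lf N, of M r] r by (intro mult_right_mono) auto
      also have "\<dots> = 100 * N * real M * (52 * (real M)\<^sup>2) / r" using rpos by (simp add: power2_eq_square)
      finally show ?thesis by simp
    qed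
    show ?thesis unfolding \<Phi>2 K_def add_divide_distrib using p1 p2 by linarith
  qed
  have "(\<Phi> \<longlongrightarrow> 0) at_top"
  proof (rule Lim_null_comparison)
    show "((\<lambda>r. K / r) \<longlongrightarrow> 0) at_top"
      by (rule tendsto_divide_0[OF tendsto_const filterlim_at_top_imp_at_infinity[OF filterlim_ident]])
    show "\<forall>\<^sub>F r in at_top. norm (\<Phi> r) \<le> K / r"
      using eventually_ge_at_top[of "4 * real M + 2"] by eventually_elim (simp add: main)
  qed
  then show ?thesis unfolding \<Phi>_def t_def .
qed


text \<open>The area kernel is (2/r^2) times the integral of t ln (t/m) over t, an average of Jensen
  kernels, so the bound (d) passes to it. Points closer than 1 to \<open>c\<close> are treated there
  as if at distance 1; the correction is minus their logarithmic sum, up to O(1).\<close>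

lemma area_mean_vs_local:
  assumes lf: "locally_finite D" and N: "\<And>c. dabs D (cball c 1) \<le> N"
    and I: "\<And>r. r > 1 \<Longrightarrow> \<bar>dsum D (ball c r) (\<lambda>a. ln (r / max 1 (cmod (a - c))))\<bar> \<le> C" and c: "D c = 0" and r: "r > 1"
  shows "\<bar>dsum D (ball c r) (\<lambda>a. kern r (cmod (a - c))) + dsum D (ball c 1) (\<lambda>a. ln (cmod (c - a)))\<bar> \<le> 2 * C + N"
proof -
  have Cpos: "C \<ge> 0" using I[of 2] by linarith
  define m where "m = (\<lambda>a. max 1 (cmod (a - c)))"
  have m: "m a > 0" for a by (auto simp: m_def)
  define H where "H = (\<lambda>a t. t\<^sup>2 / 2 * ln (t / m a) - t\<^sup>2 / 4)"
  define h where "h = (\<lambda>a t. t * ln (t / m a))"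
  define X where "X = dsum D (ball c r) (\<lambda>a. (1::real) * of_real (H a r - H a (max 1 (cmod (a - c)))))"
  have "((\<lambda>t. dsum D (ball c t) (\<lambda>a. (1::real) * of_real (h a t))) has_integral X) {1..r}"
    unfolding X_def
  proof (rule dsum_has_integral[OF lf])
    fix a and t :: real assume t: "t \<ge> 1"
    show "(H a has_real_derivative h a t) (at t)" unfolding H_def h_def
      using t m[of a] by (auto intro!: derivative_eq_intros simp: field_simps power2_eq_square)
  qed (use r in auto)
  then have iX: "((\<lambda>t. t * dsum D (ball c t) (\<lambda>a. ln (t / m a))) has_integral X) {1..r}"
    by (simp add: h_def dsum_cmult[symmetric])
  have "norm X \<le> (r * C) * measure lborel {1..r}"
  proof (rule has_integral_bound_real[OF _ _ iX])
    show "finite {1::real}" by simp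
    fix t assume t: "t \<in> {1..r} - {1}"
    then have t1: "t > 1" by auto
    show "norm (t * dsum D (ball c t) (\<lambda>a. ln (t / m a))) \<le> r * C"
      using I[OF t1] t unfolding norm_mult m_def by (intro mult_mono) auto
  qed (use Cpos r in auto)
  also have "\<dots> \<le> (r * C) * r" using r Cpos by (intro mult_left_mono) auto
  finally have X: "\<bar>X\<bar> \<le> C * r\<^sup>2" by (simp add: power2_eq_square mult_ac)
  have "\<bar>2 / r\<^sup>2 * X\<bar> \<le> 2 / r\<^sup>2 * (C * r\<^sup>2)" unfolding abs_mult using X by (intro mult_mono) auto
  then have X2: "\<bar>2 / r\<^sup>2 * X\<bar> \<le> 2 * C" using r by simp
  define s where "s = (\<lambda>a. ((cmod (a - c))\<^sup>2 - 1) / (2 * r\<^sup>2))"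
  have "dsum D (ball c r) (\<lambda>a. kern r (cmod (a - c)))
     = dsum D (ball c r) (\<lambda>a. 2 / r\<^sup>2 * (1 * of_real (H a r - H a (max 1 (cmod (a - c))))) + (if cmod (a - c) < 1 then s a - ln (cmod (c - a)) else 0))"
  proof (rule dsum_cong)
    fix a assume a: "a \<in> ball c r" "D a \<noteq> 0"
    have ac: "a \<noteq> c" using a c by auto
    have pos: "cmod (a - c) > 0" "cmod (a - c) < r" "r > 0" using ac a r by (auto simp: dist_norm norm_minus_commute)
    have "2 / r\<^sup>2 * (H a r - H a (m a)) = ln (r / m a) - (1 - (m a)\<^sup>2 / r\<^sup>2) / 2"
      using m[of a] pos by (simp add: H_def field_simps)
    moreover have "kern r (cmod (a - c)) = ln (r / m a) - (1 - (m a)\<^sup>2 / r\<^sup>2) / 2 + (if cmod (a - c) < 1 then s a - ln (cmod (c - a)) else 0)"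
    proof (cases "cmod (a - c) < 1")
      case True
      then have "m a = 1" by (simp add: m_def)
      then show ?thesis using pos True by (simp add: kern_def s_def ln_div norm_minus_commute[of c a]) (simp add: field_simps)
    next
      case False
      then have "m a = cmod (a - c)" by (simp add: m_def)
      then show ?thesis using pos False by (simp add: kern_def)
    qed
    ultimately show "kern r (cmod (a - c)) = 2 / r\<^sup>2 * (1 * of_real (H a r - H a (max 1 (cmod (a - c))))) + (if cmod (a - c) < 1 then s a - ln (cmod (c - a)) else 0)"
      by (simp add: m_def)
  qed
  also have "\<dots> = 2 / r\<^sup>2 * X + dsum D (ball c r) (\<lambda>a. if cmod (a - c) < 1 then s a - ln (cmod (c - a)) else 0)"
    unfolding dsum_add dsum_cmult X_def ..
  also have "dsum D (ball c r) (\<lambda>a. if cmod (a - c) < 1 then s a - ln (cmod (c - a)) else 0)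
      = dsum D (ball c 1) (\<lambda>a. if cmod (a - c) < 1 then s a - ln (cmod (c - a)) else 0)"
    by (rule dsum_extend[OF lf, symmetric]) (use r in \<open>auto simp: dist_norm norm_minus_commute\<close>)
  also have "\<dots> = dsum D (ball c 1) (\<lambda>a. s a - ln (cmod (c - a)))"
    by (rule dsum_cong) (auto simp: dist_norm norm_minus_commute)
  also have "\<dots> = dsum D (ball c 1) s - dsum D (ball c 1) (\<lambda>a. ln (cmod (c - a)))" by (rule dsum_sub)
  finally have e: "dsum D (ball c r) (\<lambda>a. kern r (cmod (a - c))) + dsum D (ball c 1) (\<lambda>a. ln (cmod (c - a))) = 2 / r\<^sup>2 * X + dsum D (ball c 1) s" by simp
  have "norm (dsum D (ball c 1) s) \<le> dabs D (ball c 1) * 1"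
  proof (rule norm_dsum_le)
    fix a assume "a \<in> ball c 1"
    then have "(cmod (a - c))\<^sup>2 \<le> 1" by (simp add: dist_norm norm_minus_commute power_le_one)
    moreover have "0 \<le> (cmod (a - c))\<^sup>2" by simp
    ultimately have "\<bar>(cmod (a - c))\<^sup>2 - 1\<bar> \<le> 1" by (simp only: abs_le_iff) linarith
    moreover have "1 \<le> r\<^sup>2" using r by (intro one_le_power) simp
    then have "1 \<le> 2 * r\<^sup>2" by linarith
    ultimately show "norm (s a) \<le> 1" by (simp add: s_def divide_le_eq)
  qed
  also have "\<dots> \<le> N" using dabs_mono[OF lf bounded_cball ball_subset_cball, of c 1] N[of c] by simp
  finally have "\<bar>dsum D (ball c 1) s\<bar> \<le> N" by simp
  then show ?thesis unfolding e using X2 by linarith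
qed

text \<open>Since the area means about c and 0 agree in the limit, ln |f(c)| is the limit of
  \<open>K0 r - Kc r\<close>, and each of these is minus a local logarithmic sum up to a constant.
  The local sum at 0 is a fixed number and enters the constant.\<close>

lemma growth_from_limit:
  assumes lf: "locally_finite D" and D0: "D 0 = 0" and N: "\<And>c. dabs D (cball c 1) \<le> N"
    and I: "\<And>c r. r > 1 \<Longrightarrow> \<bar>dsum D (ball c r) (\<lambda>a. ln (r / max 1 (cmod (a - c))))\<bar> \<le> C"
    and f: "\<And>c. D c = 0 \<Longrightarrow> \<exists>w. w \<noteq> 0 \<and> f c = Some w \<and>
      ((\<lambda>r. dsum D (ball 0 r) (\<lambda>a. ln (cmod (1 - c / a)) + Re (c * cnj a) / r\<^sup>2)) \<longlongrightarrow> ln (cmod w)) at_top"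
  shows "growth D f (2 * (2 * C + N) + \<bar>dsum D (ball 0 1) (\<lambda>a. ln (cmod a))\<bar>)"
  unfolding growth_def
proof (intro allI impI)
  fix c assume c: "D c = 0"
  obtain w where w: "w \<noteq> 0" "f c = Some w"
    "((\<lambda>r. dsum D (ball 0 r) (\<lambda>a. ln (cmod (1 - c / a)) + Re (c * cnj a) / r\<^sup>2)) \<longlongrightarrow> ln (cmod w)) at_top"
    using f[OF c] by blast
  define Kc where "Kc = (\<lambda>r. dsum D (ball c r) (\<lambda>a. kern r (cmod (a - c))))"
  define K0 where "K0 = (\<lambda>r. dsum D (ball 0 r) (\<lambda>a. kern r (cmod a)))"
  define Jc where "Jc = dsum D (ball c 1) (\<lambda>a. ln (cmod (c - a)))"
  define J0 where "J0 = dsum D (ball 0 1) (\<lambda>a. ln (cmod a))"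
  have I0: "\<And>r. r > 1 \<Longrightarrow> \<bar>dsum D (ball 0 r) (\<lambda>a. ln (r / max 1 (cmod a)))\<bar> \<le> C" using I[of _ 0] by simp
  have "((\<lambda>r. (dsum D (ball 0 r) (\<lambda>a. ln (cmod (1 - c / a)) + Re (c * cnj a) / r\<^sup>2) + Kc r - K0 r)
     - dsum D (ball 0 r) (\<lambda>a. ln (cmod (1 - c / a)) + Re (c * cnj a) / r\<^sup>2)) \<longlongrightarrow> 0 - ln (cmod w)) at_top"
    unfolding Kc_def K0_def by (intro tendsto_diff w(3) area_means_agree[OF lf D0 N I0 c])
  then have "((\<lambda>r. Kc r - K0 r) \<longlongrightarrow> - ln (cmod w)) at_top" by simp
  then have lim: "((\<lambda>r. \<bar>(Kc r - K0 r) + (Jc - J0)\<bar>) \<longlongrightarrow> \<bar>- ln (cmod w) + (Jc - J0)\<bar>) at_top"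
    by (intro tendsto_intros)
  have ev: "\<forall>\<^sub>F r in at_top. \<bar>(Kc r - K0 r) + (Jc - J0)\<bar> \<le> 2 * (2 * C + N)"
    using eventually_gt_at_top[of 1]
  proof eventually_elim
    case (elim r)
    have 1: "\<bar>Kc r + Jc\<bar> \<le> 2 * C + N" unfolding Kc_def Jc_def by (rule area_mean_vs_local[OF lf N I c elim])
    have 2: "\<bar>K0 r + J0\<bar> \<le> 2 * C + N"
      using area_mean_vs_local[OF lf N I D0 elim] unfolding K0_def J0_def by simp
    have "(Kc r - K0 r) + (Jc - J0) = (Kc r + Jc) - (K0 r + J0)" by simp
    then show ?case using order_trans[OF abs_triangle_ineq4 add_mono[OF 1 2]] by simp
  qed
  have "\<bar>- ln (cmod w) + (Jc - J0)\<bar> \<le> 2 * (2 * C + N)"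
    using tendsto_upperbound[OF lim ev] by simp
  then have "\<bar>ln (cmod w) - Jc\<bar> \<le> 2 * (2 * C + N) + \<bar>J0\<bar>" by linarith
  then show "\<exists>w. w \<noteq> 0 \<and> f c = Some w \<and> \<bar>ln (cmod w) - dsum D (ball c 1) (\<lambda>a. ln (cmod (c - a)))\<bar>
     \<le> 2 * (2 * C + N) + \<bar>dsum D (ball 0 1) (\<lambda>a. ln (cmod a))\<bar>"
    using w unfolding Jc_def J0_def by blast
qed

text \<open>The convergence factors contribute Re (c/a). In \<open>alpha_approx\<close> the same
  terms occur with the opposite sign, so only the correction with r^2 survives, and this is the sum
  treated by \<open>area_means_agree\<close>.\<close>

lemma product_log_limit:
  assumes lf: "locally_finite D" and D0: "D 0 = 0" and c: "D c = 0" and \<alpha>: "(alpha_approx D \<longlongrightarrow> \<alpha>) at_top"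
    and w: "((\<lambda>r. sprod D (ball 0 r) c) \<longlongrightarrow> w) at_top" "w \<noteq> 0"
  shows "((\<lambda>r. dsum D (ball 0 r) (\<lambda>a. ln (cmod (1 - c / a)) + Re (c * cnj a) / r\<^sup>2)) \<longlongrightarrow> ln (cmod (exp (\<alpha> * c) * w))) at_top"
proof -
  have "((\<lambda>r. ln (cmod (sprod D (ball 0 r) c)) + Re (alpha_approx D r * c)) \<longlongrightarrow> ln (cmod w) + Re (\<alpha> * c)) at_top"
    using w by (intro tendsto_intros \<alpha>) auto
  moreover have "ln (cmod (sprod D (ball 0 r) c)) + Re (alpha_approx D r * c)
     = dsum D (ball 0 r) (\<lambda>a. ln (cmod (1 - c / a)) + Re (c * cnj a) / r\<^sup>2)" for r
  proof -
    have fin: "finite {a\<in>ball 0 r. D a \<noteq> 0}" by (rule locally_finite_bounded[OF lf bounded_ball])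
    have nz: "1 - c / a \<noteq> 0" "a \<noteq> 0" if "D a \<noteq> 0" for a
    proof -
      show "a \<noteq> 0" using that D0 by auto
      moreover have "c \<noteq> a" using that c by auto
      ultimately show "1 - c / a \<noteq> 0" by simp
    qed
    have "ln (cmod (sprod D (ball 0 r) c)) = (\<Sum>a\<in>{a\<in>ball 0 r. D a \<noteq> 0}. ln (cmod ((1 - c / a) * exp (c / a)) powi D a))"
      unfolding sprod_def prod_norm[symmetric] norm_power_int
      by (subst ln_prod) (use fin nz in \<open>auto simp: zero_less_power_int norm_mult\<close>)
    also have "\<dots> = dsum D (ball 0 r) (\<lambda>a. ln (cmod (1 - c / a)) + Re (c / a))"
      unfolding dsum_def
    proof (intro sum.cong refl)
      fix a assume "a \<in> {a\<in>ball 0 r. D a \<noteq> 0}"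
      then have "1 - c / a \<noteq> 0" using nz by blast
      then show "ln (cmod ((1 - c / a) * exp (c / a)) powi D a) = of_int (D a) * (ln (cmod (1 - c / a)) + Re (c / a))"
        by (subst ln_power_int_pos) (auto simp: norm_mult ln_mult)
    qed
    finally have 1: "ln (cmod (sprod D (ball 0 r) c)) = dsum D (ball 0 r) (\<lambda>a. ln (cmod (1 - c / a)) + Re (c / a))" .
    have "alpha_approx D r = - (zsum D (ball 0 r) (\<lambda>a. 1 / a - cnj a / of_real (r\<^sup>2)) - psum D (ball 0 r) (\<lambda>a. 1 / a - cnj a / of_real (r\<^sup>2)))"
      by (simp add: alpha_approx_def)
    also have "\<dots> = - dsum D (ball 0 r) (\<lambda>a. 1 / a - cnj a / of_real (r\<^sup>2))"
      by (simp only: zsum_minus_psum[OF lf bounded_ball])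
    finally have "Re (alpha_approx D r * c) = - Re (c * dsum D (ball 0 r) (\<lambda>a. 1 / a - cnj a / of_real (r\<^sup>2)))"
      by (simp add: mult.commute)
    also have "c * dsum D (ball 0 r) (\<lambda>a. 1 / a - cnj a / of_real (r\<^sup>2)) = dsum D (ball 0 r) (\<lambda>a. c * (1 / a - cnj a / of_real (r\<^sup>2)))"
      by (rule dsum_cmult[symmetric])
    also have "Re \<dots> = dsum D (ball 0 r) (\<lambda>a. Re (c * (1 / a - cnj a / of_real (r\<^sup>2))))"
    proof -
      have "Re (of_int k * x) = of_int k * Re x" for k x by simp
      then show ?thesis unfolding dsum_def Re_sum by (simp only:)
    qed
    also have "\<dots> = dsum D (ball 0 r) (\<lambda>a. Re (c / a) - Re (c * cnj a) / r\<^sup>2)"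
    proof (rule dsum_cong)
      fix a
      have "c * (1 / a - cnj a / of_real (r\<^sup>2)) = c / a - c * cnj a / of_real (r\<^sup>2)" by (simp add: right_diff_distrib)
      then show "Re (c * (1 / a - cnj a / of_real (r\<^sup>2))) = Re (c / a) - Re (c * cnj a) / r\<^sup>2"
        by (simp only: minus_complex.sel Re_divide_of_real)
    qed
    finally have 2: "Re (alpha_approx D r * c) = - dsum D (ball 0 r) (\<lambda>a. Re (c / a) - Re (c * cnj a) / r\<^sup>2)" .
    show ?thesis unfolding 1 2 diff_conv_add_uminus[symmetric] dsum_sub[symmetric] by (rule dsum_cong) simp
  qed
  moreover have "ln (cmod w) + Re (\<alpha> * c) = ln (cmod (exp (\<alpha> * c) * w))"
    using w(2) by (simp add: norm_mult ln_mult)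
  ultimately show ?thesis by simp
qed

section \<open>Controlled growth implies membership in the first category\<close>

lemma growth_sinv: assumes "growth D f C" shows "growth (\<lambda>z. - D z) (\<lambda>z. sinv (f z)) C"
  unfolding growth_def
proof (intro allI impI)
  fix z assume "- D z = 0"
  then obtain w where w: "w \<noteq> 0" "f z = Some w" "\<bar>ln (cmod w) - dsum D (ball z 1) (\<lambda>a. ln (cmod (z - a)))\<bar> \<le> C"
    using assms unfolding growth_def by auto
  have "ln (cmod (1 / w)) = - ln (cmod w)" using w(1) by (simp add: norm_divide ln_div)
  then have "\<bar>ln (cmod (1 / w)) - dsum (\<lambda>z. - D z) (ball z 1) (\<lambda>a. ln (cmod (z - a)))\<bar> \<le> C"
    unfolding dsum_minus_divisor using w(3) by linarith
  then show "\<exists>w. w \<noteq> 0 \<and> sinv (f z) = Some w \<and> \<bar>ln (cmod w) - dsum (\<lambda>z. - D z) (ball z 1) (\<lambda>a. ln (cmod (z - a)))\<bar> \<le> C"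
    using w by (intro exI[of _ "1 / w"]) simp
qed

text \<open>Away from poles the local logarithmic sum is bounded above: zeros contribute negative
  terms, and each pole has distance at least \<open>d\<close>, contributing at most ln (1/d) per
  order. Hence \<open>f\<close> is bounded near \<open>c\<close>, and Cauchy's estimate
  applies.\<close>

lemma growth_Lipschitz:
  assumes lf: "locally_finite D" and mo: "\<And>z. mer_order f z (D z)" and gr: "growth D f C"
    and N: "\<And>c. dabs D (cball c 1) \<le> N" and d: "0 < d" "d \<le> 1/2"
    and np: "\<And>b. b \<in> ball c (2 * d) \<Longrightarrow> \<not> D b < 0" and z: "dist z c \<le> d / 4"
  shows "chordal (f z) (f c) \<le> 2 * (exp (C + N * ln (1 / d)) / (d / 4) * dist z c)"
proof -
  define M where "M = exp (C + N * ln (1 / d))"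
  have b: "f x \<noteq> None \<and> cmod (the (f x)) \<le> M" if x: "x \<in> ball c d" for x
  proof -
    have npx: "\<not> D b < 0" if "b \<in> ball x d" for b
      using np[of b] that x dist_triangle[of c b x] by simp
    show ?thesis
    proof (cases "D x = 0")
      case False
      then have "D x > 0" using npx[of x] d by force
      then have "f x = Some 0" using mer_order_zero_iff[OF mo] by blast
      then show ?thesis by (simp add: M_def)
    next
      case True
      obtain w where w: "w \<noteq> 0" "f x = Some w" "\<bar>ln (cmod w) - dsum D (ball x 1) (\<lambda>a. ln (cmod (x - a)))\<bar> \<le> C"
        using gr True unfolding growth_def by blast
      have l0: "ln (1 / d) \<ge> 0" using d by simp
      have "dsum D (ball x 1) (\<lambda>a. ln (cmod (x - a))) \<le> (\<Sum>a\<in>{a\<in>ball x 1. D a \<noteq> 0}. real_of_int \<bar>D a\<bar> * ln (1 / d))"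
        unfolding dsum_def
      proof (rule sum_mono)
        fix a assume a: "a \<in> {a\<in>ball x 1. D a \<noteq> 0}"
        have xa: "x \<noteq> a" using a True by auto
        have ln0: "ln (cmod (x - a)) \<le> 0" using a xa by (simp add: dist_norm)
        show "of_int (D a) * ln (cmod (x - a)) \<le> real_of_int \<bar>D a\<bar> * ln (1 / d)"
        proof (cases "D a > 0")
          case True
          then have "of_int (D a) * ln (cmod (x - a)) \<le> 0" using ln0 by (simp add: mult_nonneg_nonpos)
          also have "0 \<le> real_of_int \<bar>D a\<bar> * ln (1 / d)" using l0 by simp
          finally show ?thesis .
        next
          case False
          then have neg: "D a < 0" using a by auto
          then have "a \<notin> ball x d" using npx[of a] by blast
          then have "d \<le> cmod (x - a)" by (simp add: dist_norm)
          then have "ln d \<le> ln (cmod (x - a))" using d by (subst ln_le_cancel_iff) auto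
          then have "- ln (cmod (x - a)) \<le> ln (1 / d)" using d by (simp add: ln_div)
          then have "real_of_int (- D a) * (- ln (cmod (x - a))) \<le> real_of_int (- D a) * ln (1 / d)"
            using neg by (intro mult_left_mono) auto
          then show ?thesis using neg by simp
        qed
      qed
      also have "\<dots> = dabs D (ball x 1) * ln (1 / d)" by (simp only: dabs_def sum_distrib_right)
      also have "\<dots> \<le> N * ln (1 / d)"
        using dabs_mono[OF lf bounded_cball ball_subset_cball, of x 1] N[of x] l0 by (intro mult_right_mono) auto
      finally have "ln (cmod w) \<le> C + N * ln (1 / d)" using w(3) by linarith
      then have "cmod w \<le> M" unfolding M_def using w(1) by (metis exp_le_cancel_iff exp_ln zero_less_norm_iff)
      then show ?thesis using w(2) by simp
    qed
  qed
  have hol: "(\<lambda>x. the (f x)) holomorphic_on ball c d" using b by (intro holomorphic_the[OF mo]) auto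
  have zc: "cmod (z - c) \<le> d / 4" using z by (simp add: dist_norm)
  have "cmod (the (f z) - the (f c)) \<le> M / (d / 4) * cmod (z - c)"
    by (rule bounded_holomorphic_Lipschitz[OF hol _ _ _ zc]) (use b d in auto)
  moreover have "z \<in> ball c d" using z d by (simp add: dist_commute)
  then have "f z = Some (the (f z))" "f c = Some (the (f c))" using b[of z] b[of c] d by auto
  then have "chordal (f z) (f c) \<le> 2 * cmod (the (f z) - the (f c))" by (metis chordal_Some_le)
  ultimately show ?thesis by (simp add: M_def dist_norm)
qed

lemma growth_uniformly_continuous:
  assumes lf: "locally_finite D" and mo: "\<And>z. mer_order f z (D z)" and gr: "growth D f C"
    and N: "\<And>c. dabs D (cball c 1) \<le> N" and A: "condA D" and e: "e > 0"
  obtains \<eta> where "\<eta> > 0" "\<And>z c. dist z c < \<eta> \<Longrightarrow> chordal (f z) (f c) < e"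
proof -
  obtain \<delta> where \<delta>: "\<delta> > 0" "\<And>a b. D a > 0 \<Longrightarrow> D b < 0 \<Longrightarrow> \<delta> \<le> cmod (a - b)" using A unfolding condA_def by blast
  \<comment> \<open>With 4d \<le> \<delta> a disc of radius 2d cannot contain both a zero and a
    pole, so \<open>growth_Lipschitz\<close> applies to \<open>f\<close> or to its
    inversion.\<close>
  define d where "d = min \<delta> 1 / 4"
  have d: "0 < d" "d \<le> 1/2" "4 * d \<le> \<delta>" using \<delta> by (auto simp: d_def)
  define M where "M = exp (C + N * ln (1 / d)) / (d / 4)"
  have M: "M > 0" using d by (simp add: M_def)
  have mo': "\<And>z. mer_order (\<lambda>z. sinv (f z)) z (- D z)" using mo mer_order_sinv by blast
  have lf': "locally_finite (\<lambda>z. - D z)" using lf by (simp add: locally_finite_def)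
  have N': "\<And>c. dabs (\<lambda>z. - D z) (cball c 1) \<le> N" using N by (simp add: dabs_minus_divisor)
  have L: "chordal (f z) (f c) \<le> 2 * (M * dist z c)" if z: "dist z c \<le> d / 4" for z c
  proof (cases "\<exists>b\<in>ball c (2 * d). D b < 0")
    case False
    then show ?thesis unfolding M_def using growth_Lipschitz[OF lf mo gr N d(1,2) _ z] by blast
  next
    case True
    then obtain b where b: "dist c b < 2 * d" "D b < 0" by auto
    have "\<not> - D a < 0" if "a \<in> ball c (2 * d)" for a
    proof
      assume "- D a < 0"
      then have "\<delta> \<le> dist a b" using \<delta>(2)[of a b] b by (simp add: dist_norm)
      also have "\<dots> < 4 * d" using that b dist_triangle[of a b c] by (simp add: dist_commute)
      finally show False using d by simp
    qed
    then have "chordal (sinv (f z)) (sinv (f c)) \<le> 2 * (M * dist z c)"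
      unfolding M_def using growth_Lipschitz[OF lf' mo' growth_sinv[OF gr] N' d(1,2) _ z] by blast
    then show ?thesis by simp
  qed
  show thesis
  proof (rule that[of "min (d / 4) (e / (2 * M))"])
    show "min (d / 4) (e / (2 * M)) > 0" using d e M by simp
    fix z c :: complex assume zc: "dist z c < min (d / 4) (e / (2 * M))"
    then have "2 * (M * dist z c) < e" using M by (simp add: field_simps)
    then show "chordal (f z) (f c) < e" using L[of z c] zc by simp
  qed
qed

text \<open>All translates share one modulus of continuity, so their images on the unit sphere are
  equicontinuous and bounded. Arzela-Ascoli on each disc and a diagonal sequence give the
  subsequence.\<close>

lemma uniformly_continuous_normal:
  assumes mer: "meromorphic_C f"
    and uc: "\<And>e. e > 0 \<Longrightarrow> \<exists>\<eta>>0. \<forall>z c. dist z c < \<eta> \<longrightarrow> chordal (f z) (f c) < e"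
  shows "normal_fun f"
proof -
  have "\<exists>\<sigma>. strict_mono \<sigma> \<and> chordal_cauchy_seq (\<lambda>n z. f (z + h (\<sigma> n)))" for h :: "nat \<Rightarrow> complex"
  proof -
    define P where "P = (\<lambda>(i::nat) (\<sigma>::nat \<Rightarrow> nat). \<forall>e>0. \<exists>N. \<forall>n\<ge>N. \<forall>m\<ge>N. \<forall>z\<in>cball 0 (real i). chordal (f (z + h (\<sigma> n))) (f (z + h (\<sigma> m))) < e)"
    obtain k where k: "strict_mono (k :: nat \<Rightarrow> nat)" "\<And>i. P i (id \<circ> k)"
    proof (rule subsequence_diagonalization_lemma[of P id])
      fix i and r :: "nat \<Rightarrow> nat"
      define \<F> where "\<F> = (\<lambda>n z. stereo (f (z + h (r n))))"
      obtain g and k :: "nat \<Rightarrow> nat" where g: "strict_mono k" "\<And>e. 0 < e \<Longrightarrow> \<exists>N. \<forall>n x. n \<ge> N \<and> x \<in> cball 0 (real i) \<longrightarrow> norm (\<F> (k n) x - g x) < e"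
      proof (rule Arzela_Ascoli[of "cball (0::complex) (real i)" \<F> 1])
        show "norm (\<F> n x) \<le> 1" for n x by (simp add: \<F>_def norm_stereo)
        fix x :: complex and e :: real assume "0 < e"
        then obtain \<eta> where \<eta>: "\<eta> > 0" "\<And>z c. dist z c < \<eta> \<Longrightarrow> chordal (f z) (f c) < e" using uc by blast
        have "norm (\<F> n x - \<F> n y) < e" if "norm (x - y) < \<eta>" for n y
          using \<eta>(2)[of "x + h (r n)" "y + h (r n)"] that by (simp add: \<F>_def chordal_stereo dist_norm)
        then show "\<exists>d. 0 < d \<and> (\<forall>n y. y \<in> cball 0 (real i) \<and> norm (x - y) < d \<longrightarrow> norm (\<F> n x - \<F> n y) < e)"
          using \<eta>(1) by blast
      qed auto
      have "P i (r \<circ> k)" unfolding P_def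
      proof (intro allI impI)
        fix e :: real assume "e > 0"
        then have "e / 2 > 0" by simp
        then obtain N where N: "\<And>n x. n \<ge> N \<Longrightarrow> x \<in> cball 0 (real i) \<Longrightarrow> norm (\<F> (k n) x - g x) < e / 2" using g(2) by meson
        have "chordal (f (z + h ((r \<circ> k) n))) (f (z + h ((r \<circ> k) m))) < e" if "n \<ge> N" "m \<ge> N" "z \<in> cball 0 (real i)" for n m z
          using N[OF that(1,3)] N[OF that(2,3)] dist_triangle2[of "\<F> (k n) z" "\<F> (k m) z" "g z"]
          by (simp add: \<F>_def chordal_stereo dist_norm)
        then show "\<exists>N. \<forall>n\<ge>N. \<forall>m\<ge>N. \<forall>z\<in>cball 0 (real i). chordal (f (z + h ((r \<circ> k) n))) (f (z + h ((r \<circ> k) m))) < e" by blast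
      qed
      then show "\<exists>k. strict_mono k \<and> P i (r \<circ> k)" using g(1) by blast
    next
      fix i and r k1 k2 :: "nat \<Rightarrow> nat" and N
      assume P1: "P i (r \<circ> k1)" and k2: "\<And>j. N \<le> j \<Longrightarrow> \<exists>j'. j \<le> j' \<and> k2 j = k1 j'"
      show "P i (r \<circ> k2)" unfolding P_def
      proof (intro allI impI)
        fix e :: real assume "e > 0"
        then obtain N1 where N1: "\<And>n m z. n \<ge> N1 \<Longrightarrow> m \<ge> N1 \<Longrightarrow> z \<in> cball 0 (real i) \<Longrightarrow> chordal (f (z + h ((r \<circ> k1) n))) (f (z + h ((r \<circ> k1) m))) < e"
          using P1 unfolding P_def by meson
        have "chordal (f (z + h ((r \<circ> k2) n))) (f (z + h ((r \<circ> k2) m))) < e" if nm: "n \<ge> max N N1" "m \<ge> max N N1" "z \<in> cball 0 (real i)" for n m z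
        proof -
          obtain n' where n': "n \<le> n'" "k2 n = k1 n'" using k2[of n] nm by auto
          obtain m' where m': "m \<le> m'" "k2 m = k1 m'" using k2[of m] nm by auto
          show ?thesis using N1[of n' m' z] n' m' nm by simp
        qed
        then show "\<exists>N. \<forall>n\<ge>N. \<forall>m\<ge>N. \<forall>z\<in>cball 0 (real i). chordal (f (z + h ((r \<circ> k2) n))) (f (z + h ((r \<circ> k2) m))) < e" by blast
      qed
    qed (use that in blast)
    have "chordal_cauchy_seq (\<lambda>n z. f (z + h (k n)))" unfolding chordal_cauchy_seq_def
    proof (intro allI impI)
      fix K :: "complex set" and e :: real assume K: "compact K" and e: "e > 0"
      obtain b where b: "\<forall>z\<in>K. cmod z \<le> b" using compact_imp_bounded[OF K] by (auto simp: bounded_iff)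
      obtain i :: nat where "b \<le> real i" using real_arch_simple by blast
      then have i: "K \<subseteq> cball 0 (real i)" using b by force
      show "\<exists>N. \<forall>n\<ge>N. \<forall>m\<ge>N. \<forall>z\<in>K. chordal (f (z + h (k n))) (f (z + h (k m))) < e"
        using k(2)[of i] e i unfolding P_def by (simp add: o_def) blast
    qed
    then show ?thesis using k(1) by blast
  qed
  then show ?thesis using mer unfolding normal_fun_def by blast
qed

lemma growth_imp_N1:
  assumes lf: "locally_finite D" and div: "divisor_of D f" and gr: "growth D f C"
    and N: "\<And>c. dabs D (cball c 1) \<le> N" and A: "condA D" and Cc: "condC D"
  shows "N1 f"
proof -
  have mo: "\<And>z. mer_order f z (D z)" and mer: "meromorphic_C f" using div by (auto simp: divisor_of_def)
  have "normal_fun f"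
  proof (rule uniformly_continuous_normal[OF mer])
    fix e :: real assume "e > 0"
    then show "\<exists>\<eta>>0. \<forall>z c. dist z c < \<eta> \<longrightarrow> chordal (f z) (f c) < e"
      using growth_uniformly_continuous[OF lf mo gr N A] by metis
  qed
  moreover have False if lim: "chordal_lim_seq (\<lambda>n z. f (z + h n)) (\<lambda>_. c)" for h c
  proof -
    \<comment> \<open>A translate takes both the values 0 and infinity in each disc of radius
      \<open>R\<close>; these are at chordal distance 2, so no constant is within 1 of both.\<close>
    obtain R where R: "\<And>x. (\<exists>a\<in>ball x R. D a > 0) \<and> (\<exists>b\<in>ball x R. D b < 0)" using Cc unfolding condC_def by blast
    obtain n where n: "\<And>z. z \<in> cball 0 R \<Longrightarrow> chordal (f (z + h n)) c < 1"
      using lim compact_cball[of "0::complex" R] unfolding chordal_lim_seq_def by (metis order_refl zero_less_one)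
    obtain a b where a: "a \<in> ball (h n) R" "D a > 0" and b: "b \<in> ball (h n) R" "D b < 0" using R by blast
    have "chordal (f a) c < 1" using n[of "a - h n"] a by (simp add: dist_norm norm_minus_commute)
    moreover have "chordal (f b) c < 1" using n[of "b - h n"] b by (simp add: dist_norm norm_minus_commute)
    moreover have "f a = Some 0" "f b = None" using a b mer_order_zero_iff[OF mo] mer_order_None_iff[OF mo] by auto
    ultimately show False using chordal_triangle[of "Some 0" None c] chordal_0_None by (simp add: chordal_commute)
  qed
  ultimately show ?thesis unfolding N1_def by blast
qed

section \<open>Uniqueness\<close>

text \<open>The local logarithmic sums cancel in the quotient, which is therefore bounded off the
  divisor; the common rational factor makes its singularities removable, and Liouville
  applies.\<close>

lemma growth_unique:
  assumes lf: "locally_finite D" and mo: "\<And>z. mer_order f z (D z)" and mo': "\<And>z. mer_order g z (D z)"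
    and gr: "growth D f C" and gr': "growth D g C'" and D0: "D 0 = 0"
  obtains k where "\<And>z. f z = sphere_scale k (g z)"
proof -
  define M where "M = exp (C + C')"
  define q where "q = (\<lambda>z. the (f z) / the (g z))"
  have qb: "cmod (q z) \<le> M \<and> f z = Some (q z * the (g z)) \<and> g z \<noteq> None" if D: "D z = 0" for z
  proof -
    obtain w where w: "w \<noteq> 0" "f z = Some w" "\<bar>ln (cmod w) - dsum D (ball z 1) (\<lambda>a. ln (cmod (z - a)))\<bar> \<le> C"
      using gr D unfolding growth_def by blast
    obtain v where v: "v \<noteq> 0" "g z = Some v" "\<bar>ln (cmod v) - dsum D (ball z 1) (\<lambda>a. ln (cmod (z - a)))\<bar> \<le> C'"
      using gr' D unfolding growth_def by blast
    have "ln (cmod (w / v)) = ln (cmod w) - ln (cmod v)" using w v by (simp add: norm_divide ln_div)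
    then have "ln (cmod (w / v)) \<le> C + C'" using w(3) v(3) by linarith
    moreover have "cmod (w / v) > 0" using w v by simp
    ultimately have "cmod (w / v) \<le> M" unfolding M_def by (metis exp_le_cancel_iff exp_ln)
    then show ?thesis using w v by (simp add: q_def)
  qed
  have M: "M > 0" by (simp add: M_def)
  have qn: "cmod (q z - q 0) \<le> M / \<rho> * cmod z" if D: "D z = 0" and \<rho>: "\<rho> > 0" "cmod z \<le> \<rho>" for z \<rho>
  proof -
    define U where "U = ball (0::complex) (3 * \<rho>)"
    have fin: "finite {a\<in>U. D a \<noteq> 0}" by (rule locally_finite_bounded[OF lf]) (simp add: U_def)
    obtain F where F: "F holomorphic_on U" "\<And>z. z \<in> U \<Longrightarrow> F z \<noteq> 0" "\<And>z. z \<in> U \<Longrightarrow> D z \<ge> 0 \<Longrightarrow> f z = Some (F z * divpoly D U z)"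
      using divisor_factor[OF mo lf, of U] by (metis U_def bounded_ball open_ball)
    obtain G where G: "G holomorphic_on U" "\<And>z. z \<in> U \<Longrightarrow> G z \<noteq> 0" "\<And>z. z \<in> U \<Longrightarrow> D z \<ge> 0 \<Longrightarrow> g z = Some (G z * divpoly D U z)"
      using divisor_factor[OF mo' lf, of U] by (metis U_def bounded_ball open_ball)
    \<comment> \<open>On the support \<open>q\<close> has meaningless default values;
      \<open>h\<close> is its holomorphic extension there and inherits the bound by
      continuity.\<close>
    define h where "h = (\<lambda>z. F z / G z)"
    have holh: "h holomorphic_on U" unfolding h_def by (intro holomorphic_intros F G)
    have hq: "h x = q x" if "x \<in> U" "D x = 0" for x
      using F(3)[OF that(1)] G(3)[OF that(1)] that(2) divpoly_nonzero[OF that(2) fin] by (simp add: h_def q_def)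
    have hM: "cmod (h x) \<le> M" if x: "x \<in> U" for x
    proof -
      obtain e where e: "e > 0" "ball x e \<subseteq> U" using x openE[of U] by (metis U_def open_ball)
      obtain e' where e': "e' > 0" "e' \<le> e" "\<And>y. y \<in> ball x e' \<Longrightarrow> y \<noteq> x \<Longrightarrow> D y = 0"
        using locally_finite_isolated[OF lf e(1)] by metis
      have "isCont h x" using holomorphic_on_imp_continuous_on[OF holh] x
        by (metis U_def continuous_on_eq_continuous_at open_ball)
      then have lim: "((\<lambda>y. cmod (h y)) \<longlongrightarrow> cmod (h x)) (at x)" by (intro tendsto_norm) (simp add: isCont_def)
      have "\<forall>\<^sub>F y in at x. y \<in> ball x e' - {x}" using e'(1) by (intro eventually_at_in_open) auto
      then have "\<forall>\<^sub>F y in at x. cmod (h y) \<le> M"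
      proof eventually_elim
        case (elim y)
        then have "D y = 0" "y \<in> U" using e' e by auto
        then show ?case using hq qb by simp
      qed
      then show ?thesis using tendsto_upperbound[OF lim] by simp
    qed
    have zU: "z \<in> U" "0 \<in> U" using \<rho> by (auto simp: U_def)
    have "cmod (h z - h 0) \<le> M / \<rho> * cmod (z - 0)"
      by (rule bounded_holomorphic_Lipschitz[of h 0 "3 * \<rho>" M]) (use holh hM \<rho> in \<open>auto simp: U_def\<close>)
    then show ?thesis using hq zU D D0 by simp
  qed
  have qc: "q z = q 0" if D: "D z = 0" for z
  proof (rule ccontr)
    assume "q z \<noteq> q 0"
    then have pos: "cmod (q z - q 0) > 0" by simp
    \<comment> \<open>Large enough that the Lipschitz bound M |z| / \<rho> falls below |q z - q
      0|.\<close>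
    define \<rho> where "\<rho> = cmod z + 1 + 2 * M * cmod z / cmod (q z - q 0)"
    have t: "2 * M * cmod z / cmod (q z - q 0) \<ge> 0" using M by simp
    have \<rho>: "\<rho> > 0" "cmod z \<le> \<rho>" unfolding \<rho>_def using t norm_ge_zero[of z] by linarith+
    have "cmod (q z - q 0) * \<rho> \<le> M * cmod z" using qn[OF D \<rho>] \<rho> by (simp add: field_simps)
    moreover have "cmod (q z - q 0) * \<rho> = cmod (q z - q 0) * (cmod z + 1) + 2 * M * cmod z" using pos by (simp add: \<rho>_def distrib_left)
    moreover have "cmod (q z - q 0) * (cmod z + 1) > 0" using pos by (intro mult_pos_pos) (auto intro: add_nonneg_pos)
    moreover have "M * cmod z \<ge> 0" using M by simp
    ultimately show False by linarith
  qed
  show thesis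
  proof (rule that[of "q 0"])
    fix z
    show "f z = sphere_scale (q 0) (g z)"
    proof (cases "D z" "0::int" rule: linorder_cases)
      case less
      then have "f z = None" "g z = None" using mer_order_None_iff[OF mo] mer_order_None_iff[OF mo'] by auto
      then show ?thesis by (simp add: sphere_scale_def)
    next
      case equal
      then show ?thesis using qb[of z] qc[of z] by (auto simp: sphere_scale_def)
    next
      case greater
      then have "f z = Some 0" "g z = Some 0" using mer_order_zero_iff[OF mo] mer_order_zero_iff[OF mo'] by auto
      then show ?thesis by (simp add: sphere_scale_def)
    qed
  qed
qed

lemma conditions_imp_product:
  assumes lf: "locally_finite D" and D0: "D 0 = 0"
    and A: "condA D" and B: "condB D" and Cc: "condC D" and Dd: "condD D" and E: "condE D" and F: "condF D"
  obtains \<alpha> g where "(alpha_approx D \<longlongrightarrow> \<alpha>) at_top" "chordal_lim_real (prod_quot D) g"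
    "N1 (\<lambda>z. sphere_scale (exp (\<alpha> * z)) (g z))" "divisor_of D (\<lambda>z. sphere_scale (exp (\<alpha> * z)) (g z))"
proof -
  obtain N where N: "\<And>c. dabs D (cball c 1) \<le> N"
    using B zcount_plus_pcount[OF lf bounded_cball] unfolding condB_def by (metis less_imp_le)
  obtain C where C: "\<And>c r. r > 1 \<Longrightarrow> \<bar>integral {1..r} (\<lambda>t. (of_int (zcount D (ball c t)) - of_int (pcount D (ball c t))) / t)\<bar> < C"
    using Dd unfolding condD_def by blast
  have I: "\<bar>dsum D (ball c r) (\<lambda>a. ln (r / max 1 (cmod (a - c))))\<bar> \<le> C" if "r > 1" for c r
    using C[OF that, of c] integral_unique[OF condD_integral[OF lf that, of c]] by simp
  obtain C' where C': "\<And>c r. r > 1 \<Longrightarrow> cmod ((1 / r) *\<^sub>R integral {1..r}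
        (\<lambda>t. (1 / t) *\<^sub>R (zsum D (ball c t) (\<lambda>z. z - c) - psum D (ball c t) (\<lambda>z. z - c)))) < C'"
    using E unfolding condE_def by blast
  \<comment> \<open>Only the case c = 0 of (e) enters here; at other centres it is then a
    consequence of membership in the first category.\<close>
  have E0: "cmod (dsum D (ball 0 r) (\<lambda>a. a * of_real (ln (r / max 1 (cmod a))))) \<le> C' * r" if r: "r > 1" for r
  proof -
    have "cmod ((1 / r) *\<^sub>R dsum D (ball 0 r) (\<lambda>a. a * of_real (ln (r / max 1 (cmod a))))) \<le> C'"
      using C'[OF r, of 0] integral_unique[OF condE_integral[OF lf r, of 0]] by simp
    then show ?thesis using r by (simp add: divide_le_eq)
  qed
  obtain \<alpha> where \<alpha>: "(alpha_approx D \<longlongrightarrow> \<alpha>) at_top" using alpha_converges[OF lf D0 E0] by blast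
  obtain L where L: "((\<lambda>r. dsum D {z. 1 \<le> cmod z \<and> cmod z < r} (\<lambda>z. 1 / z\<^sup>2)) \<longlongrightarrow> L) at_top"
  proof -
    have "bounded {z::complex. 1 \<le> cmod z \<and> cmod z < r}" for r by (rule bounded_subset[of "ball 0 r"]) auto
    then show thesis using F that unfolding condF_def by (simp only: zsum_minus_psum[OF lf]) blast
  qed
  obtain g where g: "chordal_lim_real (prod_quot D) g" "\<And>z. D z < 0 \<Longrightarrow> g z = None"
    "\<And>z. D z \<ge> 0 \<Longrightarrow> \<exists>w. g z = Some w \<and> ((\<lambda>r. sprod D (ball 0 r) z) \<longlongrightarrow> w) at_top"
    "\<And>n::nat. n \<ge> 1 \<Longrightarrow> \<exists>F. F holomorphic_on ball 0 (real n) \<and> (\<forall>z\<in>ball 0 (real n). F z \<noteq> 0) \<and>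
       (\<forall>z\<in>ball 0 (real n). D z \<ge> 0 \<longrightarrow> g z = Some (F z * divpoly D (ball 0 (real n)) z))"
  proof (rule product_limit[OF lf D0 N L], goal_cases)
    case (1 g)
    show ?case by (rule that[OF 1(2-5)])
  qed
  define f where "f = (\<lambda>z. sphere_scale (exp (\<alpha> * z)) (g z))"
  have gdiv: "divisor_of D g" by (rule factored_divisor[OF lf g(2,4)])
  have fdiv: "divisor_of D f"
  proof (rule factored_divisor[OF lf])
    show "f z = None" if "D z < 0" for z using g(2)[OF that] by (simp add: f_def sphere_scale_def)
    fix n :: nat assume "n \<ge> 1"
    then obtain F where "F holomorphic_on ball 0 (real n)" "\<forall>z\<in>ball 0 (real n). F z \<noteq> 0"
       "\<forall>z\<in>ball 0 (real n). D z \<ge> 0 \<longrightarrow> g z = Some (F z * divpoly D (ball 0 (real n)) z)"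
      using g(4) by blast
    then show "\<exists>F. F holomorphic_on ball 0 (real n) \<and> (\<forall>z\<in>ball 0 (real n). F z \<noteq> 0) \<and>
       (\<forall>z\<in>ball 0 (real n). D z \<ge> 0 \<longrightarrow> f z = Some (F z * divpoly D (ball 0 (real n)) z))"
      by (intro exI[of _ "\<lambda>z. exp (\<alpha> * z) * F z"]) (auto simp: f_def sphere_scale_def mult_ac intro!: holomorphic_intros)
  qed
  have gr: "growth D f (2 * (2 * C + N) + \<bar>dsum D (ball 0 1) (\<lambda>a. ln (cmod a))\<bar>)"
  proof (rule growth_from_limit[OF lf D0 N I])
    fix c assume c: "D c = 0"
    then obtain w where w: "g c = Some w" "((\<lambda>r. sprod D (ball 0 r) c) \<longlongrightarrow> w) at_top" using g(3)[of c] by auto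
    \<comment> \<open>A conditionally convergent product could a priori tend to 0; the factorization
      of \<open>g\<close> excludes it off the divisor.\<close>
    have "w \<noteq> 0"
    proof
      assume "w = 0"
      then have "D c > 0" using w(1) gdiv mer_order_zero_iff unfolding divisor_of_def by blast
      then show False using c by simp
    qed
    then show "\<exists>w. w \<noteq> 0 \<and> f c = Some w \<and>
      ((\<lambda>r. dsum D (ball 0 r) (\<lambda>a. ln (cmod (1 - c / a)) + Re (c * cnj a) / r\<^sup>2)) \<longlongrightarrow> ln (cmod w)) at_top"
      using product_log_limit[OF lf D0 c \<alpha> w(2)] w(1) by (intro exI[of _ "exp (\<alpha> * c) * w"]) (simp add: f_def sphere_scale_def)
  qed
  have "N1 f" by (rule growth_imp_N1[OF lf fdiv gr N A Cc])
  then show thesis using that[OF \<alpha> g(1)] fdiv unfolding f_def by blast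
qed

theorem mainTheorem1:
  fixes D :: "complex \<Rightarrow> int"
  assumes discrete: "\<forall>r. finite {z. D z \<noteq> 0 \<and> cmod z \<le> r}"
    and nonzero: "D 0 = 0"
  shows "((\<exists>f. N1 f \<and> divisor_of D f) \<longleftrightarrow>
           (condA D \<and> condB D \<and> condC D \<and> condD D \<and> condE D \<and> condF D)) \<and>
         (condA D \<and> condB D \<and> condC D \<and> condD D \<and> condE D \<and> condF D \<longrightarrow>
         (\<exists>\<alpha>. (alpha_approx D \<longlongrightarrow> \<alpha>) at_top \<and>
           (\<exists>g. chordal_lim_real (prod_quot D) g \<and>
              (\<forall>f. N1 f \<and> divisor_of D f \<longrightarrow>
                 (\<exists>k. \<forall>z. f z = sphere_scale (k * exp (\<alpha> * z)) (g z))))))"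
proof -
  have lf: "locally_finite D" using discrete by (simp add: locally_finite_def)
  have nec: "condA D \<and> condB D \<and> condC D \<and> condD D \<and> condE D \<and> condF D" if "N1 f" "divisor_of D f" for f
    by (rule N1_imp_conditions[OF that lf])
  have suff: "\<exists>\<alpha> g. (alpha_approx D \<longlongrightarrow> \<alpha>) at_top \<and> chordal_lim_real (prod_quot D) g \<and>
      N1 (\<lambda>z. sphere_scale (exp (\<alpha> * z)) (g z)) \<and> divisor_of D (\<lambda>z. sphere_scale (exp (\<alpha> * z)) (g z))"
    if "condA D \<and> condB D \<and> condC D \<and> condD D \<and> condE D \<and> condF D"
    using conditions_imp_product[OF lf nonzero] that by metis
  \<comment> \<open>Both functions are of the first category, so \<open>N1_growth\<close> gives
    controlled growth to each of them and their quotient is constant.\<close>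
  have unique: "\<exists>k. \<forall>z. f z = sphere_scale (k * exp (\<alpha> * z)) (g z)"
    if f: "N1 f" "divisor_of D f" and f0: "N1 (\<lambda>z. sphere_scale (exp (\<alpha> * z)) (g z))" "divisor_of D (\<lambda>z. sphere_scale (exp (\<alpha> * z)) (g z))"
    for f \<alpha> g
  proof -
    obtain N C where gr: "growth D f C" using N1_growth[OF f lf] by blast
    obtain N' C' where gr': "growth D (\<lambda>z. sphere_scale (exp (\<alpha> * z)) (g z)) C'" using N1_growth[OF f0 lf] by blast
    have mo: "\<And>z. mer_order f z (D z)" "\<And>z. mer_order (\<lambda>z. sphere_scale (exp (\<alpha> * z)) (g z)) z (D z)"
      using f(2) f0(2) by (auto simp: divisor_of_def)
    obtain k where "\<And>z. f z = sphere_scale k (sphere_scale (exp (\<alpha> * z)) (g z))"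
      using growth_unique[OF lf mo gr gr' nonzero] by blast
    moreover have "sphere_scale k (sphere_scale x u) = sphere_scale (k * x) u" for x u
      by (cases u) (auto simp: sphere_scale_def mult.assoc)
    ultimately show ?thesis by auto
  qed
  show ?thesis using nec suff unique by meson
qed

end
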